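(* For $m\in\{1,\dots,7\}$, let $\mathcal{P}_m$ be the set of equivalence classes of lattice polygons that have a representative contained in the square $[0,m]\times[0,m]$ but have no representative contained in a square $[0,m']\times[0,m']$ with $m'<m$ a positive integer. Let $N_m=|\mathcal{P}_m|$, let $V_m$ be the maximum number of vertices of a polygon whose class lies in $\mathcal{P}_m$, and let $A_m$ be the number of classes in $\mathcal{P}_m$ consisting of polygons with exactly $V_m$ vertices. Then $$(N_1,\dots,N_7)=(2,\ 15,\ 131,\ 1369,\ 13842,\ 129185,\ 1104895),$$ $$(V_1,\dots,V_7)=(4,\ 6,\ 8,\ 9,\ 10,\ 12,\ 13),$$ $$(A_1,\dots,A_7)=(1,\ 1,\ 1,\ 1,\ 15,\ 2,\ 3).$$
   Context: A lattice polygon is a two-dimensional convex polygon in $\mathbb{Q}^2$ whose vertices lie in $\mathbb{Z}^2$. Two lattice polygons $P$ and $P'$ are equivalent if there exist $u\in\mathbb{Z}^2$ and a change of basis $\varphi\in\mathrm{GL}_2(\mathbb{Z})$ of the lattice $\mathbb{Z}^2$ such that $\varphi(P-u)=P'$. (The number of vertices is invariant under equivalence.) *)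

theory Defs
  imports "HOL-Analysis.Cartesian_Space"
begin

(* The library notions convex, extreme_point_of and aff_dim are tied to real vector spaces.
   The first two definitions below are their verbatim analogues over the rationals. *)

definition rat_convex :: "(rat ^ 2) set \<Rightarrow> bool" where
  "rat_convex S \<longleftrightarrow>
    (\<forall>x\<in>S. \<forall>y\<in>S. \<forall>u\<ge>0. \<forall>v\<ge>0. u + v = 1 \<longrightarrow> u *s x + v *s y \<in> S)"

definition vertices :: "(rat ^ 2) set \<Rightarrow> (rat ^ 2) set" where
  "vertices P = {x \<in> P. \<forall>a\<in>P. \<forall>b\<in>P.
     \<not> (a \<noteq> b \<and> (\<exists>t. 0 < t \<and> t < 1 \<and> x = (1 - t) *s a + t *s b))}"

(* The dimension of P is that of its direction space, the span of the differences of its points. *)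
definition convex_polygon :: "(rat ^ 2) set \<Rightarrow> bool" where
  "convex_polygon P \<longleftrightarrow>
    (\<exists>V. finite V \<and> P = rat_convex hull V) \<and> vec.dim {x - y | x y. x \<in> P \<and> y \<in> P} = 2"

definition int_lattice :: "(rat ^ 2) set" where
  "int_lattice = {x. \<forall>i. x $ i \<in> \<int>}"

definition lattice_polygon :: "(rat ^ 2) set \<Rightarrow> bool" where
  "lattice_polygon P \<longleftrightarrow> convex_polygon P \<and> vertices P \<subseteq> int_lattice"

(* GL_2(Z) is the set of matrices that are invertible over int. *)
definition polygon_equiv :: "((rat ^ 2) set \<times> (rat ^ 2) set) set" where
  "polygon_equiv = {(P, P'). lattice_polygon P \<and> lattice_polygon P' \<and>
     (\<exists>u\<in>int_lattice. \<exists>A :: int ^ 2 ^ 2. invertible A \<and>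
        (\<lambda>x. map_matrix rat_of_int A *v (x - u)) ` P = P')}"

definition square :: "nat \<Rightarrow> (rat ^ 2) set" where
  "square m = {x. \<forall>i. 0 \<le> x $ i \<and> x $ i \<le> of_nat m}"

definition polygon_classes :: "nat \<Rightarrow> (rat ^ 2) set set set" where
  "polygon_classes m = {X \<in> {P. lattice_polygon P} // polygon_equiv.
     (\<exists>P\<in>X. P \<subseteq> square m) \<and>
     \<not> (\<exists>m'. 0 < m' \<and> m' < m \<and> (\<exists>P\<in>X. P \<subseteq> square m'))}"

definition num_classes :: "nat \<Rightarrow> nat" where
  "num_classes m = card (polygon_classes m)"

definition max_vertices :: "nat \<Rightarrow> nat" where
  "max_vertices m = Max {card (vertices P) | P. \<exists>X\<in>polygon_classes m. P \<in> X}"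

definition num_max_classes :: "nat \<Rightarrow> nat" where
  "num_max_classes m =
     card {X \<in> polygon_classes m. \<forall>P\<in>X. card (vertices P) = max_vertices m}"

end

theory Submission
  imports Defs "HOL-Analysis.Determinants"
begin

text \<open>
  Up to translation a lattice polygon is the same as a weight: a function that assigns to every primitive
  inner normal the lattice length of the edge with this normal, subject to the condition that the edges close
  up (\<open>polygon_equiv_iff\<close>, \<open>weight_surj\<close>). A change of basis permutes the normals, vertices correspond to
  normals of positive weight, and the width of the polygon in a direction is linear in the weight. A class has
  a representative in the square of side \<open>m\<close> if and only if there is a basis of the lattice of functionals
  for which both widths are at most \<open>m\<close>.

  Such a basis is rarely unique, so one cannot simply count weights. The bases and the triangles (triples of
  functionals \<open>a\<close>, \<open>b\<close>, \<open>a - b\<close> any two of which form a basis) of width at most \<open>m\<close> are nodes of Conway's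
  topograph. Widths are convex, and after a perturbation to a strictly convex function every node descends to
  a unique root, as in the reduction theory of binary quadratic forms. The nodes of one polygon therefore form
  a tree, and the number of classes is the number of bases plus the number of triangles minus the number of
  incidences, all counted up to the symmetry groups \<open>D4\<close>, \<open>D6\<close> and \<open>V4\<close> of these figures (\<open>card_classes\<close>).
  By the lemma of Burnside each of these numbers is a sum of numbers of weights that satisfy the width bounds
  and are invariant under one symmetry (\<open>orbit_count\<close>).

  A weight invariant under a symmetry is a free choice of a weight on a fundamental domain, which is a union of
  cones. Width bounds and closing condition only involve the sums over these cones, so the weights are counted
  by convolutions of the generating functions of cones (\<open>sum_invariant\<close>), in which a variable \<open>z\<close> marks the
  vertices. Evaluating the convolutions in the integers, in a semiring of leading terms and in polynomials
  modulo \<open>z ^ 3\<close> yields the numbers of all weights, of those with the maximal number of vertices, and of the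
  degenerate ones (\<open>fits_values\<close>). The classes belonging to \<open>m\<close> are those that fit into the square of side
  \<open>m\<close> but not into the square of side \<open>m - 1\<close>.
\<close>

section \<open>Integer vectors and weights on primitive vectors\<close>

type_synonym vec = "int \<times> int"

definition cross :: "vec \<Rightarrow> vec \<Rightarrow> int" where
  "cross u v = fst u * snd v - snd u * fst v"

definition prim :: "vec \<Rightarrow> bool" where
  "prim n \<longleftrightarrow> coprime (fst n) (snd n)"

definition lin :: "int \<Rightarrow> int \<Rightarrow> int \<Rightarrow> int \<Rightarrow> vec \<Rightarrow> vec" where
  "lin a b c d = (\<lambda>v. (a * fst v + b * snd v, c * fst v + d * snd v))"

definition GL :: "(vec \<Rightarrow> vec) set" where
  "GL = {lin a b c d | a b c d. \<bar>a * d - b * c\<bar> = 1}"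

definition supp :: "('a \<Rightarrow> nat) \<Rightarrow> 'a set" where
  "supp \<nu> = {n. \<nu> n \<noteq> 0}"

definition msum :: "('a \<Rightarrow> nat) \<Rightarrow> ('a \<Rightarrow> int) \<Rightarrow> int" where
  "msum \<nu> F = (\<Sum>n\<in>supp \<nu>. int (\<nu> n) * F n)"

text \<open>The boundary of a lattice polygon has, for every primitive inner normal \<open>n\<close>, an edge of some
number of primitive steps, possibly none. These numbers describe the polygon up to translation; the two
linear conditions say that the boundary closes up.\<close>
definition weights :: "(vec \<Rightarrow> nat) set" where
  "weights = {\<nu>. finite (supp \<nu>) \<and> supp \<nu> \<subseteq> Collect prim \<and> msum \<nu> fst = 0 \<and> msum \<nu> snd = 0}"

definition nondeg :: "(vec \<Rightarrow> nat) \<Rightarrow> bool" where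
  "nondeg \<nu> \<longleftrightarrow> (\<exists>n\<in>supp \<nu>. \<exists>k\<in>supp \<nu>. cross n k \<noteq> 0)"

text \<open>Going once around the boundary, a linear functional runs through its range upwards and
downwards. The sum is therefore twice the width in the direction \<open>f\<close>.\<close>
definition width2 :: "(vec \<Rightarrow> nat) \<Rightarrow> vec \<Rightarrow> int" where
  "width2 \<nu> f = msum \<nu> (\<lambda>n. \<bar>cross n f\<bar>)"

text \<open>Widths are convex but not strictly convex; this quadratic form serves to break ties.\<close>
definition qform :: "(vec \<Rightarrow> nat) \<Rightarrow> vec \<Rightarrow> int" where
  "qform \<nu> f = msum \<nu> (\<lambda>n. (cross n f)\<^sup>2)"

lemma lin_comp: "lin a b c d \<circ> lin a' b' c' d' = lin (a*a'+b*c') (a*b'+b*d') (c*a'+d*c') (c*b'+d*d')"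
  by (auto simp: lin_def fun_eq_iff algebra_simps)

lemma lin_id: "lin 1 0 0 1 = id"
  by (auto simp: lin_def fun_eq_iff)

lemma lin_inject: "lin a b c d = lin a' b' c' d' \<longleftrightarrow> a = a' \<and> b = b' \<and> c = c' \<and> d = d'"
proof
  assume "lin a b c d = lin a' b' c' d'"
  then have "lin a b c d (1,0) = lin a' b' c' d' (1,0)" "lin a b c d (0,1) = lin a' b' c' d' (0,1)"
    by simp_all
  then show "a = a' \<and> b = b' \<and> c = c' \<and> d = d'" by (simp add: lin_def)
qed simp

lemma GL_I: "\<bar>a * d - b * c\<bar> = 1 \<Longrightarrow> lin a b c d \<in> GL"
  unfolding GL_def by blast

lemma GL_E:
  assumes "A \<in> GL"
  obtains a b c d where "A = lin a b c d" "\<bar>a * d - b * c\<bar> = 1"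
  using assms unfolding GL_def by blast

lemma GL_comp:
  assumes "A \<in> GL" "B \<in> GL" shows "A \<circ> B \<in> GL"
proof -
  obtain a b c d where A: "A = lin a b c d" "\<bar>a * d - b * c\<bar> = 1" using assms(1) by (rule GL_E)
  obtain a' b' c' d' where B: "B = lin a' b' c' d'" "\<bar>a' * d' - b' * c'\<bar> = 1" using assms(2) by (rule GL_E)
  have "(a*a'+b*c') * (c*b'+d*d') - (a*b'+b*d') * (c*a'+d*c') = (a * d - b * c) * (a' * d' - b' * c')"
    by (simp add: algebra_simps)
  then show ?thesis using A B by (auto simp: lin_comp abs_mult intro!: GL_I)
qed

lemma GL_id: "id \<in> GL"
  using GL_I[of 1 1 0 0] by (simp add: lin_id)

lemma GL_inv:
  assumes "A \<in> GL" obtains B where "B \<in> GL" "A \<circ> B = id" "B \<circ> A = id"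
proof -
  obtain a b c d where A: "A = lin a b c d" "\<bar>a * d - b * c\<bar> = 1" using assms(1) by (rule GL_E)
  define e where "e = a * d - b * c"
  have e: "e * e = 1" "\<bar>e\<bar> = 1" using A(2) unfolding e_def[symmetric] by (auto simp: abs_if split: if_splits)
  let ?B = "lin (e*d) (-e*b) (-e*c) (e*a)"
  have 1: "(e*d)*(e*a) - (-e*b)*(-e*c) = e * e * e" by (simp add: e_def algebra_simps)
  have 2: "e * (a * d) - e * (b * c) = 1" "e * (d * a) - e * (b * c) = 1" using e(1) by (simp_all add: e_def algebra_simps)
  show thesis
  proof (rule that)
    show "?B \<in> GL" using 1 e by (intro GL_I) simp
    show "A \<circ> ?B = id" unfolding A lin_comp lin_id[symmetric] lin_inject using 2 by (auto simp: algebra_simps)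
    show "?B \<circ> A = id" unfolding A lin_comp lin_id[symmetric] lin_inject using 2 by (auto simp: algebra_simps)
  qed
qed

lemma GL_bij: "A \<in> GL \<Longrightarrow> bij A"
  by (metis GL_inv o_bij)

lemma GL_add: "A \<in> GL \<Longrightarrow> A (u + v) = A u + A v"
  by (erule GL_E) (auto simp: lin_def algebra_simps)

lemma GL_diff: "A \<in> GL \<Longrightarrow> A (u - v) = A u - A v"
  by (erule GL_E) (auto simp: lin_def algebra_simps)

lemma GL_minus: "A \<in> GL \<Longrightarrow> A (- v) = - A v"
  by (erule GL_E) (auto simp: lin_def algebra_simps)

lemma cross_lin: "cross (lin a b c d u) (lin a b c d v) = (a * d - b * c) * cross u v"
  by (simp add: cross_def lin_def algebra_simps)

lemma abs_cross_GL: "A \<in> GL \<Longrightarrow> \<bar>cross (A u) (A v)\<bar> = \<bar>cross u v\<bar>"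
  by (erule GL_E) (simp add: cross_lin abs_mult)

lemma prim_iff_cross: "prim n \<longleftrightarrow> (\<exists>k. cross n k = 1)"
proof
  assume "prim n"
  then obtain x y where "x * fst n + y * snd n = 1"
    unfolding prim_def by (metis bezout_int coprime_imp_gcd_eq_1)
  then have "cross n (-y, x) = 1" by (simp add: cross_def algebra_simps)
  then show "\<exists>k. cross n k = 1" ..
next
  assume "\<exists>k. cross n k = 1"
  then obtain k where k: "fst n * snd k - snd n * fst k = 1" by (auto simp: cross_def)
  show "prim n" unfolding prim_def
  proof (rule coprimeI)
    fix c assume "c dvd fst n" "c dvd snd n"
    then have "c dvd fst n * snd k - snd n * fst k" by auto
    then show "is_unit c" using k by simp
  qed
qed

lemma prim_iff_abs_cross: "prim n \<longleftrightarrow> (\<exists>k. \<bar>cross n k\<bar> = 1)"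
proof
  assume "\<exists>k. \<bar>cross n k\<bar> = 1"
  then obtain k where "cross n k = 1 \<or> cross n k = -1" by (auto simp: abs_if split: if_splits)
  moreover have "cross n (-k) = - cross n k" by (simp add: cross_def)
  ultimately show "prim n" unfolding prim_iff_cross by (metis minus_minus)
qed (metis prim_iff_cross abs_one)

lemma prim_GL: assumes "A \<in> GL" shows "prim (A n) \<longleftrightarrow> prim n"
proof
  assume "prim n"
  then show "prim (A n)" unfolding prim_iff_abs_cross using abs_cross_GL[OF assms] by metis
next
  assume "prim (A n)"
  obtain B where B: "B \<in> GL" "B \<circ> A = id" using assms by (metis GL_inv)
  from \<open>prim (A n)\<close> have "prim (B (A n))" unfolding prim_iff_abs_cross using abs_cross_GL[OF B(1)] by metis
  then show "prim n" using B(2) by (metis comp_apply id_apply)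
qed

lemma prim_nz: "prim n \<Longrightarrow> n \<noteq> 0"
  by (auto simp: prim_def)

lemma prim_uminus [simp]: "prim (- n) \<longleftrightarrow> prim n"
  by (simp add: prim_def)

lemma prim_parallel:
  assumes "prim n" "prim k" "cross n k = 0" shows "k = n \<or> k = - n"
proof -
  obtain x where x: "cross n x = 1" using assms(1) prim_iff_cross by blast
  define t where "t = cross k x"
  have e: "fst n * snd k = snd n * fst k" using assms(3) by (simp add: cross_def)
  have x': "fst n * snd x - snd n * fst x = 1" using x by (simp add: cross_def)
  have "t * fst n = fst k * (fst n * snd x) - (fst n * snd k) * fst x" by (simp add: t_def cross_def algebra_simps)
  also have "\<dots> = fst k * (fst n * snd x - snd n * fst x)" unfolding e by (simp add: algebra_simps)
  finally have 1: "fst k = t * fst n" using x' by simp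
  have "t * snd n = (snd n * fst k) * snd x - snd k * (snd n * fst x)" by (simp add: t_def cross_def algebra_simps)
  also have "\<dots> = snd k * (fst n * snd x - snd n * fst x)" unfolding e[symmetric] by (simp add: algebra_simps)
  finally have 2: "snd k = t * snd n" using x' by simp
  have "t dvd fst k" "t dvd snd k" using 1 2 by auto
  then have "is_unit t" using assms(2) unfolding prim_def by (meson coprime_def)
  then have "t = 1 \<or> t = -1" by auto
  then show ?thesis
  proof
    assume "t = 1" then have "k = n" using 1 2 by (simp add: prod_eq_iff)
    then show ?thesis ..
  next
    assume "t = -1" then have "k = - n" using 1 2 by (simp add: prod_eq_iff)
    then show ?thesis ..
  qed
qed

lemma supp_comp: assumes "bij A" shows "A ` supp (\<nu> \<circ> A) = supp \<nu>"
proof -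
  have "supp (\<nu> \<circ> A) = A -` supp \<nu>" by (auto simp: supp_def)
  then show ?thesis using surj_image_vimage_eq[OF bij_is_surj[OF assms]] by simp
qed

lemma supp_comp_bij: assumes "bij A" shows "bij_betw A (supp (\<nu> \<circ> A)) (supp \<nu>)"
  unfolding bij_betw_def using supp_comp[OF assms] inj_on_subset[OF bij_is_inj[OF assms]] by simp

lemma msum_comp: "bij A \<Longrightarrow> msum (\<nu> \<circ> A) (\<lambda>n. F (A n)) = msum \<nu> F"
  unfolding msum_def using sum.reindex_bij_betw[OF supp_comp_bij, of A "\<lambda>n. int (\<nu> n) * F n"] by simp

lemma card_supp_comp: "bij A \<Longrightarrow> card (supp (\<nu> \<circ> A)) = card (supp \<nu>)"
  using supp_comp_bij by (rule bij_betw_same_card)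

lemma finite_supp_comp: "bij A \<Longrightarrow> finite (supp (\<nu> \<circ> A)) \<longleftrightarrow> finite (supp \<nu>)"
  using supp_comp_bij by (rule bij_betw_finite)

lemma msum_linear: "msum \<nu> (\<lambda>n. a * F n + b * G n) = a * msum \<nu> F + b * msum \<nu> G"
  by (simp add: msum_def sum.distrib sum_distrib_left algebra_simps)

lemma weights_GL:
  assumes "A \<in> GL" "\<nu> \<in> weights" shows "\<nu> \<circ> A \<in> weights"
proof -
  obtain B where B: "B \<in> GL" "A \<circ> B = id" "B \<circ> A = id" using assms(1) by (rule GL_inv)
  obtain a b c d where b: "B = lin a b c d" using B(1) by (rule GL_E)
  have BA: "B (A n) = n" for n using B(3) by (metis comp_apply id_apply)
  have bj: "bij A" using assms(1) by (rule GL_bij)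
  have "msum (\<nu> \<circ> A) fst = msum (\<nu> \<circ> A) (\<lambda>n. fst (B (A n)))" by (simp add: BA)
  also have "\<dots> = msum \<nu> (\<lambda>n. a * fst n + b * snd n)" by (subst msum_comp[OF bj]) (simp add: b lin_def)
  finally have 1: "msum (\<nu> \<circ> A) fst = 0" using assms(2) by (simp add: msum_linear weights_def)
  have "msum (\<nu> \<circ> A) snd = msum (\<nu> \<circ> A) (\<lambda>n. snd (B (A n)))" by (simp add: BA)
  also have "\<dots> = msum \<nu> (\<lambda>n. c * fst n + d * snd n)" by (subst msum_comp[OF bj]) (simp add: b lin_def)
  finally have 2: "msum (\<nu> \<circ> A) snd = 0" using assms(2) by (simp add: msum_linear weights_def)
  have "prim n" if "\<nu> (A n) \<noteq> 0" for n
  proof -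
    have "A n \<in> supp \<nu>" using that by (simp add: supp_def)
    then have "prim (A n)" using assms(2) unfolding weights_def by blast
    then show ?thesis using prim_GL[OF assms(1)] by blast
  qed
  then show ?thesis using 1 2 assms(2) finite_supp_comp[OF bj]
    by (auto simp: weights_def supp_def)
qed

lemma width2_comp: assumes "A \<in> GL" shows "width2 (\<nu> \<circ> A) f = width2 \<nu> (A f)"
proof -
  have "width2 (\<nu> \<circ> A) f = msum (\<nu> \<circ> A) (\<lambda>n. \<bar>cross (A n) (A f)\<bar>)"
    unfolding width2_def abs_cross_GL[OF assms] ..
  also have "\<dots> = width2 \<nu> (A f)" unfolding width2_def
    by (subst msum_comp[OF GL_bij[OF assms]]) simp
  finally show ?thesis .
qed

lemma qform_comp: assumes "A \<in> GL" shows "qform (\<nu> \<circ> A) f = qform \<nu> (A f)"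
proof -
  have "qform (\<nu> \<circ> A) f = msum (\<nu> \<circ> A) (\<lambda>n. (cross (A n) (A f))\<^sup>2)"
    unfolding qform_def using abs_cross_GL[OF assms] by (metis power2_abs)
  also have "\<dots> = qform \<nu> (A f)" unfolding qform_def
    by (subst msum_comp[OF GL_bij[OF assms]]) simp
  finally show ?thesis .
qed

lemma nondeg_comp: assumes "A \<in> GL" shows "nondeg (\<nu> \<circ> A) \<longleftrightarrow> nondeg \<nu>"
proof -
  have "(cross n k \<noteq> 0) = (cross (A n) (A k) \<noteq> 0)" for n k using abs_cross_GL[OF assms, of n k] by linarith
  then show ?thesis unfolding nondeg_def supp_comp[OF GL_bij[OF assms], of \<nu>, symmetric] by auto
qed

lemma msum_nonneg: "(\<And>n. n \<in> supp \<nu> \<Longrightarrow> 0 \<le> F n) \<Longrightarrow> 0 \<le> msum \<nu> F"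
  unfolding msum_def by (auto intro!: sum_nonneg)

lemma msum_mono: "(\<And>n. n \<in> supp \<nu> \<Longrightarrow> F n \<le> G n) \<Longrightarrow> msum \<nu> F \<le> msum \<nu> G"
  unfolding msum_def by (auto intro!: sum_mono mult_left_mono)

lemma msum_member_le:
  assumes "finite (supp \<nu>)" "\<And>n. n \<in> supp \<nu> \<Longrightarrow> 0 \<le> F n" "k \<in> supp \<nu>"
  shows "int (\<nu> k) * F k \<le> msum \<nu> F"
  unfolding msum_def using assms by (intro member_le_sum) auto

lemma cross_add: "cross n (a + b) = cross n a + cross n b" by (simp add: cross_def algebra_simps)
lemma cross_diff: "cross n (a - b) = cross n a - cross n b" by (simp add: cross_def algebra_simps)
lemma cross_minus [simp]: "cross n (- a) = - cross n a" "cross (- n) a = - cross n a"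
  by (simp_all add: cross_def)

lemma qform_pos:
  assumes "finite (supp \<nu>)" "nondeg \<nu>" "b \<noteq> 0" shows "0 < qform \<nu> b"
proof -
  obtain n k where nk: "n \<in> supp \<nu>" "k \<in> supp \<nu>" "cross n k \<noteq> 0" using assms(2) by (auto simp: nondeg_def)
  have "cross n b \<noteq> 0 \<or> cross k b \<noteq> 0"
  proof (rule ccontr)
    assume "\<not> ?thesis"
    then have z: "fst n * snd b = snd n * fst b" "fst k * snd b = snd k * fst b" by (auto simp: cross_def)
    have "cross n k * fst b = fst n * (snd k * fst b) - (snd n * fst b) * fst k" by (simp add: cross_def algebra_simps)
    then have "cross n k * fst b = 0" unfolding z[symmetric] by simp
    moreover have "cross n k * snd b = (fst n * snd b) * snd k - snd n * (fst k * snd b)" by (simp add: cross_def algebra_simps)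
    then have "cross n k * snd b = 0" unfolding z by simp
    ultimately show False using nk(3) assms(3) by (auto simp: prod_eq_iff)
  qed
  then obtain l where l: "l \<in> supp \<nu>" "cross l b \<noteq> 0" using nk by blast
  then have "0 < int (\<nu> l) * (cross l b)\<^sup>2" by (auto simp: supp_def)
  also have "\<dots> \<le> qform \<nu> b" unfolding qform_def by (rule msum_member_le[OF assms(1) _ l(1)]) simp
  finally show ?thesis .
qed

section \<open>Orbits of weights and the lemma of Burnside\<close>

definition orbit :: "(vec \<Rightarrow> vec) set \<Rightarrow> (vec \<Rightarrow> nat) \<Rightarrow> (vec \<Rightarrow> nat) set" where
  "orbit H \<nu> = {\<nu> \<circ> A | A. A \<in> H}"

definition is_group :: "(vec \<Rightarrow> vec) set \<Rightarrow> bool" where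
  "is_group H \<longleftrightarrow> id \<in> H \<and> (\<forall>A\<in>H. \<forall>B\<in>H. A \<circ> B \<in> H) \<and> (\<forall>A\<in>H. \<exists>B\<in>H. A \<circ> B = id \<and> B \<circ> A = id)"

definition stable :: "(vec \<Rightarrow> vec) set \<Rightarrow> (vec \<Rightarrow> nat) set \<Rightarrow> bool" where
  "stable H X \<longleftrightarrow> (\<forall>\<nu>\<in>X. \<forall>A\<in>H. \<nu> \<circ> A \<in> X)"

lemma orbit_self: "is_group H \<Longrightarrow> \<nu> \<in> orbit H \<nu>"
  unfolding orbit_def is_group_def by (force intro: exI[of _ id])

lemma orbit_eq:
  assumes "is_group H" "A \<in> H" shows "orbit H (\<nu> \<circ> A) = orbit H \<nu>"
proof -
  obtain B where B: "B \<in> H" "A \<circ> B = id" using assms unfolding is_group_def by blast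
  have "\<nu> \<circ> A \<circ> C \<in> orbit H \<nu>" if "C \<in> H" for C
  proof -
    have "A \<circ> C \<in> H" using assms that unfolding is_group_def by blast
    then show ?thesis unfolding orbit_def comp_assoc by blast
  qed
  moreover have "\<nu> \<circ> C \<in> orbit H (\<nu> \<circ> A)" if "C \<in> H" for C
  proof -
    have "B \<circ> C \<in> H" using assms(1) B that unfolding is_group_def by blast
    moreover have "\<nu> \<circ> C = \<nu> \<circ> A \<circ> (B \<circ> C)" using B(2) by (metis comp_assoc comp_id)
    ultimately show ?thesis unfolding orbit_def by blast
  qed
  ultimately show ?thesis unfolding orbit_def[of H "\<nu> \<circ> A"] orbit_def[of H \<nu>] by (auto simp: orbit_def)
qed

lemma orbit_eqI: assumes "is_group H" "\<mu> \<in> orbit H \<nu>" shows "orbit H \<mu> = orbit H \<nu>"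
proof -
  obtain A where "A \<in> H" "\<mu> = \<nu> \<circ> A" using assms(2) unfolding orbit_def by blast
  then show ?thesis using orbit_eq[OF assms(1)] by simp
qed

lemma orbit_subset: "stable H X \<Longrightarrow> \<nu> \<in> X \<Longrightarrow> orbit H \<nu> \<subseteq> X"
  by (auto simp: orbit_def stable_def)

lemma card_orbits_disjoint:
  assumes "is_group H" "stable H X" "stable H Y" "X \<inter> Y = {}" "finite (orbit H ` X)" "finite (orbit H ` Y)"
  shows "card (orbit H ` (X \<union> Y)) = card (orbit H ` X) + card (orbit H ` Y)"
proof -
  have "orbit H ` X \<inter> orbit H ` Y = {}"
  proof (rule ccontr)
    assume "\<not> ?thesis"
    then obtain x y where "x \<in> X" "y \<in> Y" "orbit H x = orbit H y" by auto
    then have "x \<in> Y" using orbit_self[OF assms(1)] orbit_subset[OF assms(3)] by blast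
    then show False using \<open>x \<in> X\<close> assms(4) by blast
  qed
  then show ?thesis using assms(5,6) by (simp add: image_Un card_Un_disjoint)
qed

lemma card_orbits_transfer:
  assumes H: "is_group H" and K: "is_group K" and "H \<subseteq> K" and "X \<subseteq> Y"
    and reach: "\<And>\<nu>. \<nu> \<in> Y \<Longrightarrow> \<exists>A\<in>K. \<nu> \<circ> A \<in> X"
    and ret: "\<And>\<nu> A. \<nu> \<in> X \<Longrightarrow> A \<in> K \<Longrightarrow> \<nu> \<circ> A \<in> X \<Longrightarrow> A \<in> H"
  shows "bij_betw (\<lambda>Z. orbit K (SOME \<nu>. \<nu> \<in> X \<and> orbit H \<nu> = Z)) (orbit H ` X) (orbit K ` Y)"
proof -
  let ?r = "\<lambda>Z. SOME \<nu>. \<nu> \<in> X \<and> orbit H \<nu> = Z"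
  have r: "?r Z \<in> X \<and> orbit H (?r Z) = Z" if "Z \<in> orbit H ` X" for Z
    using someI_ex[of "\<lambda>\<nu>. \<nu> \<in> X \<and> orbit H \<nu> = Z"] that by blast
  have ko: "orbit K \<mu> = orbit K \<nu>" if "orbit H \<mu> = orbit H \<nu>" for \<mu> \<nu>
  proof -
    have "\<mu> \<in> orbit H \<nu>" using orbit_self[OF H] that by blast
    then have "\<mu> \<in> orbit K \<nu>" using \<open>H \<subseteq> K\<close> by (auto simp: orbit_def)
    then show ?thesis by (rule orbit_eqI[OF K])
  qed
  show ?thesis unfolding bij_betw_def
  proof
    show "inj_on (\<lambda>Z. orbit K (?r Z)) (orbit H ` X)"
    proof (rule inj_onI)
      fix Z Z' assume Z: "Z \<in> orbit H ` X" "Z' \<in> orbit H ` X" "orbit K (?r Z) = orbit K (?r Z')"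
      define x x' where "x = ?r Z" and "x' = ?r Z'"
      have x: "x \<in> X" "orbit H x = Z" using r[OF Z(1)] by (simp_all add: x_def)
      have x': "x' \<in> X" "orbit H x' = Z'" using r[OF Z(2)] by (simp_all add: x'_def)
      have "x' \<in> orbit K x" using orbit_self[OF K, of x'] Z(3) by (simp add: x_def x'_def)
      then obtain A where A: "A \<in> K" "x' = x \<circ> A" by (auto simp: orbit_def)
      then have "A \<in> H" using ret[OF x(1)] x'(1) by simp
      then have "orbit H x' = orbit H x" using A orbit_eq[OF H] by simp
      then show "Z = Z'" using x x' by simp
    qed
    show "(\<lambda>Z. orbit K (?r Z)) ` orbit H ` X = orbit K ` Y"
    proof (intro equalityI subsetI)
      fix P assume "P \<in> (\<lambda>Z. orbit K (?r Z)) ` orbit H ` X"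
      then show "P \<in> orbit K ` Y" using r \<open>X \<subseteq> Y\<close> by fastforce
    next
      fix P assume "P \<in> orbit K ` Y"
      then obtain y where y: "y \<in> Y" "P = orbit K y" by blast
      obtain A where A: "A \<in> K" "y \<circ> A \<in> X" using reach y by blast
      have "orbit K (?r (orbit H (y \<circ> A))) = orbit K (y \<circ> A)"
        by (rule ko) (use r[of "orbit H (y \<circ> A)"] A in blast)
      also have "\<dots> = P" using orbit_eq[OF K A(1)] y by simp
      finally show "P \<in> (\<lambda>Z. orbit K (?r Z)) ` orbit H ` X" using A(2) by blast
    qed
  qed
qed

theorem burnside:
  assumes H: "is_group H" "finite H" and X: "stable H X" "finite X"
  shows "(\<Sum>A\<in>H. card {\<nu>\<in>X. \<nu> \<circ> A = \<nu>}) = card H * card (orbit H ` X)"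
proof -
  have "(\<Sum>A\<in>H. card {\<nu>\<in>X. \<nu> \<circ> A = \<nu>}) = (\<Sum>A\<in>H. \<Sum>\<nu>\<in>X. if \<nu> \<circ> A = \<nu> then 1 else 0)"
    by (intro sum.cong refl) (use X(2) in \<open>simp add: sum.If_cases Int_def\<close>)
  also have "\<dots> = (\<Sum>\<nu>\<in>X. card {A\<in>H. \<nu> \<circ> A = \<nu>})"
    by (subst sum.swap, intro sum.cong refl) (use H(2) in \<open>simp add: sum.If_cases Int_def\<close>)
  also have "\<dots> = (\<Sum>Z\<in>orbit H ` X. \<Sum>\<nu>\<in>{x\<in>X. orbit H x = Z}. card {A\<in>H. \<nu> \<circ> A = \<nu>})"
    using X(2) by (rule sum.image_gen)
  also have "\<dots> = (\<Sum>Z\<in>orbit H ` X. card H)"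
  proof (rule sum.cong[OF refl])
    fix Z assume "Z \<in> orbit H ` X"
    then obtain x where x: "x \<in> X" "Z = orbit H x" by blast
    have set_eq: "{y\<in>X. orbit H y = Z} = Z"
    proof (intro equalityI subsetI)
      fix y assume "y \<in> {y\<in>X. orbit H y = Z}"
      then show "y \<in> Z" using orbit_self[OF H(1), of y] by simp
    next
      fix y assume "y \<in> Z"
      then have "y \<in> orbit H x" using x by simp
      then show "y \<in> {y\<in>X. orbit H y = Z}"
        using x orbit_subset[OF X(1) x(1)] orbit_eqI[OF H(1)] by auto
    qed
    have finO: "finite Z" using x orbit_subset[OF X(1) x(1)] X(2) by (simp add: finite_subset)
    have "card {A\<in>H. y \<circ> A = y} = card {A\<in>H. x \<circ> A = y}" if y: "y \<in> Z" for y
    proof -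
      obtain C where C: "C \<in> H" "y = x \<circ> C" using y x by (auto simp: orbit_def)
      obtain D where D: "D \<in> H" "C \<circ> D = id" "D \<circ> C = id" using C H(1) unfolding is_group_def by blast
      have "bij_betw (\<lambda>A. C \<circ> A) {A\<in>H. y \<circ> A = y} {A\<in>H. x \<circ> A = y}"
      proof (rule bij_betw_byWitness[where f' = "\<lambda>A. D \<circ> A"])
        show "\<forall>A\<in>{A \<in> H. y \<circ> A = y}. D \<circ> (C \<circ> A) = A" using D by (simp add: comp_assoc[symmetric])
        show "\<forall>A\<in>{A \<in> H. x \<circ> A = y}. C \<circ> (D \<circ> A) = A" using D by (simp add: comp_assoc[symmetric])
        show "(\<lambda>A. C \<circ> A) ` {A \<in> H. y \<circ> A = y} \<subseteq> {A \<in> H. x \<circ> A = y}"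
          using C H(1) unfolding is_group_def by (auto simp: comp_assoc)
        show "(\<lambda>A. D \<circ> A) ` {A \<in> H. x \<circ> A = y} \<subseteq> {A \<in> H. y \<circ> A = y}"
        proof safe
          fix A assume A: "A \<in> H" "y = x \<circ> A"
          show "D \<circ> A \<in> H" using A D H(1) unfolding is_group_def by blast
          show "x \<circ> A \<circ> (D \<circ> A) = x \<circ> A"
            using C(2) A(2) D(2) by (metis comp_assoc comp_id)
        qed
      qed
      then show ?thesis by (rule bij_betw_same_card)
    qed
    then have "(\<Sum>y\<in>Z. card {A\<in>H. y \<circ> A = y}) = (\<Sum>y\<in>Z. card {A\<in>H. x \<circ> A = y})" by simp
    also have "\<dots> = card (\<Union>y\<in>Z. {A\<in>H. x \<circ> A = y})"
      using finO H(2) by (subst card_UN_disjoint) auto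
    also have "(\<Union>y\<in>Z. {A\<in>H. x \<circ> A = y}) = H" using x by (auto simp: orbit_def)
    finally show "(\<Sum>\<nu>\<in>{x\<in>X. orbit H x = Z}. card {A\<in>H. \<nu> \<circ> A = \<nu>}) = card H" unfolding set_eq .
  qed
  finally show ?thesis by simp
qed

lemma card_fixed_conj:
  assumes B: "B \<in> H" "C \<in> H" "B \<circ> C = id" "C \<circ> B = id" and X: "stable H X"
  shows "card {\<nu>\<in>X. \<nu> \<circ> (B \<circ> A \<circ> C) = \<nu>} = card {\<nu>\<in>X. \<nu> \<circ> A = \<nu>}"
proof -
  have "bij_betw (\<lambda>\<nu>. \<nu> \<circ> B) {\<nu>\<in>X. \<nu> \<circ> (B \<circ> A \<circ> C) = \<nu>} {\<nu>\<in>X. \<nu> \<circ> A = \<nu>}"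
  proof (rule bij_betw_byWitness[where f' = "\<lambda>\<nu>. \<nu> \<circ> C"])
    show "(\<lambda>\<nu>. \<nu> \<circ> B) ` {\<nu> \<in> X. \<nu> \<circ> (B \<circ> A \<circ> C) = \<nu>} \<subseteq> {\<nu> \<in> X. \<nu> \<circ> A = \<nu>}"
    proof safe
      fix \<nu> assume n: "\<nu> \<in> X" "\<nu> \<circ> (B \<circ> A \<circ> C) = \<nu>"
      show "\<nu> \<circ> B \<in> X" using n X B unfolding stable_def by blast
      have "\<nu> \<circ> B = \<nu> \<circ> (B \<circ> A \<circ> C) \<circ> B" using n(2) by simp
      then show "\<nu> \<circ> B \<circ> A = \<nu> \<circ> B" using B(4) by (metis comp_assoc comp_id)
    qed
    show "(\<lambda>\<nu>. \<nu> \<circ> C) ` {\<nu> \<in> X. \<nu> \<circ> A = \<nu>} \<subseteq> {\<nu> \<in> X. \<nu> \<circ> (B \<circ> A \<circ> C) = \<nu>}"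
    proof safe
      fix \<nu> assume n: "\<nu> \<in> X" "\<nu> \<circ> A = \<nu>"
      show "\<nu> \<circ> C \<in> X" using n X B unfolding stable_def by blast
      show "\<nu> \<circ> C \<circ> (B \<circ> A \<circ> C) = \<nu> \<circ> C" using B(4) n(2) by (metis comp_assoc comp_id)
    qed
  qed (use B in \<open>auto simp: comp_assoc\<close>)
  then show ?thesis by (rule bij_betw_same_card)
qed

section \<open>Reduction of bases\<close>

text \<open>An even strictly convex function on the lattice behaves on bases like the values of a positive definite
quadratic form on Conway's topograph. The width itself is only convex, hence the abstract setting.\<close>
locale convex_even =
  fixes \<phi> :: "vec \<Rightarrow> int" and M :: int
  assumes even: "\<phi> (- v) = \<phi> v"
    and strict: "b \<noteq> 0 \<Longrightarrow> 2 * \<phi> a < \<phi> (a + b) + \<phi> (a - b)"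
    and nonneg: "0 \<le> \<phi> v"
begin

text \<open>A basis \<open>a, b\<close> belongs to the two triangles with third vertex \<open>a + b\<close> and \<open>a - b\<close>. It is a root
if neither of these triangles lies strictly below the other within the bound; a triangle is a root if all
of its three edges see it as the lower one.\<close>
definition root_edge :: "vec \<Rightarrow> vec \<Rightarrow> bool" where
  "root_edge a b \<longleftrightarrow> \<phi> a \<le> M \<and> \<phi> b \<le> M \<and>
     (\<phi> (a + b) = \<phi> (a - b) \<or> M < \<phi> (a + b) \<and> M < \<phi> (a - b))"

definition root_triangle :: "vec \<Rightarrow> vec \<Rightarrow> bool" where
  "root_triangle a b \<longleftrightarrow> \<phi> a \<le> M \<and> \<phi> b \<le> M \<and> \<phi> (a - b) \<le> M \<and>
     \<phi> (a - b) < \<phi> (a + b) \<and> \<phi> b < \<phi> (a + (a - b)) \<and> \<phi> a < \<phi> (b - (a - b))"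

lemma even_diff: "\<phi> (a - b) = \<phi> (b - a)"
  using even[of "a - b"] by simp

lemma root_edge_sym: "root_edge b a \<longleftrightarrow> root_edge a b"
  unfolding root_edge_def using even_diff[of a b] by (simp add: add.commute) auto

lemma root_edge_neg: "root_edge a (- b) \<longleftrightarrow> root_edge a b"
  unfolding root_edge_def by (auto simp: even)

text \<open>Passing to the lower triangle or to its lower edge decreases the values, so the descent
ends in a root.\<close>
lemma root_exists:
  assumes "\<phi> a \<le> M" "\<phi> b \<le> M" "\<bar>cross a b\<bar> = 1"
  shows "\<exists>a b. \<bar>cross a b\<bar> = 1 \<and> (root_edge a b \<or> root_triangle a b)"
  using assms
proof (induction "nat (\<phi> a + \<phi> b)" arbitrary: a b rule: less_induct)
  case less
  show ?case
  proof (cases "root_edge a b")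
    case True then show ?thesis using less by blast
  next
    case False
    define b' where "b' = (if \<phi> (a - b) < \<phi> (a + b) then b else - b)"
    have b': "\<phi> (a - b') < \<phi> (a + b')" "\<phi> (a - b') \<le> M" "\<phi> b' = \<phi> b" "\<bar>cross a b'\<bar> = 1"
      using False less.prems unfolding root_edge_def b'_def by (auto simp: even)
    have nz: "a \<noteq> 0" "b' \<noteq> 0" using b'(4) by (auto simp: cross_def)
    show ?thesis
    proof (cases "root_triangle a b'")
      case True then show ?thesis using b' by blast
    next
      case False
      then have "\<phi> (a + (a - b')) \<le> \<phi> b' \<or> \<phi> (b' - (a - b')) \<le> \<phi> a"
        using b' less.prems unfolding root_triangle_def by auto
      then show ?thesis
      proof
        assume h: "\<phi> (a + (a - b')) \<le> \<phi> b'"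
        have "2 * \<phi> (a - b') < \<phi> (a - b' + a) + \<phi> (a - b' - a)" by (rule strict[OF nz(1)])
        then have "\<phi> (a - b') < \<phi> b'" using h even[of b'] by (simp add: add.commute)
        moreover have "\<bar>cross a (a - b')\<bar> = 1" using b'(4) by (simp add: cross_def algebra_simps)
        ultimately show ?thesis using less.prems b'(2,3) nonneg[of a] nonneg[of "a - b'"]
          by (intro less.hyps[of a "a - b'"]) auto
      next
        assume h: "\<phi> (b' - (a - b')) \<le> \<phi> a"
        have "2 * \<phi> (a - b') < \<phi> (a - b' + b') + \<phi> (a - b' - b')" by (rule strict[OF nz(2)])
        then have "\<phi> (a - b') < \<phi> a" using h even_diff[of "a - b'" b'] by simp
        moreover have "\<bar>cross (a - b') b'\<bar> = 1" using b'(4) by (simp add: cross_def algebra_simps)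
        ultimately show ?thesis using less.prems b'(2,3) nonneg[of b] nonneg[of "a - b'"]
          by (intro less.hyps[of "a - b'" b']) auto
      qed
    qed
  qed
qed

end

lemma nonneg_basis_comparable:
  assumes "0 \<le> i" "0 \<le> j" "0 \<le> k" "0 \<le> l" "\<bar>i * l - j * k\<bar> = (1::int)"
    and "\<not> (i = 1 \<and> j = 0 \<and> k = 0 \<and> l = 1)" "\<not> (i = 0 \<and> j = 1 \<and> k = 1 \<and> l = 0)"
  shows "(k \<le> i \<and> l \<le> j) \<or> (i \<le> k \<and> j \<le> l)"
proof (rule ccontr)
  assume "\<not> ?thesis"
  then consider "k < i" "j < l" | "i < k" "l < j" by linarith
  then show False
  proof cases
    case 1
    then have "(k + 1) * (j + 1) \<le> i * l" using assms by (intro mult_mono) auto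
    then have "k + j + 1 \<le> i * l - j * k" by (simp add: algebra_simps)
    then have "k = 0" "j = 0" using assms by auto
    then have "i * l = 1" using assms(5) 1 by auto
    then show False using assms(6) \<open>k = 0\<close> \<open>j = 0\<close> 1 by (metis assms(1) pos_zmult_eq_1_iff)
  next
    case 2
    then have "(i + 1) * (l + 1) \<le> k * j" using assms by (intro mult_mono) auto
    then have "i + l + 1 \<le> j * k - i * l" by (simp add: algebra_simps)
    then have "i = 0" "l = 0" using assms by auto
    then have "k * j = 1" using assms(5) 2 by (auto simp: mult.commute)
    then show False using assms(7) \<open>i = 0\<close> \<open>l = 0\<close> 2 by (metis assms(3) pos_zmult_eq_1_iff)
  qed
qed

context convex_even
begin

definition quadrant :: "vec \<Rightarrow> bool" where
  "quadrant c \<longleftrightarrow> 0 \<le> fst c \<and> 0 \<le> snd c"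

definition obtuse :: bool where
  "obtuse \<longleftrightarrow> \<phi> (1,0) < \<phi> (1,1) \<and> \<phi> (0,1) < \<phi> (1,1)"

text \<open>This is the climbing lemma for Conway's topograph: once the values grow across the
standard basis, strict convexity propagates the growth through the whole quadrant.\<close>
lemma quadrant_growth:
  assumes "obtuse" "quadrant c" "quadrant d" "\<bar>cross c d\<bar> = 1"
  shows "\<phi> c < \<phi> (c + d) \<and> \<phi> d < \<phi> (c + d)"
  using assms(2-)
proof (induction "nat (fst c + snd c + fst d + snd d)" arbitrary: c d rule: less_induct)
  case less
  obtain i j k l where cd: "c = (i,j)" "d = (k,l)" by (metis prod.exhaust)
  have nn: "0 \<le> i" "0 \<le> j" "0 \<le> k" "0 \<le> l" "\<bar>i * l - j * k\<bar> = 1"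
    using less.prems unfolding cd quadrant_def cross_def by auto
  have step: "\<phi> c < \<phi> (c + d) \<and> \<phi> d < \<phi> (c + d)" 
    if q: "quadrant (c - d)" "quadrant d" "\<bar>cross (c - d) d\<bar> = 1" 
      "nat (fst (c-d) + snd (c-d) + fst d + snd d) < n" and
      IH: "\<And>c d. nat (fst c + snd c + fst d + snd d) < n \<Longrightarrow> quadrant c \<Longrightarrow> quadrant d \<Longrightarrow> \<bar>cross c d\<bar> = 1
        \<Longrightarrow> \<phi> c < \<phi> (c + d) \<and> \<phi> d < \<phi> (c + d)" for c d n
  proof -
    have h: "\<phi> (c - d) < \<phi> c" "\<phi> d < \<phi> c" using IH[of "c - d" d] q by auto
    have "d \<noteq> 0" using q(3) by (auto simp: cross_def)
    then have "2 * \<phi> c < \<phi> (c + d) + \<phi> (c - d)" by (rule strict)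
    then show ?thesis using h by linarith
  qed
  show ?case
  proof (cases "(i = 1 \<and> j = 0 \<and> k = 0 \<and> l = 1) \<or> (i = 0 \<and> j = 1 \<and> k = 1 \<and> l = 0)")
    case True
    then show ?thesis using assms(1) by (auto simp: cd obtuse_def)
  next
    case False
    then consider "k \<le> i \<and> l \<le> j" | "i \<le> k \<and> j \<le> l" using nonneg_basis_comparable[OF nn] by blast
    then show ?thesis
    proof cases
      case 1
      have "k > 0 \<or> l > 0" using nn by (cases "k = 0 \<and> l = 0") auto
      then show ?thesis using 1 nn less.prems
        by (intro step[OF _ _ _ _ less.hyps]) (auto simp: cd quadrant_def cross_def algebra_simps)
    next
      case 2
      have "i > 0 \<or> j > 0" using nn by (cases "i = 0 \<and> j = 0") auto
      then have "\<phi> d < \<phi> (d + c) \<and> \<phi> c < \<phi> (d + c)" using 2 nn less.prems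
        by (intro step[OF _ _ _ _ less.hyps]) (auto simp: cd quadrant_def cross_def algebra_simps)
      then show ?thesis by (simp add: add.commute)
    qed
  qed
qed

lemma quadrant_not_generator:
  assumes "obtuse" "quadrant c" "quadrant d" "\<bar>cross c d\<bar> = 1" "{c, d} \<noteq> {(1,0),(0,1)}"
  shows "quadrant (c - d) \<and> \<phi> (c - d) < \<phi> c \<or> quadrant (d - c) \<and> \<phi> (c - d) < \<phi> d"
proof -
  obtain i j k l where cd: "c = (i,j)" "d = (k,l)" by (metis prod.exhaust)
  have nn: "0 \<le> i" "0 \<le> j" "0 \<le> k" "0 \<le> l" "\<bar>i * l - j * k\<bar> = 1"
    using assms unfolding cd quadrant_def cross_def by auto
  have "(k \<le> i \<and> l \<le> j) \<or> (i \<le> k \<and> j \<le> l)"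
    by (rule nonneg_basis_comparable[OF nn]) (use assms(5) cd in auto)
  then show ?thesis
  proof
    assume h: "k \<le> i \<and> l \<le> j"
    have "\<phi> (c - d) < \<phi> (c - d + d)"
      using quadrant_growth[OF assms(1), of "c - d" d] h nn by (auto simp: cd quadrant_def cross_def algebra_simps)
    then show ?thesis using h by (simp add: cd quadrant_def)
  next
    assume h: "i \<le> k \<and> j \<le> l"
    have "\<phi> (d - c) < \<phi> (d - c + c)"
      using quadrant_growth[OF assms(1), of "d - c" c] h nn by (auto simp: cd quadrant_def cross_def algebra_simps)
    then show ?thesis using h even_diff[of c d] by (simp add: cd quadrant_def)
  qed
qed

lemma quadrant_no_root_edge:
  assumes "obtuse" "quadrant c" "quadrant d" "\<bar>cross c d\<bar> = 1" "{c, d} \<noteq> {(1,0),(0,1)}"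
  shows "\<not> root_edge c d"
  using quadrant_growth[OF assms(1-4)] quadrant_not_generator[OF assms] unfolding root_edge_def by auto

text \<open>Among the three edges of a triangle inside the quadrant, the one spanning it has the outer
  vertex as third vertex.\<close>
lemma quadrant_no_root_triangle:
  assumes "obtuse" "quadrant c" "quadrant d" "\<bar>cross c d\<bar> = 1" "\<phi> (c + d) < \<phi> (c - d)"
  shows "{c, d} = {(1,0),(0,1)}"
  using quadrant_growth[OF assms(1-4)] quadrant_not_generator[OF assms(1-4)] assms(5) by force


lemma obtuse_of_root_edge: "root_edge (1,0) (0,1) \<Longrightarrow> obtuse"
  using strict[of "(0,1)" "(1,0)"] strict[of "(1,0)" "(0,1)"] even_diff[of "(1,0)" "(0,1)"]
  unfolding root_edge_def obtuse_def by (auto simp: zero_prod_def)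

lemma obtuse_of_root_triangle: "root_triangle (1,0) (0,1) \<Longrightarrow> obtuse"
  using strict[of "(0,1)" "(1,0)"] strict[of "(1,0)" "(0,1)"] even_diff[of "(1,0)" "(0,1)"]
  unfolding root_triangle_def obtuse_def by (auto simp: zero_prod_def)

definition acute :: "vec \<Rightarrow> vec \<Rightarrow> vec \<Rightarrow> bool" where
  "acute x y z \<longleftrightarrow> \<phi> x \<le> M \<and> \<phi> y \<le> M \<and> \<phi> z \<le> M \<and>
     \<phi> (x + y) < \<phi> (x - y) \<and> \<phi> (y + z) < \<phi> (y - z) \<and> \<phi> (z + x) < \<phi> (z - x)"

lemma root_triangle_acute: "root_triangle a b \<Longrightarrow> acute a (- b) (b - a)"
  unfolding root_triangle_def acute_def
  using even_diff[of a b] even[of b] even[of a] even[of "a + (a - b)"] even[of "b - (a - b)"]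
  by (auto simp: algebra_simps)

lemma convex_even_comp: "A \<in> GL \<Longrightarrow> convex_even (\<phi> \<circ> A)"
proof
  fix a b :: vec assume A: "A \<in> GL" and b: "b \<noteq> 0"
  obtain B where "B \<circ> A = id" using A by (rule GL_inv)
  then have "B (A v) = v" for v by (metis comp_apply id_apply)
  moreover have "A 0 = 0" using A by (rule GL_E) (simp add: lin_def zero_prod_def)
  ultimately have "A b \<noteq> 0" using b by metis
  then show "2 * (\<phi> \<circ> A) a < (\<phi> \<circ> A) (a + b) + (\<phi> \<circ> A) (a - b)"
    using strict[of "A b" "A a"] by (simp add: GL_add[OF A] GL_diff[OF A])
qed (auto simp: GL_minus even nonneg)

end

definition reflect :: "vec \<Rightarrow> vec" where "reflect = lin 1 0 0 (- 1)"

lemma reflect_GL: "reflect \<in> GL" unfolding reflect_def by (rule GL_I) simp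

lemma reflect_simp [simp]: "reflect (x, y) = (x, - y)" by (simp add: reflect_def lin_def)

lemma reflect_reflect [simp]: "reflect (reflect v) = v" by (cases v) simp

abbreviation in_quadrant :: "vec \<Rightarrow> bool" where
  "in_quadrant c \<equiv> 0 \<le> fst c \<and> 0 \<le> snd c"

lemma basis_in_quadrant:
  assumes "\<bar>cross a b\<bar> = 1"
  obtains s t where "s \<in> {a, - a}" "t \<in> {b, - b}"
    "in_quadrant s \<and> in_quadrant t \<or> in_quadrant (reflect s) \<and> in_quadrant (reflect t)"
proof -
  obtain i j k l where ab: "a = (i,j)" "b = (k,l)" by (metis prod.exhaust)
  have d: "\<bar>i * l - j * k\<bar> = 1" using assms by (simp add: ab cross_def)
  have opp: False if "0 < x * y" "u * v < 0" "\<bar>x * v - y * u\<bar> = 1" for x y u v :: int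
  proof -
    have "(x * v) * (y * u) = (x * y) * (u * v)" by (simp only: ac_simps)
    then have "(x * v) * (y * u) < 0" using mult_pos_neg[OF that(1,2)] by (simp only:)
    then have "(0 < x * v \<and> y * u < 0) \<or> (x * v < 0 \<and> 0 < y * u)" by (simp add: mult_less_0_iff)
    then show False using that(3) by linarith
  qed
  have "(0 \<le> i * j \<and> 0 \<le> k * l) \<or> (i * j \<le> 0 \<and> k * l \<le> 0)"
    using opp[of i j k l] opp[of k l i j] d by (smt (verit, best) mult.commute)
  then show thesis
  proof
    assume h: "0 \<le> i * j \<and> 0 \<le> k * l"
    have 1: "in_quadrant v \<or> in_quadrant (- v)" if "0 \<le> fst v * snd v" for v :: vec
      using that by (auto simp: zero_le_mult_iff)
    show thesis using that[of a b] that[of "-a" b] that[of a "-b"] that[of "-a" "-b"] 1[of a] 1[of b] h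
      by (auto simp: ab)
  next
    assume h: "i * j \<le> 0 \<and> k * l \<le> 0"
    have 1: "in_quadrant (reflect v) \<or> in_quadrant (reflect (- v))" if "fst v * snd v \<le> 0" for v :: vec
      using that by (cases v) (auto simp: mult_le_0_iff)
    show thesis using that[of a b] that[of "-a" b] that[of a "-b"] that[of "-a" "-b"] 1[of a] 1[of b] h
      by (auto simp: ab)
  qed
qed

lemma basis_comparable:
  assumes "in_quadrant c" "in_quadrant d" "\<bar>cross c d\<bar> = 1"
  shows "in_quadrant (c - d) \<or> in_quadrant (d - c) \<or> (c = (1,0) \<and> d = (0,1)) \<or> (c = (0,1) \<and> d = (1,0))"
  using nonneg_basis_comparable[of "fst c" "snd c" "fst d" "snd d"] assms
  by (cases c; cases d) (auto simp: cross_def)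

lemma triangle_in_quadrant:
  assumes "\<bar>cross x y\<bar> = 1" "x + y + z = 0"
  obtains u v s where "(u,v) \<in> {(x,y),(y,z),(z,x)}" "s \<in> {(u,v), (- u, - v)}"
    "in_quadrant (fst s) \<and> in_quadrant (snd s) \<or> in_quadrant (reflect (fst s)) \<and> in_quadrant (reflect (snd s))"
proof -
  note goal = that
  have z: "z = - x - y" using assms(2) by (metis add_eq_0_iff2 minus_add_distrib diff_conv_add_uminus add.commute)
  have main: thesis if *: "p \<in> {x,-x}" "q \<in> {y,-y}" "in_quadrant (T p)" "in_quadrant (T q)"
    and T: "T = id \<or> T = reflect" for p q T
  proof -
    have fin: thesis if "(u,v) \<in> {(x,y),(y,z),(z,x)}" "s \<in> {(u,v), (- u, - v)}"
      "in_quadrant (T (fst s))" "in_quadrant (T (snd s))" for u v s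
      using goal[OF that(1,2)] that(3,4) T by auto
    have Tm: "T (- v) = - T v" "T (v - w) = T v - T w" for v w
      using T by (auto simp: GL_minus[OF reflect_GL] GL_diff[OF reflect_GL])
    have cT: "\<bar>cross (T v) (T w)\<bar> = \<bar>cross v w\<bar>" for v w
      using T by (auto simp: abs_cross_GL[OF reflect_GL])
    have cr: "\<bar>cross (T p) (T q)\<bar> = 1" using *(1,2) assms(1) by (auto simp: cT)
    have e: "x + y = - z" "y + x = - z" "- y - x = z" "- x - y = z" by (simp_all add: z)
    have mixed: thesis if m: "p = x \<and> q = - y \<or> p = - x \<and> q = y"
    proof -
      from basis_comparable[OF *(3,4) cr]
      consider "in_quadrant (T (p - q))" | "in_quadrant (T (q - p))"
        | "(T p = (1,0) \<and> T q = (0,1)) \<or> (T p = (0,1) \<and> T q = (1,0))" by (auto simp: Tm)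
      then show thesis
      proof cases
        case 1
        from m show thesis
        proof
          assume "p = x \<and> q = - y"
          then show thesis using 1 * by (intro fin[of y z "(-y,-z)"]) (auto simp: e)
        next
          assume "p = - x \<and> q = y"
          then show thesis using 1 * by (intro fin[of y z "(y,z)"]) (auto simp: e)
        qed
      next
        case 2
        from m show thesis
        proof
          assume "p = x \<and> q = - y"
          then show thesis using 2 * by (intro fin[of z x "(z,x)"]) (auto simp: e)
        next
          assume "p = - x \<and> q = y"
          then show thesis using 2 * by (intro fin[of z x "(-z,-x)"]) (auto simp: e)
        qed
      next
        case 3
        define T' where "T' = (if T = id then reflect else id)"
        have ex: "\<exists>s\<in>{(x,y),(-x,-y)}. in_quadrant (T' (fst s)) \<and> in_quadrant (T' (snd s))"
          using m 3 T unfolding T'_def by (cases p; cases q; cases x; cases y) (auto split: if_splits)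
        then obtain s where s: "s \<in> {(x,y),(-x,-y)}" "in_quadrant (T' (fst s))" "in_quadrant (T' (snd s))" by blast
        have q: "in_quadrant (fst s) \<and> in_quadrant (snd s) \<or> in_quadrant (reflect (fst s)) \<and> in_quadrant (reflect (snd s))"
          using s(2,3) by (simp add: T'_def split: if_splits)
        show thesis by (rule goal[OF _ s(1) q]) simp
      qed
    qed
    show thesis using *(1,2)
    proof (elim insertE emptyE)
      assume "p = x" "q = y" then show thesis using * by (intro fin[of x y "(x,y)"]) auto
    next
      assume "p = - x" "q = - y" then show thesis using * by (intro fin[of x y "(-x,-y)"]) auto
    qed (use mixed in auto)
  qed
  obtain p q where "p \<in> {x,-x}" "q \<in> {y,-y}"
    "in_quadrant p \<and> in_quadrant q \<or> in_quadrant (reflect p) \<and> in_quadrant (reflect q)"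
    using basis_in_quadrant[OF assms(1)] .
  then show thesis using main[of p q id] main[of p q reflect] by auto
qed


definition D4 :: "(vec \<Rightarrow> vec) set" where
  "D4 = {lin 1 0 0 1, lin (-1) 0 0 (-1), lin 0 1 1 0, lin 0 (-1) (-1) 0,
         lin 1 0 0 (-1), lin (-1) 0 0 1, lin 0 1 (-1) 0, lin 0 (-1) 1 0}"

definition V4 :: "(vec \<Rightarrow> vec) set" where
  "V4 = {lin 1 0 0 1, lin (-1) 0 0 (-1), lin 0 1 1 0, lin 0 (-1) (-1) 0}"

definition D6 :: "(vec \<Rightarrow> vec) set" where
  "D6 = {lin 1 0 0 1, lin (-1) 0 0 (-1), lin 0 1 1 0, lin 0 (-1) (-1) 0,
         lin (-1) (-1) 1 0, lin 1 1 (-1) 0, lin 0 1 (-1) (-1), lin 0 (-1) 1 1,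
         lin (-1) 0 1 1, lin 1 0 (-1) (-1), lin 1 1 0 (-1), lin (-1) (-1) 0 1}"

lemma fourth_quadrant_cones:
  assumes "in_quadrant (reflect c)" "in_quadrant (reflect d)" "\<bar>cross c d\<bar> = 1"
  shows "(\<exists>P\<in>{lin 1 1 0 (-1), lin 1 0 (-1) (-1)}. \<exists>c' d'. c = P c' \<and> d = P d' \<and> in_quadrant c' \<and> in_quadrant d')
    \<or> {c, d} = {(1,0), (0,-1)}"
proof -
  obtain i j k l where cd: "c = (i,-j)" "d = (k,-l)"
    by (metis prod.exhaust minus_minus)
  have nn: "0 \<le> i" "0 \<le> j" "0 \<le> k" "0 \<le> l" "\<bar>i * l - j * k\<bar> = 1" using assms by (auto simp: cd cross_def)
  consider "j \<le> i" "l \<le> k" | "i \<le> j" "k \<le> l" | "j < i" "k < l" | "i < j" "l < k" by linarith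
  then show ?thesis
  proof cases
    case 1
    then have "c = lin 1 1 0 (-1) (i - j, j)" "d = lin 1 1 0 (-1) (k - l, l)" by (auto simp: cd lin_def)
    then show ?thesis using 1 nn by (intro disjI1 bexI[of _ "lin 1 1 0 (-1)"]) force+
  next
    case 2
    then have "c = lin 1 0 (-1) (-1) (i, j - i)" "d = lin 1 0 (-1) (-1) (k, l - k)" by (auto simp: cd lin_def)
    then show ?thesis using 2 nn by (intro disjI1 bexI[of _ "lin 1 0 (-1) (-1)"]) force+
  next
    case 3
    then have "(j + 1) * (k + 1) \<le> i * l" using nn by (intro mult_mono) auto
    then have "j + k + 1 \<le> i * l - j * k" by (simp add: algebra_simps)
    then have "j = 0" "k = 0" using nn by auto
    then have "i = 1 \<and> l = 1" using nn(5) 3 by (simp add: abs_mult zmult_eq_1_iff)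
    then show ?thesis using \<open>j = 0\<close> \<open>k = 0\<close> by (simp add: cd)
  next
    case 4
    then have "(i + 1) * (l + 1) \<le> j * k" using nn by (intro mult_mono) auto
    then have "i + l + 1 \<le> j * k - i * l" by (simp add: algebra_simps)
    then have "i = 0" "l = 0" using nn by auto
    then have "j = 1 \<and> k = 1" using nn(5) 4 by (simp add: abs_mult zmult_eq_1_iff)
    then show ?thesis using \<open>i = 0\<close> \<open>l = 0\<close> by (auto simp: cd)
  qed
qed

context convex_even
begin

lemma root_edge_comp:
  assumes "A \<in> GL" shows "convex_even.root_edge (\<phi> \<circ> A) M c d \<longleftrightarrow> root_edge (A c) (A d)"
  unfolding convex_even.root_edge_def[OF convex_even_comp[OF assms]] root_edge_def
  by (simp add: GL_add[OF assms] GL_diff[OF assms])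

lemma root_triangle_comp:
  assumes "A \<in> GL" shows "convex_even.root_triangle (\<phi> \<circ> A) M c d \<longleftrightarrow> root_triangle (A c) (A d)"
  unfolding convex_even.root_triangle_def[OF convex_even_comp[OF assms]] root_triangle_def
  by (simp add: GL_add[OF assms] GL_diff[OF assms])

lemma acute_pair:
  assumes "acute x y z" "x + y + z = 0" "\<bar>cross x y\<bar> = 1"
    "(u,v) \<in> {(x,y),(y,z),(z,x)}" "s \<in> {(u,v), (- u, - v)}"
  shows "\<phi> (fst s + snd s) < \<phi> (fst s - snd s)" "\<phi> (fst s + snd s) \<le> M" "\<bar>cross (fst s) (snd s)\<bar> = 1"
proof -
  have z: "z = - x - y" using assms(2) by (metis add_eq_0_iff2 minus_add_distrib diff_conv_add_uminus add.commute)
  have e: "\<phi> (- u - v) = \<phi> (u + v)" "\<phi> (- u + v) = \<phi> (u - v)" "\<phi> (v - u) = \<phi> (u - v)" using even[of "u + v"] even[of "u - v"] by simp_all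
  have f: "\<phi> (u + v) < \<phi> (u - v)" using assms(1,4) unfolding acute_def by auto
  have "u + v \<in> {- x, - y, - z}" using assms(4) by (auto simp: z)
  then have g: "\<phi> (u + v) \<le> M" using assms(1) even[of x] even[of y] even[of z] unfolding acute_def by auto
  show "\<phi> (fst s + snd s) < \<phi> (fst s - snd s)" "\<phi> (fst s + snd s) \<le> M" using assms(5) e f g by auto
  have "cross y z = cross x y" "cross z x = cross x y" by (simp_all add: z cross_def algebra_simps)
  then have "\<bar>cross u v\<bar> = 1" using assms(3,4) by auto
  then show "\<bar>cross (fst s) (snd s)\<bar> = 1" using assms(5) by auto
qed

text \<open>Every basis can be moved by sign changes and the reflection into the quadrant, where growth
leaves only the standard basis as a root.\<close>
lemma unique_root_edge:
  assumes std: "root_edge (1,0) (0,1)" and "root_edge a b" "\<bar>cross a b\<bar> = 1"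
  shows "{a, b} \<subseteq> {(1,0), (-1,0), (0,1), (0,-1)}"
proof -
  obtain s t where st: "s \<in> {a, - a}" "t \<in> {b, - b}"
    "in_quadrant s \<and> in_quadrant t \<or> in_quadrant (reflect s) \<and> in_quadrant (reflect t)"
    using basis_in_quadrant[OF assms(3)] .
  have "root_edge a t" using assms(2) st(2) root_edge_neg[of a b] by auto
  then have r: "root_edge s t" using st(1) root_edge_neg[of t a] by (metis insertE root_edge_sym singletonD)
  have c: "\<bar>cross s t\<bar> = 1" using assms(3) st(1,2) by auto
  from st(3) have "{s, t} = {(1,0),(0,1)} \<or> {reflect s, reflect t} = {(1,0),(0,1)}"
  proof
    assume "in_quadrant s \<and> in_quadrant t"
    then have "quadrant s" "quadrant t" by (simp_all add: quadrant_def)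
    then show ?thesis using quadrant_no_root_edge[OF obtuse_of_root_edge[OF std] _ _ c] r by blast
  next
    assume q: "in_quadrant (reflect s) \<and> in_quadrant (reflect t)"
    interpret R: convex_even "\<phi> \<circ> reflect" M by (rule convex_even_comp[OF reflect_GL])
    have "R.root_edge (1,0) (0,1)" using std root_edge_neg[of "(1,0)" "(0,1)"]
      by (simp add: root_edge_comp[OF reflect_GL])
    moreover have "R.root_edge (reflect s) (reflect t)" using r by (simp add: root_edge_comp[OF reflect_GL])
    moreover have "R.quadrant (reflect s)" "R.quadrant (reflect t)" using q by (simp_all add: R.quadrant_def)
    moreover have "\<bar>cross (reflect s) (reflect t)\<bar> = 1" using c by (simp add: abs_cross_GL[OF reflect_GL])
    ultimately show ?thesis using R.quadrant_no_root_edge[OF R.obtuse_of_root_edge] by blast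
  qed
  then have "{s, t} \<subseteq> {(1,0), (-1,0), (0,1), (0,-1)}"
  proof
    assume h: "{reflect s, reflect t} = {(1,0),(0,1)}"
    then have "reflect s = (1,0) \<or> reflect s = (0,1)" "reflect t = (1,0) \<or> reflect t = (0,1)" by auto
    then show ?thesis by (cases s; cases t) auto
  qed auto
  moreover have "- v \<in> {(1,0), (-1,0), (0,1), (0,-1)}" if "v \<in> {(1,0), (-1,0), (0,1), (0,-1)}" for v :: vec
    using that by auto
  moreover have "a = s \<or> a = - s" "b = t \<or> b = - t" using st(1,2) by auto
  ultimately show ?thesis by blast
qed

lemma root_edge_not_acute:
  assumes std: "root_edge (1,0) (0,1)" and ac: "acute x y z" "x + y + z = 0" "\<bar>cross x y\<bar> = 1"
  shows False
proof -
  obtain u v s where s: "(u,v) \<in> {(x,y),(y,z),(z,x)}" "s \<in> {(u,v), (- u, - v)}"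
    "in_quadrant (fst s) \<and> in_quadrant (snd s) \<or> in_quadrant (reflect (fst s)) \<and> in_quadrant (reflect (snd s))"
    using triangle_in_quadrant[OF ac(3,2)] .
  obtain c d where cd: "s = (c, d)" by (cases s)
  note p = acute_pair[OF ac s(1,2), unfolded cd fst_conv snd_conv]
  have ed: "\<phi> (d - c) = \<phi> (c - d)" by (rule even_diff)
  from s(3) show False unfolding cd fst_conv snd_conv
  proof
    assume "in_quadrant c \<and> in_quadrant d"
    then have "{c, d} = {(1,0),(0,1)}"
      using quadrant_no_root_triangle[OF obtuse_of_root_edge[OF std], of c d] p by (simp add: quadrant_def)
    then have "\<phi> (1,1) < \<phi> (1,-1) \<and> \<phi> (1,1) \<le> M" using p(1,2) ed by (auto simp: doubleton_eq_iff)
    then show False using std unfolding root_edge_def by auto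
  next
    assume q: "in_quadrant (reflect c) \<and> in_quadrant (reflect d)"
    interpret R: convex_even "\<phi> \<circ> reflect" M by (rule convex_even_comp[OF reflect_GL])
    have "R.root_edge (1,0) (0,1)" using std root_edge_neg[of "(1,0)" "(0,1)"]
      by (simp add: root_edge_comp[OF reflect_GL])
    then have "{reflect c, reflect d} = {(1,0),(0,1)}"
      using R.quadrant_no_root_triangle[OF R.obtuse_of_root_edge, of "reflect c" "reflect d"] q p
      by (simp add: R.quadrant_def abs_cross_GL[OF reflect_GL] GL_add[OF reflect_GL, symmetric] GL_diff[OF reflect_GL, symmetric])
    then have "(c = (1,0) \<and> d = (0,-1)) \<or> (c = (0,-1) \<and> d = (1,0))"
      by (cases c; cases d) (auto simp: doubleton_eq_iff)
    then have "\<phi> (1,-1) < \<phi> (1,1) \<and> \<phi> (1,-1) \<le> M" using p(1,2) ed by auto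
    then show False using std unfolding root_edge_def by auto
  qed
qed

lemma unique_root_triangle:
  assumes std: "root_triangle (1,0) (0,1)" and ac: "acute x y z" "x + y + z = 0" "\<bar>cross x y\<bar> = 1"
  shows "\<exists>u v. (u,v) \<in> {(x,y),(y,z),(z,x)} \<and> ({u, v} = {(1,0),(0,-1)} \<or> {- u, - v} = {(1,0),(0,-1)})"
proof -
  obtain u v s where s: "(u,v) \<in> {(x,y),(y,z),(z,x)}" "s \<in> {(u,v), (- u, - v)}"
    "in_quadrant (fst s) \<and> in_quadrant (snd s) \<or> in_quadrant (reflect (fst s)) \<and> in_quadrant (reflect (snd s))"
    using triangle_in_quadrant[OF ac(3,2)] .
  obtain c d where cd: "s = (c, d)" by (cases s)
  note p = acute_pair[OF ac s(1,2), unfolded cd fst_conv snd_conv]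
  have ed: "\<phi> (d - c) = \<phi> (c - d)" by (rule even_diff)
  have st: "\<phi> (1,-1) < \<phi> (1,1)" "\<phi> (0,1) < \<phi> (2,-1)" "\<phi> (1,0) < \<phi> (-1,2)"
    using std unfolding root_triangle_def by auto
  have ev: "\<phi> (0,-1) = \<phi> (0,1)" "\<phi> (-1,0) = \<phi> (1,0)" "\<phi> (-1,1) = \<phi> (1,-1)" "\<phi> (1,-2) = \<phi> (-1,2)"
    using even[of "(0,1)"] even[of "(1,0)"] even[of "(1,-1)"] even[of "(-1,2)"] by simp_all
  from s(3) have fin: "{c, d} = {(1,0), (0,-1)}" unfolding cd fst_conv snd_conv
  proof
    assume "in_quadrant c \<and> in_quadrant d"
    then have "{c, d} = {(1,0),(0,1)}"
      using quadrant_no_root_triangle[OF obtuse_of_root_triangle[OF std], of c d] p by (simp add: quadrant_def)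
    then have "\<phi> (1,1) < \<phi> (1,-1)" using p(1,2) ed by (auto simp: doubleton_eq_iff)
    then show ?thesis using st by auto
  next
    assume q: "in_quadrant (reflect c) \<and> in_quadrant (reflect d)"
    show ?thesis
    proof (rule ccontr)
      assume "{c, d} \<noteq> {(1,0), (0,-1)}"
      then obtain P c' d' where P: "P \<in> {lin 1 1 0 (-1), lin 1 0 (-1) (-1)}" "c = P c'" "d = P d'"
        "in_quadrant c'" "in_quadrant d'" using fourth_quadrant_cones[of c d] q p(3) by blast
      have PG: "P \<in> GL" using P(1) by (auto intro!: GL_I)
      interpret R: convex_even "\<phi> \<circ> P" M by (rule convex_even_comp[OF PG])
      have x: "2 * \<phi> (1,-1) < \<phi> (2,-1) + \<phi> (0,-1)" "2 * \<phi> (1,0) < \<phi> (2,-1) + \<phi> (0,1)"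
        "2 * \<phi> (1,-1) < \<phi> (1,-2) + \<phi> (1,0)" "2 * \<phi> (0,-1) < \<phi> (1,-2) + \<phi> (-1,0)"
        using strict[of "(1,0)" "(1,-1)"] strict[of "(1,-1)" "(1,0)"] strict[of "(0,-1)" "(1,-1)"] strict[of "(1,-1)" "(0,-1)"]
        by (simp_all add: zero_prod_def)
      have "R.obtuse" using P(1) x st ev unfolding R.obtuse_def by (auto simp: lin_def)
      then have "{c', d'} = {(1,0),(0,1)}" using R.quadrant_no_root_triangle[of c' d'] p P PG
        by (auto simp: R.quadrant_def abs_cross_GL[OF PG] GL_add[OF PG] GL_diff[OF PG])
      then have cd': "(c' = (1,0) \<and> d' = (0,1)) \<or> (c' = (0,1) \<and> d' = (1,0))" by (auto simp: doubleton_eq_iff)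
      show False using cd' P(1,2,3) p(1) st ev by (auto simp: lin_def)
    qed
  qed
  have "(c = u \<and> d = v) \<or> (c = - u \<and> d = - v)" using s(2) cd by simp
  then have "{u, v} = {(1,0), (0,-1)} \<or> {- u, - v} = {(1,0), (0,-1)}"
    using fin by (elim disjE conjE) (simp_all only: simp_thms)
  with s(1) show ?thesis by blast
qed

end

section \<open>Counting classes by bases and triangles\<close>

text \<open>The width is scaled so that it dominates; the quadratic form makes the sum strictly convex.\<close>
definition phi :: "nat \<Rightarrow> (vec \<Rightarrow> nat) \<Rightarrow> vec \<Rightarrow> int" where
  "phi m \<nu> f = (4 * int m ^ 2 + 1) * width2 \<nu> f + qform \<nu> f"

definition phi_bound :: "nat \<Rightarrow> int" where
  "phi_bound m = (2 * int m + 1) * (4 * int m ^ 2 + 1) - 1"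

lemma width2_nonneg: "0 \<le> width2 \<nu> f"
  unfolding width2_def by (rule msum_nonneg) simp

lemma qform_nonneg: "0 \<le> qform \<nu> f"
  unfolding qform_def by (rule msum_nonneg) simp

lemma qform_le_width2:
  assumes "finite (supp \<nu>)" shows "qform \<nu> f \<le> (width2 \<nu> f)\<^sup>2"
proof -
  have "(cross n f)\<^sup>2 \<le> width2 \<nu> f * \<bar>cross n f\<bar>" if n: "n \<in> supp \<nu>" for n
  proof -
    have "1 * \<bar>cross n f\<bar> \<le> int (\<nu> n) * \<bar>cross n f\<bar>" using n by (intro mult_right_mono) (auto simp: supp_def)
    also have "\<dots> \<le> width2 \<nu> f" unfolding width2_def by (rule msum_member_le[OF assms _ n]) simp
    finally have "\<bar>cross n f\<bar> * \<bar>cross n f\<bar> \<le> width2 \<nu> f * \<bar>cross n f\<bar>" by (intro mult_right_mono) auto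
    then show ?thesis by (simp add: power2_eq_square)
  qed
  then have "qform \<nu> f \<le> msum \<nu> (\<lambda>n. width2 \<nu> f * \<bar>cross n f\<bar>)" unfolding qform_def by (rule msum_mono)
  also have "\<dots> = (width2 \<nu> f)\<^sup>2"
    using msum_linear[of \<nu> "width2 \<nu> f" "\<lambda>n. \<bar>cross n f\<bar>" 0 "\<lambda>n. 0"]
    by (simp add: width2_def[of \<nu> f, symmetric] power2_eq_square)
  finally show ?thesis .
qed

lemma phi_le_iff:
  assumes "finite (supp \<nu>)" shows "phi m \<nu> f \<le> phi_bound m \<longleftrightarrow> width2 \<nu> f \<le> 2 * int m"
proof
  assume h: "width2 \<nu> f \<le> 2 * int m"
  have "qform \<nu> f \<le> (width2 \<nu> f)\<^sup>2" by (rule qform_le_width2[OF assms])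
  also have "\<dots> \<le> (2 * int m)\<^sup>2" by (rule power_mono[OF h width2_nonneg])
  finally have "qform \<nu> f \<le> 4 * int m ^ 2" by (simp add: power_mult_distrib)
  moreover have "(4 * int m ^ 2 + 1) * width2 \<nu> f \<le> (4 * int m ^ 2 + 1) * (2 * int m)"
    using h by (intro mult_left_mono) auto
  ultimately show "phi m \<nu> f \<le> phi_bound m" unfolding phi_def phi_bound_def by (simp add: algebra_simps)
next
  assume h: "phi m \<nu> f \<le> phi_bound m"
  show "width2 \<nu> f \<le> 2 * int m"
  proof (rule ccontr)
    assume "\<not> ?thesis"
    then have "(2 * int m + 1) * (4 * int m ^ 2 + 1) \<le> width2 \<nu> f * (4 * int m ^ 2 + 1)"
      by (intro mult_right_mono) auto
    moreover have "width2 \<nu> f * (4 * int m ^ 2 + 1) + qform \<nu> f \<le> (2 * int m + 1) * (4 * int m ^ 2 + 1) - 1"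
      using h unfolding phi_def phi_bound_def by (simp only: mult.commute)
    ultimately show False using qform_nonneg[of \<nu> f] by linarith
  qed
qed

lemma width2_convex: "2 * width2 \<nu> a \<le> width2 \<nu> (a + b) + width2 \<nu> (a - b)"
proof -
  have "msum \<nu> (\<lambda>n. 2 * \<bar>cross n a\<bar> + 0 * 0) \<le> msum \<nu> (\<lambda>n. 1 * \<bar>cross n (a + b)\<bar> + 1 * \<bar>cross n (a - b)\<bar>)"
    by (rule msum_mono) (simp add: cross_add cross_diff)
  then show ?thesis unfolding msum_linear by (simp add: width2_def)
qed

lemma qform_parallelogram: "qform \<nu> (a + b) + qform \<nu> (a - b) = 2 * qform \<nu> a + 2 * qform \<nu> b"
proof -
  have "msum \<nu> (\<lambda>n. 1 * (cross n (a + b))\<^sup>2 + 1 * (cross n (a - b))\<^sup>2)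
      = msum \<nu> (\<lambda>n. 2 * (cross n a)\<^sup>2 + 2 * (cross n b)\<^sup>2)"
    by (simp add: cross_add cross_diff power2_eq_square algebra_simps)
  then show ?thesis unfolding msum_linear by (simp add: qform_def)
qed

lemma phi_convex_even:
  assumes "\<nu> \<in> weights" "nondeg \<nu>" shows "convex_even (phi m \<nu>)"
proof
  fix v show "phi m \<nu> (- v) = phi m \<nu> v" by (simp add: phi_def width2_def qform_def)
  show "0 \<le> phi m \<nu> v" unfolding phi_def using width2_nonneg[of \<nu> v] qform_nonneg[of \<nu> v] by simp
next
  fix a b :: vec assume b: "b \<noteq> 0"
  have "0 < qform \<nu> b" using qform_pos[OF _ assms(2) b] assms(1) by (simp add: weights_def)
  moreover have "(4 * int m ^ 2 + 1) * (2 * width2 \<nu> a) \<le> (4 * int m ^ 2 + 1) * (width2 \<nu> (a + b) + width2 \<nu> (a - b))"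
    by (intro mult_left_mono width2_convex) auto
  ultimately show "2 * phi m \<nu> a < phi m \<nu> (a + b) + phi m \<nu> (a - b)"
    using qform_parallelogram[of \<nu> a b] unfolding phi_def by (simp add: algebra_simps)
qed

lemma phi_comp: "A \<in> GL \<Longrightarrow> phi m (\<nu> \<circ> A) = phi m \<nu> \<circ> A"
  by (auto simp: phi_def width2_comp qform_comp)

lemma group_D4: "is_group D4"
  unfolding is_group_def D4_def by (simp add: lin_comp lin_inject lin_id[symmetric])

lemma group_V4: "is_group V4"
  unfolding is_group_def V4_def by (simp add: lin_comp lin_inject lin_id[symmetric])

lemma group_D6: "is_group D6"
  unfolding is_group_def D6_def by (simp add: lin_comp lin_inject lin_id[symmetric])

lemma group_GL: "is_group GL"
  unfolding is_group_def using GL_id GL_comp GL_inv by metis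

lemma V4_D4: "V4 \<subseteq> D4" and V4_D6: "V4 \<subseteq> D6" and D4_GL: "D4 \<subseteq> GL" and D6_GL: "D6 \<subseteq> GL"
  by (auto simp: V4_def D4_def D6_def intro!: GL_I)

text \<open>A basis for which both widths are at most \<open>m\<close> puts a polygon into the square of side \<open>m\<close>; moving this
basis to the standard one turns the count of bases into a count of weights.\<close>
definition edge_set :: "(vec \<Rightarrow> nat) set \<Rightarrow> nat \<Rightarrow> (vec \<Rightarrow> nat) set" where
  "edge_set N m = {\<nu> \<in> N. width2 \<nu> (1,0) \<le> 2 * int m \<and> width2 \<nu> (0,1) \<le> 2 * int m}"

definition triangle_set :: "(vec \<Rightarrow> nat) set \<Rightarrow> nat \<Rightarrow> (vec \<Rightarrow> nat) set" where
  "triangle_set N m = {\<nu> \<in> edge_set N m. width2 \<nu> (1,-1) \<le> 2 * int m}"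

text \<open>The same count is needed for all polygons and for those with a fixed number of vertices; both are families
of weights that are closed under change of basis.\<close>
locale weight_family =
  fixes N :: "(vec \<Rightarrow> nat) set" and m :: nat
  assumes N: "N \<subseteq> weights" "\<And>\<nu>. \<nu> \<in> N \<Longrightarrow> nondeg \<nu>" and stable_N: "stable GL N"
    and finite_edge: "finite (edge_set N m)"
begin

abbreviation "M \<equiv> phi_bound m"
abbreviation "\<Phi> \<equiv> phi m"
abbreviation "E \<equiv> edge_set N m"
abbreviation "T \<equiv> triangle_set N m"
abbreviation "redge \<nu> \<equiv> convex_even.root_edge (\<Phi> \<nu>) M"
abbreviation "rtri \<nu> \<equiv> convex_even.root_triangle (\<Phi> \<nu>) M"

lemma cv: "\<nu> \<in> N \<Longrightarrow> convex_even (\<Phi> \<nu>)"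
  using N phi_convex_even by blast

lemma E_iff: "\<nu> \<in> E \<longleftrightarrow> \<nu> \<in> N \<and> \<Phi> \<nu> (1,0) \<le> M \<and> \<Phi> \<nu> (0,1) \<le> M"
  using N(1) phi_le_iff[of \<nu>] by (auto simp: edge_set_def weights_def)

lemma T_iff: "\<nu> \<in> T \<longleftrightarrow> \<nu> \<in> E \<and> \<Phi> \<nu> (1,-1) \<le> M"
  using N(1) phi_le_iff[of \<nu>] by (auto simp: triangle_set_def edge_set_def weights_def)

lemma N_comp: "\<nu> \<in> N \<Longrightarrow> A \<in> GL \<Longrightarrow> \<nu> \<circ> A \<in> N"
  using stable_N by (auto simp: stable_def)

lemma redge_comp: "\<nu> \<in> N \<Longrightarrow> A \<in> GL \<Longrightarrow> redge (\<nu> \<circ> A) a b \<longleftrightarrow> redge \<nu> (A a) (A b)"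
  using convex_even.root_edge_comp[OF cv] by (simp add: phi_comp)

lemma rtri_comp: "\<nu> \<in> N \<Longrightarrow> A \<in> GL \<Longrightarrow> rtri (\<nu> \<circ> A) a b \<longleftrightarrow> rtri \<nu> (A a) (A b)"
  using convex_even.root_triangle_comp[OF cv] by (simp add: phi_comp)

lemma ev: 
  assumes "\<nu> \<in> N"
  shows "\<Phi> \<nu> (-1,0) = \<Phi> \<nu> (1,0)" "\<Phi> \<nu> (0,-1) = \<Phi> \<nu> (0,1)" "\<Phi> \<nu> (-1,-1) = \<Phi> \<nu> (1,1)" "\<Phi> \<nu> (-1,1) = \<Phi> \<nu> (1,-1)"
   "\<Phi> \<nu> (-2,1) = \<Phi> \<nu> (2,-1)" "\<Phi> \<nu> (-1,2) = \<Phi> \<nu> (1,-2)"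
  using convex_even.even[OF cv[OF assms], of "(1,0)"] convex_even.even[OF cv[OF assms], of "(0,1)"]
    convex_even.even[OF cv[OF assms], of "(1,1)"] convex_even.even[OF cv[OF assms], of "(1,-1)"]
    convex_even.even[OF cv[OF assms], of "(2,-1)"] convex_even.even[OF cv[OF assms], of "(1,-2)"] by simp_all

definition "E0 = {\<nu> \<in> N. redge \<nu> (1,0) (0,1)}"
definition "T0 = {\<nu> \<in> N. rtri \<nu> (1,0) (0,1)}"
definition "Tm = {\<nu> \<in> T. \<Phi> \<nu> (1,-1) < \<Phi> \<nu> (1,1)}"

lemma E0_iff: "\<nu> \<in> E0 \<longleftrightarrow> \<nu> \<in> E \<and> (\<Phi> \<nu> (1,1) = \<Phi> \<nu> (1,-1) \<or> M < \<Phi> \<nu> (1,1) \<and> M < \<Phi> \<nu> (1,-1))"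
  using convex_even.root_edge_def[OF cv] by (auto simp: E0_def E_iff)

lemma T0_iff: "\<nu> \<in> T0 \<longleftrightarrow> \<nu> \<in> T \<and> \<Phi> \<nu> (1,-1) < \<Phi> \<nu> (1,1) \<and> \<Phi> \<nu> (0,1) < \<Phi> \<nu> (2,-1) \<and> \<Phi> \<nu> (1,0) < \<Phi> \<nu> (-1,2)"
  using convex_even.root_triangle_def[OF cv] by (auto simp: T0_def T_iff E_iff)

lemma stable_E: "stable D4 E"
  unfolding stable_def
proof (intro ballI)
  fix \<nu> A assume n: "\<nu> \<in> E" and A: "A \<in> D4"
  then have "\<nu> \<in> N" "A \<in> GL" using D4_GL by (auto simp: E_iff)
  then show "\<nu> \<circ> A \<in> E" using n A N_comp[of \<nu> A] ev[of \<nu>]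
    by (auto simp: E_iff phi_comp D4_def lin_def)
qed

lemma stable_T: "stable D6 T"
  unfolding stable_def
proof (intro ballI)
  fix \<nu> A assume n: "\<nu> \<in> T" and A: "A \<in> D6"
  then have "\<nu> \<in> N" "A \<in> GL" using D6_GL by (auto simp: T_iff E_iff)
  then show "\<nu> \<circ> A \<in> T" using n A N_comp[of \<nu> A] ev[of \<nu>]
    by (auto simp: T_iff E_iff phi_comp D6_def lin_def)
qed

lemma stable_E0: "stable D4 E0"
  unfolding stable_def
proof (intro ballI)
  fix \<nu> A assume n: "\<nu> \<in> E0" and A: "A \<in> D4"
  then have "\<nu> \<in> N" "A \<in> GL" using D4_GL by (auto simp: E0_iff E_iff)
  then show "\<nu> \<circ> A \<in> E0" using n A N_comp[of \<nu> A] ev[of \<nu>]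
    by (auto simp: E0_iff E_iff phi_comp D4_def lin_def)
qed

lemma stable_T0: "stable D6 T0"
  unfolding stable_def
proof (intro ballI)
  fix \<nu> A assume n: "\<nu> \<in> T0" and A: "A \<in> D6"
  then have "\<nu> \<in> N" "A \<in> GL" using D6_GL by (auto simp: T0_iff T_iff E_iff)
  then show "\<nu> \<circ> A \<in> T0" using n A N_comp[of \<nu> A] ev[of \<nu>]
    by (auto simp: T0_iff T_iff E_iff phi_comp D6_def lin_def)
qed

lemma stable_Tm: "stable V4 Tm"
  unfolding stable_def
proof (intro ballI)
  fix \<nu> A assume n: "\<nu> \<in> Tm" and A: "A \<in> V4"
  then have "\<nu> \<in> N" "A \<in> GL" using V4_D4 D4_GL by (auto simp: Tm_def T_iff E_iff)
  then show "\<nu> \<circ> A \<in> Tm" using n A N_comp[of \<nu> A] ev[of \<nu>]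
    by (auto simp: Tm_def T_iff E_iff phi_comp V4_def lin_def)
qed


lemma E0_E: "E0 \<subseteq> E" and T0_T: "T0 \<subseteq> T" and Tm_T: "Tm \<subseteq> T" and T_E: "T \<subseteq> E" and E_N: "E \<subseteq> N"
  by (auto simp: E0_iff T0_iff Tm_def T_iff E_iff)

lemma T0_Tm: "T0 \<subseteq> Tm"
  by (auto simp: T0_iff Tm_def)

lemma stable_mono: "stable H X \<Longrightarrow> K \<subseteq> H \<Longrightarrow> stable K X"
  unfolding stable_def by blast

lemma stable_Diff:
  assumes "is_group H" "stable H X" "stable H Y" shows "stable H (X - Y)"
  unfolding stable_def
proof (intro ballI DiffI)
  fix \<nu> A assume n: "\<nu> \<in> X - Y" and A: "A \<in> H"
  show "\<nu> \<circ> A \<in> X" using assms(2) n A unfolding stable_def by blast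
  obtain B where B: "B \<in> H" "A \<circ> B = id" using assms(1) A unfolding is_group_def by blast
  show "\<nu> \<circ> A \<notin> Y"
  proof
    assume "\<nu> \<circ> A \<in> Y"
    then have "\<nu> \<circ> A \<circ> B \<in> Y" using assms(3) B(1) unfolding stable_def by blast
    then show False using n B(2) by (simp add: comp_assoc)
  qed
qed

lemma card_split:
  assumes "is_group H" "stable H X" "stable H Y" "Y \<subseteq> X" "finite X"
  shows "card (orbit H ` X) = card (orbit H ` Y) + card (orbit H ` (X - Y))"
proof -
  have "card (orbit H ` (Y \<union> (X - Y))) = card (orbit H ` Y) + card (orbit H ` (X - Y))"
    using assms stable_Diff[OF assms(1-3)] by (intro card_orbits_disjoint) (auto intro: finite_subset)
  moreover have "Y \<union> (X - Y) = X" using assms(4) by blast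
  ultimately show ?thesis by simp
qed

text \<open>A flag whose triangle has the smaller third vertex is the same as a non-root edge.\<close>
lemma card_flags_at_edges: "card (orbit V4 ` Tm) = card (orbit D4 ` (E - E0))"
proof (rule bij_betw_same_card, rule card_orbits_transfer[OF group_V4 group_D4 V4_D4])
  show "Tm \<subseteq> E - E0" by (auto simp: Tm_def T_iff E0_iff)
  show "\<exists>A\<in>D4. \<nu> \<circ> A \<in> Tm" if "\<nu> \<in> E - E0" for \<nu>
  proof (cases "\<Phi> \<nu> (1,-1) < \<Phi> \<nu> (1,1)")
    case True
    then have "\<nu> \<circ> lin 1 0 0 1 \<in> Tm" using that unfolding lin_id by (auto simp: Tm_def T_iff E0_iff)
    then show ?thesis by (intro bexI[of _ "lin 1 0 0 1"]) (auto simp: D4_def)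
  next
    case False
    have nN: "\<nu> \<in> N" using that by (auto simp: E_iff)
    have G: "lin 1 0 0 (-1) \<in> GL" by (rule GL_I) simp
    then have "\<nu> \<circ> lin 1 0 0 (-1) \<in> Tm" using that False N_comp[OF nN G] ev[OF nN]
      by (auto simp: Tm_def T_iff E_iff E0_iff phi_comp lin_def)
    then show ?thesis by (intro bexI[of _ "lin 1 0 0 (-1)"]) (auto simp: D4_def)
  qed
  show "A \<in> V4" if "\<nu> \<in> Tm" "A \<in> D4" "\<nu> \<circ> A \<in> Tm" for \<nu> A
  proof -
    have nN: "\<nu> \<in> N" and G: "A \<in> GL" using that D4_GL by (auto simp: Tm_def T_iff E_iff)
    have "\<Phi> \<nu> (1,-1) < \<Phi> \<nu> (1,1)" "\<Phi> \<nu> (A (1,-1)) < \<Phi> \<nu> (A (1,1))"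
      using that(1,3) by (auto simp: Tm_def phi_comp[OF G])
    then show ?thesis using that(2) ev[OF nN] unfolding D4_def V4_def by (auto simp: lin_def)
  qed
qed

text \<open>In every other flag the third vertex is the strict maximum of the triangle, so a
  triangle has at most one such flag, and none precisely when it is a root.\<close>
lemma card_flags_at_triangles: "card (orbit V4 ` (T - Tm)) = card (orbit D6 ` (T - T0))"
proof (rule bij_betw_same_card, rule card_orbits_transfer[OF group_V4 group_D6 V4_D6])
  show "T - Tm \<subseteq> T - T0" using T0_Tm by blast
  show "\<exists>A\<in>D6. \<nu> \<circ> A \<in> T - Tm" if n: "\<nu> \<in> T - T0" for \<nu>
  proof -
    have nN: "\<nu> \<in> N" using that by (auto simp: T_iff E_iff)
    have st: "\<nu> \<circ> A \<in> T" if "A \<in> D6" for A using n stable_T that unfolding stable_def by blast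
    consider "\<Phi> \<nu> (1,1) \<le> \<Phi> \<nu> (1,-1)" | "\<Phi> \<nu> (2,-1) \<le> \<Phi> \<nu> (0,1)" | "\<Phi> \<nu> (-1,2) \<le> \<Phi> \<nu> (1,0)"
      using n by (force simp: T0_iff)
    then show ?thesis
    proof cases
      case 1
      then have "\<nu> \<circ> lin 1 0 0 1 \<in> T - Tm" using n unfolding lin_id by (auto simp: Tm_def)
      then show ?thesis by (intro bexI[of _ "lin 1 0 0 1"]) (auto simp: D6_def)
    next
      case 2
      have A: "lin 1 1 0 (-1) \<in> D6" by (simp add: D6_def)
      then have G: "lin 1 1 0 (-1) \<in> GL" using D6_GL by blast
      have "\<nu> \<circ> lin 1 1 0 (-1) \<notin> Tm" using 2 ev[OF nN] unfolding Tm_def mem_Collect_eq phi_comp[OF G] by (simp add: lin_def)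
      then show ?thesis using st[OF A] A by blast
    next
      case 3
      have A: "lin 0 (-1) 1 1 \<in> D6" by (simp add: D6_def)
      then have G: "lin 0 (-1) 1 1 \<in> GL" using D6_GL by blast
      have "\<nu> \<circ> lin 0 (-1) 1 1 \<notin> Tm" using 3 ev[OF nN] unfolding Tm_def mem_Collect_eq phi_comp[OF G] by (simp add: lin_def)
      then show ?thesis using st[OF A] A by blast
    qed
  qed
  show "A \<in> V4" if "\<nu> \<in> T - Tm" "A \<in> D6" "\<nu> \<circ> A \<in> T - Tm" for \<nu> A
  proof -
    have nN: "\<nu> \<in> N" and G: "A \<in> GL" using that D6_GL by (auto simp: T_iff E_iff)
    have max: "\<Phi> \<mu> (1,0) < \<Phi> \<mu> (1,-1) \<and> \<Phi> \<mu> (0,1) < \<Phi> \<mu> (1,-1)" if "\<mu> \<in> T - Tm" for \<mu>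
    proof -
      have mN: "\<mu> \<in> N" using that by (auto simp: T_iff E_iff)
      interpret convex_even "\<Phi> \<mu>" M by (rule cv[OF mN])
      show ?thesis using strict[of "(0,1)" "(1,0)"] strict[of "(1,0)" "(0,1)"] that ev[OF mN]
        by (auto simp: Tm_def zero_prod_def)
    qed
    show ?thesis using max[OF that(1)] max[OF that(3)] that(2) ev[OF nN]
      unfolding phi_comp[OF G] D6_def V4_def by (auto simp: lin_def)
  qed
qed

lemma card_root_edges: "card (orbit D4 ` E0) = card (orbit GL ` {\<nu> \<in> N. \<exists>A\<in>GL. \<nu> \<circ> A \<in> E0})"
proof (rule bij_betw_same_card, rule card_orbits_transfer[OF group_D4 group_GL D4_GL])
  show "E0 \<subseteq> {\<nu> \<in> N. \<exists>A\<in>GL. \<nu> \<circ> A \<in> E0}" using GL_id by (auto simp: E0_def intro: bexI[of _ id])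
  show "A \<in> D4" if "\<nu> \<in> E0" "A \<in> GL" "\<nu> \<circ> A \<in> E0" for \<nu> A
  proof -
    have nN: "\<nu> \<in> N" using that(1) by (simp add: E0_def)
    have G: "A \<in> GL" using that(2) .
    obtain a b c d where A: "A = lin a b c d" "\<bar>a * d - b * c\<bar> = 1" using G by (rule GL_E)
    have 1: "redge \<nu> (1,0) (0,1)" "redge \<nu> (A (1,0)) (A (0,1))"
      using that redge_comp[OF nN that(2)] by (auto simp: E0_def)
    have "\<bar>cross (A (1,0)) (A (0,1))\<bar> = 1" using abs_cross_GL[OF that(2)] by (simp add: cross_def)
    then have "{A (1,0), A (0,1)} \<subseteq> {(1,0), (-1,0), (0,1), (0,-1)}"
      by (rule convex_even.unique_root_edge[OF cv[OF nN] 1])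
    then have "(a, c) \<in> {(1,0), (-1,0), (0,1), (0,-1)}" "(b, d) \<in> {(1,0), (-1,0), (0,1), (0,-1)}"
      unfolding A by (simp_all add: lin_def)
    then show ?thesis using A(2) unfolding A(1) D4_def by auto
  qed
qed auto

lemma card_root_triangles: "card (orbit D6 ` T0) = card (orbit GL ` {\<nu> \<in> N. \<exists>A\<in>GL. \<nu> \<circ> A \<in> T0})"
proof (rule bij_betw_same_card, rule card_orbits_transfer[OF group_D6 group_GL D6_GL])
  show "T0 \<subseteq> {\<nu> \<in> N. \<exists>A\<in>GL. \<nu> \<circ> A \<in> T0}" using GL_id by (auto simp: T0_def intro: bexI[of _ id])
  show "A \<in> D6" if "\<nu> \<in> T0" "A \<in> GL" "\<nu> \<circ> A \<in> T0" for \<nu> A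
  proof -
    have nN: "\<nu> \<in> N" using that(1) by (simp add: T0_def)
    have G: "A \<in> GL" using that(2) .
    obtain a b c d where A: "A = lin a b c d" "\<bar>a * d - b * c\<bar> = 1" using G by (rule GL_E)
    have 1: "rtri \<nu> (1,0) (0,1)" "rtri \<nu> (A (1,0)) (A (0,1))"
      using that rtri_comp[OF nN that(2)] by (auto simp: T0_def)
    interpret convex_even "\<Phi> \<nu>" M by (rule cv[OF nN])
    let ?x = "A (1,0)" and ?y = "- A (0,1)" and ?z = "A (0,1) - A (1,0)"
    have "\<exists>u v. (u,v) \<in> {(?x,?y),(?y,?z),(?z,?x)} \<and> ({u, v} = {(1,0),(0,-1)} \<or> {- u, - v} = {(1,0),(0,-1)})"
      by (rule unique_root_triangle[OF 1(1) root_triangle_acute[OF 1(2)]])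
        (use abs_cross_GL[OF that(2), of "(1,0)" "(0,1)"] in \<open>simp_all add: cross_def\<close>)
    then obtain u v where uv: "(u,v) \<in> {(?x,?y),(?y,?z),(?z,?x)}"
      "{u, v} = {(1,0),(0,-1)} \<or> {- u, - v} = {(1,0),(0,-1)}" by blast
    have cases: "(?x, A (0,1)) \<in> {(u, - v), (- u - v, - u), (v, u + v)}" using uv(1) by auto
    have m: "- p = q \<longleftrightarrow> p = - q" for p q :: vec by auto
    have "(u, v) \<in> {((1,0),(0,-1)), ((0,-1),(1,0)), ((-1,0),(0,1)), ((0,1),(-1,0))}"
      using uv(2) unfolding doubleton_eq_iff m by auto
    then have "(?x, A (0,1)) \<in> {((1,0),(0,1)), ((-1,1),(-1,0)), ((0,-1),(1,-1)), ((0,-1),(-1,0)), ((-1,1),(0,1)),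
       ((1,0),(1,-1)), ((-1,0),(0,-1)), ((1,-1),(1,0)), ((0,1),(-1,1)), ((0,1),(1,0)), ((1,-1),(0,-1)), ((-1,0),(-1,1))}"
      using cases by (elim insertE emptyE Pair_inject) (simp_all only:, simp_all)
    then have "((a,c),(b,d)) \<in> {((1,0),(0,1)), ((-1,1),(-1,0)), ((0,-1),(1,-1)), ((0,-1),(-1,0)), ((-1,1),(0,1)),
       ((1,0),(1,-1)), ((-1,0),(0,-1)), ((1,-1),(1,0)), ((0,1),(-1,1)), ((0,1),(1,0)), ((1,-1),(0,-1)), ((-1,0),(-1,1))}"
      unfolding A(1) by (simp only: lin_def fst_conv snd_conv mult_1_right mult_zero_right add_0_left add_0_right)
    then show ?thesis unfolding A(1) D6_def by auto
  qed
qed auto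

text \<open>The bases and the triangles of small width of one class form a tree, in which a basis is
joined to the triangles that contain it: descent leads from every node to one and the same root. A tree has
one more node than it has edges, so classes are bases plus triangles minus incidences, each up to its own
symmetry group.\<close>
theorem card_classes:
  "card (orbit GL ` {\<nu> \<in> N. \<exists>A\<in>GL. \<nu> \<circ> A \<in> E}) + card (orbit V4 ` T)
     = card (orbit D4 ` E) + card (orbit D6 ` T)"
proof -
  let ?cl = "\<lambda>X. {\<nu> \<in> N. \<exists>A\<in>GL. \<nu> \<circ> A \<in> X}"
  have finT: "finite T" using finite_edge T_E finite_subset by blast
  have stab: "stable GL (?cl X)" for X
    unfolding stable_def
  proof (intro ballI)
    fix \<nu> A assume "\<nu> \<in> ?cl X" and A: "A \<in> GL"
    then obtain C where C: "\<nu> \<in> N" "C \<in> GL" "\<nu> \<circ> C \<in> X" by blast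
    obtain B where B: "B \<in> GL" "A \<circ> B = id" using A by (rule GL_inv)
    have "\<nu> \<circ> A \<circ> (B \<circ> C) = \<nu> \<circ> C" using B(2) by (metis comp_assoc comp_id)
    then show "\<nu> \<circ> A \<in> ?cl X" using C B A N_comp[OF C(1) A] GL_comp[OF B(1) C(2)] by force
  qed
  have disj: "?cl E0 \<inter> ?cl T0 = {}"
  proof (rule ccontr)
    assume "\<not> ?thesis"
    then obtain \<nu> A B where n: "\<nu> \<in> N" "A \<in> GL" "\<nu> \<circ> A \<in> E0" "B \<in> GL" "\<nu> \<circ> B \<in> T0" by blast
    obtain C where C: "C \<in> GL" "A \<circ> C = id" using n(2) by (rule GL_inv)
    define \<mu> where "\<mu> = \<nu> \<circ> A"
    have D: "C \<circ> B \<in> GL" using C n by (intro GL_comp)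
    have mN: "\<mu> \<in> N" using n N_comp by (simp add: \<mu>_def)
    have "\<mu> \<circ> (C \<circ> B) = \<nu> \<circ> B" unfolding \<mu>_def using C(2) by (metis comp_assoc comp_id)
    then have 1: "redge \<mu> (1,0) (0,1)" "rtri \<mu> ((C \<circ> B) (1,0)) ((C \<circ> B) (0,1))"
      using n rtri_comp[OF mN D] by (auto simp: E0_def T0_def \<mu>_def)
    interpret convex_even "\<Phi> \<mu>" M by (rule cv[OF mN])
    show False by (rule root_edge_not_acute[OF 1(1) root_triangle_acute[OF 1(2)]])
        (use abs_cross_GL[OF D, of "(1,0)" "(0,1)"] in \<open>simp_all add: cross_def\<close>)
  qed
  have un: "?cl E = ?cl E0 \<union> ?cl T0"
  proof
    show "?cl E0 \<union> ?cl T0 \<subseteq> ?cl E" using E0_E T0_T T_E by blast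
    show "?cl E \<subseteq> ?cl E0 \<union> ?cl T0"
    proof
      fix \<nu> assume "\<nu> \<in> ?cl E"
      then obtain A where n: "\<nu> \<in> N" "A \<in> GL" "\<nu> \<circ> A \<in> E" by blast
      interpret convex_even "\<Phi> \<nu>" M by (rule cv[OF n(1)])
      have "\<Phi> \<nu> (A (1,0)) \<le> M" "\<Phi> \<nu> (A (0,1)) \<le> M" using n(3) by (auto simp: E_iff phi_comp[OF n(2)])
      then obtain a b where ab: "\<bar>cross a b\<bar> = 1" "root_edge a b \<or> root_triangle a b"
        using root_exists[of "A (1,0)" "A (0,1)"] abs_cross_GL[OF n(2), of "(1,0)" "(0,1)"] by (auto simp: cross_def)
      define B where "B = lin (fst a) (fst b) (snd a) (snd b)"
      have "B \<in> GL" unfolding B_def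
        by (rule GL_I) (use ab(1) in \<open>simp add: cross_def mult.commute\<close>)
      moreover have "B (1,0) = a" "B (0,1) = b" by (simp_all add: B_def lin_def)
      ultimately have B: "B \<in> GL" "B (1,0) = a" "B (0,1) = b" .
      have "\<nu> \<circ> B \<in> E0 \<or> \<nu> \<circ> B \<in> T0"
        using ab(2) redge_comp[OF n(1) B(1)] rtri_comp[OF n(1) B(1)] N_comp[OF n(1) B(1)] B(2,3)
        by (auto simp: E0_def T0_def)
      then show "\<nu> \<in> ?cl E0 \<union> ?cl T0" using n(1) B(1) by blast
    qed
  qed
  have finE0: "finite (orbit GL ` ?cl X)" if "finite X" for X
  proof (rule finite_subset)
    show "orbit GL ` ?cl X \<subseteq> orbit GL ` X" using orbit_eq[OF group_GL] by (auto simp: image_iff)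
    show "finite (orbit GL ` X)" using that by simp
  qed
  have fins: "finite E0" "finite T0" using finite_edge finT E0_E T0_T finite_subset by blast+
  have "card (orbit GL ` ?cl E) = card (orbit D4 ` E0) + card (orbit D6 ` T0)"
    unfolding un card_root_edges card_root_triangles
    by (rule card_orbits_disjoint[OF group_GL stab stab disj finE0[OF fins(1)] finE0[OF fins(2)]])
  moreover have "card (orbit D4 ` E) = card (orbit D4 ` E0) + card (orbit D4 ` (E - E0))"
    by (rule card_split[OF group_D4 stable_E stable_E0 E0_E finite_edge])
  moreover have "card (orbit D6 ` T) = card (orbit D6 ` T0) + card (orbit D6 ` (T - T0))"
    by (rule card_split[OF group_D6 stable_T stable_T0 T0_T finT])
  moreover have "card (orbit V4 ` T) = card (orbit V4 ` Tm) + card (orbit V4 ` (T - Tm))"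
    by (rule card_split[OF group_V4 stable_mono[OF stable_T V4_D6] stable_Tm Tm_T finT])
  ultimately show ?thesis using card_flags_at_edges card_flags_at_triangles by linarith
qed

end

section \<open>Generating functions of cones\<close>

definition vsum :: "(nat \<times> nat \<Rightarrow> nat) \<Rightarrow> nat \<times> nat" where
  "vsum \<mu> = (\<Sum>n\<in>supp \<mu>. \<mu> n * fst n, \<Sum>n\<in>supp \<mu>. \<mu> n * snd n)"

definition fns :: "(nat \<times> nat) set \<Rightarrow> nat \<times> nat \<Rightarrow> (nat \<times> nat \<Rightarrow> nat) set" where
  "fns D s = {\<mu>. finite (supp \<mu>) \<and> supp \<mu> \<subseteq> D \<and> vsum \<mu> = s}"

text \<open>The exponent of \<open>z\<close> records the size of the support, which is the number of edges.\<close>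
definition gfun :: "(nat \<times> nat) set \<Rightarrow> 'a::comm_semiring_1 \<Rightarrow> nat \<times> nat \<Rightarrow> 'a" where
  "gfun D z s = (\<Sum>\<mu>\<in>fns D s. z ^ card (supp \<mu>))"

lemma vsum_superset:
  assumes "finite S" "supp \<mu> \<subseteq> S"
  shows "vsum \<mu> = (\<Sum>n\<in>S. \<mu> n * fst n, \<Sum>n\<in>S. \<mu> n * snd n)"
proof -
  have "(\<Sum>n\<in>supp \<mu>. \<mu> n * f n) = (\<Sum>n\<in>S. \<mu> n * f n)" for f :: "nat \<times> nat \<Rightarrow> nat"
    by (rule sum.mono_neutral_left) (use assms in \<open>auto simp: supp_def\<close>)
  then show ?thesis by (simp add: vsum_def)
qed

lemma fns_bound:
  assumes "\<mu> \<in> fns D s"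
  shows "\<mu> n * fst n \<le> fst s" "\<mu> n * snd n \<le> snd s"
proof -
  have *: "\<mu> n * f n \<le> (\<Sum>n\<in>supp \<mu>. \<mu> n * f n)" for f :: "nat \<times> nat \<Rightarrow> nat"
  proof (cases "n \<in> supp \<mu>")
    case True then show ?thesis using assms by (intro member_le_sum) (auto simp: fns_def)
  qed (simp add: supp_def)
  show "\<mu> n * fst n \<le> fst s" "\<mu> n * snd n \<le> snd s" using *[of fst] *[of snd] assms by (auto simp: fns_def vsum_def)
qed

lemma fns_supp_bound:
  assumes "\<mu> \<in> fns D s" "n \<in> supp \<mu>" shows "fst n \<le> fst s \<and> snd n \<le> snd s"
proof -
  have "1 * fst n \<le> \<mu> n * fst n" "1 * snd n \<le> \<mu> n * snd n" using assms(2) by (auto simp: supp_def)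
  then show ?thesis using fns_bound[OF assms(1), of n] by linarith
qed

lemma fns_restrict: "fns D s = fns (D \<inter> {..fst s} \<times> {..snd s}) s"
  using fns_supp_bound[of _ D s] by (fastforce simp: fns_def mem_Times_iff)

lemma finite_fns:
  assumes "(0,0) \<notin> D" shows "finite (fns D s)"
proof -
  let ?S = "{..fst s} \<times> {..snd s}"
  have "fns D s \<subseteq> {\<mu>. \<mu> ` ?S \<subseteq> {..fst s + snd s} \<and> (\<forall>n. n \<notin> ?S \<longrightarrow> \<mu> n = 0)}"
  proof
    fix \<mu> assume m: "\<mu> \<in> fns D s"
    have b: "\<mu> n \<le> fst s + snd s" for n
    proof (cases "n \<in> supp \<mu>")
      case True
      then have "n \<noteq> (0,0)" using m assms by (auto simp: fns_def)
      then have "1 \<le> fst n \<or> 1 \<le> snd n" by (cases n) auto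
      then have "\<mu> n * 1 \<le> \<mu> n * fst n \<or> \<mu> n * 1 \<le> \<mu> n * snd n" using mult_le_mono2 by blast
      then show ?thesis using fns_bound[OF m, of n] by linarith
    qed (simp add: supp_def)
    have "\<mu> n = 0" if "n \<notin> ?S" for n
      using fns_supp_bound[OF m, of n] that by (auto simp: supp_def mem_Times_iff)
    then show "\<mu> \<in> {\<mu>. \<mu> ` ?S \<subseteq> {..fst s + snd s} \<and> (\<forall>n. n \<notin> ?S \<longrightarrow> \<mu> n = 0)}" using b by auto
  qed
  moreover have "finite {\<mu>. \<mu> ` ?S \<subseteq> {..fst s + snd s} \<and> (\<forall>n. n \<notin> ?S \<longrightarrow> \<mu> n = (0::nat))}"
    using finite_set_of_finite_funs[of ?S "{..fst s + snd s}" "0::nat"]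
    by (rule finite_subset[rotated]) (auto simp: image_subset_iff)
  ultimately show ?thesis by (rule finite_subset)
qed

lemma fns_empty: "fns {} s = (if s = (0,0) then {\<lambda>_. 0} else {})"
  by (auto simp: fns_def supp_def vsum_def fun_eq_iff)

lemma gfun_empty: "gfun {} z s = (if s = (0,0) then 1 else 0)"
  by (simp add: gfun_def fns_empty supp_def)

text \<open>The vector \<open>n\<close> is either absent or occurs with a positive multiplicity; every positive
multiplicity contributes a single factor \<open>z\<close>.\<close>
lemma gfun_insert:
  assumes "n \<notin> D" "n \<noteq> (0,0)" "finite D" "(0,0) \<notin> D"
  shows "gfun (insert n D) z (a, b) = gfun D z (a, b) +
    z * (\<Sum>t\<in>{t \<in> {1..a+b}. t * fst n \<le> a \<and> t * snd n \<le> b}. gfun D z (a - t * fst n, b - t * snd n))"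
proof -
  let ?T = "{t \<in> {1..a+b}. t * fst n \<le> a \<and> t * snd n \<le> b}"
  let ?F = "\<lambda>t. fns D (a - t * fst n, b - t * snd n)"
  let ?w = "\<lambda>\<mu>. z ^ card (supp \<mu>)"
  have split: "vsum \<mu> = (\<mu> n * fst n + fst (vsum (\<mu>(n := 0))), \<mu> n * snd n + snd (vsum (\<mu>(n := 0))))"
    if "finite (supp \<mu>)" for \<mu>
  proof -
    have f: "finite (insert n (supp \<mu>))" using that by simp
    have "vsum (\<mu>(n := 0)) = (\<Sum>k\<in>insert n (supp \<mu>). (\<mu>(n := 0)) k * fst k, \<Sum>k\<in>insert n (supp \<mu>). (\<mu>(n := 0)) k * snd k)"
      by (rule vsum_superset[OF f]) (auto simp: supp_def)
    moreover have "vsum \<mu> = (\<Sum>k\<in>insert n (supp \<mu>). \<mu> k * fst k, \<Sum>k\<in>insert n (supp \<mu>). \<mu> k * snd k)"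
      by (rule vsum_superset[OF f]) auto
    ultimately show ?thesis using sum.remove[OF f, of n "\<lambda>k. \<mu> k * fst k"] sum.remove[OF f, of n "\<lambda>k. \<mu> k * snd k"]
      sum.remove[OF f, of n "\<lambda>k. (\<mu>(n := 0)) k * fst k"] sum.remove[OF f, of n "\<lambda>k. (\<mu>(n := 0)) k * snd k"]
      by simp
  qed
  have sp: "supp (\<mu>(n := 0)) = supp \<mu> - {n}" "supp (\<mu>(n := t)) = (if t = 0 then supp \<mu> - {n} else insert n (supp \<mu>))" for \<mu> :: "nat \<times> nat \<Rightarrow> nat" and t
    by (auto simp: supp_def)
  have A: "fns D (a,b) = {\<mu> \<in> fns (insert n D) (a,b). \<mu> n = 0}"
    using assms(1) by (auto simp: fns_def supp_def)
  have B: "{\<mu> \<in> fns (insert n D) (a,b). \<mu> n \<noteq> 0} = (\<lambda>(t,\<mu>). \<mu>(n := t)) ` (SIGMA t:?T. ?F t)"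
  proof (intro equalityI subsetI)
    fix \<mu> assume "\<mu> \<in> {\<mu> \<in> fns (insert n D) (a,b). \<mu> n \<noteq> 0}"
    then have m: "\<mu> \<in> fns (insert n D) (a,b)" "\<mu> n \<noteq> 0" by auto
    note bd = fns_bound[OF m(1), of n, simplified]
    have "1 \<le> fst n \<or> 1 \<le> snd n" using assms(2) by (cases n) auto
    then have "\<mu> n * 1 \<le> \<mu> n * fst n \<or> \<mu> n * 1 \<le> \<mu> n * snd n" using mult_le_mono2 by blast
    then have "\<mu> n \<le> a + b" using bd by linarith
    then have t: "\<mu> n \<in> ?T" using bd m(2) by auto
    have "\<mu>(n := 0) \<in> ?F (\<mu> n)"
      using m(1) split[of \<mu>] by (auto simp: fns_def sp prod_eq_iff)
    then have "(\<mu> n, \<mu>(n := 0)) \<in> (SIGMA t:?T. ?F t)" using t by blast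
    then show "\<mu> \<in> (\<lambda>(t,\<mu>). \<mu>(n := t)) ` (SIGMA t:?T. ?F t)"
      by (rule rev_image_eqI) simp
  next
    fix \<mu> assume "\<mu> \<in> (\<lambda>(t,\<mu>). \<mu>(n := t)) ` (SIGMA t:?T. ?F t)"
    then obtain t \<rho> where r: "t \<in> ?T" "\<rho> \<in> ?F t" "\<mu> = \<rho>(n := t)" by auto
    have "\<rho> n = 0" using r(2) assms(1) by (auto simp: fns_def supp_def)
    then have e: "\<mu>(n := 0) = \<rho>" using r(3) by auto
    have f: "finite (supp \<mu>)" using r by (auto simp: fns_def sp)
    have "vsum \<mu> = (a, b)" using split[OF f] r unfolding e by (auto simp: fns_def)
    then show "\<mu> \<in> {\<mu> \<in> fns (insert n D) (a,b). \<mu> n \<noteq> 0}" using r f by (auto simp: fns_def sp)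
  qed
  have inj: "inj_on (\<lambda>(t,\<mu>). \<mu>(n := t)) (SIGMA t:?T. ?F t)"
  proof (rule inj_onI, clarify)
    fix t \<rho> t' \<rho>' assume r: "\<rho> \<in> ?F t" "\<rho>' \<in> ?F t'" "\<rho>(n := t) = \<rho>'(n := t')"
    have "\<rho> n = 0" "\<rho>' n = 0" using r(1,2) assms(1) by (auto simp: fns_def supp_def)
    then show "t = t' \<and> \<rho> = \<rho>'" using r(3) by (metis fun_upd_same fun_upd_triv fun_upd_upd)
  qed
  have w: "?w (\<mu>(n := t)) = z * ?w \<mu>" if "t \<in> ?T" "\<mu> \<in> ?F t" for t \<mu>
  proof -
    have "n \<notin> supp \<mu>" "finite (supp \<mu>)" using that(2) assms(1) by (auto simp: fns_def)
    then show ?thesis using that(1) by (simp add: sp)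
  qed
  have finT: "finite ?T" by simp
  have finF: "finite (?F t)" for t by (rule finite_fns[OF assms(4)])
  have "(0,0) \<notin> insert n D" using assms by auto
  then have fin: "finite (fns (insert n D) (a,b))" by (rule finite_fns)
  have "gfun (insert n D) z (a,b) = (\<Sum>\<mu>\<in>{\<mu> \<in> fns (insert n D) (a,b). \<mu> n = 0}. ?w \<mu>)
     + (\<Sum>\<mu>\<in>{\<mu> \<in> fns (insert n D) (a,b). \<mu> n \<noteq> 0}. ?w \<mu>)"
    unfolding gfun_def using fin by (subst sum.union_disjoint[symmetric]) (auto intro!: sum.cong)
  also have "(\<Sum>\<mu>\<in>{\<mu> \<in> fns (insert n D) (a,b). \<mu> n = 0}. ?w \<mu>) = gfun D z (a,b)"
    unfolding A[symmetric] gfun_def ..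
  also have "(\<Sum>\<mu>\<in>{\<mu> \<in> fns (insert n D) (a,b). \<mu> n \<noteq> 0}. ?w \<mu>) = (\<Sum>(t,\<mu>)\<in>(SIGMA t:?T. ?F t). ?w (\<mu>(n := t)))"
    unfolding B by (subst sum.reindex[OF inj]) (simp add: case_prod_unfold)
  also have "\<dots> = (\<Sum>t\<in>?T. \<Sum>\<mu>\<in>?F t. ?w (\<mu>(n := t)))"
    by (rule sum.Sigma[symmetric]) (use finT finF in auto)
  also have "\<dots> = (\<Sum>t\<in>?T. \<Sum>\<mu>\<in>?F t. z * ?w \<mu>)" by (intro sum.cong refl w)
  also have "\<dots> = z * (\<Sum>t\<in>?T. gfun D z (a - t * fst n, b - t * snd n))"
    by (simp add: gfun_def sum_distrib_left)
  finally show ?thesis .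
qed

section \<open>Weights invariant under a linear map\<close>

definition pmap :: "vec \<Rightarrow> vec \<Rightarrow> nat \<times> nat \<Rightarrow> vec" where
  "pmap u v n = (int (fst n) * fst u + int (snd n) * fst v, int (fst n) * snd u + int (snd n) * snd v)"

lemma GL_pmap: "A \<in> GL \<Longrightarrow> A (pmap u v n) = pmap (A u) (A v) n"
  by (erule GL_E) (simp add: lin_def pmap_def algebra_simps)

lemma GL_funpow: "A \<in> GL \<Longrightarrow> A ^^ k \<in> GL"
  by (induction k) (auto simp: GL_id intro: GL_comp)

text \<open>A fundamental domain for the action of \<open>A\<close> on primitive vectors: the disjoint union of \<open>K\<close> cones, the \<open>j\<close>-th
of which is spanned by \<open>U j\<close> and \<open>V j\<close> and has \<open>R j\<close> distinct images. The function \<open>loc\<close> inverts this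
parametrisation.\<close>
locale sectors =
  fixes A :: "vec \<Rightarrow> vec" and K :: nat and D :: "nat \<Rightarrow> (nat \<times> nat) set"
    and U V :: "nat \<Rightarrow> vec" and R :: "nat \<Rightarrow> nat" and loc :: "vec \<Rightarrow> nat \<times> nat \<times> (nat \<times> nat)"
  assumes GL: "A \<in> GL"
    and R: "\<And>j. j < K \<Longrightarrow> 0 < R j"
    and period: "\<And>j n. j < K \<Longrightarrow> n \<in> D j \<Longrightarrow> pmap ((A ^^ R j) (U j)) ((A ^^ R j) (V j)) n = pmap (U j) (V j) n"
    and loc_pmap: "\<And>j k n. j < K \<Longrightarrow> k < R j \<Longrightarrow> n \<in> D j \<Longrightarrow>
      prim (pmap ((A ^^ k) (U j)) ((A ^^ k) (V j)) n) \<and> loc (pmap ((A ^^ k) (U j)) ((A ^^ k) (V j)) n) = (j, k, n)"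
    and loc_prim: "\<And>x j k n. prim x \<Longrightarrow> loc x = (j, k, n) \<Longrightarrow>
      j < K \<and> k < R j \<and> n \<in> D j \<and> pmap ((A ^^ k) (U j)) ((A ^^ k) (V j)) n = x"
    and D0: "\<And>j. j < K \<Longrightarrow> (0,0) \<notin> D j"
begin

definition P :: "nat \<Rightarrow> nat \<Rightarrow> nat \<times> nat \<Rightarrow> vec" where
  "P j k n = pmap ((A ^^ k) (U j)) ((A ^^ k) (V j)) n"

definition X :: "(vec \<Rightarrow> nat) set" where
  "X = {\<nu>. finite (supp \<nu>) \<and> supp \<nu> \<subseteq> Collect prim \<and> \<nu> \<circ> A = \<nu>}"

definition part :: "nat \<Rightarrow> (vec \<Rightarrow> nat) \<Rightarrow> nat \<times> nat \<Rightarrow> nat" where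
  "part j \<nu> n = (if n \<in> D j then \<nu> (P j 0 n) else 0)"

definition glue :: "(nat \<Rightarrow> nat \<times> nat \<Rightarrow> nat) \<Rightarrow> vec \<Rightarrow> nat" where
  "glue \<mu> x = (if prim x then (case loc x of (j, k, n) \<Rightarrow> \<mu> j n) else 0)"

lemma P_funpow: "P j k n = (A ^^ k) (P j 0 n)"
  using GL_pmap[OF GL_funpow[OF GL]] by (simp add: P_def)

lemma P_period: "j < K \<Longrightarrow> n \<in> D j \<Longrightarrow> (A ^^ R j) (P j 0 n) = P j 0 n"
  using GL_pmap[OF GL_funpow[OF GL]] period by (simp add: P_def)

lemma loc_P: "j < K \<Longrightarrow> k < R j \<Longrightarrow> n \<in> D j \<Longrightarrow> prim (P j k n) \<and> loc (P j k n) = (j, k, n)"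
  unfolding P_def by (rule loc_pmap)

lemma P_loc: "prim x \<Longrightarrow> loc x = (j, k, n) \<Longrightarrow> j < K \<and> k < R j \<and> n \<in> D j \<and> P j k n = x"
  unfolding P_def by (rule loc_prim)

lemma X_P:
  assumes "\<nu> \<in> X" "n \<in> D j" shows "\<nu> (P j k n) = part j \<nu> n"
proof -
  have "\<nu> (A x) = \<nu> x" for x using assms(1) by (metis (mono_tags, lifting) X_def comp_apply mem_Collect_eq)
  then have "\<nu> ((A ^^ k) x) = \<nu> x" for x by (induction k) auto
  then show ?thesis using assms(2) unfolding P_funpow[of j k] by (simp add: part_def)
qed

lemma supp_bij:
  assumes "\<nu> \<in> X"
  shows "bij_betw (\<lambda>(j,k,n). P j k n) (SIGMA j:{..<K}. {..<R j} \<times> supp (part j \<nu>)) (supp \<nu>)"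
proof (rule bij_betw_byWitness[where f' = loc])
  have D: "n \<in> D j" if "n \<in> supp (part j \<nu>)" for j n using that by (auto simp: supp_def part_def split: if_splits)
  show "\<forall>x\<in>SIGMA j:{..<K}. {..<R j} \<times> supp (part j \<nu>). loc (case x of (j, k, n) \<Rightarrow> P j k n) = x"
    using loc_P D by auto
  show "\<forall>x\<in>supp \<nu>. (case loc x of (j, k, n) \<Rightarrow> P j k n) = x"
    using P_loc assms by (auto simp: X_def split: prod.splits)
  show "(\<lambda>(j, k, n). P j k n) ` (SIGMA j:{..<K}. {..<R j} \<times> supp (part j \<nu>)) \<subseteq> supp \<nu>"
    using X_P[OF assms D] by (auto simp: supp_def)
  show "loc ` supp \<nu> \<subseteq> (SIGMA j:{..<K}. {..<R j} \<times> supp (part j \<nu>))"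
  proof
    fix y assume "y \<in> loc ` supp \<nu>"
    then obtain x where x: "x \<in> supp \<nu>" "y = loc x" by blast
    obtain j k n where y: "y = (j,k,n)" by (metis prod.exhaust)
    have "prim x" using x(1) assms by (auto simp: X_def)
    then have p: "j < K" "k < R j" "n \<in> D j" "P j k n = x" using P_loc[of x j k n] x(2) y by auto
    then have "n \<in> supp (part j \<nu>)" using X_P[OF assms p(3), of k] x(1) by (simp add: supp_def)
    then show "y \<in> (SIGMA j:{..<K}. {..<R j} \<times> supp (part j \<nu>))" using p y by auto
  qed
qed

lemma finite_part:
  assumes "\<nu> \<in> X" "j < K" shows "finite (supp (part j \<nu>))"
proof -
  have "(\<lambda>n. P j 0 n) ` supp (part j \<nu>) \<subseteq> supp \<nu>"
    by (auto simp: supp_def part_def split: if_splits)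
  moreover have "inj_on (\<lambda>n. P j 0 n) (supp (part j \<nu>))"
    using loc_P[OF assms(2) R[OF assms(2)]]
    by (intro inj_onI) (metis (mono_tags, lifting) mem_Collect_eq part_def prod.inject supp_def)
  ultimately show ?thesis using assms(1) finite_subset finite_imageD unfolding X_def by blast
qed

lemma sum_supp:
  assumes "\<nu> \<in> X"
  shows "(\<Sum>x\<in>supp \<nu>. g x) = (\<Sum>j<K. \<Sum>k<R j. \<Sum>n\<in>supp (part j \<nu>). g (P j k n))"
proof -
  have "(\<Sum>x\<in>supp \<nu>. g x) = (\<Sum>(j,k,n)\<in>(SIGMA j:{..<K}. {..<R j} \<times> supp (part j \<nu>)). g (P j k n))"
    using sum.reindex_bij_betw[OF supp_bij[OF assms], of g] by (simp add: case_prod_unfold)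
  also have "\<dots> = (\<Sum>j<K. \<Sum>(k,n)\<in>{..<R j} \<times> supp (part j \<nu>). g (P j k n))"
    using finite_part[OF assms] by (subst sum.Sigma) (auto simp: case_prod_unfold)
  also have "\<dots> = (\<Sum>j<K. \<Sum>k<R j. \<Sum>n\<in>supp (part j \<nu>). g (P j k n))"
    by (simp add: sum.cartesian_product)
  finally show ?thesis .
qed

lemma card_supp:
  assumes "\<nu> \<in> X" shows "card (supp \<nu>) = (\<Sum>j<K. R j * card (supp (part j \<nu>)))"
  using sum_supp[OF assms, of "\<lambda>_. 1::nat"] by simp

lemma msum_linear_parts:
  assumes "\<nu> \<in> X"
    and lin: "\<And>j n. j < K \<Longrightarrow> n \<in> D j \<Longrightarrow> (\<Sum>k<R j. F (P j k n)) = \<alpha> j * int (fst n) + \<beta> j * int (snd n)"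
  shows "msum \<nu> F = (\<Sum>j<K. \<alpha> j * int (fst (vsum (part j \<nu>))) + \<beta> j * int (snd (vsum (part j \<nu>))))"
proof -
  have "msum \<nu> F = (\<Sum>j<K. \<Sum>k<R j. \<Sum>n\<in>supp (part j \<nu>). int (\<nu> (P j k n)) * F (P j k n))"
    unfolding msum_def by (rule sum_supp[OF assms(1)])
  also have "\<dots> = (\<Sum>j<K. \<alpha> j * int (fst (vsum (part j \<nu>))) + \<beta> j * int (snd (vsum (part j \<nu>))))"
  proof (rule sum.cong[OF refl])
    fix j assume "j \<in> {..<K}"
    then have j: "j < K" by simp
    have "(\<Sum>k<R j. \<Sum>n\<in>supp (part j \<nu>). int (\<nu> (P j k n)) * F (P j k n))
       = (\<Sum>n\<in>supp (part j \<nu>). \<Sum>k<R j. int (\<nu> (P j k n)) * F (P j k n))" by (rule sum.swap)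
    also have "\<dots> = (\<Sum>n\<in>supp (part j \<nu>). int (part j \<nu> n) * (\<alpha> j * int (fst n) + \<beta> j * int (snd n)))"
    proof (rule sum.cong[OF refl])
      fix n assume "n \<in> supp (part j \<nu>)"
      then have n: "n \<in> D j" by (auto simp: supp_def part_def split: if_splits)
      show "(\<Sum>k<R j. int (\<nu> (P j k n)) * F (P j k n)) = int (part j \<nu> n) * (\<alpha> j * int (fst n) + \<beta> j * int (snd n))"
        unfolding lin[OF j n, symmetric] X_P[OF assms(1) n] by (simp add: sum_distrib_left)
    qed
    also have "\<dots> = \<alpha> j * int (fst (vsum (part j \<nu>))) + \<beta> j * int (snd (vsum (part j \<nu>)))"
      by (simp add: vsum_def sum.distrib sum_distrib_left algebra_simps)
    finally show "(\<Sum>k<R j. \<Sum>n\<in>supp (part j \<nu>). int (\<nu> (P j k n)) * F (P j k n))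
      = \<alpha> j * int (fst (vsum (part j \<nu>))) + \<beta> j * int (snd (vsum (part j \<nu>)))" .
  qed
  finally show ?thesis .
qed

lemma supp_part: "supp (part j \<nu>) \<subseteq> D j"
  by (auto simp: supp_def part_def split: if_splits)

lemma glue_P: "j < K \<Longrightarrow> k < R j \<Longrightarrow> n \<in> D j \<Longrightarrow> glue \<mu> (P j k n) = \<mu> j n"
  using loc_P[of j k n] by (simp add: glue_def)

lemma glue_X:
  assumes "\<And>j. j < K \<Longrightarrow> finite (supp (\<mu> j))"
  shows "glue \<mu> \<in> X"
proof -
  have "supp (glue \<mu>) \<subseteq> (\<lambda>(j,k,n). P j k n) ` (SIGMA j:{..<K}. {..<R j} \<times> supp (\<mu> j))"
  proof
    fix x assume "x \<in> supp (glue \<mu>)"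
    then have x: "prim x" "glue \<mu> x \<noteq> 0" by (auto simp: supp_def glue_def split: if_splits)
    obtain j k n where l: "loc x = (j,k,n)" by (metis prod.exhaust)
    note p = P_loc[OF x(1) l]
    have "n \<in> supp (\<mu> j)" using x l by (simp add: supp_def glue_def)
    then show "x \<in> (\<lambda>(j,k,n). P j k n) ` (SIGMA j:{..<K}. {..<R j} \<times> supp (\<mu> j))"
      using p by (intro image_eqI[of _ _ "(j,k,n)"]) auto
  qed
  moreover have "finite (SIGMA j:{..<K}. {..<R j} \<times> supp (\<mu> j))" using assms by auto
  ultimately have "finite (supp (glue \<mu>))" by (meson finite_imageI finite_subset)
  moreover have "supp (glue \<mu>) \<subseteq> Collect prim" by (auto simp: supp_def glue_def split: if_splits)
  moreover have "glue \<mu> (A x) = glue \<mu> x" for x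
  proof (cases "prim x")
    case True
    obtain j k n where l: "loc x = (j,k,n)" by (metis prod.exhaust)
    note p = P_loc[OF True l]
    have Ax: "A x = (A ^^ Suc k) (P j 0 n)" using p P_funpow[of j k n] by simp
    have "glue \<mu> (A x) = \<mu> j n"
    proof (cases "Suc k < R j")
      case True
      then show ?thesis using glue_P[of j "Suc k" n] p Ax P_funpow[of j "Suc k" n] by simp
    next
      case False
      then have "Suc k = R j" using p by linarith
      then have "A x = P j 0 n" using Ax P_period[of j n] p by simp
      then show ?thesis using glue_P[of j 0 n] p R[of j] by simp
    qed
    then show ?thesis using True l by (simp add: glue_def)
  next
    case False
    then show ?thesis using prim_GL[OF GL, of x] by (simp add: glue_def)
  qed
  ultimately show ?thesis by (auto simp: X_def)
qed

lemma part_glue: "j < K \<Longrightarrow> supp (\<mu> j) \<subseteq> D j \<Longrightarrow> part j (glue \<mu>) = \<mu> j"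
  using glue_P[of j 0 _ \<mu>] R[of j] by (auto simp: part_def supp_def fun_eq_iff)

lemma glue_part:
  assumes "\<nu> \<in> X" "\<And>j. j < K \<Longrightarrow> \<mu> j = part j \<nu>" shows "glue \<mu> = \<nu>"
proof
  fix x show "glue \<mu> x = \<nu> x"
  proof (cases "prim x")
    case True
    obtain j k n where l: "loc x = (j,k,n)" by (metis prod.exhaust)
    note p = P_loc[OF True l]
    then show ?thesis using True l X_P[OF assms(1), of n j k] assms(2)[of j] by (simp add: glue_def)
  next
    case False
    then show ?thesis using assms(1) by (auto simp: glue_def X_def supp_def)
  qed
qed

text \<open>The conditions on an invariant weight that matter here are linear, hence depend only on the sums
over the cones. Weights with prescribed sums form a product of sets, and their generating function is the
product of the generating functions of the cones.\<close>
theorem sum_invariant: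
  fixes z :: "'a::comm_semiring_1"
  assumes S: "S \<subseteq> X" and T: "finite T"
    and C: "\<And>\<nu>. \<nu> \<in> X \<Longrightarrow> \<nu> \<in> S \<longleftrightarrow> (\<exists>t\<in>T. \<forall>j<K. vsum (part j \<nu>) = s t j)"
    and inj: "\<And>t t'. t \<in> T \<Longrightarrow> t' \<in> T \<Longrightarrow> (\<And>j. j < K \<Longrightarrow> s t j = s t' j) \<Longrightarrow> t = t'"
  shows "finite S" "(\<Sum>\<nu>\<in>S. z ^ card (supp \<nu>)) = (\<Sum>t\<in>T. \<Prod>j<K. gfun (D j) (z ^ R j) (s t j))"
proof -
  let ?G = "\<lambda>t. PiE {..<K} (\<lambda>j. fns (D j) (s t j))"
  let ?B = "SIGMA t:T. ?G t"
  have finG: "finite (?G t)" for t using finite_fns D0 by (intro finite_PiE) auto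
  have bij: "bij_betw (\<lambda>(t,\<mu>). glue \<mu>) ?B S"
    unfolding bij_betw_def
  proof
    have pg: "part j (glue \<mu>) = \<mu> j" if "\<mu> \<in> ?G t" "j < K" for t \<mu> j
      using that by (intro part_glue) (auto simp: PiE_def Pi_def fns_def)
    show "inj_on (\<lambda>(t,\<mu>). glue \<mu>) ?B"
    proof (rule inj_onI, clarify)
      fix t \<mu> t' \<mu>' assume h: "t \<in> T" "\<mu> \<in> ?G t" "t' \<in> T" "\<mu>' \<in> ?G t'" "glue \<mu> = glue \<mu>'"
      have e: "\<mu> j = \<mu>' j" if "j < K" for j using pg[OF h(2) that] pg[OF h(4) that] h(5) by simp
      then have "\<mu> = \<mu>'" using h(2,4) by (intro PiE_ext) auto
      moreover have "s t j = s t' j" if "j < K" for j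
      proof -
        have "\<mu> j \<in> fns (D j) (s t j)" "\<mu>' j \<in> fns (D j) (s t' j)" using h(2,4) that by auto
        then show ?thesis using e[OF that] by (simp add: fns_def)
      qed
      ultimately show "t = t' \<and> \<mu> = \<mu>'" using inj h(1,3) by blast
    qed
    show "(\<lambda>(t,\<mu>). glue \<mu>) ` ?B = S"
    proof (intro equalityI subsetI)
      fix \<nu> assume "\<nu> \<in> (\<lambda>(t,\<mu>). glue \<mu>) ` ?B"
      then obtain t \<mu> where h: "t \<in> T" "\<mu> \<in> ?G t" "\<nu> = glue \<mu>" by auto
      have "\<nu> \<in> X" unfolding h(3) by (rule glue_X) (use h(2) in \<open>auto simp: PiE_def Pi_def fns_def\<close>)
      moreover have "vsum (part j \<nu>) = s t j" if "j < K" for j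
      proof -
        have "\<mu> j \<in> fns (D j) (s t j)" using h(2) that by auto
        then show ?thesis using pg[OF h(2) that] h(3) by (simp add: fns_def)
      qed
      ultimately show "\<nu> \<in> S" using C h(1) by blast
    next
      fix \<nu> assume n: "\<nu> \<in> S"
      then have nX: "\<nu> \<in> X" using S by blast
      then obtain t where t: "t \<in> T" "\<forall>j<K. vsum (part j \<nu>) = s t j" using C n by blast
      define \<mu> where "\<mu> = restrict (\<lambda>j. part j \<nu>) {..<K}"
      have "supp (part j \<nu>) \<subseteq> D j" for j by (auto simp: supp_def part_def split: if_splits)
      then have "\<mu> \<in> ?G t" using t finite_part[OF nX] by (simp add: \<mu>_def fns_def PiE_iff)
      moreover have "glue \<mu> = \<nu>" by (rule glue_part[OF nX]) (simp add: \<mu>_def)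
      ultimately show "\<nu> \<in> (\<lambda>(t,\<mu>). glue \<mu>) ` ?B" using t(1) by (intro image_eqI[of _ _ "(t,\<mu>)"]) auto
    qed
  qed
  have "finite ?B" using T finG by auto
  then show "finite S" using bij_betw_finite[OF bij] by blast
  have w: "z ^ card (supp (glue \<mu>)) = (\<Prod>j<K. (z ^ R j) ^ card (supp (\<mu> j)))" if "\<mu> \<in> ?G t" for t \<mu>
  proof -
    have g: "glue \<mu> \<in> X" by (rule glue_X) (use that in \<open>auto simp: PiE_def Pi_def fns_def\<close>)
    have "part j (glue \<mu>) = \<mu> j" if "j < K" for j
      using that \<open>\<mu> \<in> ?G t\<close> by (intro part_glue) (auto simp: PiE_def Pi_def fns_def)
    then have "card (supp (glue \<mu>)) = (\<Sum>j<K. R j * card (supp (\<mu> j)))" using card_supp[OF g] by simp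
    then show ?thesis by (simp add: power_sum power_mult)
  qed
  have "(\<Sum>\<nu>\<in>S. z ^ card (supp \<nu>)) = (\<Sum>(t,\<mu>)\<in>?B. z ^ card (supp (glue \<mu>)))"
    using sum.reindex_bij_betw[OF bij, of "\<lambda>\<nu>. z ^ card (supp \<nu>)"] by (simp add: case_prod_unfold)
  also have "\<dots> = (\<Sum>t\<in>T. \<Sum>\<mu>\<in>?G t. z ^ card (supp (glue \<mu>)))"
    by (rule sum.Sigma[symmetric]) (use T finG in auto)
  also have "\<dots> = (\<Sum>t\<in>T. \<Sum>\<mu>\<in>?G t. \<Prod>j<K. (z ^ R j) ^ card (supp (\<mu> j)))"
    by (intro sum.cong refl w)
  also have "\<dots> = (\<Sum>t\<in>T. \<Prod>j<K. gfun (D j) (z ^ R j) (s t j))"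
    unfolding gfun_def by (intro sum.cong refl prod_sum_PiE[symmetric]) (auto intro!: finite_fns D0)
  finally show "(\<Sum>\<nu>\<in>S. z ^ card (supp \<nu>)) = (\<Sum>t\<in>T. \<Prod>j<K. gfun (D j) (z ^ R j) (s t j))" .
qed

end

section \<open>Fundamental domains of the symmetries\<close>

definition cone :: "(nat \<Rightarrow> nat \<Rightarrow> bool) \<Rightarrow> (nat \<times> nat) set" where
  "cone Q = {n. Q (fst n) (snd n) \<and> coprime (fst n) (snd n)}"

abbreviation "half_cone \<equiv> cone (\<lambda>i j. 1 \<le> i)"
abbreviation "open_cone \<equiv> cone (\<lambda>i j. 1 \<le> i \<and> 1 \<le> j)"
abbreviation "ray_cone \<equiv> cone (\<lambda>i j. 1 \<le> i \<and> j = 0)"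

lemma prim_pmap: "\<bar>cross u v\<bar> = 1 \<Longrightarrow> prim (pmap u v n) \<longleftrightarrow> coprime (fst n) (snd n)"
proof -
  assume c: "\<bar>cross u v\<bar> = 1"
  have "lin (fst u) (fst v) (snd u) (snd v) \<in> GL" by (rule GL_I) (use c in \<open>simp add: cross_def mult.commute\<close>)
  then have "prim (lin (fst u) (fst v) (snd u) (snd v) (int (fst n), int (snd n))) \<longleftrightarrow> prim (int (fst n), int (snd n))"
    by (rule prim_GL)
  moreover have "lin (fst u) (fst v) (snd u) (snd v) (int (fst n), int (snd n)) = pmap u v n"
    by (simp add: lin_def pmap_def mult.commute)
  ultimately show ?thesis by (simp add: prim_def)
qed

lemma sectorsI:
  assumes A: "A \<in> GL" and R: "\<forall>j<K. 0 < R j \<and> \<bar>cross (U j) (V j)\<bar> = 1 \<and>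
      (\<forall>a b. Q j a b \<longrightarrow> pmap ((A ^^ R j) (U j)) ((A ^^ R j) (V j)) (a,b) = pmap (U j) (V j) (a,b))"
    and D: "\<forall>j<K. D j = cone (Q j) \<and> \<not> Q j 0 0"
    and l1: "\<forall>j<K. \<forall>k<R j. \<forall>a b. Q j a b \<longrightarrow> loc (pmap ((A ^^ k) (U j)) ((A ^^ k) (V j)) (a,b)) = (j, k, (a,b))"
    and l2: "\<forall>x y. (x,y) \<noteq> (0,0) \<longrightarrow> (case loc (x,y) of (j, k, n) \<Rightarrow> j < K \<and> k < R j \<and> Q j (fst n) (snd n) \<and>
      pmap ((A ^^ k) (U j)) ((A ^^ k) (V j)) n = (x,y))"
  shows "sectors A K D U V R loc"
proof
  have c: "\<bar>cross ((A ^^ k) (U j)) ((A ^^ k) (V j))\<bar> = 1" if "j < K" for j k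
    using R that abs_cross_GL[OF GL_funpow[OF A]] by simp
  show "A \<in> GL" by fact
  fix j
  show "j < K \<Longrightarrow> 0 < R j" "j < K \<Longrightarrow> (0,0) \<notin> D j"
    using R D by (auto simp: cone_def)
  show "pmap ((A ^^ R j) (U j)) ((A ^^ R j) (V j)) n = pmap (U j) (V j) n" if "j < K" "n \<in> D j" for n
    using that R D by (cases n) (auto simp: cone_def)
  show "prim (pmap ((A ^^ k) (U j)) ((A ^^ k) (V j)) n) \<and> loc (pmap ((A ^^ k) (U j)) ((A ^^ k) (V j)) n) = (j, k, n)"
    if "j < K" "k < R j" "n \<in> D j" for k n
    using that D l1 prim_pmap[OF c[OF that(1)], of k n] by (cases n) (auto simp: cone_def)
  show "j < K \<and> k < R j \<and> n \<in> D j \<and> pmap ((A ^^ k) (U j)) ((A ^^ k) (V j)) n = x"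
    if "prim x" "loc x = (j,k,n)" for x k n
  proof -
    obtain p q where x: "x = (p,q)" by (cases x)
    have "(p,q) \<noteq> (0,0)" using that(1) x by (auto simp: prim_def)
    then have h: "j < K" "k < R j" "Q j (fst n) (snd n)" "pmap ((A ^^ k) (U j)) ((A ^^ k) (V j)) n = x"
      using l2[rule_format, of p q] that(2) x by simp_all
    then show ?thesis using prim_pmap[OF c[OF h(1)], of k n] that(1) D by (auto simp: cone_def)
  qed
qed

definition fixed_edge :: "(vec \<Rightarrow> vec) \<Rightarrow> nat \<Rightarrow> (vec \<Rightarrow> nat) set" where
  "fixed_edge A m = {\<nu> \<in> edge_set weights m. \<nu> \<circ> A = \<nu>}"

definition fixed_triangle :: "(vec \<Rightarrow> vec) \<Rightarrow> nat \<Rightarrow> (vec \<Rightarrow> nat) set" where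
  "fixed_triangle A m = {\<nu> \<in> triangle_set weights m. \<nu> \<circ> A = \<nu>}"

lemma vsum_ray: assumes "supp \<mu> \<subseteq> ray_cone" shows "snd (vsum \<mu>) = 0"
proof -
  have "snd n = 0" if "n \<in> supp \<mu>" for n using subsetD[OF assms that] by (simp add: cone_def)
  then show ?thesis by (simp add: vsum_def)
qed

lemma sum_over_Sigma:
  "finite A \<Longrightarrow> (\<And>x. x \<in> A \<Longrightarrow> finite (B x)) \<Longrightarrow> sum g (Sigma A B) = (\<Sum>x\<in>A. \<Sum>y\<in>B x. g (x, y))"
  by (subst sum.Sigma) auto

lemmas nat_expand = less_eq_div_iff_mult_less_eq eval_nat_numeral All_less_Suc2 sum.lessThan_Suc prod.lessThan_Suc

text \<open>The plane is cut into four quadrants, each containing one of its boundary rays. The numbers \<open>p\<close>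
and \<open>q\<close> are the two coordinate widths; the remaining variables split them over the quadrants so that the
boundary closes up. The other symmetries are treated in the same way with their own fundamental domains.\<close>
lemma edge_identity:
  fixes z :: "'a::comm_semiring_1"
  defines "g \<equiv> gfun half_cone z"
  shows "finite (fixed_edge (lin 1 0 0 1) m)"
    "(\<Sum>\<nu>\<in>fixed_edge (lin 1 0 0 1) m. z ^ card (supp \<nu>)) =
     (\<Sum>p\<le>m. \<Sum>q\<le>m. \<Sum>b\<le>q. \<Sum>h\<le>q. \<Sum>a\<le>p. \<Sum>a'\<le>p. g (a,b) * g (h,p-a) * (g (a',q-h) * g (q-b,p-a')))"
proof -
  interpret sectors "lin 1 0 0 1" 4 "\<lambda>j. [half_cone,half_cone,half_cone,half_cone] ! j" "\<lambda>j. [(1,0),(0,1),(-1,0),(0,-1)] ! j" "\<lambda>j. [(0,1),(-1,0),(0,-1),(1,0)] ! j"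
    "\<lambda>j. [1,1,1,1] ! j" "\<lambda>(x,y). if 1 \<le> x \<and> 0 \<le> y then (0,0,(nat x,nat y)) else if x \<le> 0 \<and> 1 \<le> y then (1,0,(nat y,nat (-x))) else if x \<le> -1 \<and> y \<le> 0 then (2,0,(nat (-x),nat (-y))) else (3,0,(nat (-y),nat x))"
    by (rule sectorsI[where Q = "\<lambda>j. [\<lambda>i j. 1 \<le> i,\<lambda>i j. 1 \<le> i,\<lambda>i j. 1 \<le> i,\<lambda>i j. 1 \<le> i] ! j", OF GL_I])
      (auto simp: nat_expand lin_def cross_def pmap_def)
  let ?T = "SIGMA p:{..m}. SIGMA q:{..m}. SIGMA b:{..q}. SIGMA h:{..q}. {..p} \<times> {..p}"
  let ?s = "\<lambda>(p,q,b,h,a,a') j. [(a,b),(q-b,p-a'),(a',q-h),(h,p-a)] ! j"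
  have C: "\<nu> \<in> fixed_edge (lin 1 0 0 1) m \<longleftrightarrow> (\<exists>t\<in>?T. \<forall>j<4. vsum (part j \<nu>) = ?s t j)" if "\<nu> \<in> X" for \<nu>
  proof -
    define a b where ab: "a j = fst (vsum (part j \<nu>))" "b j = snd (vsum (part j \<nu>))" for j
    have v: "vsum (part j \<nu>) = (a j, b j)" for j by (simp add: ab)
    have f0: "msum \<nu> fst = 1 * int (a 0) + (-1) * int (b 1) + (-1) * int (a 2) + 1 * int (b 3)"
      by (subst msum_linear_parts[OF that, where \<alpha> = "\<lambda>j. [1,0,-1,0] ! j" and \<beta> = "\<lambda>j. [0,-1,0,1] ! j"])
        (simp_all only: P_def, auto simp: nat_expand less_Suc_eq pmap_def cone_def lin_def ab)
    have f1: "msum \<nu> snd = 1 * int (b 0) + 1 * int (a 1) + (-1) * int (b 2) + (-1) * int (a 3)"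
      by (subst msum_linear_parts[OF that, where \<alpha> = "\<lambda>j. [0,1,0,-1] ! j" and \<beta> = "\<lambda>j. [1,0,-1,0] ! j"])
        (simp_all only: P_def, auto simp: nat_expand less_Suc_eq pmap_def cone_def lin_def ab)
    have f2: "width2 \<nu> (0,1) = 1 * int (a 0) + 1 * int (b 1) + 1 * int (a 2) + 1 * int (b 3)" unfolding width2_def
      by (subst msum_linear_parts[OF that, where \<alpha> = "\<lambda>j. [1,0,1,0] ! j" and \<beta> = "\<lambda>j. [0,1,0,1] ! j"])
        (simp_all only: P_def, auto simp: nat_expand less_Suc_eq pmap_def cone_def lin_def cross_def ab)
    have f3: "width2 \<nu> (1,0) = 1 * int (b 0) + 1 * int (a 1) + 1 * int (b 2) + 1 * int (a 3)" unfolding width2_def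
      by (subst msum_linear_parts[OF that, where \<alpha> = "\<lambda>j. [0,1,0,1] ! j" and \<beta> = "\<lambda>j. [1,0,1,0] ! j"])
        (simp_all only: P_def, auto simp: nat_expand less_Suc_eq pmap_def cone_def lin_def cross_def ab)
    have F: "\<nu> \<in> fixed_edge (lin 1 0 0 1) m \<longleftrightarrow> a 0 + b 3 = b 1 + a 2 \<and> b 0 + a 1 = b 2 + a 3 \<and> a 0 + b 3 \<le> m \<and> b 0 + a 1 \<le> m"
      using that f0 f1 f2 f3 by (auto simp: fixed_edge_def edge_set_def X_def weights_def)
    show ?thesis
    proof
      assume "\<nu> \<in> fixed_edge (lin 1 0 0 1) m"
      then show "\<exists>t\<in>?T. \<forall>j<4. vsum (part j \<nu>) = ?s t j" unfolding F v
        by (intro bexI[of _ "(a 0 + b 3, b 0 + a 1, b 0, a 3, a 0, a 2)"]) (auto simp: nat_expand )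
    next
      assume "\<exists>t\<in>?T. \<forall>j<4. vsum (part j \<nu>) = ?s t j"
      then show "\<nu> \<in> fixed_edge (lin 1 0 0 1) m" unfolding F v by (auto simp: nat_expand)
    qed
  qed
  have sub: "fixed_edge (lin 1 0 0 1) m \<subseteq> X" by (auto simp: fixed_edge_def edge_set_def X_def weights_def)
  have inj: "t = t'" if "t \<in> ?T" "t' \<in> ?T" "\<And>j. j < 4 \<Longrightarrow> ?s t j = ?s t' j" for t t'
    using that(1,2) that(3)[of 0] that(3)[of 1] that(3)[of 2] that(3)[of 3] by (auto simp: nat_expand)
  note S = sum_invariant[OF sub _ C inj]
  show "finite (fixed_edge (lin 1 0 0 1) m)" by (rule S(1)) auto
  have "(\<Sum>\<nu>\<in>fixed_edge (lin 1 0 0 1) m. z ^ card (supp \<nu>)) =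
    (\<Sum>(p,q,b,h,a,a')\<in>?T. g (a,b) * g (h,p-a) * (g (a',q-h) * g (q-b,p-a')))"
    by (subst S(2)) (auto simp: nat_expand g_def mult_ac intro!: sum.cong)
  also have "\<dots> = (\<Sum>p\<le>m. \<Sum>q\<le>m. \<Sum>b\<le>q. \<Sum>h\<le>q. \<Sum>a\<le>p. \<Sum>a'\<le>p. g (a,b) * g (h,p-a) * (g (a',q-h) * g (q-b,p-a')))"
    by (simp add: sum_over_Sigma)
  finally show "(\<Sum>\<nu>\<in>fixed_edge (lin 1 0 0 1) m. z ^ card (supp \<nu>)) = \<dots>" .
qed

lemma edge_negation:
  fixes z :: "'a::comm_semiring_1"
  defines "g \<equiv> gfun half_cone (z^2)"
  shows "finite (fixed_edge (lin (-1) 0 0 (-1)) m)"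
    "(\<Sum>\<nu>\<in>fixed_edge (lin (-1) 0 0 (-1)) m. z ^ card (supp \<nu>)) =
     (\<Sum>a\<le>m. \<Sum>b\<le>m. \<Sum>c\<le>m-b. \<Sum>d\<le>m-a. g (a,b) * g (c,d))"
proof -
  interpret sectors "lin (-1) 0 0 (-1)" 2 "\<lambda>j. [half_cone,half_cone] ! j" "\<lambda>j. [(1,0),(0,1)] ! j" "\<lambda>j. [(0,1),(-1,0)] ! j"
    "\<lambda>j. [2,2] ! j" "\<lambda>(x,y). if 1 \<le> x \<and> 0 \<le> y then (0,0,(nat x,nat y)) else if x \<le> 0 \<and> 1 \<le> y then (1,0,(nat y,nat (-x))) else if x \<le> -1 \<and> y \<le> 0 then (0,1,(nat (-x),nat (-y))) else (1,1,(nat (-y),nat x))"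
    by (rule sectorsI[where Q = "\<lambda>j. [\<lambda>i j. 1 \<le> i,\<lambda>i j. 1 \<le> i] ! j", OF GL_I])
      (auto simp: nat_expand lin_def cross_def pmap_def)
  let ?T = "SIGMA a:{..m}. SIGMA b:{..m}. {..m-b} \<times> {..m-a}"
  let ?s = "\<lambda>(a,b,c,d) j. [(a,b),(c,d)] ! j"
  have C: "\<nu> \<in> fixed_edge (lin (-1) 0 0 (-1)) m \<longleftrightarrow> (\<exists>t\<in>?T. \<forall>j<2. vsum (part j \<nu>) = ?s t j)" if "\<nu> \<in> X" for \<nu>
  proof -
    define a b where ab: "a j = fst (vsum (part j \<nu>))" "b j = snd (vsum (part j \<nu>))" for j
    have v: "vsum (part j \<nu>) = (a j, b j)" for j by (simp add: ab)
    have f0: "msum \<nu> fst = 0"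
      by (subst msum_linear_parts[OF that, where \<alpha> = "\<lambda>j. [0,0] ! j" and \<beta> = "\<lambda>j. [0,0] ! j"])
        (simp_all only: P_def, auto simp: nat_expand less_Suc_eq pmap_def cone_def lin_def ab)
    have f1: "msum \<nu> snd = 0"
      by (subst msum_linear_parts[OF that, where \<alpha> = "\<lambda>j. [0,0] ! j" and \<beta> = "\<lambda>j. [0,0] ! j"])
        (simp_all only: P_def, auto simp: nat_expand less_Suc_eq pmap_def cone_def lin_def ab)
    have f2: "width2 \<nu> (0,1) = 2 * int (a 0) + 2 * int (b 1)" unfolding width2_def
      by (subst msum_linear_parts[OF that, where \<alpha> = "\<lambda>j. [2,0] ! j" and \<beta> = "\<lambda>j. [0,2] ! j"])
        (simp_all only: P_def, auto simp: nat_expand less_Suc_eq pmap_def cone_def lin_def cross_def ab)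
    have f3: "width2 \<nu> (1,0) = 2 * int (b 0) + 2 * int (a 1)" unfolding width2_def
      by (subst msum_linear_parts[OF that, where \<alpha> = "\<lambda>j. [0,2] ! j" and \<beta> = "\<lambda>j. [2,0] ! j"])
        (simp_all only: P_def, auto simp: nat_expand less_Suc_eq pmap_def cone_def lin_def cross_def ab)
    have F: "\<nu> \<in> fixed_edge (lin (-1) 0 0 (-1)) m \<longleftrightarrow> a 0 + b 1 \<le> m \<and> b 0 + a 1 \<le> m"
      using that f0 f1 f2 f3 by (auto simp: fixed_edge_def edge_set_def X_def weights_def)
    show ?thesis
    proof
      assume "\<nu> \<in> fixed_edge (lin (-1) 0 0 (-1)) m"
      then show "\<exists>t\<in>?T. \<forall>j<2. vsum (part j \<nu>) = ?s t j" unfolding F v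
        by (intro bexI[of _ "(a 0, b 0, a 1, b 1)"]) (auto simp: nat_expand )
    next
      assume "\<exists>t\<in>?T. \<forall>j<2. vsum (part j \<nu>) = ?s t j"
      then show "\<nu> \<in> fixed_edge (lin (-1) 0 0 (-1)) m" unfolding F v by (auto simp: nat_expand)
    qed
  qed
  have sub: "fixed_edge (lin (-1) 0 0 (-1)) m \<subseteq> X" by (auto simp: fixed_edge_def edge_set_def X_def weights_def)
  have inj: "t = t'" if "t \<in> ?T" "t' \<in> ?T" "\<And>j. j < 2 \<Longrightarrow> ?s t j = ?s t' j" for t t'
    using that(1,2) that(3)[of 0] that(3)[of 1] by (auto simp: nat_expand)
  note S = sum_invariant[OF sub _ C inj]
  show "finite (fixed_edge (lin (-1) 0 0 (-1)) m)" by (rule S(1)) auto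
  have "(\<Sum>\<nu>\<in>fixed_edge (lin (-1) 0 0 (-1)) m. z ^ card (supp \<nu>)) =
    (\<Sum>(a,b,c,d)\<in>?T. g (a,b) * g (c,d))"
    by (subst S(2)) (auto simp: nat_expand g_def mult_ac intro!: sum.cong)
  also have "\<dots> = (\<Sum>a\<le>m. \<Sum>b\<le>m. \<Sum>c\<le>m-b. \<Sum>d\<le>m-a. g (a,b) * g (c,d))"
    by (simp add: sum_over_Sigma)
  finally show "(\<Sum>\<nu>\<in>fixed_edge (lin (-1) 0 0 (-1)) m. z ^ card (supp \<nu>)) = \<dots>" .
qed

lemma edge_quarter_turn:
  fixes z :: "'a::comm_semiring_1"
  defines "g \<equiv> gfun half_cone (z^4)"
  shows "finite (fixed_edge (lin 0 (-1) 1 0) m)"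
    "(\<Sum>\<nu>\<in>fixed_edge (lin 0 (-1) 1 0) m. z ^ card (supp \<nu>)) =
     (\<Sum>a\<le>m. \<Sum>b\<le>m-a. g (a,b))"
proof -
  interpret sectors "lin 0 (-1) 1 0" 1 "\<lambda>j. [half_cone] ! j" "\<lambda>j. [(1,0)] ! j" "\<lambda>j. [(0,1)] ! j"
    "\<lambda>j. [4] ! j" "\<lambda>(x,y). if 1 \<le> x \<and> 0 \<le> y then (0,0,(nat x,nat y)) else if x \<le> 0 \<and> 1 \<le> y then (0,1,(nat y,nat (-x))) else if x \<le> -1 \<and> y \<le> 0 then (0,2,(nat (-x),nat (-y))) else (0,3,(nat (-y),nat x))"
    by (rule sectorsI[where Q = "\<lambda>j. [\<lambda>i j. 1 \<le> i] ! j", OF GL_I])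
      (auto simp: nat_expand lin_def cross_def pmap_def)
  let ?T = "SIGMA a:{..m}. {..m-a}"
  let ?s = "\<lambda>(a,b) j. [(a,b)] ! j"
  have C: "\<nu> \<in> fixed_edge (lin 0 (-1) 1 0) m \<longleftrightarrow> (\<exists>t\<in>?T. \<forall>j<1. vsum (part j \<nu>) = ?s t j)" if "\<nu> \<in> X" for \<nu>
  proof -
    define a b where ab: "a j = fst (vsum (part j \<nu>))" "b j = snd (vsum (part j \<nu>))" for j
    have v: "vsum (part j \<nu>) = (a j, b j)" for j by (simp add: ab)
    have f0: "msum \<nu> fst = 0"
      by (subst msum_linear_parts[OF that, where \<alpha> = "\<lambda>j. [0] ! j" and \<beta> = "\<lambda>j. [0] ! j"])
        (simp_all only: P_def, auto simp: nat_expand less_Suc_eq pmap_def cone_def lin_def ab)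
    have f1: "msum \<nu> snd = 0"
      by (subst msum_linear_parts[OF that, where \<alpha> = "\<lambda>j. [0] ! j" and \<beta> = "\<lambda>j. [0] ! j"])
        (simp_all only: P_def, auto simp: nat_expand less_Suc_eq pmap_def cone_def lin_def ab)
    have f2: "width2 \<nu> (0,1) = 2 * int (a 0) + 2 * int (b 0)" unfolding width2_def
      by (subst msum_linear_parts[OF that, where \<alpha> = "\<lambda>j. [2] ! j" and \<beta> = "\<lambda>j. [2] ! j"])
        (simp_all only: P_def, auto simp: nat_expand less_Suc_eq pmap_def cone_def lin_def cross_def ab)
    have f3: "width2 \<nu> (1,0) = 2 * int (a 0) + 2 * int (b 0)" unfolding width2_def
      by (subst msum_linear_parts[OF that, where \<alpha> = "\<lambda>j. [2] ! j" and \<beta> = "\<lambda>j. [2] ! j"])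
        (simp_all only: P_def, auto simp: nat_expand less_Suc_eq pmap_def cone_def lin_def cross_def ab)
    have F: "\<nu> \<in> fixed_edge (lin 0 (-1) 1 0) m \<longleftrightarrow> a 0 + b 0 \<le> m"
      using that f0 f1 f2 f3 by (auto simp: fixed_edge_def edge_set_def X_def weights_def)
    show ?thesis
    proof
      assume "\<nu> \<in> fixed_edge (lin 0 (-1) 1 0) m"
      then show "\<exists>t\<in>?T. \<forall>j<1. vsum (part j \<nu>) = ?s t j" unfolding F v
        by (intro bexI[of _ "(a 0, b 0)"]) (auto simp: nat_expand )
    next
      assume "\<exists>t\<in>?T. \<forall>j<1. vsum (part j \<nu>) = ?s t j"
      then show "\<nu> \<in> fixed_edge (lin 0 (-1) 1 0) m" unfolding F v by (auto simp: nat_expand)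
    qed
  qed
  have sub: "fixed_edge (lin 0 (-1) 1 0) m \<subseteq> X" by (auto simp: fixed_edge_def edge_set_def X_def weights_def)
  have inj: "t = t'" if "t \<in> ?T" "t' \<in> ?T" "\<And>j. j < 1 \<Longrightarrow> ?s t j = ?s t' j" for t t'
    using that(1,2) that(3)[of 0] by (auto simp: nat_expand)
  note S = sum_invariant[OF sub _ C inj]
  show "finite (fixed_edge (lin 0 (-1) 1 0) m)" by (rule S(1)) auto
  have "(\<Sum>\<nu>\<in>fixed_edge (lin 0 (-1) 1 0) m. z ^ card (supp \<nu>)) =
    (\<Sum>(a,b)\<in>?T. g (a,b))"
    by (subst S(2)) (auto simp: nat_expand g_def mult_ac intro!: sum.cong)
  also have "\<dots> = (\<Sum>a\<le>m. \<Sum>b\<le>m-a. g (a,b))"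
    by (simp add: sum_over_Sigma)
  finally show "(\<Sum>\<nu>\<in>fixed_edge (lin 0 (-1) 1 0) m. z ^ card (supp \<nu>)) = \<dots>" .
qed

lemma edge_reflection:
  fixes z :: "'a::comm_semiring_1"
  defines "r \<equiv> gfun ray_cone z" and "g \<equiv> gfun half_cone (z^2)" and "i \<equiv> gfun open_cone (z^2)"
  shows "finite (fixed_edge (lin 1 0 0 (-1)) m)"
    "(\<Sum>\<nu>\<in>fixed_edge (lin 1 0 0 (-1)) m. z ^ card (supp \<nu>)) =
     (\<Sum>p\<le>m. \<Sum>b\<le>p div 2. \<Sum>d\<le>p div 2. \<Sum>a\<le>m. \<Sum>c\<le>m-a. r (p-2*b,0) * r (p-2*d,0) * (g (a,b) * i (c,d)))"
proof -
  interpret sectors "lin 1 0 0 (-1)" 4 "\<lambda>j. [ray_cone,ray_cone,half_cone,open_cone] ! j" "\<lambda>j. [(1,0),(-1,0),(0,1),(0,1)] ! j" "\<lambda>j. [(0,1),(0,1),(1,0),(-1,0)] ! j"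
    "\<lambda>j. [1,1,2,2] ! j" "\<lambda>(x,y). if y = 0 then (if 1 \<le> x then (0,0,(nat x,0)) else (1,0,(nat (-x),0))) else if 1 \<le> y then (if 0 \<le> x then (2,0,(nat y,nat x)) else (3,0,(nat y,nat (-x)))) else (if 0 \<le> x then (2,1,(nat (-y),nat x)) else (3,1,(nat (-y),nat (-x))))"
    by (rule sectorsI[where Q = "\<lambda>j. [\<lambda>i j. 1 \<le> i \<and> j = 0,\<lambda>i j. 1 \<le> i \<and> j = 0,\<lambda>i j. 1 \<le> i,\<lambda>i j. 1 \<le> i \<and> 1 \<le> j] ! j", OF GL_I])
      (auto simp: nat_expand lin_def cross_def pmap_def)
  let ?T = "SIGMA p:{..m}. SIGMA b:{..p div 2}. SIGMA d:{..p div 2}. SIGMA a:{..m}. {..m-a}"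
  let ?s = "\<lambda>(p,b,d,a,c) j. [(p-2*b,0),(p-2*d,0),(a,b),(c,d)] ! j"
  have C: "\<nu> \<in> fixed_edge (lin 1 0 0 (-1)) m \<longleftrightarrow> (\<exists>t\<in>?T. \<forall>j<4. vsum (part j \<nu>) = ?s t j)" if "\<nu> \<in> X" for \<nu>
  proof -
    define a b where ab: "a j = fst (vsum (part j \<nu>))" "b j = snd (vsum (part j \<nu>))" for j
    have ray0: "b 0 = 0" unfolding ab using supp_part[of 0 \<nu>] by (intro vsum_ray) (simp add: nat_expand)
    have ray1: "b (Suc 0) = 0" unfolding ab using supp_part[of 1 \<nu>] by (intro vsum_ray) (simp add: nat_expand)
    have v: "vsum (part j \<nu>) = (a j, b j)" for j by (simp add: ab)
    have f0: "msum \<nu> fst = 1 * int (a 0) + (-1) * int (a 1) + 2 * int (b 2) + (-2) * int (b 3)"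
      by (subst msum_linear_parts[OF that, where \<alpha> = "\<lambda>j. [1,-1,0,0] ! j" and \<beta> = "\<lambda>j. [0,0,2,-2] ! j"])
        (simp_all only: P_def, auto simp: nat_expand less_Suc_eq pmap_def cone_def lin_def ab)
    have f1: "msum \<nu> snd = 0"
      by (subst msum_linear_parts[OF that, where \<alpha> = "\<lambda>j. [0,0,0,0] ! j" and \<beta> = "\<lambda>j. [0,0,0,0] ! j"])
        (simp_all only: P_def, auto simp: nat_expand less_Suc_eq pmap_def cone_def lin_def ab)
    have f2: "width2 \<nu> (0,1) = 1 * int (a 0) + 1 * int (a 1) + 2 * int (b 2) + 2 * int (b 3)" unfolding width2_def
      by (subst msum_linear_parts[OF that, where \<alpha> = "\<lambda>j. [1,1,0,0] ! j" and \<beta> = "\<lambda>j. [0,0,2,2] ! j"])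
        (simp_all only: P_def, auto simp: nat_expand less_Suc_eq pmap_def cone_def lin_def cross_def ab)
    have f3: "width2 \<nu> (1,0) = 2 * int (a 2) + 2 * int (a 3)" unfolding width2_def
      by (subst msum_linear_parts[OF that, where \<alpha> = "\<lambda>j. [0,0,2,2] ! j" and \<beta> = "\<lambda>j. [0,0,0,0] ! j"])
        (simp_all only: P_def, auto simp: nat_expand less_Suc_eq pmap_def cone_def lin_def cross_def ab)
    have F: "\<nu> \<in> fixed_edge (lin 1 0 0 (-1)) m \<longleftrightarrow> a 0 + 2 * b 2 = a 1 + 2 * b 3 \<and> a 0 + 2 * b 2 \<le> m \<and> a 2 + a 3 \<le> m"
      using that f0 f1 f2 f3 by (auto simp: fixed_edge_def edge_set_def X_def weights_def)
    show ?thesis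
    proof
      assume "\<nu> \<in> fixed_edge (lin 1 0 0 (-1)) m"
      then show "\<exists>t\<in>?T. \<forall>j<4. vsum (part j \<nu>) = ?s t j" unfolding F v
        by (intro bexI[of _ "(a 0 + 2 * b 2, b 2, b 3, a 2, a 3)"]) (auto simp: nat_expand ray0 ray1)
    next
      assume "\<exists>t\<in>?T. \<forall>j<4. vsum (part j \<nu>) = ?s t j"
      then show "\<nu> \<in> fixed_edge (lin 1 0 0 (-1)) m" unfolding F v by (auto simp: nat_expand)
    qed
  qed
  have sub: "fixed_edge (lin 1 0 0 (-1)) m \<subseteq> X" by (auto simp: fixed_edge_def edge_set_def X_def weights_def)
  have inj: "t = t'" if "t \<in> ?T" "t' \<in> ?T" "\<And>j. j < 4 \<Longrightarrow> ?s t j = ?s t' j" for t t'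
    using that(1,2) that(3)[of 0] that(3)[of 1] that(3)[of 2] that(3)[of 3] by (auto simp: nat_expand)
  note S = sum_invariant[OF sub _ C inj]
  show "finite (fixed_edge (lin 1 0 0 (-1)) m)" by (rule S(1)) auto
  have "(\<Sum>\<nu>\<in>fixed_edge (lin 1 0 0 (-1)) m. z ^ card (supp \<nu>)) =
    (\<Sum>(p,b,d,a,c)\<in>?T. r (p-2*b,0) * r (p-2*d,0) * (g (a,b) * i (c,d)))"
    by (subst S(2)) (auto simp: nat_expand r_def g_def i_def mult_ac intro!: sum.cong)
  also have "\<dots> = (\<Sum>p\<le>m. \<Sum>b\<le>p div 2. \<Sum>d\<le>p div 2. \<Sum>a\<le>m. \<Sum>c\<le>m-a. r (p-2*b,0) * r (p-2*d,0) * (g (a,b) * i (c,d)))"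
    by (simp add: sum_over_Sigma)
  finally show "(\<Sum>\<nu>\<in>fixed_edge (lin 1 0 0 (-1)) m. z ^ card (supp \<nu>)) = \<dots>" .
qed

lemma edge_swap:
  fixes z :: "'a::comm_semiring_1"
  defines "r \<equiv> gfun ray_cone z" and "g \<equiv> gfun half_cone (z^2)" and "i \<equiv> gfun open_cone (z^2)"
  shows "finite (fixed_edge (lin 0 1 1 0) m)"
    "(\<Sum>\<nu>\<in>fixed_edge (lin 0 1 1 0) m. z ^ card (supp \<nu>)) =
     (\<Sum>p\<le>m. \<Sum>c\<le>m-p. \<Sum>e\<le>m-p-c. \<Sum>b\<le>p div 2. \<Sum>a\<le>p-2*b. \<Sum>d\<le>p-2*b-a. \<Sum>b'\<le>p div 2. \<Sum>a'\<le>p-2*b'. \<Sum>f\<le>p-2*b'-a'. r (p-2*b-a-d,0) * g (a,b) * g (c,d) * (r (p-2*b'-a'-f,0) * g (a',b') * i (e,f)))"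
proof -
  interpret sectors "lin 0 1 1 0" 6 "\<lambda>j. [ray_cone,ray_cone,half_cone,half_cone,half_cone,open_cone] ! j" "\<lambda>j. [(1,1),(-1,-1),(1,0),(-1,0),(1,-1),(1,-1)] ! j" "\<lambda>j. [(0,1),(0,1),(1,1),(-1,-1),(1,0),(0,-1)] ! j"
    "\<lambda>j. [1,1,2,2,2,2] ! j" "\<lambda>(x,y). if x = y then (if 1 \<le> x then (0,0,(nat x,0)) else (1,0,(nat (-x),0))) else if y < x then (if 0 \<le> y then (2,0,(nat (x-y),nat y)) else if x \<le> 0 then (3,1,(nat (x-y),nat (-x))) else if 0 \<le> x + y then (4,0,(nat (-y),nat (x+y))) else (5,0,(nat x,nat (-x-y)))) else (if 0 \<le> x then (2,1,(nat (y-x),nat x)) else if y \<le> 0 then (3,0,(nat (y-x),nat (-y))) else if 0 \<le> x + y then (4,1,(nat (-x),nat (x+y))) else (5,1,(nat y,nat (-x-y))))"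
    by (rule sectorsI[where Q = "\<lambda>j. [\<lambda>i j. 1 \<le> i \<and> j = 0,\<lambda>i j. 1 \<le> i \<and> j = 0,\<lambda>i j. 1 \<le> i,\<lambda>i j. 1 \<le> i,\<lambda>i j. 1 \<le> i,\<lambda>i j. 1 \<le> i \<and> 1 \<le> j] ! j", OF GL_I])
      (auto simp: nat_expand lin_def cross_def pmap_def)
  let ?T = "SIGMA p:{..m}. SIGMA c:{..m-p}. SIGMA e:{..m-p-c}. SIGMA b:{..p div 2}. SIGMA a:{..p-2*b}. SIGMA d:{..p-2*b-a}. SIGMA b':{..p div 2}. SIGMA a':{..p-2*b'}. {..p-2*b'-a'}"
  let ?s = "\<lambda>(p,c,e,b,a,d,b',a',f) j. [(p-2*b-a-d,0),(p-2*b'-a'-f,0),(a,b),(a',b'),(c,d),(e,f)] ! j"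
  have C: "\<nu> \<in> fixed_edge (lin 0 1 1 0) m \<longleftrightarrow> (\<exists>t\<in>?T. \<forall>j<6. vsum (part j \<nu>) = ?s t j)" if "\<nu> \<in> X" for \<nu>
  proof -
    define a b where ab: "a j = fst (vsum (part j \<nu>))" "b j = snd (vsum (part j \<nu>))" for j
    have ray0: "b 0 = 0" unfolding ab using supp_part[of 0 \<nu>] by (intro vsum_ray) (simp add: nat_expand)
    have ray1: "b (Suc 0) = 0" unfolding ab using supp_part[of 1 \<nu>] by (intro vsum_ray) (simp add: nat_expand)
    have v: "vsum (part j \<nu>) = (a j, b j)" for j by (simp add: ab)
    have f0: "msum \<nu> fst = 1 * int (a 0) + (-1) * int (a 1) + 1 * int (a 2) + 2 * int (b 2) + (-1) * int (a 3) + (-2) * int (b 3) + 1 * int (b 4) + (-1) * int (b 5)"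
      by (subst msum_linear_parts[OF that, where \<alpha> = "\<lambda>j. [1,-1,1,-1,0,0] ! j" and \<beta> = "\<lambda>j. [0,0,2,-2,1,-1] ! j"])
        (simp_all only: P_def, auto simp: nat_expand less_Suc_eq pmap_def cone_def lin_def ab)
    have f1: "msum \<nu> snd = 1 * int (a 0) + (-1) * int (a 1) + 1 * int (a 2) + 2 * int (b 2) + (-1) * int (a 3) + (-2) * int (b 3) + 1 * int (b 4) + (-1) * int (b 5)"
      by (subst msum_linear_parts[OF that, where \<alpha> = "\<lambda>j. [1,-1,1,-1,0,0] ! j" and \<beta> = "\<lambda>j. [0,0,2,-2,1,-1] ! j"])
        (simp_all only: P_def, auto simp: nat_expand less_Suc_eq pmap_def cone_def lin_def ab)
    have f2: "width2 \<nu> (0,1) = 1 * int (a 0) + 1 * int (a 1) + 1 * int (a 2) + 2 * int (b 2) + 1 * int (a 3) + 2 * int (b 3) + 2 * int (a 4) + 1 * int (b 4) + 2 * int (a 5) + 1 * int (b 5)" unfolding width2_def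
      by (subst msum_linear_parts[OF that, where \<alpha> = "\<lambda>j. [1,1,1,1,2,2] ! j" and \<beta> = "\<lambda>j. [0,0,2,2,1,1] ! j"])
        (simp_all only: P_def, auto simp: nat_expand less_Suc_eq pmap_def cone_def lin_def cross_def ab)
    have f3: "width2 \<nu> (1,0) = 1 * int (a 0) + 1 * int (a 1) + 1 * int (a 2) + 2 * int (b 2) + 1 * int (a 3) + 2 * int (b 3) + 2 * int (a 4) + 1 * int (b 4) + 2 * int (a 5) + 1 * int (b 5)" unfolding width2_def
      by (subst msum_linear_parts[OF that, where \<alpha> = "\<lambda>j. [1,1,1,1,2,2] ! j" and \<beta> = "\<lambda>j. [0,0,2,2,1,1] ! j"])
        (simp_all only: P_def, auto simp: nat_expand less_Suc_eq pmap_def cone_def lin_def cross_def ab)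
    have F: "\<nu> \<in> fixed_edge (lin 0 1 1 0) m \<longleftrightarrow> a 0 + a 2 + 2 * b 2 + b 4 = a 1 + a 3 + 2 * b 3 + b 5 \<and> a 0 + a 2 + 2 * b 2 + b 4 + a 4 + a 5 \<le> m"
      using that f0 f1 f2 f3 by (auto simp: fixed_edge_def edge_set_def X_def weights_def)
    show ?thesis
    proof
      assume "\<nu> \<in> fixed_edge (lin 0 1 1 0) m"
      then show "\<exists>t\<in>?T. \<forall>j<6. vsum (part j \<nu>) = ?s t j" unfolding F v
        by (intro bexI[of _ "(a 0 + a 2 + 2 * b 2 + b 4, a 4, a 5, b 2, a 2, b 4, b 3, a 3, b 5)"]) (auto simp: nat_expand ray0 ray1)
    next
      assume "\<exists>t\<in>?T. \<forall>j<6. vsum (part j \<nu>) = ?s t j"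
      then obtain t where t: "t \<in> ?T" "\<forall>j<6. vsum (part j \<nu>) = ?s t j" by (rule bexE)
      obtain p c e x1 x2 x3 y1 y2 y3 where tt: "t = (p,c,e,x1,x2,x3,y1,y2,y3)"
      using that[of "fst (t)" "fst (snd (t))" "fst (snd (snd (t)))" "fst (snd (snd (snd (t))))" "fst (snd (snd (snd (snd (t)))))" "fst (snd (snd (snd (snd (snd (t))))))" "fst (snd (snd (snd (snd (snd (snd (t)))))))" "fst (snd (snd (snd (snd (snd (snd (snd (t))))))))" "snd (snd (snd (snd (snd (snd (snd (snd (t))))))))"] by (simp only: prod.collapse)
      have T: "p \<le> m" "c \<le> m-p" "e \<le> m-p-c" "x1 \<le> p div 2" "x2 \<le> p-2*x1" "x3 \<le> p-2*x1-x2" "y1 \<le> p div 2" "y2 \<le> p-2*y1" "y3 \<le> p-2*y1-y2"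
        using t(1) unfolding tt mem_Sigma_iff atMost_iff lessThan_iff atLeastLessThan_iff min_less_iff_conj by blast+
      have A1: "p + c \<le> m" using T(1,2) by linarith
      have A2: "p + c + e \<le> m" using T(3) A1 by linarith
      have A3: "2*x1 \<le> p" using T(4) by linarith
      have A4: "2*x1 + x2 \<le> p" using T(5) A3 by linarith
      have A5: "2*x1+x2+x3 \<le> p" using T(6) A4 by linarith
      have A6: "2*y1 \<le> p" using T(7) by linarith
      have A7: "2*y1 + y2 \<le> p" using T(8) A6 by linarith
      have A8: "2*y1+y2+y3 \<le> p" using T(9) A7 by linarith
      have e0: "a 0 = p-2*x1-x2-x3" "b 0 = 0" using t(2)[rule_format, of 0] unfolding tt v by simp_all
      have e1: "a 1 = p-2*y1-y2-y3" "b 1 = 0" using t(2)[rule_format, of 1] unfolding tt v by simp_all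
      have e2: "a 2 = x2" "b 2 = x1" using t(2)[rule_format, of 2] unfolding tt v by simp_all
      have e3: "a 3 = y2" "b 3 = y1" using t(2)[rule_format, of 3] unfolding tt v by simp_all
      have e4: "a 4 = c" "b 4 = x3" using t(2)[rule_format, of 4] unfolding tt v by simp_all
      have e5: "a 5 = e" "b 5 = y3" using t(2)[rule_format, of 5] unfolding tt v by simp_all
      have h0: "a 0 + 2*x1+x2+x3 = p" using e0(1) A1 A2 A3 A4 A5 A6 A7 A8 by linarith
      have h1: "a 1 + 2*y1+y2+y3 = p" using e1(1) A1 A2 A3 A4 A5 A6 A7 A8 by linarith
      show "\<nu> \<in> fixed_edge (lin 0 1 1 0) m" unfolding F using h0 h1 e0(2) e1(2) e2(1) e2(2) e3(1) e3(2) e4(1) e4(2) e5(1) e5(2) A1 A2 A3 A4 A5 A6 A7 A8 T(1) by (intro conjI) linarith+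
    qed
  qed
  have sub: "fixed_edge (lin 0 1 1 0) m \<subseteq> X" by (auto simp: fixed_edge_def edge_set_def X_def weights_def)
  let ?W = "\<lambda>\<sigma>. ((fst (\<sigma> 0)) + (fst (\<sigma> 2)) + 2 * (snd (\<sigma> 2)) + (snd (\<sigma> 4)), (fst (\<sigma> 4)), (fst (\<sigma> 5)), (snd (\<sigma> 2)), (fst (\<sigma> 2)), (snd (\<sigma> 4)), (snd (\<sigma> 3)), (fst (\<sigma> 3)), (snd (\<sigma> 5)))"
  have rec: "?W (?s t) = t" if tT: "t \<in> ?T" for t
  proof -
    obtain p c e x1 x2 x3 y1 y2 y3 where tt: "t = (p,c,e,x1,x2,x3,y1,y2,y3)"
      using that[of "fst (t)" "fst (snd (t))" "fst (snd (snd (t)))" "fst (snd (snd (snd (t))))" "fst (snd (snd (snd (snd (t)))))" "fst (snd (snd (snd (snd (snd (t))))))" "fst (snd (snd (snd (snd (snd (snd (t)))))))" "fst (snd (snd (snd (snd (snd (snd (snd (t))))))))" "snd (snd (snd (snd (snd (snd (snd (snd (t))))))))"] by (simp only: prod.collapse)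
      have T: "p \<le> m" "c \<le> m-p" "e \<le> m-p-c" "x1 \<le> p div 2" "x2 \<le> p-2*x1" "x3 \<le> p-2*x1-x2" "y1 \<le> p div 2" "y2 \<le> p-2*y1" "y3 \<le> p-2*y1-y2"
        using tT unfolding tt mem_Sigma_iff atMost_iff lessThan_iff atLeastLessThan_iff min_less_iff_conj by blast+
      have A1: "p + c \<le> m" using T(1,2) by linarith
      have A2: "p + c + e \<le> m" using T(3) A1 by linarith
      have A3: "2*x1 \<le> p" using T(4) by linarith
      have A4: "2*x1 + x2 \<le> p" using T(5) A3 by linarith
      have A5: "2*x1+x2+x3 \<le> p" using T(6) A4 by linarith
      have A6: "2*y1 \<le> p" using T(7) by linarith
      have A7: "2*y1 + y2 \<le> p" using T(8) A6 by linarith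
      have A8: "2*y1+y2+y3 \<le> p" using T(9) A7 by linarith
    show ?thesis unfolding tt by (simp; (intro conjI)?; use A1 A2 A3 A4 A5 A6 A7 A8 in linarith)
  qed
  have inj: "t = t'" if "t \<in> ?T" "t' \<in> ?T" "\<And>j. j < 6 \<Longrightarrow> ?s t j = ?s t' j" for t t'
  proof -
    have e: "?s t 0 = ?s t' 0" "?s t 1 = ?s t' 1" "?s t 2 = ?s t' 2" "?s t 3 = ?s t' 3" "?s t 4 = ?s t' 4" "?s t 5 = ?s t' 5" by (rule that(3), simp)+
    have "?W (?s t) = ?W (?s t')" by (simp only: e)
    then show ?thesis unfolding rec[OF that(1)] rec[OF that(2)] .
  qed
  note S = sum_invariant[OF sub _ C inj]
  show "finite (fixed_edge (lin 0 1 1 0) m)" by (rule S(1)) auto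
  have "(\<Sum>\<nu>\<in>fixed_edge (lin 0 1 1 0) m. z ^ card (supp \<nu>)) =
    (\<Sum>(p,c,e,b,a,d,b',a',f)\<in>?T. r (p-2*b-a-d,0) * g (a,b) * g (c,d) * (r (p-2*b'-a'-f,0) * g (a',b') * i (e,f)))"
    by (subst S(2)) (auto simp: nat_expand r_def g_def i_def mult_ac intro!: sum.cong)
  also have "\<dots> = (\<Sum>p\<le>m. \<Sum>c\<le>m-p. \<Sum>e\<le>m-p-c. \<Sum>b\<le>p div 2. \<Sum>a\<le>p-2*b. \<Sum>d\<le>p-2*b-a. \<Sum>b'\<le>p div 2. \<Sum>a'\<le>p-2*b'. \<Sum>f\<le>p-2*b'-a'. r (p-2*b-a-d,0) * g (a,b) * g (c,d) * (r (p-2*b'-a'-f,0) * g (a',b') * i (e,f)))"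
    by (simp add: sum_over_Sigma)
  finally show "(\<Sum>\<nu>\<in>fixed_edge (lin 0 1 1 0) m. z ^ card (supp \<nu>)) = \<dots>" .
qed

text \<open>The bound on the third width is linear on the six cones spanned by consecutive vectors
among \<open>\<plusminus>(1,0), \<plusminus>(0,1), \<plusminus>(1,-1)\<close>, which replace the quadrants.\<close>
lemma triangle_identity:
  fixes z :: "'a::comm_semiring_1"
  defines "g \<equiv> gfun half_cone z"
  shows "finite (fixed_triangle (lin 1 0 0 1) m)"
    "(\<Sum>\<nu>\<in>fixed_triangle (lin 1 0 0 1) m. z ^ card (supp \<nu>)) =
     (\<Sum>X\<le>m. \<Sum>Y\<le>m. \<Sum>Z\<le>m. \<Sum>v=X-Z..<min (Suc Y) (Suc (X+Y)-Z). \<Sum>s<Suc X-v. \<Sum>p<Suc Z-(Y-v). \<Sum>b\<le>Y-v. \<Sum>d\<le>v. \<Sum>b'\<le>Z+v-X. \<Sum>d'\<le>X+(Y-v)-Z. g (p,b) * g (Y-v-b,d) * g (v-d,s) * (g (X-v-s,b') * g (Z+v-X-b',d') * g (X+(Y-v)-Z-d',Z-p-(Y-v))))"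
proof -
  interpret sectors "lin 1 0 0 1" 6 "\<lambda>j. [half_cone,half_cone,half_cone,half_cone,half_cone,half_cone] ! j" "\<lambda>j. [(1,0),(0,1),(-1,1),(-1,0),(0,-1),(1,-1)] ! j" "\<lambda>j. [(0,1),(-1,1),(-1,0),(0,-1),(1,-1),(1,0)] ! j"
    "\<lambda>j. [1,1,1,1,1,1] ! j" "\<lambda>(x,y). if 1 \<le> x \<and> 0 \<le> y then (0,0,(nat x,nat y)) else if x \<le> 0 \<and> 1 \<le> x + y then (1,0,(nat (x+y),nat (-x))) else if 1 \<le> y \<and> x + y \<le> 0 then (2,0,(nat y,nat (-x-y))) else if x \<le> -1 \<and> y \<le> 0 then (3,0,(nat (-x),nat (-y))) else if 0 \<le> x \<and> x + y \<le> -1 then (4,0,(nat (-x-y),nat x)) else (5,0,(nat (-y),nat (x+y)))"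
    by (rule sectorsI[where Q = "\<lambda>j. [\<lambda>i j. 1 \<le> i,\<lambda>i j. 1 \<le> i,\<lambda>i j. 1 \<le> i,\<lambda>i j. 1 \<le> i,\<lambda>i j. 1 \<le> i,\<lambda>i j. 1 \<le> i] ! j", OF GL_I])
      (auto simp: nat_expand lin_def cross_def pmap_def)
  let ?T = "SIGMA X:{..m}. SIGMA Y:{..m}. SIGMA Z:{..m}. SIGMA v:{X-Z..<min (Suc Y) (Suc (X+Y)-Z)}. SIGMA s:{..<Suc X-v}. SIGMA p:{..<Suc Z-(Y-v)}. SIGMA b:{..Y-v}. SIGMA d:{..v}. {..Z+v-X} \<times> {..X+(Y-v)-Z}"
  let ?s = "\<lambda>(X,Y,Z,v,s,p,b,d,b',d') j. [(p,b),(Y-v-b,d),(v-d,s),(X-v-s,b'),(Z+v-X-b',d'),(X+(Y-v)-Z-d',Z-p-(Y-v))] ! j"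
  have C: "\<nu> \<in> fixed_triangle (lin 1 0 0 1) m \<longleftrightarrow> (\<exists>t\<in>?T. \<forall>j<6. vsum (part j \<nu>) = ?s t j)" if "\<nu> \<in> X" for \<nu>
  proof -
    define a b where ab: "a j = fst (vsum (part j \<nu>))" "b j = snd (vsum (part j \<nu>))" for j
    have v: "vsum (part j \<nu>) = (a j, b j)" for j by (simp add: ab)
    have f0: "msum \<nu> fst = 1 * int (a 0) + (-1) * int (b 1) + (-1) * int (a 2) + (-1) * int (b 2) + (-1) * int (a 3) + 1 * int (b 4) + 1 * int (a 5) + 1 * int (b 5)"
      by (subst msum_linear_parts[OF that, where \<alpha> = "\<lambda>j. [1,0,-1,-1,0,1] ! j" and \<beta> = "\<lambda>j. [0,-1,-1,0,1,1] ! j"])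
        (simp_all only: P_def, auto simp: nat_expand less_Suc_eq pmap_def cone_def lin_def ab)
    have f1: "msum \<nu> snd = 1 * int (b 0) + 1 * int (a 1) + 1 * int (b 1) + 1 * int (a 2) + (-1) * int (b 3) + (-1) * int (a 4) + (-1) * int (b 4) + (-1) * int (a 5)"
      by (subst msum_linear_parts[OF that, where \<alpha> = "\<lambda>j. [0,1,1,0,-1,-1] ! j" and \<beta> = "\<lambda>j. [1,1,0,-1,-1,0] ! j"])
        (simp_all only: P_def, auto simp: nat_expand less_Suc_eq pmap_def cone_def lin_def ab)
    have f2: "width2 \<nu> (0,1) = 1 * int (a 0) + 1 * int (b 1) + 1 * int (a 2) + 1 * int (b 2) + 1 * int (a 3) + 1 * int (b 4) + 1 * int (a 5) + 1 * int (b 5)" unfolding width2_def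
      by (subst msum_linear_parts[OF that, where \<alpha> = "\<lambda>j. [1,0,1,1,0,1] ! j" and \<beta> = "\<lambda>j. [0,1,1,0,1,1] ! j"])
        (simp_all only: P_def, auto simp: nat_expand less_Suc_eq pmap_def cone_def lin_def cross_def ab)
    have f3: "width2 \<nu> (1,0) = 1 * int (b 0) + 1 * int (a 1) + 1 * int (b 1) + 1 * int (a 2) + 1 * int (b 3) + 1 * int (a 4) + 1 * int (b 4) + 1 * int (a 5)" unfolding width2_def
      by (subst msum_linear_parts[OF that, where \<alpha> = "\<lambda>j. [0,1,1,0,1,1] ! j" and \<beta> = "\<lambda>j. [1,1,0,1,1,0] ! j"])
        (simp_all only: P_def, auto simp: nat_expand less_Suc_eq pmap_def cone_def lin_def cross_def ab)
    have f4: "width2 \<nu> (1,-1) = 1 * int (a 0) + 1 * int (b 0) + 1 * int (a 1) + 1 * int (b 2) + 1 * int (a 3) + 1 * int (b 3) + 1 * int (a 4) + 1 * int (b 5)" unfolding width2_def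
      by (subst msum_linear_parts[OF that, where \<alpha> = "\<lambda>j. [1,1,0,1,1,0] ! j" and \<beta> = "\<lambda>j. [1,0,1,1,0,1] ! j"])
        (simp_all only: P_def, auto simp: nat_expand less_Suc_eq pmap_def cone_def lin_def cross_def ab)
    have F: "\<nu> \<in> fixed_triangle (lin 1 0 0 1) m \<longleftrightarrow> a 0 + b 4 + a 5 + b 5 = b 1 + a 2 + b 2 + a 3 \<and> b 0 + a 1 + b 1 + a 2 = b 3 + a 4 + b 4 + a 5 \<and> a 0 + b 4 + a 5 + b 5 \<le> m \<and> b 0 + a 1 + b 1 + a 2 \<le> m \<and> a 0 + b 0 + a 1 + b 5 \<le> m"
      using that f0 f1 f2 f3 f4 by (auto simp: fixed_triangle_def triangle_set_def edge_set_def X_def weights_def)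
    show ?thesis
    proof
      assume "\<nu> \<in> fixed_triangle (lin 1 0 0 1) m"
      then show "\<exists>t\<in>?T. \<forall>j<6. vsum (part j \<nu>) = ?s t j" unfolding F v
        by (intro bexI[of _ "(a 0 + b 4 + a 5 + b 5, b 0 + a 1 + b 1 + a 2, a 0 + b 0 + a 1 + b 5, b 1 + a 2, b 2, a 0, b 0, b 1, b 3, b 4)"]) (auto simp: nat_expand )
    next
      assume "\<exists>t\<in>?T. \<forall>j<6. vsum (part j \<nu>) = ?s t j"
      then obtain t where t: "t \<in> ?T" "\<forall>j<6. vsum (part j \<nu>) = ?s t j" by (rule bexE)
      obtain X Y Z v s p x1 x2 y1 y2 where tt: "t = (X,Y,Z,v,s,p,x1,x2,y1,y2)"
      using that[of "fst (t)" "fst (snd (t))" "fst (snd (snd (t)))" "fst (snd (snd (snd (t))))" "fst (snd (snd (snd (snd (t)))))" "fst (snd (snd (snd (snd (snd (t))))))" "fst (snd (snd (snd (snd (snd (snd (t)))))))" "fst (snd (snd (snd (snd (snd (snd (snd (t))))))))" "fst (snd (snd (snd (snd (snd (snd (snd (snd (t)))))))))" "snd (snd (snd (snd (snd (snd (snd (snd (snd (t)))))))))"] by (simp only: prod.collapse)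
      have T: "X \<le> m" "Y \<le> m" "Z \<le> m" "X-Z \<le> v" "v < Suc Y" "v < Suc (X+Y)-Z" "s < Suc X-v" "p < Suc Z-(Y-v)" "x1 \<le> Y-v" "x2 \<le> v" "y1 \<le> Z+v-X" "y2 \<le> X+(Y-v)-Z"
        using t(1) unfolding tt mem_Sigma_iff atMost_iff lessThan_iff atLeastLessThan_iff min_less_iff_conj by blast+
      have A1: "v \<le> Y" using T(5) by linarith
      have A2: "X \<le> Z+v" using T(4) by linarith
      have A3: "Z+v \<le> X+Y" using T(6) by linarith
      have A4: "v+s \<le> X" using T(7) by linarith
      have A5: "p+Y \<le> Z+v" using T(8) A1 by linarith
      have A6: "x1+v \<le> Y" using T(9) A1 by linarith
      have A7: "x2 \<le> v" using T(10) by linarith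
      have A8: "y1+X \<le> Z+v" using T(11) A2 by linarith
      have A9: "y2+Z+v \<le> X+Y" using T(12) A1 A3 by linarith
      have e0: "a 0 = p" "b 0 = x1" using t(2)[rule_format, of 0] unfolding tt v by simp_all
      have e1: "a 1 = Y-v-x1" "b 1 = x2" using t(2)[rule_format, of 1] unfolding tt v by simp_all
      have e2: "a 2 = v-x2" "b 2 = s" using t(2)[rule_format, of 2] unfolding tt v by simp_all
      have e3: "a 3 = X-v-s" "b 3 = y1" using t(2)[rule_format, of 3] unfolding tt v by simp_all
      have e4: "a 4 = Z+v-X-y1" "b 4 = y2" using t(2)[rule_format, of 4] unfolding tt v by simp_all
      have e5: "a 5 = X+(Y-v)-Z-y2" "b 5 = Z-p-(Y-v)" using t(2)[rule_format, of 5] unfolding tt v by simp_all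
      have h0: "a 1 + v + x1 = Y" using e1(1) A1 A2 A3 A4 A5 A6 A7 A8 A9 by linarith
      have h1: "a 2 + x2 = v" using e2(1) A1 A2 A3 A4 A5 A6 A7 A8 A9 by linarith
      have h2: "a 3 + v + s = X" using e3(1) A1 A2 A3 A4 A5 A6 A7 A8 A9 by linarith
      have h3: "a 4 + X + y1 = Z + v" using e4(1) A1 A2 A3 A4 A5 A6 A7 A8 A9 by linarith
      have h4: "a 5 + Z + v + y2 = X + Y" using e5(1) A1 A2 A3 A4 A5 A6 A7 A8 A9 by linarith
      have h5: "b 5 + p + Y = Z + v" using e5(2) A1 A2 A3 A4 A5 A6 A7 A8 A9 by linarith
      show "\<nu> \<in> fixed_triangle (lin 1 0 0 1) m" unfolding F using h0 h1 h2 h3 h4 h5 e0(1) e0(2) e1(2) e2(2) e3(2) e4(2) A1 A2 A3 A4 A5 A6 A7 A8 A9 T(1) T(2) T(3) T(5) T(10) by (intro conjI) linarith+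
    qed
  qed
  have sub: "fixed_triangle (lin 1 0 0 1) m \<subseteq> X" by (auto simp: fixed_triangle_def triangle_set_def edge_set_def X_def weights_def)
  let ?W = "\<lambda>\<sigma>. ((fst (\<sigma> 0)) + (snd (\<sigma> 4)) + (fst (\<sigma> 5)) + (snd (\<sigma> 5)), (snd (\<sigma> 0)) + (fst (\<sigma> 1)) + (snd (\<sigma> 1)) + (fst (\<sigma> 2)), (fst (\<sigma> 0)) + (snd (\<sigma> 0)) + (fst (\<sigma> 1)) + (snd (\<sigma> 5)), (snd (\<sigma> 1)) + (fst (\<sigma> 2)), (snd (\<sigma> 2)), (fst (\<sigma> 0)), (snd (\<sigma> 0)), (snd (\<sigma> 1)), (snd (\<sigma> 3)), (snd (\<sigma> 4)))"
  have rec: "?W (?s t) = t" if tT: "t \<in> ?T" for t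
  proof -
    obtain X Y Z v s p x1 x2 y1 y2 where tt: "t = (X,Y,Z,v,s,p,x1,x2,y1,y2)"
      using that[of "fst (t)" "fst (snd (t))" "fst (snd (snd (t)))" "fst (snd (snd (snd (t))))" "fst (snd (snd (snd (snd (t)))))" "fst (snd (snd (snd (snd (snd (t))))))" "fst (snd (snd (snd (snd (snd (snd (t)))))))" "fst (snd (snd (snd (snd (snd (snd (snd (t))))))))" "fst (snd (snd (snd (snd (snd (snd (snd (snd (t)))))))))" "snd (snd (snd (snd (snd (snd (snd (snd (snd (t)))))))))"] by (simp only: prod.collapse)
      have T: "X \<le> m" "Y \<le> m" "Z \<le> m" "X-Z \<le> v" "v < Suc Y" "v < Suc (X+Y)-Z" "s < Suc X-v" "p < Suc Z-(Y-v)" "x1 \<le> Y-v" "x2 \<le> v" "y1 \<le> Z+v-X" "y2 \<le> X+(Y-v)-Z"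
        using tT unfolding tt mem_Sigma_iff atMost_iff lessThan_iff atLeastLessThan_iff min_less_iff_conj by blast+
      have A1: "v \<le> Y" using T(5) by linarith
      have A2: "X \<le> Z+v" using T(4) by linarith
      have A3: "Z+v \<le> X+Y" using T(6) by linarith
      have A4: "v+s \<le> X" using T(7) by linarith
      have A5: "p+Y \<le> Z+v" using T(8) A1 by linarith
      have A6: "x1+v \<le> Y" using T(9) A1 by linarith
      have A7: "x2 \<le> v" using T(10) by linarith
      have A8: "y1+X \<le> Z+v" using T(11) A2 by linarith
      have A9: "y2+Z+v \<le> X+Y" using T(12) A1 A3 by linarith
    show ?thesis unfolding tt by (simp; (intro conjI)?; use A1 A2 A3 A4 A5 A6 A7 A8 A9 in linarith)
  qed
  have inj: "t = t'" if "t \<in> ?T" "t' \<in> ?T" "\<And>j. j < 6 \<Longrightarrow> ?s t j = ?s t' j" for t t'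
  proof -
    have e: "?s t 0 = ?s t' 0" "?s t 1 = ?s t' 1" "?s t 2 = ?s t' 2" "?s t 3 = ?s t' 3" "?s t 4 = ?s t' 4" "?s t 5 = ?s t' 5" by (rule that(3), simp)+
    have "?W (?s t) = ?W (?s t')" by (simp only: e)
    then show ?thesis unfolding rec[OF that(1)] rec[OF that(2)] .
  qed
  note S = sum_invariant[OF sub _ C inj]
  show "finite (fixed_triangle (lin 1 0 0 1) m)" by (rule S(1)) auto
  have "(\<Sum>\<nu>\<in>fixed_triangle (lin 1 0 0 1) m. z ^ card (supp \<nu>)) =
    (\<Sum>(X,Y,Z,v,s,p,b,d,b',d')\<in>?T. g (p,b) * g (Y-v-b,d) * g (v-d,s) * (g (X-v-s,b') * g (Z+v-X-b',d') * g (X+(Y-v)-Z-d',Z-p-(Y-v))))"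
    by (subst S(2)) (auto simp: nat_expand g_def mult_ac intro!: sum.cong)
  also have "\<dots> = (\<Sum>X\<le>m. \<Sum>Y\<le>m. \<Sum>Z\<le>m. \<Sum>v=X-Z..<min (Suc Y) (Suc (X+Y)-Z). \<Sum>s<Suc X-v. \<Sum>p<Suc Z-(Y-v). \<Sum>b\<le>Y-v. \<Sum>d\<le>v. \<Sum>b'\<le>Z+v-X. \<Sum>d'\<le>X+(Y-v)-Z. g (p,b) * g (Y-v-b,d) * g (v-d,s) * (g (X-v-s,b') * g (Z+v-X-b',d') * g (X+(Y-v)-Z-d',Z-p-(Y-v))))"
    by (simp only: sum_over_Sigma finite_atMost finite_lessThan finite_atLeastLessThan finite_SigmaI prod.case)
  finally show "(\<Sum>\<nu>\<in>fixed_triangle (lin 1 0 0 1) m. z ^ card (supp \<nu>)) = \<dots>" .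
qed

lemma triangle_negation:
  fixes z :: "'a::comm_semiring_1"
  defines "g \<equiv> gfun half_cone (z^2)"
  shows "finite (fixed_triangle (lin (-1) 0 0 (-1)) m)"
    "(\<Sum>\<nu>\<in>fixed_triangle (lin (-1) 0 0 (-1)) m. z ^ card (supp \<nu>)) =
     (\<Sum>p\<le>m. \<Sum>s\<le>m-p. \<Sum>v\<le>m-p-s. \<Sum>w\<le>min (m-v) (m-p-s). \<Sum>b\<le>w. \<Sum>d\<le>v. g (p,b) * g (w-b,d) * g (v-d,s))"
proof -
  interpret sectors "lin (-1) 0 0 (-1)" 3 "\<lambda>j. [half_cone,half_cone,half_cone] ! j" "\<lambda>j. [(1,0),(0,1),(-1,1)] ! j" "\<lambda>j. [(0,1),(-1,1),(-1,0)] ! j"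
    "\<lambda>j. [2,2,2] ! j" "\<lambda>(x,y). if 1 \<le> x \<and> 0 \<le> y then (0,0,(nat x,nat y)) else if x \<le> 0 \<and> 1 \<le> x + y then (1,0,(nat (x+y),nat (-x))) else if 1 \<le> y \<and> x + y \<le> 0 then (2,0,(nat y,nat (-x-y))) else if x \<le> -1 \<and> y \<le> 0 then (0,1,(nat (-x),nat (-y))) else if 0 \<le> x \<and> x + y \<le> -1 then (1,1,(nat (-x-y),nat x)) else (2,1,(nat (-y),nat (x+y)))"
    by (rule sectorsI[where Q = "\<lambda>j. [\<lambda>i j. 1 \<le> i,\<lambda>i j. 1 \<le> i,\<lambda>i j. 1 \<le> i] ! j", OF GL_I])
      (auto simp: nat_expand lin_def cross_def pmap_def)
  let ?T = "SIGMA p:{..m}. SIGMA s:{..m-p}. SIGMA v:{..m-p-s}. SIGMA w:{..min (m-v) (m-p-s)}. {..w} \<times> {..v}"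
  let ?s = "\<lambda>(p,s,v,w,b,d) j. [(p,b),(w-b,d),(v-d,s)] ! j"
  have C: "\<nu> \<in> fixed_triangle (lin (-1) 0 0 (-1)) m \<longleftrightarrow> (\<exists>t\<in>?T. \<forall>j<3. vsum (part j \<nu>) = ?s t j)" if "\<nu> \<in> X" for \<nu>
  proof -
    define a b where ab: "a j = fst (vsum (part j \<nu>))" "b j = snd (vsum (part j \<nu>))" for j
    have v: "vsum (part j \<nu>) = (a j, b j)" for j by (simp add: ab)
    have f0: "msum \<nu> fst = 0"
      by (subst msum_linear_parts[OF that, where \<alpha> = "\<lambda>j. [0,0,0] ! j" and \<beta> = "\<lambda>j. [0,0,0] ! j"])
        (simp_all only: P_def, auto simp: nat_expand less_Suc_eq pmap_def cone_def lin_def ab)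
    have f1: "msum \<nu> snd = 0"
      by (subst msum_linear_parts[OF that, where \<alpha> = "\<lambda>j. [0,0,0] ! j" and \<beta> = "\<lambda>j. [0,0,0] ! j"])
        (simp_all only: P_def, auto simp: nat_expand less_Suc_eq pmap_def cone_def lin_def ab)
    have f2: "width2 \<nu> (0,1) = 2 * int (a 0) + 2 * int (b 1) + 2 * int (a 2) + 2 * int (b 2)" unfolding width2_def
      by (subst msum_linear_parts[OF that, where \<alpha> = "\<lambda>j. [2,0,2] ! j" and \<beta> = "\<lambda>j. [0,2,2] ! j"])
        (simp_all only: P_def, auto simp: nat_expand less_Suc_eq pmap_def cone_def lin_def cross_def ab)
    have f3: "width2 \<nu> (1,0) = 2 * int (b 0) + 2 * int (a 1) + 2 * int (b 1) + 2 * int (a 2)" unfolding width2_def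
      by (subst msum_linear_parts[OF that, where \<alpha> = "\<lambda>j. [0,2,2] ! j" and \<beta> = "\<lambda>j. [2,2,0] ! j"])
        (simp_all only: P_def, auto simp: nat_expand less_Suc_eq pmap_def cone_def lin_def cross_def ab)
    have f4: "width2 \<nu> (1,-1) = 2 * int (a 0) + 2 * int (b 0) + 2 * int (a 1) + 2 * int (b 2)" unfolding width2_def
      by (subst msum_linear_parts[OF that, where \<alpha> = "\<lambda>j. [2,2,0] ! j" and \<beta> = "\<lambda>j. [2,0,2] ! j"])
        (simp_all only: P_def, auto simp: nat_expand less_Suc_eq pmap_def cone_def lin_def cross_def ab)
    have F: "\<nu> \<in> fixed_triangle (lin (-1) 0 0 (-1)) m \<longleftrightarrow> a 0 + b 1 + a 2 + b 2 \<le> m \<and> b 0 + a 1 + b 1 + a 2 \<le> m \<and> a 0 + b 0 + a 1 + b 2 \<le> m"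
      using that f0 f1 f2 f3 f4 by (auto simp: fixed_triangle_def triangle_set_def edge_set_def X_def weights_def)
    show ?thesis
    proof
      assume "\<nu> \<in> fixed_triangle (lin (-1) 0 0 (-1)) m"
      then show "\<exists>t\<in>?T. \<forall>j<3. vsum (part j \<nu>) = ?s t j" unfolding F v
        by (intro bexI[of _ "(a 0, b 2, b 1 + a 2, b 0 + a 1, b 0, b 1)"]) (auto simp: nat_expand )
    next
      assume "\<exists>t\<in>?T. \<forall>j<3. vsum (part j \<nu>) = ?s t j"
      then show "\<nu> \<in> fixed_triangle (lin (-1) 0 0 (-1)) m" unfolding F v by (auto simp: nat_expand)
    qed
  qed
  have sub: "fixed_triangle (lin (-1) 0 0 (-1)) m \<subseteq> X" by (auto simp: fixed_triangle_def triangle_set_def edge_set_def X_def weights_def)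
  have inj: "t = t'" if "t \<in> ?T" "t' \<in> ?T" "\<And>j. j < 3 \<Longrightarrow> ?s t j = ?s t' j" for t t'
    using that(1,2) that(3)[of 0] that(3)[of 1] that(3)[of 2] by (auto simp: nat_expand)
  note S = sum_invariant[OF sub _ C inj]
  show "finite (fixed_triangle (lin (-1) 0 0 (-1)) m)" by (rule S(1)) auto
  have "(\<Sum>\<nu>\<in>fixed_triangle (lin (-1) 0 0 (-1)) m. z ^ card (supp \<nu>)) =
    (\<Sum>(p,s,v,w,b,d)\<in>?T. g (p,b) * g (w-b,d) * g (v-d,s))"
    by (subst S(2)) (auto simp: nat_expand g_def mult_ac intro!: sum.cong)
  also have "\<dots> = (\<Sum>p\<le>m. \<Sum>s\<le>m-p. \<Sum>v\<le>m-p-s. \<Sum>w\<le>min (m-v) (m-p-s). \<Sum>b\<le>w. \<Sum>d\<le>v. g (p,b) * g (w-b,d) * g (v-d,s))"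
    by (simp add: sum_over_Sigma)
  finally show "(\<Sum>\<nu>\<in>fixed_triangle (lin (-1) 0 0 (-1)) m. z ^ card (supp \<nu>)) = \<dots>" .
qed

lemma triangle_third_turn:
  fixes z :: "'a::comm_semiring_1"
  defines "g \<equiv> gfun half_cone (z^3)"
  shows "finite (fixed_triangle (lin (-1) (-1) 1 0) m)"
    "(\<Sum>\<nu>\<in>fixed_triangle (lin (-1) (-1) 1 0) m. z ^ card (supp \<nu>)) =
     (\<Sum>a\<le>m. \<Sum>b\<le>m-a. \<Sum>c\<le>m-a-b. \<Sum>d\<le>m-a-b-c. g (a,b) * g (c,d))"
proof -
  interpret sectors "lin (-1) (-1) 1 0" 2 "\<lambda>j. [half_cone,half_cone] ! j" "\<lambda>j. [(1,0),(0,1)] ! j" "\<lambda>j. [(0,1),(-1,1)] ! j"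
    "\<lambda>j. [3,3] ! j" "\<lambda>(x,y). if 1 \<le> x \<and> 0 \<le> y then (0,0,(nat x,nat y)) else if x \<le> 0 \<and> 1 \<le> x + y then (1,0,(nat (x+y),nat (-x))) else if 1 \<le> y \<and> x + y \<le> 0 then (0,1,(nat y,nat (-x-y))) else if x \<le> -1 \<and> y \<le> 0 then (1,1,(nat (-x),nat (-y))) else if 0 \<le> x \<and> x + y \<le> -1 then (0,2,(nat (-x-y),nat x)) else (1,2,(nat (-y),nat (x+y)))"
    by (rule sectorsI[where Q = "\<lambda>j. [\<lambda>i j. 1 \<le> i,\<lambda>i j. 1 \<le> i] ! j", OF GL_I])
      (auto simp: nat_expand lin_def cross_def pmap_def)
  let ?T = "SIGMA a:{..m}. SIGMA b:{..m-a}. SIGMA c:{..m-a-b}. {..m-a-b-c}"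
  let ?s = "\<lambda>(a,b,c,d) j. [(a,b),(c,d)] ! j"
  have C: "\<nu> \<in> fixed_triangle (lin (-1) (-1) 1 0) m \<longleftrightarrow> (\<exists>t\<in>?T. \<forall>j<2. vsum (part j \<nu>) = ?s t j)" if "\<nu> \<in> X" for \<nu>
  proof -
    define a b where ab: "a j = fst (vsum (part j \<nu>))" "b j = snd (vsum (part j \<nu>))" for j
    have v: "vsum (part j \<nu>) = (a j, b j)" for j by (simp add: ab)
    have f0: "msum \<nu> fst = 0"
      by (subst msum_linear_parts[OF that, where \<alpha> = "\<lambda>j. [0,0] ! j" and \<beta> = "\<lambda>j. [0,0] ! j"])
        (simp_all only: P_def, auto simp: nat_expand less_Suc_eq pmap_def cone_def lin_def ab)
    have f1: "msum \<nu> snd = 0"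
      by (subst msum_linear_parts[OF that, where \<alpha> = "\<lambda>j. [0,0] ! j" and \<beta> = "\<lambda>j. [0,0] ! j"])
        (simp_all only: P_def, auto simp: nat_expand less_Suc_eq pmap_def cone_def lin_def ab)
    have f2: "width2 \<nu> (0,1) = 2 * int (a 0) + 2 * int (b 0) + 2 * int (a 1) + 2 * int (b 1)" unfolding width2_def
      by (subst msum_linear_parts[OF that, where \<alpha> = "\<lambda>j. [2,2] ! j" and \<beta> = "\<lambda>j. [2,2] ! j"])
        (simp_all only: P_def, auto simp: nat_expand less_Suc_eq pmap_def cone_def lin_def cross_def ab)
    have f3: "width2 \<nu> (1,0) = 2 * int (a 0) + 2 * int (b 0) + 2 * int (a 1) + 2 * int (b 1)" unfolding width2_def
      by (subst msum_linear_parts[OF that, where \<alpha> = "\<lambda>j. [2,2] ! j" and \<beta> = "\<lambda>j. [2,2] ! j"])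
        (simp_all only: P_def, auto simp: nat_expand less_Suc_eq pmap_def cone_def lin_def cross_def ab)
    have f4: "width2 \<nu> (1,-1) = 2 * int (a 0) + 2 * int (b 0) + 2 * int (a 1) + 2 * int (b 1)" unfolding width2_def
      by (subst msum_linear_parts[OF that, where \<alpha> = "\<lambda>j. [2,2] ! j" and \<beta> = "\<lambda>j. [2,2] ! j"])
        (simp_all only: P_def, auto simp: nat_expand less_Suc_eq pmap_def cone_def lin_def cross_def ab)
    have F: "\<nu> \<in> fixed_triangle (lin (-1) (-1) 1 0) m \<longleftrightarrow> a 0 + b 0 + a 1 + b 1 \<le> m"
      using that f0 f1 f2 f3 f4 by (auto simp: fixed_triangle_def triangle_set_def edge_set_def X_def weights_def)
    show ?thesis
    proof
      assume "\<nu> \<in> fixed_triangle (lin (-1) (-1) 1 0) m"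
      then show "\<exists>t\<in>?T. \<forall>j<2. vsum (part j \<nu>) = ?s t j" unfolding F v
        by (intro bexI[of _ "(a 0, b 0, a 1, b 1)"]) (auto simp: nat_expand )
    next
      assume "\<exists>t\<in>?T. \<forall>j<2. vsum (part j \<nu>) = ?s t j"
      then show "\<nu> \<in> fixed_triangle (lin (-1) (-1) 1 0) m" unfolding F v by (auto simp: nat_expand)
    qed
  qed
  have sub: "fixed_triangle (lin (-1) (-1) 1 0) m \<subseteq> X" by (auto simp: fixed_triangle_def triangle_set_def edge_set_def X_def weights_def)
  have inj: "t = t'" if "t \<in> ?T" "t' \<in> ?T" "\<And>j. j < 2 \<Longrightarrow> ?s t j = ?s t' j" for t t'
    using that(1,2) that(3)[of 0] that(3)[of 1] by (auto simp: nat_expand)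
  note S = sum_invariant[OF sub _ C inj]
  show "finite (fixed_triangle (lin (-1) (-1) 1 0) m)" by (rule S(1)) auto
  have "(\<Sum>\<nu>\<in>fixed_triangle (lin (-1) (-1) 1 0) m. z ^ card (supp \<nu>)) =
    (\<Sum>(a,b,c,d)\<in>?T. g (a,b) * g (c,d))"
    by (subst S(2)) (auto simp: nat_expand g_def mult_ac intro!: sum.cong)
  also have "\<dots> = (\<Sum>a\<le>m. \<Sum>b\<le>m-a. \<Sum>c\<le>m-a-b. \<Sum>d\<le>m-a-b-c. g (a,b) * g (c,d))"
    by (simp add: sum_over_Sigma)
  finally show "(\<Sum>\<nu>\<in>fixed_triangle (lin (-1) (-1) 1 0) m. z ^ card (supp \<nu>)) = \<dots>" .
qed

lemma triangle_sixth_turn: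
  fixes z :: "'a::comm_semiring_1"
  defines "g \<equiv> gfun half_cone (z^6)"
  shows "finite (fixed_triangle (lin 0 (-1) 1 1) m)"
    "(\<Sum>\<nu>\<in>fixed_triangle (lin 0 (-1) 1 1) m. z ^ card (supp \<nu>)) =
     (\<Sum>a\<le>m div 2. \<Sum>b\<le>(m-2*a) div 2. g (a,b))"
proof -
  interpret sectors "lin 0 (-1) 1 1" 1 "\<lambda>j. [half_cone] ! j" "\<lambda>j. [(1,0)] ! j" "\<lambda>j. [(0,1)] ! j"
    "\<lambda>j. [6] ! j" "\<lambda>(x,y). if 1 \<le> x \<and> 0 \<le> y then (0,0,(nat x,nat y)) else if x \<le> 0 \<and> 1 \<le> x + y then (0,1,(nat (x+y),nat (-x))) else if 1 \<le> y \<and> x + y \<le> 0 then (0,2,(nat y,nat (-x-y))) else if x \<le> -1 \<and> y \<le> 0 then (0,3,(nat (-x),nat (-y))) else if 0 \<le> x \<and> x + y \<le> -1 then (0,4,(nat (-x-y),nat x)) else (0,5,(nat (-y),nat (x+y)))"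
    by (rule sectorsI[where Q = "\<lambda>j. [\<lambda>i j. 1 \<le> i] ! j", OF GL_I])
      (auto simp: nat_expand lin_def cross_def pmap_def)
  let ?T = "SIGMA a:{..m div 2}. {..(m-2*a) div 2}"
  let ?s = "\<lambda>(a,b) j. [(a,b)] ! j"
  have C: "\<nu> \<in> fixed_triangle (lin 0 (-1) 1 1) m \<longleftrightarrow> (\<exists>t\<in>?T. \<forall>j<1. vsum (part j \<nu>) = ?s t j)" if "\<nu> \<in> X" for \<nu>
  proof -
    define a b where ab: "a j = fst (vsum (part j \<nu>))" "b j = snd (vsum (part j \<nu>))" for j
    have v: "vsum (part j \<nu>) = (a j, b j)" for j by (simp add: ab)
    have f0: "msum \<nu> fst = 0"
      by (subst msum_linear_parts[OF that, where \<alpha> = "\<lambda>j. [0] ! j" and \<beta> = "\<lambda>j. [0] ! j"])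
        (simp_all only: P_def, auto simp: nat_expand less_Suc_eq pmap_def cone_def lin_def ab)
    have f1: "msum \<nu> snd = 0"
      by (subst msum_linear_parts[OF that, where \<alpha> = "\<lambda>j. [0] ! j" and \<beta> = "\<lambda>j. [0] ! j"])
        (simp_all only: P_def, auto simp: nat_expand less_Suc_eq pmap_def cone_def lin_def ab)
    have f2: "width2 \<nu> (0,1) = 4 * int (a 0) + 4 * int (b 0)" unfolding width2_def
      by (subst msum_linear_parts[OF that, where \<alpha> = "\<lambda>j. [4] ! j" and \<beta> = "\<lambda>j. [4] ! j"])
        (simp_all only: P_def, auto simp: nat_expand less_Suc_eq pmap_def cone_def lin_def cross_def ab)
    have f3: "width2 \<nu> (1,0) = 4 * int (a 0) + 4 * int (b 0)" unfolding width2_def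
      by (subst msum_linear_parts[OF that, where \<alpha> = "\<lambda>j. [4] ! j" and \<beta> = "\<lambda>j. [4] ! j"])
        (simp_all only: P_def, auto simp: nat_expand less_Suc_eq pmap_def cone_def lin_def cross_def ab)
    have f4: "width2 \<nu> (1,-1) = 4 * int (a 0) + 4 * int (b 0)" unfolding width2_def
      by (subst msum_linear_parts[OF that, where \<alpha> = "\<lambda>j. [4] ! j" and \<beta> = "\<lambda>j. [4] ! j"])
        (simp_all only: P_def, auto simp: nat_expand less_Suc_eq pmap_def cone_def lin_def cross_def ab)
    have F: "\<nu> \<in> fixed_triangle (lin 0 (-1) 1 1) m \<longleftrightarrow> 2 * (a 0 + b 0) \<le> m"
      using that f0 f1 f2 f3 f4 by (auto simp: fixed_triangle_def triangle_set_def edge_set_def X_def weights_def)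
    show ?thesis
    proof
      assume "\<nu> \<in> fixed_triangle (lin 0 (-1) 1 1) m"
      then show "\<exists>t\<in>?T. \<forall>j<1. vsum (part j \<nu>) = ?s t j" unfolding F v
        by (intro bexI[of _ "(a 0, b 0)"]) (auto simp: nat_expand )
    next
      assume "\<exists>t\<in>?T. \<forall>j<1. vsum (part j \<nu>) = ?s t j"
      then show "\<nu> \<in> fixed_triangle (lin 0 (-1) 1 1) m" unfolding F v by (auto simp: nat_expand)
    qed
  qed
  have sub: "fixed_triangle (lin 0 (-1) 1 1) m \<subseteq> X" by (auto simp: fixed_triangle_def triangle_set_def edge_set_def X_def weights_def)
  have inj: "t = t'" if "t \<in> ?T" "t' \<in> ?T" "\<And>j. j < 1 \<Longrightarrow> ?s t j = ?s t' j" for t t'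
    using that(1,2) that(3)[of 0] by (auto simp: nat_expand)
  note S = sum_invariant[OF sub _ C inj]
  show "finite (fixed_triangle (lin 0 (-1) 1 1) m)" by (rule S(1)) auto
  have "(\<Sum>\<nu>\<in>fixed_triangle (lin 0 (-1) 1 1) m. z ^ card (supp \<nu>)) =
    (\<Sum>(a,b)\<in>?T. g (a,b))"
    by (subst S(2)) (auto simp: nat_expand g_def mult_ac intro!: sum.cong)
  also have "\<dots> = (\<Sum>a\<le>m div 2. \<Sum>b\<le>(m-2*a) div 2. g (a,b))"
    by (simp add: sum_over_Sigma)
  finally show "(\<Sum>\<nu>\<in>fixed_triangle (lin 0 (-1) 1 1) m. z ^ card (supp \<nu>)) = \<dots>" .
qed

section \<open>Edges of finite point sets\<close>

definition dot :: "vec \<Rightarrow> vec \<Rightarrow> int" where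
  "dot n s = fst n * fst s + snd n * snd s"

definition dir :: "vec \<Rightarrow> vec" where
  "dir n = (snd n, - fst n)"

definition scal :: "int \<Rightarrow> vec \<Rightarrow> vec" where
  "scal j v = (j * fst v, j * snd v)"

lemma dot_add [simp]: "dot n (a + b) = dot n a + dot n b" by (simp add: dot_def algebra_simps)
lemma dot_diff [simp]: "dot n (a - b) = dot n a - dot n b" by (simp add: dot_def algebra_simps)
lemma dot_minus [simp]: "dot n (- a) = - dot n a" "dot (- n) a = - dot n a" by (simp_all add: dot_def)
lemma dot_scal [simp]: "dot n (scal j a) = j * dot n a" by (simp add: dot_def scal_def algebra_simps)
lemma dot_zero [simp]: "dot n 0 = 0" by (simp add: dot_def)
lemma dot_dir [simp]: "dot n (dir k) = cross n k" by (simp add: dot_def dir_def cross_def)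
lemma dot_sum: "dot n (sum f A) = (\<Sum>a\<in>A. dot n (f a))"
  by (induction A rule: infinite_finite_induct) auto
lemma dir_minus [simp]: "dir (- n) = - dir n" by (simp add: dir_def)
lemma scal_minus [simp]: "scal j (- v) = - scal j v" "scal (- j) v = - scal j v" by (simp_all add: scal_def)
lemma scal_0 [simp]: "scal 0 v = 0" by (simp add: scal_def zero_prod_def)
lemma scal_add: "scal (i + j) v = scal i v + scal j v" by (simp add: scal_def algebra_simps)
lemma cross_self [simp]: "cross n n = 0" by (simp add: cross_def)
lemma cross_anti: "cross k n = - cross n k" by (simp add: cross_def)

lemma scal_dir_inject: "prim n \<Longrightarrow> scal i (dir n) = scal j (dir n) \<longleftrightarrow> i = j"
  using prim_nz[of n] by (auto simp: scal_def dir_def prod_eq_iff zero_prod_def)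

lemma prim_orthogonal:
  assumes "prim n" "dot n v = 0" obtains j where "v = scal j (dir n)"
proof -
  obtain k where k: "fst n * snd k - snd n * fst k = 1" using assms(1) prim_iff_cross by (auto simp: cross_def)
  define j where "j = - (fst v * fst k + snd v * snd k)"
  have z: "snd n * snd v = - (fst n * fst v)" using assms(2) by (simp add: dot_def)
  have "j * snd n = - (fst v * fst k * snd n) - snd k * (snd n * snd v)" by (simp add: j_def algebra_simps)
  also have "\<dots> = fst v * (fst n * snd k - snd n * fst k)" unfolding z by (simp add: algebra_simps)
  finally have 1: "fst v = j * snd n" using k by simp
  have z': "fst n * fst v = - (snd n * snd v)" using z by simp
  have "j * fst n = - (fst n * fst v) * fst k - snd v * (snd k * fst n)" by (simp add: j_def algebra_simps)
  also have "\<dots> = - snd v * (fst n * snd k - snd n * fst k)" unfolding z' by (simp add: algebra_simps)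
  finally have 2: "snd v = - j * fst n" using k by simp
  show thesis by (rule that[of j]) (simp add: scal_def dir_def prod_eq_iff 1 2)
qed

lemma vec_prim_multiple:
  assumes "v \<noteq> 0" obtains l k where "prim k" "0 < l" "v = scal l (dir k)"
    "\<bar>fst k\<bar> \<le> \<bar>snd v\<bar>" "\<bar>snd k\<bar> \<le> \<bar>fst v\<bar>"
proof -
  define g where "g = gcd (fst v) (snd v)"
  have g: "0 < g" using assms by (auto simp: g_def zero_prod_def prod_eq_iff)
  have "g dvd fst v" "g dvd snd v" by (simp_all add: g_def)
  then obtain p q where pq: "fst v = g * p" "snd v = g * q" by (auto elim!: dvdE)
  have "coprime p q" using g pq unfolding g_def by (metis gcd_coprime_exists gcd_mult_distrib_int g_def abs_of_pos coprime_iff_gcd_eq_1 mult_cancel_left1 less_irrefl)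
  then have "prim (- q, p)" by (simp add: prim_def coprime_commute)
  moreover have "v = scal g (dir (- q, p))" using pq by (simp add: scal_def dir_def prod_eq_iff)
  moreover have "\<bar>q\<bar> \<le> \<bar>snd v\<bar>" "\<bar>p\<bar> \<le> \<bar>fst v\<bar>" using g pq by (auto simp: abs_mult mult_le_cancel_right1 intro: order_trans[OF _ mult_right_mono[of 1 g]])
  ultimately show thesis using that[of "(- q, p)" g] g by simp
qed

text \<open>The face of \<open>S\<close> on which \<open>n\<close> is smallest runs from \<open>s\<close> through \<open>k\<close> primitive steps.\<close>
definition edge :: "vec set \<Rightarrow> vec \<Rightarrow> vec \<Rightarrow> nat \<Rightarrow> bool" where
  "edge S n s k \<longleftrightarrow> s \<in> S \<and> s + scal (int k) (dir n) \<in> S \<and>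
     (\<forall>t\<in>S. dot n s < dot n t \<or> (\<exists>j. 0 \<le> j \<and> j \<le> int k \<and> t = s + scal j (dir n)))"

lemma edge_dot: "edge S n s k \<Longrightarrow> t \<in> S \<Longrightarrow> dot n s \<le> dot n t"
  unfolding edge_def by (metis add.right_neutral cross_self dot_add dot_dir dot_scal le_less mult_zero_right)

lemma edge_unique:
  assumes n: "prim n" and e: "edge S n s k" "edge S n s' k'" shows "s' = s \<and> k' = k"
proof -
  have c: "dot n (s + scal j (dir n)) = dot n s" for s j by simp
  have eq: "dot n s = dot n s'" using edge_dot[OF e(1), of s'] edge_dot[OF e(2), of s] e by (simp add: edge_def)
  obtain j where j: "0 \<le> j" "s' = s + scal j (dir n)" using e eq unfolding edge_def by (metis less_irrefl)
  obtain j' where j': "0 \<le> j'" "s = s' + scal j' (dir n)" using e eq unfolding edge_def by (metis less_irrefl)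
  have "scal (j + j') (dir n) = scal 0 (dir n)" using j j' by (simp add: scal_add add.commute)
  then have "j + j' = 0" using scal_dir_inject[OF n] by blast
  then have "j = 0" using j(1) j'(1) by linarith
  then have s: "s' = s" using j(2) by simp
  have le: "a \<le> b" if h: "edge S n s a" "edge S n s b" for a b
  proof -
    have "s + scal (int a) (dir n) \<in> S" using h(1) by (simp add: edge_def)
    then obtain i where "i \<le> int b" "s + scal (int a) (dir n) = s + scal i (dir n)"
      using h(2) c unfolding edge_def by (metis less_irrefl)
    then show ?thesis using scal_dir_inject[OF n] by simp
  qed
  show ?thesis using s le e by (simp add: antisym)
qed

lemma edge_exists:
  assumes "finite S" "S \<noteq> {}" "prim n" obtains s k where "edge S n s k"
proof -
  obtain t0 where t0: "t0 \<in> S" "\<And>t. t \<in> S \<Longrightarrow> dot n t0 \<le> dot n t"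
    using arg_min_if_finite[OF assms(1,2), of "dot n"] by (metis not_le)
  let ?J = "{j. t0 + scal j (dir n) \<in> S}"
  have "inj (\<lambda>j. t0 + scal j (dir n))" using scal_dir_inject[OF assms(3)] by (auto intro!: injI)
  then have fin: "finite ?J" using finite_vimageI[OF assms(1), of "\<lambda>j. t0 + scal j (dir n)"] by (simp add: vimage_def)
  have "0 \<in> ?J" using t0 by simp
  then have ne: "?J \<noteq> {}" by blast
  define a where "a = Min ?J"
  define b where "b = Max ?J"
  have ab: "a \<in> ?J" "b \<in> ?J" "a \<le> b" "\<And>j. j \<in> ?J \<Longrightarrow> a \<le> j \<and> j \<le> b"
    using fin ne Min_in[OF fin ne] Max_in[OF fin ne] unfolding a_def b_def by auto
  have "edge S n (t0 + scal a (dir n)) (nat (b - a))"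
    unfolding edge_def
  proof (intro conjI ballI)
    show "t0 + scal a (dir n) \<in> S" using ab by simp
    have "scal a (dir n) + scal (int (nat (b - a))) (dir n) = scal b (dir n)"
      using ab(3) by (simp add: scal_add[symmetric])
    then show "t0 + scal a (dir n) + scal (int (nat (b - a))) (dir n) \<in> S"
      using ab(2) by (simp only: add.assoc mem_Collect_eq)
    fix t assume t: "t \<in> S"
    show "dot n (t0 + scal a (dir n)) < dot n t \<or>
      (\<exists>j\<ge>0. j \<le> int (nat (b - a)) \<and> t = t0 + scal a (dir n) + scal j (dir n))"
    proof (cases "dot n t = dot n t0")
      case True
      then have "dot n (t - t0) = 0" by simp
      then obtain j where "t - t0 = scal j (dir n)" by (rule prim_orthogonal[OF assms(3)])
      then have j: "t = t0 + scal j (dir n)" by (metis add.commute diff_add_cancel)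
      then have "a \<le> j" "j \<le> b" using ab(4)[of j] t by auto
      moreover have "t = t0 + scal a (dir n) + scal (j - a) (dir n)"
        unfolding j by (simp add: scal_add[symmetric] add.assoc)
      ultimately show ?thesis by (intro disjI2 exI[of _ "j - a"]) auto
    next
      case False then show ?thesis using t0(2)[OF t] by simp
    qed
  qed
  then show thesis by (rule that)
qed

definition start :: "vec set \<Rightarrow> vec \<Rightarrow> vec" where
  "start S n = (THE s. \<exists>k. edge S n s k)"

definition len :: "vec set \<Rightarrow> vec \<Rightarrow> nat" where
  "len S n = (if prim n then THE k. \<exists>s. edge S n s k else 0)"

lemma edge_iff: 
  assumes "finite S" "S \<noteq> {}" "prim n" shows "edge S n s k \<longleftrightarrow> s = start S n \<and> k = len S n"
proof -
  obtain s0 k0 where e: "edge S n s0 k0" using edge_exists[OF assms] .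
  have "start S n = s0" unfolding start_def by (rule the_equality) (use e edge_unique[OF assms(3) e] in blast)+
  moreover have "len S n = k0" unfolding len_def if_P[OF assms(3)]
    by (rule the_equality) (use e edge_unique[OF assms(3) e] in blast)+
  ultimately show ?thesis using e edge_unique[OF assms(3) e] by blast
qed

lemma edge_start_len: "finite S \<Longrightarrow> S \<noteq> {} \<Longrightarrow> prim n \<Longrightarrow> edge S n (start S n) (len S n)"
  by (simp add: edge_iff)

definition upper :: "vec \<Rightarrow> bool" where
  "upper n \<longleftrightarrow> 0 < snd n \<or> (snd n = 0 \<and> 0 < fst n)"

lemma upper_uminus: "prim n \<Longrightarrow> upper (- n) \<longleftrightarrow> \<not> upper n"
  using prim_nz[of n] by (auto simp: upper_def zero_prod_def prod_eq_iff)

lemma upper_total: "prim n \<Longrightarrow> prim k \<Longrightarrow> upper n \<Longrightarrow> upper k \<Longrightarrow> cross n k = 0 \<Longrightarrow> n = k"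
  using prim_parallel[of n k] upper_uminus[of n] by auto

lemma upper_trans:
  assumes "upper a" "upper b" "upper c" "0 < cross a b" "0 < cross b c" shows "0 < cross a c"
proof -
  have id: "snd b * cross a c = snd c * cross a b + snd a * cross b c" 
    "fst b * cross a c = fst c * cross a b + fst a * cross b c" by (simp_all add: cross_def algebra_simps)
  show ?thesis
  proof (cases "snd b = 0")
    case True
    then have "0 < fst b" using assms(2) by (auto simp: upper_def)
    moreover have "snd a = 0 \<or> 0 < snd a" using assms(1) by (auto simp: upper_def)
    ultimately have "cross a b \<le> 0" using True by (auto simp: cross_def mult_le_0_iff)
    then show ?thesis using assms(4) by simp
  next
    case False
    then have b: "0 < snd b" using assms(2) by (auto simp: upper_def)
    have "0 < snd c"
    proof (rule ccontr)
      assume "\<not> 0 < snd c"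
      then have "snd c = 0" "0 < fst c" using assms(3) by (auto simp: upper_def)
      then have "cross b c < 0" using b by (simp add: cross_def)
      then show False using assms(5) by simp
    qed
    then have "0 < snd c * cross a b" using assms(4) by simp
    moreover have "0 \<le> snd a * cross b c" using assms(1,5) by (auto simp: upper_def)
    ultimately have "0 < snd b * cross a c" using id by linarith
    then show ?thesis using b by (simp add: zero_less_mult_iff)
  qed
qed

lemma edge_adjacent:
  assumes S: "finite S" "S \<noteq> {}" and n: "prim n" "prim n'" "0 < cross n n'"
    and gap: "\<And>w v. v \<in> S \<Longrightarrow> w \<in> S \<Longrightarrow> \<not> (\<exists>k l. prim k \<and> 0 < l \<and> w - v = scal l (dir k) \<and> 0 < cross n k \<and> 0 < cross k n')"
  shows "start S n' = start S n + scal (int (len S n)) (dir n)"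
proof (rule ccontr)
  define p where "p = start S n + scal (int (len S n)) (dir n)"
  define q where "q = start S n'"
  assume "start S n' \<noteq> start S n + scal (int (len S n)) (dir n)"
  then have ne: "q - p \<noteq> 0" by (simp add: p_def q_def)
  note e = edge_start_len[OF S n(1)] and e' = edge_start_len[OF S n(2)]
  have pS: "p \<in> S" and qS: "q \<in> S" using e e' by (simp_all add: edge_def p_def q_def)
  obtain l k where k: "prim k" "0 < l" "q - p = scal l (dir k)" using vec_prim_multiple[OF ne] by metis
  have "dot n p = dot n (start S n)" by (simp add: p_def)
  then have 1: "dot n p \<le> dot n q" using edge_dot[OF e qS] by simp
  have 2: "dot n' q \<le> dot n' p" using edge_dot[OF e' pS] by (simp add: q_def)
  have n1: "l * cross n k = dot n q - dot n p" using k(3) by (metis dot_diff dot_scal dot_dir)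
  have n2: "l * cross k n' = dot n' p - dot n' q"
    using k(3) cross_anti[of k n'] by (metis dot_diff dot_scal dot_dir minus_diff_eq mult_minus_right)
  have "cross n k \<noteq> 0"
  proof
    assume z: "cross n k = 0"
    then have "dot n q = dot n (start S n)" using n1 by (simp add: p_def)
    then obtain j where j: "0 \<le> j" "j \<le> int (len S n)" "q = start S n + scal j (dir n)"
      using e qS unfolding edge_def by (metis less_irrefl)
    then have qp: "q - p = scal (j - int (len S n)) (dir n)" unfolding p_def by (simp add: scal_def prod_eq_iff algebra_simps)
    then have "dot n' (q - p) = (j - int (len S n)) * cross n' n" by simp
    then have "0 \<le> (int (len S n) - j) * cross n' n" using 2 by (simp add: algebra_simps)
    then have "int (len S n) - j = 0" using n(3) cross_anti[of n n'] j(2)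
      by (simp add: zero_le_mult_iff)
    then show False using qp ne by simp
  qed
  moreover have "cross k n' \<noteq> 0"
  proof
    assume z: "cross k n' = 0"
    then have "dot n' p = dot n' q" using n2 by simp
    then obtain j where j: "0 \<le> j" "p = q + scal j (dir n')"
      using e' pS unfolding edge_def q_def by (metis less_irrefl)
    then have "dot n (q - p) = - j * cross n n'" by simp
    then have "0 \<le> - j * cross n n'" using 1 by simp
    then have "j = 0" using n(3) j(1) by (simp add: mult_le_0_iff)
    then show False using j(2) ne by simp
  qed
  moreover have "0 \<le> cross n k" "0 \<le> cross k n'" using n1 n2 1 2 k(2) by (metis diff_ge_0_iff_ge zero_le_mult_iff not_less)+
  ultimately have "0 < cross n k" "0 < cross k n'" by linarith+
  then show False using gap[OF pS qS] k by blast
qed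


lemma finite_box: "finite {n :: vec. \<bar>fst n\<bar> \<le> B \<and> \<bar>snd n\<bar> \<le> B}"
proof -
  have "{n :: vec. \<bar>fst n\<bar> \<le> B \<and> \<bar>snd n\<bar> \<le> B} \<subseteq> {-B..B} \<times> {-B..B}" by auto
  then show ?thesis by (rule finite_subset) simp
qed

locale point_set =
  fixes S :: "vec set"
  assumes fin: "finite S" and ne: "S \<noteq> {}"
begin

definition B :: int where
  "B = 1 + (\<Sum>s\<in>S. \<bar>fst s\<bar> + \<bar>snd s\<bar>) * 2"

definition D :: "vec set" where
  "D = {n. prim n \<and> \<bar>fst n\<bar> \<le> B \<and> \<bar>snd n\<bar> \<le> B}"

lemma B1: "1 \<le> B" unfolding B_def by (simp add: sum_nonneg)

lemma finite_D: "finite D"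
  by (rule finite_subset[OF _ finite_box[of B]]) (auto simp: D_def)

lemma diff_bound:
  assumes "s \<in> S" "t \<in> S" shows "\<bar>fst (s - t)\<bar> \<le> B" "\<bar>snd (s - t)\<bar> \<le> B"
proof -
  have *: "\<bar>fst u\<bar> + \<bar>snd u\<bar> \<le> (\<Sum>s\<in>S. \<bar>fst s\<bar> + \<bar>snd s\<bar>)" if "u \<in> S" for u
    using fin that by (intro member_le_sum[of u S "\<lambda>s. \<bar>fst s\<bar> + \<bar>snd s\<bar>"]) auto
  show "\<bar>fst (s - t)\<bar> \<le> B" "\<bar>snd (s - t)\<bar> \<le> B" using *[OF assms(1)] *[OF assms(2)] unfolding B_def by auto
qed

lemma direction_in_D:
  assumes "v \<in> S" "w \<in> S" "prim k" "0 < l" "w - v = scal l (dir k)" shows "k \<in> D"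
proof -
  have "\<bar>l\<bar> * \<bar>snd k\<bar> \<le> B" "\<bar>l\<bar> * \<bar>fst k\<bar> \<le> B"
    using diff_bound[OF assms(2,1)] unfolding assms(5) by (simp_all add: scal_def dir_def abs_mult)
  moreover have "1 * \<bar>snd k\<bar> \<le> \<bar>l\<bar> * \<bar>snd k\<bar>" "1 * \<bar>fst k\<bar> \<le> \<bar>l\<bar> * \<bar>fst k\<bar>"
    using assms(4) by (intro mult_right_mono; simp)+
  ultimately show ?thesis using assms(3) by (simp add: D_def)
qed

lemma edge_S: "prim n \<Longrightarrow> edge S n (start S n) (len S n)"
  by (rule edge_start_len[OF fin ne])

lemma supp_len: "supp (len S) \<subseteq> D"
proof
  fix n assume "n \<in> supp (len S)"
  then have n: "prim n" "len S n \<noteq> 0" by (auto simp: supp_def len_def split: if_splits)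
  note e = edge_S[OF n(1)]
  show "n \<in> D" using e n by (intro direction_in_D[of "start S n" "start S n + scal (int (len S n)) (dir n)" n "int (len S n)"])
    (auto simp: edge_def)
qed

lemma adjacent:
  assumes "prim n" "prim n'" "0 < cross n n'" "\<And>k. k \<in> D \<Longrightarrow> \<not> (0 < cross n k \<and> 0 < cross k n')"
  shows "start S n' = start S n + scal (int (len S n)) (dir n)"
  by (rule edge_adjacent[OF fin ne assms(1-3)]) (use assms(4) direction_in_D in blast)

lemma e1_D: "(1,0) \<in> D" "(0,1) \<in> D" using B1 by (auto simp: D_def prim_def)

lemma upper_max:
  assumes "finite F" "F \<noteq> {}" "\<And>k. k \<in> F \<Longrightarrow> prim k \<and> upper k"
  obtains m where "m \<in> F" "\<And>k. k \<in> F \<Longrightarrow> k = m \<or> 0 < cross k m"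
proof -
  have "\<exists>m\<in>F. \<forall>k\<in>F. k = m \<or> 0 < cross k m" using assms
  proof (induction F rule: finite_ne_induct)
    case (insert x F)
    then obtain m where m: "m \<in> F" "\<forall>k\<in>F. k = m \<or> 0 < cross k m" by auto
    have px: "prim x" "upper x" "prim m" "upper m" using insert.prems m(1) by auto
    consider "x = m" | "0 < cross x m" | "0 < cross m x"
      using upper_total[OF px(1,3,2,4)] cross_anti[of x m] by linarith
    then show ?case
    proof cases
      case 3
      have "k = x \<or> 0 < cross k x" if "k \<in> insert x F" for k
        using that m(2) 3 upper_trans[of k m x] insert.prems px by auto
      then show ?thesis by blast
    qed (use m in auto)
  qed auto
  then show thesis using that by blast
qed

abbreviation "step k \<equiv> scal (int (len S k)) (dir k)"

lemma upper_chain: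
  assumes "prim n" "upper n"
  shows "start S n = start S (1,0) + (\<Sum>k\<in>{k\<in>D. upper k \<and> 0 < cross k n}. step k)"
  using assms
proof (induction "card {k\<in>D. upper k \<and> 0 < cross k n}" arbitrary: n rule: less_induct)
  case less
  let ?F = "\<lambda>n. {k\<in>D. upper k \<and> 0 < cross k n}"
  have fF: "finite (?F n)" for n using finite_D by simp
  show ?case
  proof (cases "?F n = {}")
    case True
    have "n = (1,0)"
    proof (rule ccontr)
      assume "n \<noteq> (1,0)"
      then have "cross (1,0) n \<noteq> 0" using upper_total[of "(1,0)" n] less.prems by (auto simp: prim_def upper_def)
      then have "0 < cross (1,0) n" using less.prems by (auto simp: cross_def upper_def)
      then have "(1,0) \<in> ?F n" using e1_D by (simp add: upper_def)
      then show False using True by blast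
    qed
    then show ?thesis using True by (simp only: sum.empty add_0_right)
  next
    case False
    obtain m where m: "m \<in> ?F n" "\<And>k. k \<in> ?F n \<Longrightarrow> k = m \<or> 0 < cross k m"
      by (rule upper_max[OF fF False]) (auto simp: D_def)
    have pm: "prim m" "upper m" "0 < cross m n" using m(1) by (auto simp: D_def)
    have eq: "?F n = insert m (?F m)"
    proof (intro equalityI subsetI)
      fix k assume "k \<in> ?F n" then show "k \<in> insert m (?F m)" using m(2)[of k] by auto
    next
      fix k assume "k \<in> insert m (?F m)" 
      then show "k \<in> ?F n" using m(1) upper_trans[of k m n] pm less.prems by auto
    qed
    have nm: "m \<notin> ?F m" by simp
    have "card (?F m) < card (?F n)" unfolding eq using fF[of m] nm by simp
    then have IH: "start S m = start S (1,0) + (\<Sum>k\<in>?F m. step k)" using less.hyps pm by blast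
    have "start S n = start S m + step m"
    proof (rule adjacent[OF pm(1) less.prems(1) pm(3)])
      fix k assume k: "k \<in> D"
      show "\<not> (0 < cross m k \<and> 0 < cross k n)"
      proof
        assume c: "0 < cross m k \<and> 0 < cross k n"
        have "upper k"
        proof (rule ccontr)
          assume "\<not> upper k"
          then have u: "upper (- k)" using k upper_uminus by (auto simp: D_def)
          have "0 < cross n (- k)" "0 < cross (- k) m" using c cross_anti[of n k] cross_anti[of k m] by auto
          then have "0 < cross n m" using upper_trans[OF less.prems(2) u pm(2)] by blast
          then show False using pm(3) cross_anti[of n m] by simp
        qed
        then have "k = m \<or> 0 < cross k m" using m(2) k c by blast
        then show False using c cross_anti[of k m] by auto
      qed
    qed
    then show ?thesis unfolding eq using IH fF[of m] nm by (simp add: add.assoc add.commute)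
  qed
qed

lemma upper_chain_end: "start S (-1,0) = start S (1,0) + (\<Sum>k\<in>{k\<in>D. upper k}. step k)"
proof -
  let ?U = "{k\<in>D. upper k}"
  have fU: "finite ?U" using finite_D by simp
  have U01: "(0,1) \<in> ?U" using e1_D by (simp add: upper_def)
  obtain m where m: "m \<in> ?U" "\<And>k. k \<in> ?U \<Longrightarrow> k = m \<or> 0 < cross k m"
  proof (rule upper_max[OF fU])
    show "?U \<noteq> {}" using U01 by blast
  qed (auto simp: D_def)
  have pm: "prim m" "upper m" using m(1) by (auto simp: D_def)
  have sm: "0 < snd m"
    using m(2)[OF U01] pm(2) by (auto simp: cross_def upper_def)
  have eq: "?U = insert m {k\<in>D. upper k \<and> 0 < cross k m}" using m by auto
  have "start S (-1,0) = start S m + step m"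
  proof (rule adjacent[OF pm(1)])
    show "prim (-1,0)" by (simp add: prim_def)
    show "0 < cross m (-1,0)" using sm by (simp add: cross_def)
    fix k assume k: "k \<in> D"
    show "\<not> (0 < cross m k \<and> 0 < cross k (-1,0))"
    proof
      assume c: "0 < cross m k \<and> 0 < cross k (-1,0)"
      then have "upper k" by (simp add: cross_def upper_def)
      then have "k = m \<or> 0 < cross k m" using m(2) k by blast
      then show False using c cross_anti[of k m] by auto
    qed
  qed
  then show ?thesis unfolding eq upper_chain[OF pm] using finite_D by (simp add: add.assoc add.commute)
qed

end

text \<open>The angular order starting at \<open>(1,0)\<close>. The sign of \<open>cross\<close> compares directions only within a half
turn, so the two half planes are compared separately.\<close>
definition before :: "vec \<Rightarrow> vec \<Rightarrow> bool" where
  "before k n \<longleftrightarrow> (if upper n then upper k \<and> 0 < cross k n else upper k \<or> 0 < cross k n)"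

definition offset :: "(vec \<Rightarrow> nat) \<Rightarrow> vec \<Rightarrow> vec" where
  "offset \<nu> n = (\<Sum>k\<in>{k\<in>supp \<nu>. before k n}. scal (int (\<nu> k)) (dir k))"

lemma edge_uminus: "edge (uminus ` S) (- n) (- s) k \<longleftrightarrow> edge S n s k"
proof -
  have i: "- v \<in> uminus ` S \<longleftrightarrow> v \<in> S" for v :: vec by (auto simp: image_iff)
  have "- s + scal (int k) (dir (- n)) = - (s + scal (int k) (dir n))" by simp
  then have 1: "- s + scal (int k) (dir (- n)) \<in> uminus ` S \<longleftrightarrow> s + scal (int k) (dir n) \<in> S" by (simp only: i)
  have "(- t = - s + scal j (dir (- n))) = (t = s + scal j (dir n))" for t j
    by (metis (no_types) dir_minus minus_add_distrib minus_equation_iff scal_minus(1))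
  then show ?thesis unfolding edge_def i 1 by (simp only: ball_simps dot_minus minus_minus)
qed

lemma point_set_uminus: "point_set S \<Longrightarrow> point_set (uminus ` S)"
  by (simp add: point_set_def)

context point_set
begin

lemma start_uminus: "prim n \<Longrightarrow> start (uminus ` S) (- n) = - start S n"
  and len_uminus: "prim n \<Longrightarrow> len (uminus ` S) (- n) = len S n"
  using edge_S[of n] edge_uminus[of S n "start S n" "len S n"] edge_iff[of "uminus ` S" "- n"] fin ne by auto

lemma D_uminus: "point_set.D (uminus ` S) = D"
proof -
  interpret m: point_set "uminus ` S" by (rule point_set_uminus) unfold_locales
  have "m.B = B" unfolding m.B_def B_def by (subst sum.reindex) auto
  then show ?thesis by (simp add: m.D_def D_def)
qed

lemma sum_lower: "(\<Sum>k\<in>{k\<in>D. upper k \<and> Q k}. scal (int (len (uminus ` S) k)) (dir k))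
   = - (\<Sum>k\<in>{k\<in>D. \<not> upper k \<and> Q (- k)}. step k)"
proof -
  have "(\<Sum>k\<in>{k\<in>D. upper k \<and> Q k}. scal (int (len (uminus ` S) k)) (dir k)) =
     (\<Sum>k\<in>{k\<in>D. \<not> upper k \<and> Q (- k)}. - step k)"
  proof (rule sum.reindex_bij_witness[of _ uminus uminus])
    fix k assume "k \<in> {k\<in>D. upper k \<and> Q k}"
    then have k: "k \<in> D" "upper k" "Q k" "prim k" by (auto simp: D_def)
    then have "\<not> upper (- k)" using upper_uminus by blast
    then show "- k \<in> {k\<in>D. \<not> upper k \<and> Q (- k)}" using k by (auto simp: D_def)
    show "- step (- k) = scal (int (len (uminus ` S) k)) (dir k)" using len_uminus[of "- k"] k(4) by simp
  next
    fix k assume "k \<in> {k\<in>D. \<not> upper k \<and> Q (- k)}"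
    then show "- k \<in> {k\<in>D. upper k \<and> Q k}" using upper_uminus[of k] by (auto simp: D_def)
  qed auto
  then show ?thesis by (simp add: sum_negf)
qed

lemma closed: "(\<Sum>k\<in>D. step k) = 0"
proof -
  interpret m: point_set "uminus ` S" by (rule point_set_uminus) unfold_locales
  have p: "prim (1,0)" "prim (-1,0)" by (simp_all add: prim_def)
  have "- start S (1,0) = - start S (-1,0) - (\<Sum>k\<in>{k\<in>D. \<not> upper k}. step k)"
    using m.upper_chain_end sum_lower[of "\<lambda>_. True"] start_uminus[OF p(1)] start_uminus[OF p(2)]
    unfolding D_uminus by simp
  then have "(\<Sum>k\<in>{k\<in>D. \<not> upper k}. step k) = - (\<Sum>k\<in>{k\<in>D. upper k}. step k)"
    unfolding upper_chain_end by simp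
  then have "(\<Sum>k\<in>{k\<in>D. upper k}. step k) + (\<Sum>k\<in>{k\<in>D. \<not> upper k}. step k) = 0" by simp
  moreover have "(\<Sum>k\<in>D. step k) = (\<Sum>k\<in>{k\<in>D. upper k}. step k) + (\<Sum>k\<in>{k\<in>D. \<not> upper k}. step k)"
    using finite_D by (subst sum.union_disjoint[symmetric]) (auto intro: sum.cong)
  ultimately show ?thesis by simp
qed

lemma step_0: "k \<notin> supp (len S) \<Longrightarrow> step k = 0" by (simp add: supp_def)

text \<open>Turning the normal counterclockwise from \<open>(1,0)\<close>, the first vertex of the supporting edge stays
in place except at normals of edges, where it advances along the edge.\<close>
theorem start_eq_offset:
  assumes n: "prim n" shows "start S n = start S (1,0) + offset (len S) n"
proof -
  have off: "offset (len S) n = (\<Sum>k\<in>{k\<in>D. before k n}. step k)" unfolding offset_def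
    by (rule sum.mono_neutral_left) (use finite_D supp_len step_0 in auto)
  show ?thesis
  proof (cases "upper n")
    case True
    then show ?thesis unfolding off upper_chain[OF n True] before_def by simp
  next
    case False
    interpret m: point_set "uminus ` S" by (rule point_set_uminus) unfold_locales
    have p: "prim (-1,0)" by (simp add: prim_def)
    have "start (uminus ` S) (- n) = start (uminus ` S) (1,0) +
       (\<Sum>k\<in>{k\<in>m.D. upper k \<and> 0 < cross k (- n)}. scal (int (len (uminus ` S) k)) (dir k))"
      by (rule m.upper_chain) (use n False upper_uminus[OF n] in auto)
    then have neg: "- start S n = - start S (-1,0) - (\<Sum>k\<in>{k\<in>D. \<not> upper k \<and> 0 < cross k n}. step k)"
      using sum_lower[of "\<lambda>k. 0 < cross k (- n)"] start_uminus[OF n] start_uminus[OF p]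
      unfolding D_uminus by simp
    have "start S n = start S (-1,0) + (\<Sum>k\<in>{k\<in>D. \<not> upper k \<and> 0 < cross k n}. step k)"
      using arg_cong[OF neg, of uminus] by simp
    moreover have "{k\<in>D. before k n} = {k\<in>D. upper k} \<union> {k\<in>D. \<not> upper k \<and> 0 < cross k n}"
      using False by (auto simp: before_def)
    then have "(\<Sum>k\<in>{k\<in>D. before k n}. step k) = (\<Sum>k\<in>{k\<in>D. upper k}. step k) + (\<Sum>k\<in>{k\<in>D. \<not> upper k \<and> 0 < cross k n}. step k)"
      using finite_D by (simp only:) (rule sum.union_disjoint; auto)
    ultimately show ?thesis unfolding off upper_chain_end by (simp add: add.assoc)
  qed
qed

lemma len_weights: "len S \<in> weights"
proof -
  have "(\<Sum>k\<in>supp (len S). step k) = (\<Sum>k\<in>D. step k)"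
    by (rule sum.mono_neutral_left) (use finite_D supp_len step_0 in auto)
  then have z: "(\<Sum>k\<in>supp (len S). step k) = 0" using closed by simp
  have "dot v (\<Sum>k\<in>supp (len S). step k) = msum (len S) (\<lambda>k. cross v k)" for v
    by (simp add: dot_sum msum_def)
  then have c: "msum (len S) (\<lambda>k. cross v k) = 0" for v using z by simp
  have "msum (len S) fst = 0" using c[of "(0,-1)"] by (simp add: cross_def)
  moreover have "msum (len S) snd = 0" using c[of "(1,0)"] by (simp add: cross_def)
  moreover have "finite (supp (len S))" using finite_subset[OF supp_len finite_D] .
  moreover have "supp (len S) \<subseteq> Collect prim" by (auto simp: supp_def len_def split: if_splits)
  ultimately show ?thesis by (simp add: weights_def)
qed

end

section \<open>The polygon of a weight\<close>

text \<open>The vertices are the partial sums of the edges in angular order.\<close>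
definition pts :: "(vec \<Rightarrow> nat) \<Rightarrow> vec set" where
  "pts \<nu> = offset \<nu> ` Collect prim"

abbreviation "steps \<nu> w \<equiv> scal (int (\<nu> w)) (dir w)"

lemma sum_steps_zero:
  assumes "\<nu> \<in> weights" shows "(\<Sum>w\<in>supp \<nu>. steps \<nu> w) = 0"
proof -
  have "fst (\<Sum>w\<in>supp \<nu>. steps \<nu> w) = msum \<nu> snd" "snd (\<Sum>w\<in>supp \<nu>. steps \<nu> w) = - msum \<nu> fst"
    by (simp_all add: fst_sum snd_sum msum_def scal_def dir_def sum_negf)
  then show ?thesis using assms by (simp add: weights_def prod_eq_iff)
qed

lemma sum_steps_diff:
  assumes "finite (supp \<nu>)" "Q \<subseteq> supp \<nu>" "R \<subseteq> Q"
  shows "(\<Sum>w\<in>Q. steps \<nu> w) - (\<Sum>w\<in>R. steps \<nu> w) = (\<Sum>w\<in>Q - R. steps \<nu> w)"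
  using assms by (simp add: sum_diff finite_subset)

lemma offset_arc_upper:
  assumes \<nu>: "\<nu> \<in> weights" and n: "prim n" "upper n" and k: "prim k"
  shows "\<exists>\<Delta>\<subseteq>supp \<nu>. (offset \<nu> k - offset \<nu> n = (\<Sum>w\<in>\<Delta>. steps \<nu> w) \<and> (\<forall>w\<in>\<Delta>. w = n \<or> 0 < cross n w))
     \<or> (offset \<nu> k - offset \<nu> n = - (\<Sum>w\<in>\<Delta>. steps \<nu> w) \<and> (\<forall>w\<in>\<Delta>. cross n w < 0))"
proof -
  let ?B = "\<lambda>k. {w\<in>supp \<nu>. before w k}"
  have fin: "finite (supp \<nu>)" and pr: "\<And>w. w \<in> supp \<nu> \<Longrightarrow> prim w" using \<nu> by (auto simp: weights_def)
  have off: "offset \<nu> k = (\<Sum>w\<in>?B k. steps \<nu> w)" for k by (simp add: offset_def)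
  have trich: "w = n \<or> 0 < cross n w \<or> 0 < cross w n" if "prim w" "upper w" for w
  proof (cases "cross n w = 0")
    case True then show ?thesis using upper_total[OF n(1) that(1) n(2) that(2)] by simp
  next
    case False then show ?thesis using cross_anti[of n w] by linarith
  qed
  have low: "upper (- w)" if "prim w" "\<not> upper w" for w using upper_uminus[OF that(1)] that(2) by simp
  consider (1) "upper k" "k = n" | (2) "upper k" "0 < cross n k" | (3) "upper k" "0 < cross k n"
    | (4) "\<not> upper k" "- k = n \<or> 0 < cross (- k) n" | (5) "\<not> upper k" "0 < cross n (- k)"
    using trich[of k] trich[of "- k"] k low by (metis prim_uminus)
  then show ?thesis
  proof cases
    case 1 then show ?thesis by (intro exI[of _ "{}"]) auto
  next
    case 2
    have sub: "?B n \<subseteq> ?B k" using 2 n upper_trans[of _ n k] by (auto simp: before_def)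
    have "w = n \<or> 0 < cross n w" if "w \<in> ?B k - ?B n" for w
      using that trich[of w] pr 2 n by (auto simp: before_def)
    then show ?thesis using sum_steps_diff[OF fin _ sub] unfolding off by (intro exI[of _ "?B k - ?B n"]) auto
  next
    case 3
    have sub: "?B k \<subseteq> ?B n" using 3 n upper_trans[of _ k n] by (auto simp: before_def)
    have "cross n w < 0" if "w \<in> ?B n - ?B k" for w
      using that n cross_anti[of n w] by (auto simp: before_def)
    moreover have "offset \<nu> k - offset \<nu> n = - (\<Sum>w\<in>?B n - ?B k. steps \<nu> w)"
    proof -
      have "(\<Sum>w\<in>?B n. steps \<nu> w) - (\<Sum>w\<in>?B k. steps \<nu> w) = (\<Sum>w\<in>?B n - ?B k. steps \<nu> w)"
        by (rule sum_steps_diff[OF fin _ sub]) auto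
      then show ?thesis unfolding off by (subst minus_diff_eq[symmetric]) (rule arg_cong)
    qed
    ultimately show ?thesis by (intro exI[of _ "?B n - ?B k"]) auto
  next
    case 4
    have sub: "?B n \<subseteq> ?B k" using 4 n by (auto simp: before_def)
    have "w = n \<or> 0 < cross n w" if w: "w \<in> ?B k - ?B n" for w
    proof (cases "upper w")
      case True
      then show ?thesis using w trich[of w] pr n by (auto simp: before_def)
    next
      case False
      then have "0 < cross (- w) (- k)" using w 4 by (auto simp: before_def)
      then have "0 < cross (- w) n" using 4(2) upper_trans[of "- w" "- k" n] low[OF k 4(1)] low[of w] False pr[of w] w n by auto
      then show ?thesis using cross_anti[of n w] by simp
    qed
    then show ?thesis using sum_steps_diff[OF fin _ sub] unfolding off by (intro exI[of _ "?B k - ?B n"]) auto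
  next
    case 5
    let ?C = "(supp \<nu> - ?B k) \<union> ?B n"
    have neg: "cross n w < 0" if w: "w \<in> ?C" for w
    proof (cases "w \<in> ?B n")
      case True then show ?thesis using n cross_anti[of n w] by (auto simp: before_def)
    next
      case False
      then have w': "w \<in> supp \<nu>" "\<not> upper w" "\<not> 0 < cross w k" using w 5 by (auto simp: before_def)
      then have p: "prim w" "prim (- w)" "upper (- w)" using pr low by auto
      have "w = k \<or> 0 < cross (- k) (- w)"
        using upper_total[OF p(2) _ p(3) low[OF k 5(1)]] k w'(3) cross_anti[of w k] by fastforce
      then have "0 < cross n (- w)" using 5(2) upper_trans[OF n(2) low[OF k 5(1)] p(3)] by auto
      then show ?thesis by simp
    qed
    have disj: "(supp \<nu> - ?B k) \<inter> ?B n = {}" using 5 n by (auto simp: before_def)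
    have "(\<Sum>w\<in>supp \<nu> - ?B k. steps \<nu> w) = - offset \<nu> k"
      using sum_steps_diff[OF fin, of "supp \<nu>" "?B k"] sum_steps_zero[OF \<nu>] unfolding off by auto
    then have "(\<Sum>w\<in>?C. steps \<nu> w) = - offset \<nu> k + offset \<nu> n"
      using disj fin by (subst sum.union_disjoint) (auto simp: off)
    then have "offset \<nu> k - offset \<nu> n = - (\<Sum>w\<in>?C. steps \<nu> w)" by simp
    then show ?thesis using neg by (intro exI[of _ ?C]) blast
  qed
qed

lemma weights_uminus: "\<nu> \<in> weights \<Longrightarrow> \<nu> \<circ> uminus \<in> weights"
proof -
  have "(uminus :: vec \<Rightarrow> vec) = lin (-1) 0 0 (-1)" by (auto simp: lin_def fun_eq_iff)
  moreover have "lin (-1) 0 0 (-1) \<in> GL" by (rule GL_I) simp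
  ultimately show "\<nu> \<in> weights \<Longrightarrow> \<nu> \<circ> uminus \<in> weights" using weights_GL by metis
qed

lemma supp_uminus: "supp (\<nu> \<circ> uminus) = uminus ` supp \<nu>" for \<nu> :: "vec \<Rightarrow> nat"
proof -
  have "x \<in> uminus ` supp \<nu> \<longleftrightarrow> - x \<in> supp \<nu>" for x by (auto simp: image_iff) (metis minus_minus)
  then show ?thesis by (auto simp: supp_def)
qed

lemma sum_steps_uminus:
  "(\<Sum>w\<in>uminus ` Q. steps (\<nu> \<circ> uminus) w) = - (\<Sum>w\<in>Q. steps \<nu> w)"
  by (subst sum.reindex) (auto simp: sum_negf)

lemma offset_uminus:
  assumes \<nu>: "\<nu> \<in> weights" and n: "prim n"
  shows "offset (\<nu> \<circ> uminus) (- n) + offset \<nu> n = (\<Sum>w\<in>{w\<in>supp \<nu>. upper w}. steps \<nu> w)"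
proof -
  have fin: "finite (supp \<nu>)" and pr: "\<And>w. w \<in> supp \<nu> \<Longrightarrow> prim w" using \<nu> by (auto simp: weights_def)
  let ?B = "{w\<in>supp \<nu>. before (- w) (- n)}"
  have "{w\<in>supp (\<nu> \<circ> uminus). before w (- n)} = uminus ` ?B" unfolding supp_uminus by auto
  then have o: "offset (\<nu> \<circ> uminus) (- n) = - (\<Sum>w\<in>?B. steps \<nu> w)" by (simp only: offset_def sum_steps_uminus)
  have up: "upper (- w) \<longleftrightarrow> \<not> upper w" if "w \<in> supp \<nu>" for w using upper_uminus pr that by blast
  have all: "(\<Sum>w\<in>{w\<in>supp \<nu>. upper w}. steps \<nu> w) = - (\<Sum>w\<in>{w\<in>supp \<nu>. \<not> upper w}. steps \<nu> w)"
  proof -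
    have "{w\<in>supp \<nu>. \<not> upper w} = supp \<nu> - {w\<in>supp \<nu>. upper w}" by auto
    then have "(\<Sum>w\<in>{w\<in>supp \<nu>. \<not> upper w}. steps \<nu> w) = - (\<Sum>w\<in>{w\<in>supp \<nu>. upper w}. steps \<nu> w)"
      using sum_steps_diff[OF fin, of "supp \<nu>" "{w\<in>supp \<nu>. upper w}"] sum_steps_zero[OF \<nu>] by auto
    then show ?thesis by simp
  qed
  show ?thesis
  proof (cases "upper n")
    case True
    have "?B = {w\<in>supp \<nu>. \<not> upper w} \<union> {w\<in>supp \<nu>. before w n}"
      using up True upper_uminus[OF n] by (auto simp: before_def)
    moreover have "{w\<in>supp \<nu>. \<not> upper w} \<inter> {w\<in>supp \<nu>. before w n} = {}" using True by (auto simp: before_def)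
    ultimately have "(\<Sum>w\<in>?B. steps \<nu> w) = (\<Sum>w\<in>{w\<in>supp \<nu>. \<not> upper w}. steps \<nu> w) + offset \<nu> n"
      using fin by (simp add: sum.union_disjoint offset_def)
    then show ?thesis unfolding o all by simp
  next
    case False
    have "{w\<in>supp \<nu>. before w n} = {w\<in>supp \<nu>. upper w} \<union> ?B"
      using up False upper_uminus[OF n] by (auto simp: before_def)
    moreover have "{w\<in>supp \<nu>. upper w} \<inter> ?B = {}" using up False upper_uminus[OF n] by (auto simp: before_def)
    ultimately have "offset \<nu> n = (\<Sum>w\<in>{w\<in>supp \<nu>. upper w}. steps \<nu> w) + (\<Sum>w\<in>?B. steps \<nu> w)"
      using fin by (simp add: sum.union_disjoint offset_def)
    then show ?thesis unfolding o by simp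
  qed
qed

lemma offset_arc:
  assumes \<nu>: "\<nu> \<in> weights" and n: "prim n" and k: "prim k"
  shows "\<exists>\<Delta>\<subseteq>supp \<nu>. (offset \<nu> k - offset \<nu> n = (\<Sum>w\<in>\<Delta>. steps \<nu> w) \<and> (\<forall>w\<in>\<Delta>. w = n \<or> 0 < cross n w))
     \<or> (offset \<nu> k - offset \<nu> n = - (\<Sum>w\<in>\<Delta>. steps \<nu> w) \<and> (\<forall>w\<in>\<Delta>. cross n w < 0))"
proof (cases "upper n")
  case True then show ?thesis using offset_arc_upper[OF \<nu> n _ k] by blast
next
  case False
  define \<mu> where "\<mu> = \<nu> \<circ> uminus"
  have "\<exists>\<Delta>\<subseteq>supp \<mu>. (offset \<mu> (- k) - offset \<mu> (- n) = (\<Sum>w\<in>\<Delta>. steps \<mu> w) \<and> (\<forall>w\<in>\<Delta>. w = - n \<or> 0 < cross (- n) w))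
     \<or> (offset \<mu> (- k) - offset \<mu> (- n) = - (\<Sum>w\<in>\<Delta>. steps \<mu> w) \<and> (\<forall>w\<in>\<Delta>. cross (- n) w < 0))"
    by (rule offset_arc_upper) (use \<nu> n k False upper_uminus weights_uminus \<mu>_def in auto)
  then obtain \<Delta> where d: "\<Delta> \<subseteq> supp \<mu>" "(offset \<mu> (- k) - offset \<mu> (- n) = (\<Sum>w\<in>\<Delta>. steps \<mu> w) \<and> (\<forall>w\<in>\<Delta>. w = - n \<or> 0 < cross (- n) w))
     \<or> (offset \<mu> (- k) - offset \<mu> (- n) = - (\<Sum>w\<in>\<Delta>. steps \<mu> w) \<and> (\<forall>w\<in>\<Delta>. cross (- n) w < 0))" by blast
  define \<Gamma> where "\<Gamma> = uminus ` \<Delta>"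
  have \<Delta>: "\<Delta> = uminus ` \<Gamma>" by (simp add: \<Gamma>_def image_image)
  have e: "offset \<mu> (- k) - offset \<mu> (- n) = - (offset \<nu> k - offset \<nu> n)"
  proof -
    have "offset \<mu> (- k) + offset \<nu> k = offset \<mu> (- n) + offset \<nu> n"
      unfolding \<mu>_def offset_uminus[OF \<nu> n] offset_uminus[OF \<nu> k] ..
    then show ?thesis by (simp add: algebra_simps)
  qed
  have s: "(\<Sum>w\<in>\<Delta>. steps \<mu> w) = - (\<Sum>w\<in>\<Gamma>. steps \<nu> w)" unfolding \<Delta> \<mu>_def by (rule sum_steps_uminus)
  have "\<Gamma> \<subseteq> supp \<nu>" using d(1) unfolding \<Gamma>_def \<mu>_def supp_uminus by auto
  moreover have "(offset \<nu> k - offset \<nu> n = (\<Sum>w\<in>\<Gamma>. steps \<nu> w) \<and> (\<forall>w\<in>\<Gamma>. w = n \<or> 0 < cross n w))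
     \<or> (offset \<nu> k - offset \<nu> n = - (\<Sum>w\<in>\<Gamma>. steps \<nu> w) \<and> (\<forall>w\<in>\<Gamma>. cross n w < 0))"
  proof -
    have m: "(- x = y) = (x = - y)" for x y :: vec by auto
    show ?thesis using d(2) unfolding e s unfolding \<Delta>
      by (simp only: neg_equal_iff_equal ball_simps cross_minus minus_minus m)
  qed
  ultimately show ?thesis by blast
qed

lemma offset_cases:
  assumes \<nu>: "\<nu> \<in> weights" and n: "prim n" and k: "prim k"
  shows "dot n (offset \<nu> n) < dot n (offset \<nu> k) \<or> offset \<nu> k = offset \<nu> n \<or> offset \<nu> k = offset \<nu> n + steps \<nu> n"
proof -
  have fin: "finite (supp \<nu>)" using \<nu> by (auto simp: weights_def)
  obtain \<Delta> where d: "\<Delta> \<subseteq> supp \<nu>" "(offset \<nu> k - offset \<nu> n = (\<Sum>w\<in>\<Delta>. steps \<nu> w) \<and> (\<forall>w\<in>\<Delta>. w = n \<or> 0 < cross n w))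
     \<or> (offset \<nu> k - offset \<nu> n = - (\<Sum>w\<in>\<Delta>. steps \<nu> w) \<and> (\<forall>w\<in>\<Delta>. cross n w < 0))"
    using offset_arc[OF assms] by blast
  have f: "finite \<Delta>" using d(1) fin finite_subset by blast
  have pos: "0 < int (\<nu> w)" if "w \<in> \<Delta>" for w using d(1) that by (auto simp: supp_def)
  have ds: "dot n (\<Sum>w\<in>\<Delta>. steps \<nu> w) = (\<Sum>w\<in>\<Delta>. int (\<nu> w) * cross n w)" by (simp add: dot_sum)
  from d(2) show ?thesis
  proof
    assume h: "offset \<nu> k - offset \<nu> n = (\<Sum>w\<in>\<Delta>. steps \<nu> w) \<and> (\<forall>w\<in>\<Delta>. w = n \<or> 0 < cross n w)"
    show ?thesis
    proof (cases "\<Delta> \<subseteq> {n}")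
      case True
      then have "\<Delta> = {} \<or> \<Delta> = {n}" by blast
      then have "offset \<nu> k - offset \<nu> n = 0 \<or> offset \<nu> k - offset \<nu> n = steps \<nu> n" using h by auto
      then show ?thesis by (auto simp: algebra_simps)
    next
      case False
      then obtain w where w: "w \<in> \<Delta>" "w \<noteq> n" by blast
      have "0 < (\<Sum>w\<in>\<Delta>. int (\<nu> w) * cross n w)"
      proof (rule sum_pos2[OF f w(1)])
        have "0 < cross n w" using h w by blast
        then show "0 < int (\<nu> w) * cross n w" using mult_pos_pos[OF pos[OF w(1)]] by blast
        fix v assume "v \<in> \<Delta>"
        then have "v = n \<or> 0 < cross n v" using h by blast
        then have "0 \<le> cross n v" by auto
        then show "0 \<le> int (\<nu> v) * cross n v" by simp
      qed
      then have "0 < dot n (offset \<nu> k - offset \<nu> n)" using h ds by simp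
      then show ?thesis by simp
    qed
  next
    assume h: "offset \<nu> k - offset \<nu> n = - (\<Sum>w\<in>\<Delta>. steps \<nu> w) \<and> (\<forall>w\<in>\<Delta>. cross n w < 0)"
    show ?thesis
    proof (cases "\<Delta> = {}")
      case True then show ?thesis using h by simp
    next
      case False
      then have "(\<Sum>w\<in>\<Delta>. int (\<nu> w) * cross n w) < 0"
      proof -
        have "int (\<nu> w) * cross n w < 0" if "w \<in> \<Delta>" for w
          using mult_pos_neg[OF pos[OF that]] h that by blast
        then show ?thesis using sum_strict_mono[OF f False, of "\<lambda>w. int (\<nu> w) * cross n w" "\<lambda>_. 0"] by simp
      qed
      then have "0 < dot n (offset \<nu> k - offset \<nu> n)" using h ds by simp
      then show ?thesis by simp
    qed
  qed
qed

text \<open>A normal slightly beyond \<open>n\<close> is preceded by \<open>n\<close> and by the predecessors of \<open>n\<close> only.\<close>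
lemma offset_next:
  assumes \<nu>: "\<nu> \<in> weights" and n: "prim n"
  obtains k where "prim k" "offset \<nu> k = offset \<nu> n + steps \<nu> n"
proof -
  have fin: "finite (supp \<nu>)" and pr: "\<And>w. w \<in> supp \<nu> \<Longrightarrow> prim w" using \<nu> by (auto simp: weights_def)
  obtain m where m: "cross n m = 1" using n prim_iff_cross by blast
  define N where "N = 1 + \<bar>snd m\<bar> + (\<Sum>w\<in>supp \<nu>. \<bar>cross w m\<bar>)"
  have N: "\<bar>cross w m\<bar> < N" if "w \<in> supp \<nu>" for w
    using member_le_sum[OF that, of "\<lambda>w. \<bar>cross w m\<bar>"] fin unfolding N_def by auto
  have N': "\<bar>snd m\<bar> < N" unfolding N_def by (simp add: sum_nonneg add_pos_nonneg)
  define k where "k = scal N n + m"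
  have ck: "cross w k = N * cross w n + cross w m" for w by (simp add: k_def cross_def scal_def algebra_simps)
  have "\<bar>cross k n\<bar> = 1" using ck[of n] m cross_anti[of k n] by simp
  then have pk: "prim k" using prim_iff_abs_cross by blast
  have big: "0 < N * x + y \<longleftrightarrow> 0 < x" if "x \<noteq> 0" "\<bar>y\<bar> < N" for x y
  proof (cases "0 < x")
    case True
    then have "N * 1 \<le> N * x" using that(2) by (intro mult_left_mono) auto
    then show ?thesis using True that(2) by linarith
  next
    case False
    then have "N * x \<le> N * (-1)" using that by (intro mult_left_mono) auto
    then show ?thesis using False that(2) by linarith
  qed
  have up: "upper k \<longleftrightarrow> upper n"
  proof (cases "snd n = 0")
    case True
    then have "snd k = snd m" "fst n * snd m = 1" using m by (auto simp: k_def scal_def cross_def)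
    then show ?thesis using True by (auto simp: upper_def zmult_eq_1_iff)
  next
    case False
    have "snd k \<noteq> 0"
    proof
      assume "snd k = 0"
      then have e: "N * snd n = - snd m" by (simp add: k_def scal_def)
      have "N * 1 \<le> N * \<bar>snd n\<bar>" using False N' by (intro mult_left_mono) auto
      then show False using e N' by (simp add: abs_mult[symmetric] abs_if split: if_splits)
    qed
    then show ?thesis using False big[OF False N'] by (auto simp: upper_def k_def scal_def)
  qed
  have bf: "before w k \<longleftrightarrow> before w n \<or> w = n" if w: "w \<in> supp \<nu>" for w
  proof (cases "cross w n = 0")
    case True
    then have "n = w \<or> n = - w" using prim_parallel[OF pr[OF w] n] by blast
    then show ?thesis
    proof
      assume "n = w" then show ?thesis using up ck[of n] m by (simp add: before_def)
    next
      assume nw: "n = - w"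
      then have "cross w k = - 1" using ck[of w] m by simp
      then show ?thesis using nw up upper_uminus[OF pr[OF w]] True prim_nz[OF n]
        by (auto simp: before_def)
    qed
  next
    case False
    then show ?thesis using big[OF False N[OF w]] ck[of w] up by (auto simp: before_def)
  qed
  have "offset \<nu> k = offset \<nu> n + steps \<nu> n"
  proof (cases "n \<in> supp \<nu>")
    case True
    then have "{w\<in>supp \<nu>. before w k} = insert n {w\<in>supp \<nu>. before w n}" using bf by auto
    moreover have "n \<notin> {w\<in>supp \<nu>. before w n}" by (simp add: before_def)
    ultimately show ?thesis using fin unfolding offset_def by (simp add: add.commute)
  next
    case False
    then have "{w\<in>supp \<nu>. before w k} = {w\<in>supp \<nu>. before w n}" using bf by auto
    then show ?thesis using False by (simp add: offset_def supp_def)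
  qed
  then show thesis using that pk by blast
qed

lemma point_set_pts:
  assumes "\<nu> \<in> weights" shows "point_set (pts \<nu>)"
proof
  have "offset \<nu> n \<in> (\<lambda>Q. \<Sum>w\<in>Q. steps \<nu> w) ` Pow (supp \<nu>)" for n unfolding offset_def by blast
  then have "pts \<nu> \<subseteq> (\<lambda>Q. \<Sum>w\<in>Q. steps \<nu> w) ` Pow (supp \<nu>)" by (auto simp: pts_def)
  moreover have "finite (supp \<nu>)" using assms by (simp add: weights_def)
  ultimately show "finite (pts \<nu>)" by (meson finite_Pow_iff finite_imageI finite_subset)
  have "prim (1,0)" by (simp add: prim_def)
  then show "pts \<nu> \<noteq> {}" unfolding pts_def by blast
qed

text \<open>This is Minkowski's theorem in the plane: closed edge data are realised by a polygon. The difference of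
two partial sums is a sum over an arc of edges, and one of the two complementary arcs makes a positive angle
with \<open>n\<close> throughout.\<close>
theorem edge_pts:
  assumes \<nu>: "\<nu> \<in> weights" and n: "prim n" shows "edge (pts \<nu>) n (offset \<nu> n) (\<nu> n)"
  unfolding edge_def
proof (intro conjI ballI)
  show "offset \<nu> n \<in> pts \<nu>" using n by (simp add: pts_def)
  obtain k where "prim k" "offset \<nu> k = offset \<nu> n + steps \<nu> n" by (rule offset_next[OF assms])
  then show "offset \<nu> n + steps \<nu> n \<in> pts \<nu>" unfolding pts_def by (metis imageI mem_Collect_eq)
  fix t assume "t \<in> pts \<nu>"
  then obtain k where k: "prim k" "t = offset \<nu> k" by (auto simp: pts_def)
  from offset_cases[OF assms k(1)]
  show "dot n (offset \<nu> n) < dot n t \<or> (\<exists>j\<ge>0. j \<le> int (\<nu> n) \<and> t = offset \<nu> n + scal j (dir n))"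
    unfolding k(2)[symmetric]
  proof (elim disjE)
    assume "t = offset \<nu> n" then show ?thesis by (intro disjI2 exI[of _ 0]) simp
  next
    assume "t = offset \<nu> n + steps \<nu> n" then show ?thesis by (intro disjI2 exI[of _ "int (\<nu> n)"]) simp
  qed simp
qed

lemma start_pts: "\<nu> \<in> weights \<Longrightarrow> prim n \<Longrightarrow> start (pts \<nu>) n = offset \<nu> n"
  and len_pts: "\<nu> \<in> weights \<Longrightarrow> len (pts \<nu>) = \<nu>"
proof -
  assume \<nu>: "\<nu> \<in> weights"
  interpret point_set "pts \<nu>" by (rule point_set_pts[OF \<nu>])
  have *: "offset \<nu> n = start (pts \<nu>) n \<and> \<nu> n = len (pts \<nu>) n" if "prim n" for n
    using edge_pts[OF \<nu> that] edge_iff[OF fin ne that] by blast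
  then show "prim n \<Longrightarrow> start (pts \<nu>) n = offset \<nu> n" by simp
  show "len (pts \<nu>) = \<nu>"
  proof
    fix n show "len (pts \<nu>) n = \<nu> n"
    proof (cases "prim n")
      case False
      then have "\<nu> n = 0" using \<nu> by (auto simp: weights_def supp_def)
      then show ?thesis using False by (simp add: len_def)
    qed (use * in simp)
  qed
qed

section \<open>Widths, translations and extreme points\<close>

lemma edge_translate: "edge ((+) u ` S) n (u + s) k \<longleftrightarrow> edge S n s k"
proof -
  have i: "u + v \<in> (+) u ` S \<longleftrightarrow> v \<in> S" for v by auto
  show ?thesis unfolding edge_def add.assoc i by (simp add: add.assoc)
qed

lemma edge_image:
  assumes det: "\<bar>a * d - b * c\<bar> = 1" and e: "edge S (lin a c b d n) s k"
  obtains s' where "edge (lin a b c d ` S) n s' k"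
proof -
  let ?g = "lin a b c d" and ?n = "lin a c b d n"
  have G: "?g \<in> GL" using det by (rule GL_I)
  have dt: "dot n (?g t) = dot ?n t" for t by (simp add: dot_def lin_def algebra_simps)
  have di: "?g (dir ?n) = scal (a * d - b * c) (dir n)" by (simp add: dir_def lin_def scal_def algebra_simps)
  have sc: "?g (scal j v) = scal j (?g v)" for j v by (simp add: lin_def scal_def algebra_simps)
  have adv: "?g (s + scal j (dir ?n)) = ?g s + scal ((a * d - b * c) * j) (dir n)" for j
    unfolding GL_add[OF G] sc di by (simp add: scal_def mult.commute mult.left_commute)
  from det consider "a * d - b * c = 1" | "a * d - b * c = -1" by linarith
  then show thesis
  proof cases
    case 1
    have "edge (?g ` S) n (?g s) k" unfolding edge_def
    proof (intro conjI ballI)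
      show "?g s \<in> ?g ` S" using e by (simp add: edge_def)
      show "?g s + scal (int k) (dir n) \<in> ?g ` S" using e adv[of "int k"] 1 unfolding edge_def by (metis imageI mult_1)
      fix t assume "t \<in> ?g ` S"
      then obtain v where v: "v \<in> S" "t = ?g v" by blast
      show "dot n (?g s) < dot n t \<or> (\<exists>j\<ge>0. j \<le> int k \<and> t = ?g s + scal j (dir n))"
        unfolding v(2) dt using e v(1) adv 1 unfolding edge_def by (metis mult_1)
    qed
    then show thesis by (rule that)
  next
    case 2
    let ?s = "?g (s + scal (int k) (dir ?n))"
    have s: "?s = ?g s + scal (- int k) (dir n)" unfolding adv 2 by simp
    have "edge (?g ` S) n ?s k" unfolding edge_def
    proof (intro conjI ballI)
      show "?s \<in> ?g ` S" using e by (simp add: edge_def)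
      have "?s + scal (int k) (dir n) = ?g s" unfolding s by (simp add: scal_def prod_eq_iff)
      then show "?s + scal (int k) (dir n) \<in> ?g ` S" using e by (simp add: edge_def)
      fix t assume "t \<in> ?g ` S"
      then obtain v where v: "v \<in> S" "t = ?g v" by blast
      have ds: "dot n ?s = dot ?n s" unfolding dt by simp
      from e v(1) have "dot ?n s < dot ?n v \<or> (\<exists>j\<ge>0. j \<le> int k \<and> v = s + scal j (dir ?n))" by (simp add: edge_def)
      then show "dot n ?s < dot n t \<or> (\<exists>j\<ge>0. j \<le> int k \<and> t = ?s + scal j (dir n))"
      proof
        assume "dot ?n s < dot ?n v" then show ?thesis by (simp add: v(2) dt)
      next
        assume "\<exists>j\<ge>0. j \<le> int k \<and> v = s + scal j (dir ?n)"
        then obtain j where j: "0 \<le> j" "j \<le> int k" "v = s + scal j (dir ?n)" by blast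
        have "t = ?s + scal (int k - j) (dir n)" unfolding v(2) j(3) s unfolding adv 2
          by (simp add: scal_def prod_eq_iff algebra_simps)
        then show ?thesis using j by (intro disjI2 exI[of _ "int k - j"]) auto
      qed
    qed
    then show thesis by (rule that)
  qed
qed

context point_set
begin

lemma len_translate: "len ((+) u ` S) = len S"
proof
  interpret t: point_set "(+) u ` S" using fin ne by (simp add: point_set_def)
  fix n show "len ((+) u ` S) n = len S n"
  proof (cases "prim n")
    case True
    have "edge ((+) u ` S) n (u + start S n) (len S n)" using edge_S[OF True] by (simp add: edge_translate)
    then show ?thesis using edge_iff[OF t.fin t.ne True] by metis
  qed (simp add: len_def)
qed

lemma len_image:
  assumes det: "\<bar>a * d - b * c\<bar> = 1" shows "len (lin a b c d ` S) = len S \<circ> lin a c b d"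
proof
  interpret t: point_set "lin a b c d ` S" using fin ne by (simp add: point_set_def)
  have "\<bar>a * d - c * b\<bar> = 1" using det by (simp add: mult.commute)
  then have G: "lin a c b d \<in> GL" by (rule GL_I)
  fix n show "len (lin a b c d ` S) n = (len S \<circ> lin a c b d) n"
  proof (cases "prim n")
    case True
    then have "prim (lin a c b d n)" using prim_GL[OF G] by blast
    then obtain s' where "edge (lin a b c d ` S) n s' (len S (lin a c b d n))"
      using edge_image[OF det edge_S] by blast
    then show ?thesis using edge_iff[OF t.fin t.ne True] by (metis comp_apply)
  next
    case False
    then show ?thesis using prim_GL[OF G, of n] by (simp add: len_def)
  qed
qed

lemma msum_len_D: "msum (len S) F = (\<Sum>k\<in>D. int (len S k) * F k)"
  unfolding msum_def by (rule sum.mono_neutral_left) (use finite_D supp_len in \<open>auto simp: supp_def\<close>)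

lemma width_fst:
  shows "s \<in> S \<Longrightarrow> fst (start S (1,0)) \<le> fst s" "s \<in> S \<Longrightarrow> fst s \<le> fst (start S (-1,0))"
    "width2 (len S) (1,0) = 2 * (fst (start S (-1,0)) - fst (start S (1,0)))"
proof -
  have p: "prim (1,0)" "prim (-1,0)" by (simp_all add: prim_def)
  show "s \<in> S \<Longrightarrow> fst (start S (1,0)) \<le> fst s" using edge_dot[OF edge_S[OF p(1)], of s] by (simp add: dot_def)
  show "s \<in> S \<Longrightarrow> fst s \<le> fst (start S (-1,0))" using edge_dot[OF edge_S[OF p(2)], of s] by (simp add: dot_def)
  have split: "(\<Sum>k\<in>D. f k) = (\<Sum>k\<in>{k\<in>D. upper k}. f k) + (\<Sum>k\<in>{k\<in>D. \<not> upper k}. f k)" for f :: "vec \<Rightarrow> int"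
    using finite_D by (subst sum.union_disjoint[symmetric]) (auto intro: sum.cong)
  define u where "u = (\<Sum>k\<in>{k\<in>D. upper k}. int (len S k) * snd k)"
  have a: "(\<Sum>k\<in>{k\<in>D. upper k}. int (len S k) * \<bar>snd k\<bar>) = u"
    unfolding u_def by (rule sum.cong) (auto simp: upper_def)
  have b: "(\<Sum>k\<in>{k\<in>D. \<not> upper k}. int (len S k) * \<bar>snd k\<bar>) = - (\<Sum>k\<in>{k\<in>D. \<not> upper k}. int (len S k) * snd k)"
    unfolding sum_negf[symmetric] by (rule sum.cong) (auto simp: upper_def)
  have "msum (len S) snd = 0" using len_weights by (simp add: weights_def)
  then have "u + (\<Sum>k\<in>{k\<in>D. \<not> upper k}. int (len S k) * snd k) = 0"
    unfolding msum_len_D split u_def .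
  then have w: "width2 (len S) (1,0) = 2 * u"
    unfolding width2_def msum_len_D split by (simp add: cross_def a b)
  have "fst (start S (-1,0)) - fst (start S (1,0)) = u"
    unfolding upper_chain_end by (simp add: fst_sum u_def scal_def dir_def)
  then show "width2 (len S) (1,0) = 2 * (fst (start S (-1,0)) - fst (start S (1,0)))" using w by simp
qed

lemma width_snd:
  obtains l r where "l \<in> S" "r \<in> S" "\<And>s. s \<in> S \<Longrightarrow> snd l \<le> snd s \<and> snd s \<le> snd r" "width2 (len S) (0,1) = 2 * (snd r - snd l)"
proof -
  let ?g = "lin 0 1 1 0"
  interpret t: point_set "?g ` S" using fin ne by (simp add: point_set_def)
  have G: "?g \<in> GL" by (rule GL_I) simp
  have gg: "?g (?g v) = v" for v by (simp add: lin_def)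
  have fs: "fst (?g v) = snd v" for v by (simp add: lin_def)
  have p: "prim (1,0)" "prim (-1,0)" by (simp_all add: prim_def)
  obtain l where l: "l \<in> S" "start (?g ` S) (1,0) = ?g l" using t.edge_S[OF p(1)] unfolding edge_def by blast
  obtain r where r: "r \<in> S" "start (?g ` S) (-1,0) = ?g r" using t.edge_S[OF p(2)] unfolding edge_def by blast
  have "width2 (len (?g ` S)) (1,0) = width2 (len S) (?g (1,0))"
    by (subst len_image) (simp_all add: width2_comp[OF G])
  then have "width2 (len S) (0,1) = 2 * (snd r - snd l)"
    using t.width_fst(3) unfolding l(2) r(2) fs by (simp add: lin_def)
  moreover have "snd l \<le> snd s \<and> snd s \<le> snd r" if "s \<in> S" for s
    using t.width_fst(1,2)[of "?g s"] that unfolding l(2) r(2) fs by auto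
  ultimately show thesis using that l r by blast
qed

lemma pts_translate:
  assumes "\<And>s. s \<in> S \<Longrightarrow> \<exists>n. prim n \<and> s = start S n"
  shows "S = (+) (start S (1,0)) ` pts (len S)"
proof (intro equalityI subsetI)
  fix s assume "s \<in> S"
  then obtain n where "prim n" "s = start S n" using assms by blast
  then show "s \<in> (+) (start S (1,0)) ` pts (len S)" using start_eq_offset unfolding pts_def by blast
next
  fix s assume "s \<in> (+) (start S (1,0)) ` pts (len S)"
  then obtain n where n: "prim n" "s = start S (1,0) + offset (len S) n" by (auto simp: pts_def)
  then have "s = start S n" using start_eq_offset by simp
  then show "s \<in> S" using edge_S[OF n(1)] by (simp add: edge_def)
qed

lemma card_supp_len:
  assumes "\<And>s. s \<in> S \<Longrightarrow> \<exists>n\<in>supp (len S). s = start S n"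
  shows "card S = card (supp (len S))"
proof -
  have pr: "prim n" "0 < len S n" if "n \<in> supp (len S)" for n using that by (auto simp: supp_def len_def split: if_splits)
  have "inj_on (start S) (supp (len S))"
  proof (rule inj_onI)
    fix n k assume n: "n \<in> supp (len S)" and k: "k \<in> supp (len S)" and eq: "start S n = start S k"
    have *: "0 \<le> cross k n" if "n \<in> supp (len S)" "k \<in> supp (len S)" "start S n = start S k" for n k
    proof -
      have "start S n + scal (int (len S n)) (dir n) \<in> S" using edge_S[OF pr(1)[OF that(1)]] by (simp add: edge_def)
      then have "dot k (start S k) \<le> dot k (start S n + scal (int (len S n)) (dir n))"
        using edge_dot[OF edge_S[OF pr(1)[OF that(2)]]] by blast
      then show ?thesis using that(3) pr(2)[OF that(1)] by (simp add: zero_le_mult_iff)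
    qed
    have "cross n k = 0" using *[OF n k eq] *[OF k n eq[symmetric]] cross_anti[of k n] by linarith
    then consider "k = n" | "k = - n" using prim_parallel[OF pr(1)[OF n] pr(1)[OF k]] by blast
    then show "n = k"
    proof cases
      case 2
      let ?t = "start S n + scal (int (len S k)) (dir k)"
      have "?t \<in> S" using edge_S[OF pr(1)[OF k]] eq by (simp add: edge_def)
      moreover have "dot n ?t = dot n (start S n)" using 2 by simp
      ultimately obtain j where j: "0 \<le> j" "?t = start S n + scal j (dir n)"
        using edge_S[OF pr(1)[OF n]] unfolding edge_def by (metis less_irrefl)
      then have "scal (- int (len S k)) (dir n) = scal j (dir n)" using 2 by simp
      then have "- int (len S k) = j" using scal_dir_inject[OF pr(1)[OF n]] by blast
      then show ?thesis using j(1) pr(2)[OF k] by simp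
    qed simp
  qed
  moreover have "start S ` supp (len S) = S"
    using assms edge_S pr(1) by (auto simp: edge_def image_iff)
  ultimately show ?thesis using card_image by fastforce
qed

end

text \<open>No point of \<open>F\<close> is a nonnegative combination of the origin: the points of \<open>F\<close> lie in a
  pointed cone, and a clockwise extreme one exists.\<close>
lemma clockwise_extreme:
  fixes F :: "vec set"
  assumes "finite F" "F \<noteq> {}"
    and pointed: "\<And>x y z \<alpha> \<beta> \<gamma>. x \<in> F \<Longrightarrow> y \<in> F \<Longrightarrow> z \<in> F \<Longrightarrow> 0 < \<alpha> \<Longrightarrow> 0 \<le> \<beta> \<Longrightarrow> 0 \<le> \<gamma> \<Longrightarrow>
      scal \<alpha> x + scal \<beta> y + scal \<gamma> z \<noteq> 0"
  shows "\<exists>m\<in>F. \<forall>k\<in>F. 0 < cross m k \<or> (cross m k = 0 \<and> 0 < dot m k)"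
  using assms
proof (induction F rule: finite_ne_induct)
  case (singleton x)
  have "x \<noteq> 0" using singleton(1)[of x x x 1 0 0] by (auto simp: scal_def zero_prod_def)
  then have "0 < dot x x" by (cases x) (auto simp: dot_def zero_prod_def sum_squares_gt_zero_iff power2_eq_square[symmetric] add_pos_nonneg add_nonneg_pos)
  then show ?case by simp
next
  case (insert x F)
  let ?r = "\<lambda>m k. 0 < cross m k \<or> (cross m k = 0 \<and> 0 < dot m k)"
  have par: "0 < dot a b" if "a \<in> insert x F" "b \<in> insert x F" "cross a b = 0" for a b
  proof (rule ccontr)
    assume n: "\<not> 0 < dot a b"
    have "b \<noteq> 0" using insert.prems[of b b b 1 0 0] that by (auto simp: scal_def zero_prod_def)
    then have "0 < dot b b" by (cases b) (auto simp: dot_def zero_prod_def power2_eq_square[symmetric] add_pos_nonneg add_nonneg_pos)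
    moreover have "scal (dot b b) a + scal (- dot a b) b + scal 0 b = 0"
      using that(3) by (simp add: scal_def dot_def cross_def zero_prod_def prod_eq_iff algebra_simps)
    ultimately show False using insert.prems[OF that(1,2,2), of "dot b b" "- dot a b" 0] n by simp
  qed
  have "\<exists>m\<in>F. \<forall>k\<in>F. ?r m k" by (rule insert.IH) (use insert.prems in blast)
  then obtain m where m: "m \<in> F" "\<forall>k\<in>F. ?r m k" by blast
  show ?case
  proof (cases "?r m x")
    case True then show ?thesis using m by blast
  next
    case False
    then have "cross m x < 0" using par[of m x] m(1) by auto
    then have xm: "0 < cross x m" using cross_anti[of m x] by linarith
    have "?r x k" if k: "k \<in> F" for k
    proof (cases "cross x k = 0")
      case True then show ?thesis using par[of x k] k by blast
    next
      case False
      have "\<not> cross x k < 0"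
      proof
        assume c: "cross x k < 0"
        have "scal (cross k x) m + scal (cross m k) x + scal (cross x m) k = 0"
          by (simp add: scal_def cross_def zero_prod_def algebra_simps)
        moreover have "0 \<le> cross m k" using m(2) k by auto
        moreover have "0 < cross k x" using c cross_anti[of x k] by linarith
        ultimately show False using insert.prems[of m x k "cross k x" "cross m k" "cross x m"] m(1) k xm by simp
      qed
      then show ?thesis using False by linarith
    qed
    moreover have "?r x x" using par[of x x] by simp
    ultimately show ?thesis by blast
  qed
qed

lemma (in point_set) extreme_is_start:
  assumes p: "p \<in> S" "S \<noteq> {p}"
    and pointed: "\<And>x y z \<alpha> \<beta> \<gamma>. x \<in> S - {p} \<Longrightarrow> y \<in> S - {p} \<Longrightarrow> z \<in> S - {p} \<Longrightarrow> 0 < \<alpha> \<Longrightarrow> 0 \<le> \<beta> \<Longrightarrow> 0 \<le> \<gamma> \<Longrightarrow>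
      scal \<alpha> (x - p) + scal \<beta> (y - p) + scal \<gamma> (z - p) \<noteq> 0"
  shows "\<exists>k\<in>supp (len S). p = start S k"
proof -
  let ?F = "(\<lambda>s. s - p) ` (S - {p})"
  have "\<exists>m\<in>?F. \<forall>k\<in>?F. 0 < cross m k \<or> (cross m k = 0 \<and> 0 < dot m k)"
    by (rule clockwise_extreme) (use fin p pointed in auto)
  then obtain t0 where t0: "t0 \<in> S" "t0 \<noteq> p"
    "\<And>t. t \<in> S \<Longrightarrow> t \<noteq> p \<Longrightarrow> 0 < cross (t0 - p) (t - p) \<or> (cross (t0 - p) (t - p) = 0 \<and> 0 < dot (t0 - p) (t - p))" by auto
  obtain l k where k: "prim k" "0 < l" "t0 - p = scal l (dir k)"
    using vec_prim_multiple[of "t0 - p"] t0(2) by (metis right_minus_eq)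
  have c: "cross (t0 - p) v = l * dot k v" for v unfolding k(3) by (simp add: cross_def scal_def dir_def dot_def algebra_simps)
  note e = edge_S[OF k(1)]
  have ge: "dot k p \<le> dot k t" if "t \<in> S" for t
    using t0(3)[OF that] k(2) unfolding c by (cases "t = p") (auto simp: zero_less_mult_iff)
  have "start S k \<in> S" using e by (simp add: edge_def)
  then have eq: "dot k p = dot k (start S k)" using ge[of "start S k"] edge_dot[OF e p(1)] by simp
  then obtain j where j: "0 \<le> j" "p = start S k + scal j (dir k)" using e p(1) unfolding edge_def by (metis less_irrefl)
  have st: "start S k = p"
  proof (rule ccontr)
    assume n: "start S k \<noteq> p"
    have "dot k (start S k - p) = 0" using eq by simp
    then have "0 < dot (t0 - p) (start S k - p)" using t0(3)[OF \<open>start S k \<in> S\<close> n] unfolding c by simp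
    moreover have "start S k - p = scal (- j) (dir k)" using j(2) by (simp add: scal_def prod_eq_iff)
    ultimately have "0 < l * (- j) * dot (dir k) (dir k)" unfolding k(3) by (simp add: dot_def scal_def algebra_simps)
    moreover have "0 \<le> l * j * dot (dir k) (dir k)" using j(1) k(2) by (intro mult_nonneg_nonneg) (auto simp: dot_def)
    ultimately show False by simp
  qed
  have "dot k t0 = dot k p" using arg_cong[OF k(3), of "dot k"] by simp
  then obtain j where j: "j \<le> int (len S k)" "t0 = p + scal j (dir k)"
    using e t0(1) st unfolding edge_def by (metis less_irrefl)
  then have "scal l (dir k) = scal j (dir k)" using k(3) by (metis add_diff_cancel_left')
  then have "l = j" using scal_dir_inject[OF k(1)] by blast
  then have "k \<in> supp (len S)" using j(1) k(2) by (auto simp: supp_def)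
  then show ?thesis using st by blast
qed

section \<open>Polygons over the rationals\<close>

definition emb :: "vec \<Rightarrow> rat ^ 2" where
  "emb p = (\<chi> i. if i = 1 then of_int (fst p) else of_int (snd p))"

definition rdot :: "vec \<Rightarrow> rat ^ 2 \<Rightarrow> rat" where
  "rdot n x = of_int (fst n) * x $ 1 + of_int (snd n) * x $ 2"

lemma emb_nth [simp]: "emb p $ 1 = of_int (fst p)" "emb p $ 2 = of_int (snd p)"
  by (simp_all add: emb_def)

lemma rat2_eq: "x = y \<longleftrightarrow> x $ 1 = y $ 1 \<and> x $ 2 = (y :: rat ^ 2) $ 2"
  by (simp add: vec_eq_iff forall_2)

lemma emb_inject [simp]: "emb p = emb q \<longleftrightarrow> p = q"
  by (simp add: rat2_eq prod_eq_iff)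

lemma inj_emb: "inj emb" by (rule injI) simp

lemma emb_lattice: "x \<in> int_lattice \<longleftrightarrow> (\<exists>p. x = emb p)"
proof
  assume "x \<in> int_lattice"
  then have "x $ 1 \<in> \<int>" "x $ 2 \<in> \<int>" by (simp_all add: int_lattice_def)
  then obtain a b where "x $ 1 = of_int a" "x $ 2 = of_int b" by (auto elim!: Ints_cases)
  then have "x = emb (a, b)" by (simp add: rat2_eq)
  then show "\<exists>p. x = emb p" ..
qed (auto simp: int_lattice_def forall_2)

lemma rdot_emb: "rdot n (emb p) = of_int (dot n p)"
  by (simp add: rdot_def dot_def)

lemma rdot_combination: "rdot n (u *s x + v *s y) = u * rdot n x + v * rdot n y"
  by (simp add: rdot_def algebra_simps)

lemma rat_convex_hull: "rat_convex (rat_convex hull V)"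
  by (rule hull_in) (auto simp: rat_convex_def)

lemma rat_convexI:
  "(\<And>x y u v. x \<in> C \<Longrightarrow> y \<in> C \<Longrightarrow> 0 \<le> u \<Longrightarrow> 0 \<le> v \<Longrightarrow> u + v = 1 \<Longrightarrow> u *s x + v *s y \<in> C) \<Longrightarrow> rat_convex C"
  by (simp add: rat_convex_def)

lemma rat_convexD: "rat_convex C \<Longrightarrow> x \<in> C \<Longrightarrow> y \<in> C \<Longrightarrow> 0 \<le> u \<Longrightarrow> 0 \<le> v \<Longrightarrow> u + v = 1 \<Longrightarrow> u *s x + v *s y \<in> C"
  by (auto simp: rat_convex_def)

lemma hull_insert_subset:
  assumes "W \<noteq> {}"
  shows "rat_convex hull (insert x W) \<subseteq> {(1 - u) *s x + u *s w | u w. 0 \<le> u \<and> u \<le> 1 \<and> w \<in> rat_convex hull W}" (is "_ \<subseteq> ?C")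
proof (rule hull_minimal)
  obtain w0 where "w0 \<in> W" using assms by blast
  then have w0: "w0 \<in> rat_convex hull W" by (rule hull_inc)
  have "x \<in> ?C" using w0 by (intro CollectI exI[of _ 0] exI[of _ w0]) (simp add: rat2_eq)
  moreover have "w \<in> ?C" if "w \<in> W" for w
    using hull_inc[OF that] by (intro CollectI exI[of _ 1] exI[of _ w]) (simp add: rat2_eq)
  ultimately show "insert x W \<subseteq> ?C" by blast
  have "a *s y1 + b *s y2 \<in> ?C" if h: "y1 \<in> ?C" "y2 \<in> ?C" "0 \<le> a" "0 \<le> b" "a + b = 1" for y1 y2 a b
  proof -
    obtain u1 w1 where 1: "y1 = (1 - u1) *s x + u1 *s w1" "0 \<le> u1" "u1 \<le> 1" "w1 \<in> rat_convex hull W" using h(1) by blast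
    obtain u2 w2 where 2: "y2 = (1 - u2) *s x + u2 *s w2" "0 \<le> u2" "u2 \<le> 1" "w2 \<in> rat_convex hull W" using h(2) by blast
    define u where "u = a * u1 + b * u2"
    have u: "0 \<le> u" using h 1 2 by (simp add: u_def)
    have "a * u1 \<le> a * 1" "b * u2 \<le> b * 1" using h 1 2 by (intro mult_left_mono; simp)+
    then have u1: "u \<le> 1" using h(5) by (simp add: u_def)
    show "a *s y1 + b *s y2 \<in> ?C"
    proof (cases "u = 0")
      case True
      then have "a * u1 = 0" "b * u2 = 0" using h 1 2 unfolding u_def by (simp_all add: add_nonneg_eq_0_iff)
      then have z: "a = 0 \<or> u1 = 0" "b = 0 \<or> u2 = 0" by simp_all
      have b: "b = 1 - a" using h(5) by simp
      have "a *s y1 + b *s y2 = (1 - 0) *s x + 0 *s w0"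
        using z unfolding 1(1) 2(1) b by (elim disjE) (simp_all add: rat2_eq algebra_simps)
      then show ?thesis using w0 by (intro CollectI exI[of _ 0] exI[of _ w0]) simp
    next
      case False
      define w where "w = (a * u1 / u) *s w1 + (b * u2 / u) *s w2"
      have wW: "w \<in> rat_convex hull W" unfolding w_def
        by (rule rat_convexD[OF rat_convex_hull 1(4) 2(4)])
          (use h 1 2 u False in \<open>auto simp: u_def add_divide_distrib[symmetric]\<close>)
      have b: "b = 1 - a" using h(5) by simp
      have "u *s w = (a * u1) *s w1 + (b * u2) *s w2" using False by (simp add: w_def rat2_eq field_simps)
      then have "a *s y1 + b *s y2 = (1 - u) *s x + u *s w"
        unfolding 1(1) 2(1) by (simp add: rat2_eq u_def) (simp add: b algebra_simps)
      then show ?thesis using u u1 wW by blast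
    qed
  qed
  then show "rat_convex ?C" unfolding rat_convex_def by blast
qed

lemma vertices_subset: "vertices (rat_convex hull V) \<subseteq> V"
proof
  fix v assume v: "v \<in> vertices (rat_convex hull V)"
  show "v \<in> V"
  proof (rule ccontr)
    assume n: "v \<notin> V"
    have "rat_convex (rat_convex hull V - {v})"
    proof (rule rat_convexI)
      fix x y and a b :: rat assume h: "x \<in> rat_convex hull V - {v}" "y \<in> rat_convex hull V - {v}" "0 \<le> a" "0 \<le> b" "a + b = 1"
      have m: "a *s x + b *s y \<in> rat_convex hull V" using h rat_convexD[OF rat_convex_hull] by blast
      have "a *s x + b *s y \<noteq> v"
      proof
        assume e: "a *s x + b *s y = v"
        have a: "a = 1 - b" using h(5) by simp
        have "x \<noteq> y" using e h unfolding a by (auto simp: rat2_eq algebra_simps)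
        moreover have "0 < b" using e h unfolding a by (cases "b = 0") (auto simp: rat2_eq)
        moreover have "b < 1" using e h unfolding a by (cases "b = 1") (auto simp: rat2_eq)
        ultimately show False using v h e unfolding a vertices_def by blast
      qed
      then show "a *s x + b *s y \<in> rat_convex hull V - {v}" using m by blast
    qed
    moreover have "V \<subseteq> rat_convex hull V - {v}" using n hull_subset[of V rat_convex] by auto
    ultimately have "rat_convex hull V \<subseteq> rat_convex hull V - {v}" by (intro hull_minimal)
    then show False using v by (auto simp: vertices_def)
  qed
qed

lemma hull_remove:
  assumes "x \<in> V" "x \<notin> vertices (rat_convex hull V)"
  shows "rat_convex hull (V - {x}) = rat_convex hull V"
proof -
  let ?P = "rat_convex hull V" and ?W = "V - {x}"
  have V: "insert x ?W = V" using assms(1) by blast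
  have "x \<in> ?P" using hull_inc[OF assms(1)] .
  then obtain a b t where ab: "a \<in> ?P" "b \<in> ?P" "a \<noteq> b" "0 < t" "t < 1" "x = (1 - t) *s a + t *s b"
    using assms(2) unfolding vertices_def by blast
  have ne: "?W \<noteq> {}"
  proof
    assume "?W = {}"
    then have "V = {x}" using assms(1) by blast
    moreover have "rat_convex {x}" unfolding rat_convex_def by (auto simp: rat2_eq distrib_right[symmetric])
    ultimately have "?P \<subseteq> {x}" by (intro hull_minimal) auto
    then have "a = x" "b = x" using subsetD ab(1,2) by fast+
    then show False using ab(3) by simp
  qed
  note sub = hull_insert_subset[OF ne, of x, unfolded V]
  obtain u a' where a: "a = (1 - u) *s x + u *s a'" "0 \<le> u" "u \<le> 1" "a' \<in> rat_convex hull ?W"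
    using subsetD[OF sub ab(1)] by blast
  obtain v b' where b: "b = (1 - v) *s x + v *s b'" "0 \<le> v" "v \<le> 1" "b' \<in> rat_convex hull ?W"
    using subsetD[OF sub ab(2)] by blast
  define s where "s = (1 - t) * u + t * v"
  have nn: "0 \<le> (1 - t) * u" "0 \<le> t * v" using ab(4,5) a(2) b(2) by simp_all
  have s: "s \<noteq> 0"
  proof
    assume "s = 0"
    then have "(1 - t) * u = 0" "t * v = 0" using nn unfolding s_def by (simp_all only: add_nonneg_eq_0_iff)
    then have "u = 0" "v = 0" using ab(4,5) by simp_all
    then have "a = x" "b = x" using a(1) b(1) by (simp_all add: rat2_eq)
    then show False using ab(3) by simp
  qed
  have "x $ i = (1 - t) * ((1 - u) * x $ i + u * a' $ i) + t * ((1 - v) * x $ i + v * b' $ i)" for i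
    using arg_cong[OF ab(6)[unfolded a(1) b(1)], of "\<lambda>y. y $ i"] by simp
  then have "s * x $ i = (1 - t) * u * a' $ i + t * v * b' $ i" for i
    by (simp add: s_def algebra_simps)
  then have eq: "s *s x = ((1 - t) * u) *s a' + (t * v) *s b'" by (simp add: rat2_eq)
  have "x = ((1 - t) * u / s) *s a' + (t * v / s) *s b'"
    using eq s unfolding rat2_eq by (auto simp: field_simps)
  moreover have "((1 - t) * u / s) *s a' + (t * v / s) *s b' \<in> rat_convex hull ?W"
    by (rule rat_convexD[OF rat_convex_hull a(4) b(4)]) (use nn s in \<open>auto simp: s_def add_divide_distrib[symmetric]\<close>)
  ultimately have "x \<in> rat_convex hull ?W" by simp
  then have "V \<subseteq> rat_convex hull ?W" using hull_subset[of ?W rat_convex] by blast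
  then have "?P \<subseteq> rat_convex hull ?W" by (intro hull_minimal rat_convex_hull)
  then show ?thesis using hull_mono[of ?W V rat_convex] by blast
qed

text \<open>Points of a finite generating set that are not vertices can be removed one at a time without
changing the hull.\<close>
lemma krein_milman:
  assumes "finite V" shows "rat_convex hull (vertices (rat_convex hull V)) = rat_convex hull V"
  using assms
proof (induction "card V" arbitrary: V rule: less_induct)
  case less
  show ?case
  proof (cases "V \<subseteq> vertices (rat_convex hull V)")
    case True
    then have "vertices (rat_convex hull V) = V" using vertices_subset by blast
    then show ?thesis by simp
  next
    case False
    then obtain x where x: "x \<in> V" "x \<notin> vertices (rat_convex hull V)" by blast
    have "card (V - {x}) < card V" using less.prems x(1) by (rule card_Diff1_less)
    then have "rat_convex hull (vertices (rat_convex hull (V - {x}))) = rat_convex hull (V - {x})"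
      using less.hyps less.prems by blast
    then show ?thesis unfolding hull_remove[OF x] .
  qed
qed

definition affine_map :: "(rat ^ 2 \<Rightarrow> rat ^ 2) \<Rightarrow> bool" where
  "affine_map f \<longleftrightarrow> (\<forall>x y u v. u + v = 1 \<longrightarrow> f (u *s x + v *s y) = u *s f x + v *s f y)"

lemma affine_hull:
  assumes "affine_map f" shows "f ` (rat_convex hull V) = rat_convex hull (f ` V)"
proof
  have "rat_convex {x. f x \<in> rat_convex hull (f ` V)}"
    using assms rat_convexD[OF rat_convex_hull] unfolding rat_convex_def affine_map_def by fastforce
  moreover have "V \<subseteq> {x. f x \<in> rat_convex hull (f ` V)}" using hull_subset[of "f ` V" rat_convex] by blast
  ultimately have "rat_convex hull V \<subseteq> {x. f x \<in> rat_convex hull (f ` V)}" by (intro hull_minimal)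
  then show "f ` (rat_convex hull V) \<subseteq> rat_convex hull (f ` V)" by blast
  show "rat_convex hull (f ` V) \<subseteq> f ` (rat_convex hull V)"
  proof (rule hull_minimal)
    show "f ` V \<subseteq> f ` (rat_convex hull V)" using hull_subset[of V rat_convex] by blast
    show "rat_convex (f ` (rat_convex hull V))"
    proof (rule rat_convexI)
      fix x y and u v :: rat assume h: "x \<in> f ` (rat_convex hull V)" "y \<in> f ` (rat_convex hull V)" "0 \<le> u" "0 \<le> v" "u + v = 1"
      obtain a b where ab: "a \<in> rat_convex hull V" "b \<in> rat_convex hull V" "x = f a" "y = f b" using h by blast
      have "u *s x + v *s y = f (u *s a + v *s b)" using assms h(5) ab unfolding affine_map_def by simp
      then show "u *s x + v *s y \<in> f ` (rat_convex hull V)"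
        using rat_convexD[OF rat_convex_hull ab(1,2) h(3-5)] by blast
    qed
  qed
qed

lemma affine_vertices:
  assumes "affine_map f" "inj f" shows "vertices (f ` P) = f ` vertices P"
proof -
  have e: "f x = (1 - t) *s f a + t *s f b \<longleftrightarrow> x = (1 - t) *s a + t *s b" for x a b t
  proof -
    have "f ((1 - t) *s a + t *s b) = (1 - t) *s f a + t *s f b" using assms(1) unfolding affine_map_def by simp
    then show ?thesis using assms(2) by (metis injD)
  qed
  have i: "f x \<in> f ` P \<longleftrightarrow> x \<in> P" "(f x \<noteq> f y) = (x \<noteq> y)" for x y using assms(2) by (auto simp: inj_image_mem_iff inj_eq)
  have "f x \<in> vertices (f ` P) \<longleftrightarrow> x \<in> vertices P" for x
    unfolding vertices_def mem_Collect_eq ball_simps i e ..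
  moreover have "vertices (f ` P) \<subseteq> f ` P" "vertices P \<subseteq> P" by (auto simp: vertices_def)
  ultimately show ?thesis by blast
qed

section \<open>Lattice polygons and weights\<close>

definition verts :: "(rat ^ 2) set \<Rightarrow> vec set" where
  "verts P = {s. emb s \<in> vertices P}"

definition weight :: "(rat ^ 2) set \<Rightarrow> vec \<Rightarrow> nat" where
  "weight P = len (verts P)"

abbreviation "hul S \<equiv> rat_convex hull (emb ` S)"

lemma verts_image: "vertices P \<subseteq> int_lattice \<Longrightarrow> emb ` verts P = vertices P"
  by (auto simp: verts_def emb_lattice subset_iff)

context point_set
begin

lemma start_is_vertex:
  assumes n: "prim n" shows "emb (start S n) \<in> vertices (hul S)"
proof -
  let ?p = "start S n" and ?d = "dir n"
  note e = edge_S[OF n]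
  let ?C = "{x. rdot n (emb ?p) < rdot n x \<or> (rdot n x = rdot n (emb ?p) \<and> rdot ?d (emb ?p) \<le> rdot ?d x)}"
  have "rat_convex ?C"
  proof (rule rat_convexI)
    fix x y and u v :: rat
    assume x: "x \<in> ?C" and y: "y \<in> ?C" and uv: "0 \<le> u" "0 \<le> v" "u + v = 1"
    define c e where "c = rdot n (emb ?p)" "e = rdot ?d (emb ?p)"
    have c: "u * c + v * c = c" "u * e + v * e = e" using uv(3) by (simp_all add: distrib_right[symmetric])
    have le: "u * c \<le> u * rdot n x" "v * c \<le> v * rdot n y" using x y uv by (auto simp: c_e_def intro!: mult_left_mono)
    have eq: "rdot n x = c" if "u * c = u * rdot n x" "u \<noteq> 0" using that by simp
    have eq': "rdot n y = c" if "v * c = v * rdot n y" "v \<noteq> 0" using that by simp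
    have "u * e + v * e \<le> u * rdot ?d x + v * rdot ?d y" if "u * c = u * rdot n x" "v * c = v * rdot n y"
    proof (intro add_mono)
      show "u * e \<le> u * rdot ?d x" using eq[OF that(1)] x uv by (cases "u = 0") (auto simp: c_e_def intro!: mult_left_mono)
      show "v * e \<le> v * rdot ?d y" using eq'[OF that(2)] y uv by (cases "v = 0") (auto simp: c_e_def intro!: mult_left_mono)
    qed
    then have "c < u * rdot n x + v * rdot n y \<or> (u * rdot n x + v * rdot n y = c \<and> e \<le> u * rdot ?d x + v * rdot ?d y)"
      using le c by linarith
    then show "u *s x + v *s y \<in> ?C"
      unfolding mem_Collect_eq rdot_combination c_e_def by blast
  qed
  moreover have "emb ` S \<subseteq> ?C"
  proof clarify
    fix t assume t: "t \<in> S" and h: "\<not> (rdot n (emb t) = rdot n (emb ?p) \<and> rdot ?d (emb ?p) \<le> rdot ?d (emb t))"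
    from e t consider "dot n ?p < dot n t" | j where "0 \<le> j" "t = ?p + scal j ?d" unfolding edge_def by blast
    then show "rdot n (emb ?p) < rdot n (emb t)"
    proof cases
      case 1 then show ?thesis by (simp add: rdot_emb)
    next
      case 2
      have "0 \<le> j * cross ?d n" using 2(1) by (simp add: cross_def dir_def)
      then have "dot n t = dot n ?p" "dot ?d ?p \<le> dot ?d t" using 2 by simp_all
      then show ?thesis using h by (simp add: rdot_emb)
    qed
  qed
  ultimately have sub: "hul S \<subseteq> ?C" by (intro hull_minimal)
  have mem: "emb ?p \<in> hul S" using e by (intro hull_inc) (simp add: edge_def)
  have False if h: "a \<in> hul S" "b \<in> hul S" "a \<noteq> b" "0 < t" "t < 1" "emb ?p = (1 - t) *s a + t *s b" for a b t
  proof -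
    have "a \<in> ?C" "b \<in> ?C" using sub h by blast+
    then have a: "rdot n (emb ?p) < rdot n a \<or> (rdot n a = rdot n (emb ?p) \<and> rdot ?d (emb ?p) \<le> rdot ?d a)"
      and b: "rdot n (emb ?p) < rdot n b \<or> (rdot n b = rdot n (emb ?p) \<and> rdot ?d (emb ?p) \<le> rdot ?d b)" by auto
    have r: "rdot k (emb ?p) = (1 - t) * rdot k a + t * rdot k b" for k unfolding h(6) by (rule rdot_combination)
    have key: "A = c \<and> B = c" if "c = (1 - t) * A + t * B" "c \<le> A" "c \<le> B" for A B c :: rat
    proof -
      have "(1 - t) * (A - c) + t * (B - c) = 0" using that(1) by (simp add: algebra_simps)
      moreover have "0 \<le> (1 - t) * (A - c)" "0 \<le> t * (B - c)" using that h by auto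
      ultimately have "(1 - t) * (A - c) = 0" "t * (B - c) = 0" by linarith+
      then show ?thesis using h by simp
    qed
    have 1: "rdot n a = rdot n (emb ?p) \<and> rdot n b = rdot n (emb ?p)" by (rule key[OF r]) (use a b in auto)
    have 2: "rdot ?d a = rdot ?d (emb ?p) \<and> rdot ?d b = rdot ?d (emb ?p)" by (rule key[OF r]) (use a b 1 in auto)
    have "rdot n (a - b) = 0" "rdot ?d (a - b) = 0" using 1 2 by (simp_all add: rdot_def algebra_simps)
    then have z: "of_int (fst n) * (a-b)$1 + of_int (snd n) * (a-b)$2 = 0" "of_int (snd n) * (a-b)$1 - of_int (fst n) * (a-b)$2 = 0"
      by (simp_all add: rdot_def dir_def)
    define N :: rat where "N = of_int (fst n) * of_int (fst n) + of_int (snd n) * of_int (snd n)"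
    have "N * (a-b)$1 = of_int (fst n) * (of_int (fst n) * (a-b)$1 + of_int (snd n) * (a-b)$2) + of_int (snd n) * (of_int (snd n) * (a-b)$1 - of_int (fst n) * (a-b)$2)"
      "N * (a-b)$2 = of_int (snd n) * (of_int (fst n) * (a-b)$1 + of_int (snd n) * (a-b)$2) - of_int (fst n) * (of_int (snd n) * (a-b)$1 - of_int (fst n) * (a-b)$2)"
      by (simp_all add: N_def algebra_simps)
    then have "N * (a-b)$1 = 0" "N * (a-b)$2 = 0" unfolding z by simp_all
    moreover have "N \<noteq> 0" unfolding N_def using prim_nz[OF n] by (auto simp: sum_squares_eq_zero_iff zero_prod_def prod_eq_iff)
    ultimately show False using h(3) by (auto simp: rat2_eq)
  qed
  then show ?thesis using mem unfolding vertices_def by blast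
qed

lemma vertex_is_start:
  assumes p: "p \<in> S" "S \<noteq> {p}" "emb p \<in> vertices (hul S)"
  shows "\<exists>k\<in>supp (len S). p = start S k"
proof (rule extreme_is_start[OF p(1,2)])
  fix x y z and \<alpha> \<beta> \<gamma> :: int
  assume h: "x \<in> S - {p}" "y \<in> S - {p}" "z \<in> S - {p}" "0 < \<alpha>" "0 \<le> \<beta>" "0 \<le> \<gamma>"
  show "scal \<alpha> (x - p) + scal \<beta> (y - p) + scal \<gamma> (z - p) \<noteq> 0"
  proof
    assume z: "scal \<alpha> (x - p) + scal \<beta> (y - p) + scal \<gamma> (z - p) = 0"
    then have zf: "\<alpha> * fst x + \<beta> * fst y + \<gamma> * fst z = (\<alpha> + \<beta> + \<gamma>) * fst p"
      "\<alpha> * snd x + \<beta> * snd y + \<gamma> * snd z = (\<alpha> + \<beta> + \<gamma>) * snd p"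
      by (auto simp: scal_def prod_eq_iff algebra_simps)
    define a b c :: rat where "a = of_int \<alpha>" "b = of_int \<beta>" "c = of_int \<gamma>"
    note abc = a_b_c_def
    have pos: "0 < a" "0 \<le> b" "0 \<le> c" using h by (auto simp: abc)
    have zr: "a * of_int (fst x) + b * of_int (fst y) + c * of_int (fst z) = (a + b + c) * (of_int (fst p) :: rat)"
      "a * of_int (snd x) + b * of_int (snd y) + c * of_int (snd z) = (a + b + c) * (of_int (snd p) :: rat)"
      unfolding abc using zf by (metis of_int_add of_int_mult)+
    show False
    proof (cases "b + c = 0")
      case True
      then have "b = 0" "c = 0" using pos by auto
      then have "x = p" using zr pos by (simp add: prod_eq_iff)
      then show False using h by simp
    next
      case False
      then have bc: "0 < b + c" using pos by auto
      define q where "q = (b / (b + c)) *s emb y + (c / (b + c)) *s emb z"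
      have S: "emb s \<in> hul S" if "s \<in> S" for s using that by (simp add: hull_inc)
      have q: "q \<in> hul S" unfolding q_def
        by (rule rat_convexD[OF rat_convex_hull S S]) (use h pos bc in \<open>auto simp: add_divide_distrib[symmetric]\<close>)
      define t where "t = (b + c) / (a + b + c)"
      have T: "a + b + c \<noteq> 0" using pos bc by linarith
      have t: "0 < t" "t < 1" using pos bc by (auto simp: t_def)
      have t1: "1 - t = a / (a + b + c)" using T by (simp add: t_def field_simps)
      have tq: "t *s q = (b / (a + b + c)) *s emb y + (c / (a + b + c)) *s emb z"
      proof -
        have "D / T * (b / D * Y + c / D * Z) = b / T * Y + c / T * Z" if "D \<noteq> 0" for D T Y Z :: rat
          using that by (simp add: distrib_left)
        from this[OF False] show ?thesis by (simp add: t_def q_def rat2_eq)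
      qed
      have eq: "emb p = (1 - t) *s emb x + t *s q"
      proof -
        have "P = a / T * X + (b / T * Y + c / T * Z)" if "a * X + b * Y + c * Z = T * P" "T \<noteq> 0" for P T X Y Z :: rat
        proof -
          have "a / T * X + (b / T * Y + c / T * Z) = (a * X + b * Y + c * Z) / T" by (simp add: add_divide_distrib)
          then show ?thesis using that by simp
        qed
        from this[OF zr(1) T] this[OF zr(2) T] show ?thesis unfolding tq t1 by (simp add: rat2_eq)
      qed
      have "emb x \<noteq> q"
      proof
        assume "emb x = q"
        then have "emb p = emb x" using eq by (simp add: rat2_eq algebra_simps)
        then show False using h by simp
      qed
      then show False using p(3) S[of x] q h t eq unfolding vertices_def by blast
    qed
  qed
qed

end

text \<open>Vertex sets of lattice polygons, expressed through integer data only.\<close>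
definition tight :: "vec set \<Rightarrow> bool" where
  "tight S \<longleftrightarrow> finite S \<and> S \<noteq> {} \<and> nondeg (len S) \<and> (\<forall>s\<in>S. \<exists>n\<in>supp (len S). s = start S n)"

lemma len_prim: "n \<in> supp (len S) \<Longrightarrow> prim n \<and> 0 < len S n"
  by (auto simp: supp_def len_def split: if_splits)

lemma tight_point_set: "tight S \<Longrightarrow> point_set S"
  by (simp add: tight_def point_set_def)

lemma tight_vertices:
  assumes "tight S" shows "vertices (hul S) = emb ` S" "verts (hul S) = S"
proof -
  interpret point_set S by (rule tight_point_set[OF assms])
  have "emb s \<in> vertices (hul S)" if "s \<in> S" for s
    using assms that len_prim start_is_vertex unfolding tight_def by metis
  then show v: "vertices (hul S) = emb ` S" using vertices_subset[of "emb ` S"] by blast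
  show "verts (hul S) = S" unfolding verts_def v by auto
qed

text \<open>Cramer's rule: two edge directions with nonzero determinant span the plane.\<close>
lemma cramer:
  fixes c :: rat assumes c: "a1 * b2 - a2 * b1 = c" "c \<noteq> 0"
  shows "(v1 * b2 - v2 * b1) / c * a1 + (a1 * v2 - a2 * v1) / c * b1 = v1"
    "(v1 * b2 - v2 * b1) / c * a2 + (a1 * v2 - a2 * v1) / c * b2 = v2"
proof -
  have "(v1 * b2 - v2 * b1) * a1 + (a1 * v2 - a2 * v1) * b1 = v1 * c"
    "(v1 * b2 - v2 * b1) * a2 + (a1 * v2 - a2 * v1) * b2 = v2 * c" by (simp_all add: c(1)[symmetric] algebra_simps)
  then show "(v1 * b2 - v2 * b1) / c * a1 + (a1 * v2 - a2 * v1) / c * b1 = v1"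
    "(v1 * b2 - v2 * b1) / c * a2 + (a1 * v2 - a2 * v1) / c * b2 = v2"
    using c(2) by (simp_all add: add_divide_distrib[symmetric] divide_eq_eq)
qed

lemma tight_lattice_polygon:
  assumes t: "tight S" shows "lattice_polygon (hul S)" "weight (hul S) = len S"
proof -
  interpret point_set S by (rule tight_point_set[OF t])
  show "weight (hul S) = len S" by (simp add: weight_def tight_vertices[OF t])
  let ?X = "{x - y | x y. x \<in> hul S \<and> y \<in> hul S}"
  obtain n k where nk: "n \<in> supp (len S)" "k \<in> supp (len S)" "cross n k \<noteq> 0" using t by (auto simp: tight_def nondeg_def)
  have d: "emb (dir n) \<in> vec.span ?X" if n: "n \<in> supp (len S)" for n
  proof -
    have e: "edge S n (start S n) (len S n)" using edge_S len_prim n by blast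
    let ?b = "start S n + scal (int (len S n)) (dir n)"
    have "emb ?b \<in> hul S" "emb (start S n) \<in> hul S" using e by (auto simp: edge_def intro!: hull_inc)
    then have "emb ?b - emb (start S n) \<in> ?X" by blast
    then have "emb ?b - emb (start S n) \<in> vec.span ?X" by (rule vec.span_base)
    then have "(1 / of_nat (len S n)) *s (emb ?b - emb (start S n)) \<in> vec.span ?X" by (rule vec.span_scale)
    moreover have "(1 / of_nat (len S n)) *s (emb ?b - emb (start S n)) = emb (dir n)"
      using len_prim[OF n] by (simp add: rat2_eq scal_def)
    ultimately show ?thesis by simp
  qed
  have "v \<in> vec.span ?X" for v
  proof -
    define c :: rat where "c = of_int (cross n k)"
    have c: "c \<noteq> 0" using nk by (simp add: c_def)
    let ?a = "emb (dir n)" and ?b = "emb (dir k)"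
    have ab: "?a$1 * ?b$2 - ?a$2 * ?b$1 = c" by (simp add: dir_def c_def cross_def algebra_simps)
    have "v = ((v$1 * ?b$2 - v$2 * ?b$1) / c) *s ?a + ((?a$1 * v$2 - ?a$2 * v$1) / c) *s ?b"
      unfolding rat2_eq using cramer[OF ab c, of "v$1" "v$2"] by simp
    moreover have "((v$1 * ?b$2 - v$2 * ?b$1) / c) *s ?a + ((?a$1 * v$2 - ?a$2 * v$1) / c) *s ?b \<in> vec.span ?X"
      by (intro vec.span_add vec.span_scale d nk)
    ultimately show ?thesis by simp
  qed
  then have "vec.span ?X = UNIV" by blast
  then have "vec.dim (vec.span ?X) = vec.dim (UNIV :: (rat ^ 2) set)" by (rule arg_cong)
  then have "vec.dim ?X = vec.dim (UNIV :: (rat ^ 2) set)" by (simp only: vec.dim_span)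
  also have "\<dots> = 2" by (simp add: vec.dimension_def card_cart_basis)
  finally have "vec.dim ?X = 2" .
  then have "convex_polygon (hul S)" unfolding convex_polygon_def using fin by blast
  then show "lattice_polygon (hul S)" unfolding lattice_polygon_def tight_vertices(1)[OF t]
    using emb_lattice by blast
qed

lemma vertices_tight:
  assumes fin: "finite S" and two: "\<And>p. S \<noteq> {p}" and ne: "S \<noteq> {}" and nd: "nondeg (len S)" and v: "vertices (hul S) = emb ` S"
  shows "tight S"
proof -
  interpret point_set S using fin ne by (simp add: point_set_def)
  show ?thesis unfolding tight_def using assms vertex_is_start by auto
qed

lemma lattice_polygon_tight:
  assumes P: "lattice_polygon P" shows "tight (verts P)" "P = hul (verts P)"
proof -
  let ?S = "verts P"
  obtain V where V: "finite V" "P = rat_convex hull V" using P by (auto simp: lattice_polygon_def convex_polygon_def)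
  have vP: "emb ` ?S = vertices P" using P by (intro verts_image) (simp add: lattice_polygon_def)
  have hull: "P = hul ?S" unfolding vP using krein_milman[OF V(1)] V(2) by simp
  then show "P = hul (verts P)" .
  have "finite (vertices P)" using V vertices_subset finite_subset by blast
  then have fin: "finite ?S" using vP finite_imageD[OF _ inj_on_subset[OF inj_emb]] by (metis subset_UNIV)
  let ?X = "{x - y | x y. x \<in> P \<and> y \<in> P}"
  have dim: "vec.dim ?X = 2" using P by (simp add: lattice_polygon_def convex_polygon_def)
  have noline: False if n: "prim n" and l: "\<And>s. s \<in> ?S \<Longrightarrow> dot n s = c" for n c
  proof -
    have "rat_convex {x. rdot n x = of_int c}"
      by (rule rat_convexI) (simp add: rdot_combination distrib_right[symmetric])
    moreover have "emb ` ?S \<subseteq> {x. rdot n x = of_int c}" using l by (auto simp: rdot_emb)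
    ultimately have "P \<subseteq> {x. rdot n x = of_int c}" by (subst hull) (rule hull_minimal)
    from subsetD[OF this] have on_line: "rdot n x = of_int c" if "x \<in> P" for x using that by blast
    have "?X \<subseteq> {x. rdot n x = 0}"
    proof
      fix z assume "z \<in> ?X"
      then obtain x y where z: "z = x - y" "x \<in> P" "y \<in> P" by (elim CollectE exE conjE)
      have "rdot n (x - y) = rdot n x - rdot n y" by (simp add: rdot_def algebra_simps)
      then show "z \<in> {x. rdot n x = 0}" by (simp add: z(1) on_line[OF z(2)] on_line[OF z(3)])
    qed
    moreover have "rdot n (x + y) = rdot n x + rdot n y" "rdot n (r *s x) = r * rdot n x" "rdot n 0 = 0" for x y r
      by (simp_all add: rdot_def algebra_simps)
    then have "vec.subspace {x. rdot n x = 0}" by (intro vec.subspaceI) simp_all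
    ultimately have "vec.span ?X \<subseteq> {x. rdot n x = 0}" by (rule vec.span_minimal)
    moreover have "vec.span ?X = UNIV" using dim vec.dim_eq_full[of ?X] by (simp add: vec.dimension_def card_cart_basis)
    ultimately have "rdot n (emb n) = 0" by blast
    then have "dot n n = 0" by (simp add: rdot_emb)
    then show False using prim_nz[OF n] by (auto simp: dot_def zero_prod_def prod_eq_iff sum_squares_eq_zero_iff)
  qed
  have p1: "prim (1,0)" by (simp add: prim_def)
  have ne: "?S \<noteq> {}" using noline[OF p1] by blast
  have two: "?S \<noteq> {p}" for p
  proof
    assume e: "?S = {p}"
    show False by (rule noline[OF p1, of "dot (1,0) p"]) (use e in simp)
  qed
  interpret point_set ?S using fin ne by (simp add: point_set_def)
  have start: "\<exists>n\<in>supp (len ?S). s = start ?S n" if "s \<in> ?S" for s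
  proof (rule vertex_is_start[OF that two])
    show "emb s \<in> vertices (hul ?S)" using that unfolding hull[symmetric] by (simp add: verts_def)
  qed
  have "nondeg (len ?S)"
  proof (rule ccontr)
    assume d: "\<not> nondeg (len ?S)"
    obtain n where n: "n \<in> supp (len ?S)" using start ne by blast
    have c: "cross n k = 0" if "k \<in> supp (len ?S)" for k using d n that by (auto simp: nondeg_def)
    have "dot n s = dot n (start ?S (1,0))" if "s \<in> ?S" for s
    proof -
      obtain k where k: "k \<in> supp (len ?S)" "s = start ?S k" using start \<open>s \<in> ?S\<close> by blast
      have "dot n (offset (len ?S) k) = 0" unfolding offset_def dot_sum by (rule sum.neutral) (use c in auto)
      then show ?thesis using start_eq_offset[of k] len_prim[OF k(1)] k(2) by simp
    qed
    then show False using noline len_prim[OF n] by blast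
  qed
  then show "tight (verts P)" unfolding tight_def using fin ne start by blast
qed

lemma weight_weights:
  assumes "lattice_polygon P" shows "weight P \<in> weights" "nondeg (weight P)" "card (vertices P) = card (supp (weight P))"
proof -
  note t = lattice_polygon_tight[OF assms]
  interpret point_set "verts P" by (rule tight_point_set[OF t(1)])
  show "weight P \<in> weights" unfolding weight_def by (rule len_weights)
  show "nondeg (weight P)" using t(1) by (simp add: weight_def tight_def)
  have "card (verts P) = card (supp (weight P))" unfolding weight_def
    by (rule card_supp_len) (use t(1) in \<open>auto simp: tight_def\<close>)
  moreover have "emb ` verts P = vertices P" using assms by (intro verts_image) (simp add: lattice_polygon_def)
  then have "card (vertices P) = card (verts P)" using card_image[OF inj_on_subset[OF inj_emb]] by (metis subset_UNIV)
  ultimately show "card (vertices P) = card (supp (weight P))" by simp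
qed

lemma pts_tight:
  assumes \<nu>: "\<nu> \<in> weights" "nondeg \<nu>" shows "tight (pts \<nu>)" "len (pts \<nu>) = \<nu>"
proof -
  interpret point_set "pts \<nu>" by (rule point_set_pts[OF \<nu>(1)])
  show l: "len (pts \<nu>) = \<nu>" by (rule len_pts[OF \<nu>(1)])
  have nd: "nondeg (len (pts \<nu>))" using \<nu>(2) l by simp
  have v: "vertices (hul (pts \<nu>)) = emb ` pts \<nu>"
  proof
    show "emb ` pts \<nu> \<subseteq> vertices (hul (pts \<nu>))"
    proof clarify
      fix s assume "s \<in> pts \<nu>"
      then obtain n where n: "prim n" "s = offset \<nu> n" by (auto simp: pts_def)
      then show "emb s \<in> vertices (hul (pts \<nu>))" using start_is_vertex[OF n(1)] start_pts[OF \<nu>(1) n(1)] by simp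
    qed
  qed (rule vertices_subset)
  have two: "pts \<nu> \<noteq> {p}" for p
  proof
    assume e: "pts \<nu> = {p}"
    obtain n where n: "n \<in> supp \<nu>" using \<nu>(2) by (auto simp: nondeg_def)
    then have pn: "prim n" "0 < \<nu> n" using \<nu>(1) by (auto simp: weights_def supp_def)
    have "edge {p} n (offset \<nu> n) (\<nu> n)" using edge_pts[OF \<nu>(1) pn(1)] unfolding e .
    then have "offset \<nu> n = p" "offset \<nu> n + scal (int (\<nu> n)) (dir n) = p" unfolding edge_def by blast+
    then have "scal (int (\<nu> n)) (dir n) = 0" by (metis add.right_neutral add_left_cancel)
    also have "\<dots> = scal 0 (dir n)" by (simp add: scal_def zero_prod_def)
    finally have "int (\<nu> n) = 0" unfolding scal_dir_inject[OF pn(1)] .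
    then show False using pn(2) by simp
  qed
  show "tight (pts \<nu>)" by (rule vertices_tight[OF fin two ne nd v])
qed

lemma weight_surj: "\<nu> \<in> weights \<Longrightarrow> nondeg \<nu> \<Longrightarrow> \<exists>P. lattice_polygon P \<and> weight P = \<nu>"
  by (rule exI[of _ "hul (pts \<nu>)"]) (simp add: tight_lattice_polygon[OF pts_tight(1)] pts_tight(2))

section \<open>Equivalence of polygons\<close>

definition act :: "int ^ 2 ^ 2 \<Rightarrow> vec \<Rightarrow> rat ^ 2 \<Rightarrow> rat ^ 2" where
  "act M u x = map_matrix rat_of_int M *v (x - emb u)"

abbreviation "lm M \<equiv> lin (M$1$1) (M$1$2) (M$2$1) (M$2$2)"

lemma act_nth: "act M u x $ 1 = of_int (M$1$1) * (x$1 - of_int (fst u)) + of_int (M$1$2) * (x$2 - of_int (snd u))"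
  "act M u x $ 2 = of_int (M$2$1) * (x$1 - of_int (fst u)) + of_int (M$2$2) * (x$2 - of_int (snd u))"
  by (simp_all add: act_def matrix_vector_mult_def sum_2)

lemma act_emb: "act M u (emb s) = emb (lm M (s - u))"
  by (simp add: rat2_eq act_nth lin_def)

lemma act_affine: "affine_map (act M u)"
  unfolding affine_map_def
proof (intro allI impI)
  fix x y and a b :: rat assume "a + b = 1"
  then have b: "b = 1 - a" by simp
  show "act M u (a *s x + b *s y) = a *s act M u x + b *s act M u y"
    unfolding rat2_eq b by (simp add: act_nth algebra_simps)
qed

lemma invertible_det:
  assumes "invertible (M :: int ^ 2 ^ 2)" shows "\<bar>M$1$1 * M$2$2 - M$1$2 * M$2$1\<bar> = 1"
proof -
  obtain N where "M ** N = mat 1" using assms by (auto simp: invertible_def)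
  then have "det M * det N = 1" by (metis det_I det_mul)
  then have "\<bar>det M\<bar> = 1" by (metis abs_zmult_eq_1 abs_1 dvd_def zdvd1_eq)
  then show ?thesis by (simp add: det_2 mult.commute)
qed

lemma act_inj:
  assumes "\<bar>M$1$1 * M$2$2 - M$1$2 * M$2$1\<bar> = 1" shows "inj (act M u)"
proof (rule injI)
  fix x y assume e: "act M u x = act M u y"
  define a b c d p q :: rat where "a = of_int (M$1$1)" "b = of_int (M$1$2)" "c = of_int (M$2$1)" "d = of_int (M$2$2)"
    "p = x$1 - y$1" "q = x$2 - y$2"
  note D = a_b_c_d_p_q_def
  have 1: "a * p + b * q = 0" "c * p + d * q = 0"
    using arg_cong[OF e, of "\<lambda>v. v $ 1"] arg_cong[OF e, of "\<lambda>v. v $ 2"] unfolding act_nth D by (simp_all add: algebra_simps)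
  have dt: "a * d - b * c \<noteq> 0"
  proof -
    have "M$1$1 * M$2$2 - M$1$2 * M$2$1 \<noteq> 0" using assms by auto
    then have "rat_of_int (M$1$1 * M$2$2 - M$1$2 * M$2$1) \<noteq> 0" by (simp only: of_int_eq_0_iff not_False_eq_True)
    then show ?thesis by (simp add: D)
  qed
  have "(a * d - b * c) * p = d * (a * p + b * q) - b * (c * p + d * q)"
    "(a * d - b * c) * q = a * (c * p + d * q) - c * (a * p + b * q)" by (simp_all add: algebra_simps)
  then have "p = 0" "q = 0" using dt unfolding 1 by simp_all
  then show "x = y" by (simp add: rat2_eq D)
qed

lemma polygon_equiv_iff_act: "(P, P') \<in> polygon_equiv \<longleftrightarrow> lattice_polygon P \<and> lattice_polygon P' \<and>
    (\<exists>u M. invertible M \<and> act M u ` P = P')"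
  unfolding polygon_equiv_def act_def by (auto simp: emb_lattice Bex_def)

lemma weight_act:
  assumes P: "lattice_polygon P" and det: "\<bar>M$1$1 * M$2$2 - M$1$2 * M$2$1\<bar> = 1"
  shows "weight (act M u ` P) = weight P \<circ> lin (M$1$1) (M$2$1) (M$1$2) (M$2$2)"
    "lattice_polygon (act M u ` P)"
proof -
  note t = lattice_polygon_tight[OF P]
  let ?S = "verts P"
  let ?S' = "lm M ` ((+) (- u) ` ?S)"
  interpret point_set ?S by (rule tight_point_set[OF t(1)])
  interpret tr: point_set "(+) (- u) ` ?S" using fin ne by (simp add: point_set_def)
  have S': "act M u ` emb ` ?S = emb ` ?S'" by (simp add: image_image act_emb)
  have vP: "emb ` ?S = vertices P" using P by (intro verts_image) (simp add: lattice_polygon_def)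
  have hP: "act M u ` P = hul ?S'" using affine_hull[OF act_affine, of M u "emb ` ?S"] t(2) S' by simp
  have v': "vertices (hul ?S') = emb ` ?S'"
    unfolding hP[symmetric] affine_vertices[OF act_affine act_inj[OF det]] vP[symmetric] by (rule S')
  have len': "len ?S' = weight P \<circ> lin (M$1$1) (M$2$1) (M$1$2) (M$2$2)"
    unfolding weight_def tr.len_image[OF det] len_translate ..
  have "\<bar>M$1$1 * M$2$2 - M$2$1 * M$1$2\<bar> = 1" using det by (simp add: mult.commute)
  then have G: "lin (M$1$1) (M$2$1) (M$1$2) (M$2$2) \<in> GL" by (rule GL_I)
  have G': "lm M \<in> GL" using det by (rule GL_I)
  have "inj (lm M)" using bij_is_inj[OF GL_bij[OF G']] .
  then have card: "card ?S' = card ?S" by (subst card_image, blast intro: inj_on_subset, subst card_image, auto intro: injI)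
  have nd: "nondeg (len ?S')" unfolding len' nondeg_comp[OF G] by (rule weight_weights(2)[OF P])
  have "card ?S \<noteq> 1"
  proof
    assume "card ?S = 1"
    then have c: "card (supp (len ?S)) = 1" using card_supp_len t(1) unfolding tight_def by metis
    then obtain n where "supp (len ?S) = {n}" by (metis card_1_singletonE)
    then show False using t(1) by (auto simp: tight_def nondeg_def)
  qed
  then have two: "?S' \<noteq> {p}" for p using card by (metis card_1_singleton_iff One_nat_def)
  have tS': "tight ?S'" by (rule vertices_tight[OF _ two _ nd v']) (use fin ne in auto)
  show "lattice_polygon (act M u ` P)" "weight (act M u ` P) = weight P \<circ> lin (M$1$1) (M$2$1) (M$1$2) (M$2$2)"
    unfolding hP using tight_lattice_polygon[OF tS'] len' by simp_all
qed

lemma tight_start: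
  assumes "tight S" "s \<in> S" shows "\<exists>n. prim n \<and> s = start S n"
proof -
  have "\<forall>s\<in>S. \<exists>n\<in>supp (len S). s = start S n" using assms(1) unfolding tight_def by (elim conjE)
  from bspec[OF this assms(2)] obtain n where n: "n \<in> supp (len S)" "s = start S n" by (elim bexE)
  show ?thesis by (rule exI[of _ n]) (simp only: len_prim[OF n(1)] n(2) simp_thms)
qed

lemma tight_translate:
  assumes "tight S" "tight S'" "len S = len S'" shows "\<exists>c. S' = (+) c ` S"
proof -
  interpret S: point_set S by (rule tight_point_set[OF assms(1)])
  interpret S': point_set S' by (rule tight_point_set[OF assms(2)])
  have 1: "S = (+) (start S (1,0)) ` pts (len S)" by (rule S.pts_translate[OF tight_start[OF assms(1)]])
  have 2: "S' = (+) (start S' (1,0)) ` pts (len S')" by (rule S'.pts_translate[OF tight_start[OF assms(2)]])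
  have "(+) (b - a) ` (+) a ` Q = (+) b ` Q" for a b :: vec and Q by (simp add: image_image add.assoc[symmetric])
  note tr = this[of "start S' (1,0)" "start S (1,0)" "pts (len S')"]
  have "S' = (+) (start S' (1,0) - start S (1,0)) ` (+) (start S (1,0)) ` pts (len S')" unfolding tr by (rule 2)
  then have "S' = (+) (start S' (1,0) - start S (1,0)) ` S" unfolding assms(3)[symmetric] 1[symmetric] .
  then show ?thesis ..
qed

text \<open>Translations do not change the weight, and a matrix acts on normals by its transpose, which
again runs through all of \<open>GL\<close>. Equal weights give vertex sets that differ by a translation.\<close>
theorem polygon_equiv_iff:
  assumes P: "lattice_polygon P" and P': "lattice_polygon P'"
  shows "(P, P') \<in> polygon_equiv \<longleftrightarrow> (\<exists>A\<in>GL. weight P' = weight P \<circ> A)"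
proof
  assume "(P, P') \<in> polygon_equiv"
  then obtain u M where M: "invertible M" "act M u ` P = P'" unfolding polygon_equiv_iff_act by blast
  note det = invertible_det[OF M(1)]
  have "\<bar>M$1$1 * M$2$2 - M$2$1 * M$1$2\<bar> = 1" using det by (simp add: mult.commute)
  then show "\<exists>A\<in>GL. weight P' = weight P \<circ> A" using weight_act(1)[OF P det, of u] M(2) GL_I by blast
next
  assume "\<exists>A\<in>GL. weight P' = weight P \<circ> A"
  then obtain a b c d where A: "\<bar>a * d - b * c\<bar> = 1" "weight P' = weight P \<circ> lin a b c d" by (metis GL_E)
  define M :: "int ^ 2 ^ 2" where "M = vector [vector [a, c], vector [b, d]]"
  have Me: "M$1$1 = a" "M$1$2 = c" "M$2$1 = b" "M$2$2 = d" by (simp_all add: M_def)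
  have det: "\<bar>M$1$1 * M$2$2 - M$1$2 * M$2$1\<bar> = 1" using A(1) by (simp add: Me mult.commute)
  define e where "e = a * d - b * c"
  have ee: "e * e = 1" using A(1) by (auto simp: e_def[symmetric] abs_if split: if_splits)
  define N :: "int ^ 2 ^ 2" where "N = vector [vector [e * d, - e * c], vector [- e * b, e * a]]"
  have Ne: "N$1$1 = e * d" "N$1$2 = - e * c" "N$2$1 = - e * b" "N$2$2 = e * a" by (simp_all add: N_def)
  have h: "e * (a * d) - e * (b * c) = 1" using ee by (simp add: e_def algebra_simps)
  have "M ** N = mat 1" "N ** M = mat 1"
    using h by (simp_all add: vec_eq_iff forall_2 matrix_matrix_mult_def sum_2 Me Ne mat_def algebra_simps)
  then have inv: "invertible M" unfolding invertible_def by blast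
  let ?Q = "act M 0 ` P"
  note Q = weight_act[OF P det, of 0]
  have w: "weight ?Q = weight P'" unfolding Q(1) A(2) Me ..
  have tQ: "tight (verts ?Q)" "?Q = hul (verts ?Q)" using lattice_polygon_tight[OF Q(2)] .
  have tP': "tight (verts P')" "P' = hul (verts P')" using lattice_polygon_tight[OF P'] .
  obtain v where v: "verts P' = (+) v ` verts ?Q" using tight_translate[OF tQ(1) tP'(1)] w by (auto simp: weight_def)
  have G: "lm M \<in> GL" using det by (rule GL_I)
  obtain B where B: "B \<in> GL" "lm M \<circ> B = id" using G by (rule GL_inv)
  define u where "u = - B v"
  have Mu: "lm M u = - v" using B(2) unfolding u_def GL_minus[OF G] by (metis comp_apply id_apply)
  have acts: "act M u x = emb v + act M 0 x" for x
  proof -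
    have "a * fst u + c * snd u = - fst v" "b * fst u + d * snd u = - snd v" using Mu by (auto simp: lin_def Me prod_eq_iff)
    then have "rat_of_int (a * fst u + c * snd u) = - of_int (fst v)" "rat_of_int (b * fst u + d * snd u) = - of_int (snd v)" by simp_all
    then show ?thesis by (simp add: rat2_eq act_nth Me algebra_simps)
  qed
  have tr: "affine_map ((+) (emb v))" unfolding affine_map_def
  proof (intro allI impI)
    fix x y and r s :: rat assume "r + s = 1"
    then have s: "s = 1 - r" by simp
    show "emb v + (r *s x + s *s y) = r *s (emb v + x) + s *s (emb v + y)" unfolding s by (simp add: rat2_eq algebra_simps)
  qed
  have "act M u ` P = (+) (emb v) ` ?Q" by (simp add: image_image acts)
  also have "\<dots> = rat_convex hull ((+) (emb v) ` emb ` verts ?Q)" by (subst tQ(2)) (rule affine_hull[OF tr])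
  also have "(+) (emb v) ` emb ` verts ?Q = emb ` verts P'" unfolding v by (auto simp: image_image rat2_eq intro!: image_cong)
  finally have "act M u ` P = P'" using tP'(2) by simp
  then show "(P, P') \<in> polygon_equiv" unfolding polygon_equiv_iff_act using P P' inv by blast
qed

lemma rat_convex_square: "rat_convex (square m)"
proof (rule rat_convexI)
  fix x y and u v :: rat
  assume h: "x \<in> square m" "y \<in> square m" "0 \<le> u" "0 \<le> v" "u + v = 1"
  have "0 \<le> u * x $ i + v * y $ i \<and> u * x $ i + v * y $ i \<le> of_nat m" for i
  proof -
    have b: "0 \<le> x $ i" "x $ i \<le> of_nat m" "0 \<le> y $ i" "y $ i \<le> of_nat m" using h(1,2) by (auto simp: square_def)
    have "u * x $ i + v * y $ i \<le> u * of_nat m + v * of_nat m" using b h by (intro add_mono mult_left_mono) auto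
    also have "\<dots> = of_nat m" using h(5) by (simp add: distrib_right[symmetric])
    finally show ?thesis using b h by simp
  qed
  then show "u *s x + v *s y \<in> square m" by (simp add: square_def)
qed

lemma emb_square: "emb s \<in> square m \<longleftrightarrow> 0 \<le> fst s \<and> fst s \<le> int m \<and> 0 \<le> snd s \<and> snd s \<le> int m"
proof -
  have "(of_int k \<le> (of_nat m :: rat)) = (k \<le> int m)" for k by (metis of_int_le_iff of_int_of_nat_eq)
  then show ?thesis by (auto simp: square_def forall_2)
qed

lemma square_width:
  assumes P: "lattice_polygon P" "P \<subseteq> square m"
  shows "width2 (weight P) (1,0) \<le> 2 * int m \<and> width2 (weight P) (0,1) \<le> 2 * int m"
proof -
  note t = lattice_polygon_tight[OF P(1)]
  interpret point_set "verts P" by (rule tight_point_set[OF t(1)])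
  have s: "0 \<le> fst s \<and> fst s \<le> int m \<and> 0 \<le> snd s \<and> snd s \<le> int m" if "s \<in> verts P" for s
    using that P(2) unfolding emb_square[symmetric] verts_def vertices_def by blast
  have p: "prim (1,0)" "prim (-1,0)" by (simp_all add: prim_def)
  have "start (verts P) (1,0) \<in> verts P" "start (verts P) (-1,0) \<in> verts P"
    using edge_S[OF p(1)] edge_S[OF p(2)] by (simp_all add: edge_def)
  from s[OF this(1)] s[OF this(2)] have 1: "width2 (weight P) (1,0) \<le> 2 * int m" unfolding weight_def width_fst(3) by auto
  obtain l r where lr: "l \<in> verts P" "r \<in> verts P" "width2 (len (verts P)) (0,1) = 2 * (snd r - snd l)" by (rule width_snd)
  from s[OF lr(1)] s[OF lr(2)] have "width2 (weight P) (0,1) \<le> 2 * int m" unfolding weight_def lr(3) by auto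
  with 1 show ?thesis ..
qed

lemma width_square:
  assumes P: "lattice_polygon P" and w: "width2 (weight P) (1,0) \<le> 2 * int m" "width2 (weight P) (0,1) \<le> 2 * int m"
  shows "\<exists>Q. lattice_polygon Q \<and> weight Q = weight P \<and> Q \<subseteq> square m"
proof -
  note t = lattice_polygon_tight[OF P(1)]
  interpret point_set "verts P" by (rule tight_point_set[OF t(1)])
  obtain l r where "l \<in> verts P" "r \<in> verts P" and lr: "\<And>s. s \<in> verts P \<Longrightarrow> snd l \<le> snd s \<and> snd s \<le> snd r" "width2 (len (verts P)) (0,1) = 2 * (snd r - snd l)"
    by (rule width_snd, rule that) auto
  define u where "u = (fst (start (verts P) (1,0)), snd l)"
  have inv: "invertible (mat 1 :: int ^ 2 ^ 2)" unfolding invertible_def by (metis matrix_mul_lid)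
  have m1: "(mat 1 :: int ^ 2 ^ 2)$1$1 = 1" "(mat 1 :: int ^ 2 ^ 2)$1$2 = 0" "(mat 1 :: int ^ 2 ^ 2)$2$1 = 0" "(mat 1 :: int ^ 2 ^ 2)$2$2 = 1"
    by (simp_all add: mat_def)
  note W = weight_act[OF P invertible_det[OF inv], of u, unfolded m1 lin_id comp_id]
  have "act (mat 1) u ` P = hul ((\<lambda>s. s - u) ` verts P)"
    using affine_hull[OF act_affine, of "mat 1" u "emb ` verts P"] t(2) by (simp add: image_image act_emb m1 lin_id)
  moreover have "hul ((\<lambda>s. s - u) ` verts P) \<subseteq> square m"
  proof (intro hull_minimal rat_convex_square)
    have "emb (s - u) \<in> square m" if "s \<in> verts P" for s
      using width_fst(1,2)[OF that] width_fst(3) lr(1)[OF that] lr(2) w unfolding emb_square u_def weight_def by auto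
    then show "emb ` (\<lambda>s. s - u) ` verts P \<subseteq> square m" by auto
  qed
  ultimately show ?thesis using W by metis
qed

section \<open>Evaluating the generating functions\<close>

fun slist :: "(nat \<Rightarrow> 'a::comm_monoid_add) \<Rightarrow> nat list \<Rightarrow> 'a" where
  "slist f [] = 0" | "slist f (x # xs) = f x + slist f xs"

definition ssum :: "(nat \<Rightarrow> 'a::comm_monoid_add) \<Rightarrow> nat \<Rightarrow> 'a" where
  "ssum f n = slist f [0..<Suc n]"

definition idx :: "nat list" where "idx = [0..<8]"

fun gs :: "'a::comm_semiring_1 list list \<Rightarrow> nat \<Rightarrow> nat \<Rightarrow> nat \<Rightarrow> nat \<Rightarrow> nat \<Rightarrow> 'a" where
  "gs T 0 i j a b = 0"
| "gs T (Suc k) i j a b = (if i \<le> a \<and> j \<le> b then T ! (a-i) ! (b-j) + gs T k i j (a-i) (b-j) else 0)"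

definition g0 :: "'a::comm_semiring_1 \<Rightarrow> nat \<Rightarrow> nat \<Rightarrow> 'a list list \<Rightarrow> nat \<Rightarrow> nat \<Rightarrow> 'a" where
  "g0 z i j T a b = T ! a ! b + z * gs T 7 i j a b"
definition g1 :: "'a::comm_semiring_1 \<Rightarrow> nat \<Rightarrow> nat \<Rightarrow> 'a list list \<Rightarrow> nat \<Rightarrow> 'a list" where
  "g1 z i j T a = map (g0 z i j T a) idx"
definition gstep :: "'a::comm_semiring_1 \<Rightarrow> nat \<times> nat \<Rightarrow> 'a list list \<Rightarrow> 'a list list" where
  "gstep z p T = map (g1 z (fst p) (snd p) T) idx"
definition ginit :: "'a::comm_semiring_1 list list" where
  "ginit = map (\<lambda>a. map (\<lambda>b. if a = 0 \<and> b = 0 then 1 else 0) idx) idx"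
definition normals :: "nat \<Rightarrow> (nat \<times> nat) list" where
  "normals k = filter (\<lambda>p. gcd (fst p) (snd p) = 1) (List.product [1..<8] [k..<8])"
text \<open>Primitive vectors are added to the cone one at a time; after all vectors with coordinates below 8, the
table agrees with the generating function of the cone.\<close>
definition gtab :: "nat \<Rightarrow> 'a::comm_semiring_1 \<Rightarrow> 'a list list" where
  "gtab k z = fold (gstep z) (normals k) ginit"

lemma slist_eq: "slist f [a..<b] = (\<Sum>i=a..<b. f i)"
proof -
  have "slist f xs = sum_list (map f xs)" for xs by (induction xs) auto
  then show ?thesis by (simp add: interv_sum_list_conv_sum_set_nat)
qed

lemma ssum_eq: "ssum f n = (\<Sum>i\<le>n. f i)"
  unfolding ssum_def slist_eq by (simp only: atLeast0LessThan lessThan_Suc_atMost)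

lemma idx_nth: "a < 8 \<Longrightarrow> map f idx ! a = f a"
  by (simp add: idx_def)

definition tabulates :: "'a::comm_semiring_1 list list \<Rightarrow> (nat \<times> nat \<Rightarrow> 'a) \<Rightarrow> bool" where
  "tabulates T g \<longleftrightarrow> (\<forall>a<8. \<forall>b<8. T ! a ! b = g (a, b))"

lemma gs_eq: "gs T k i j a b = (\<Sum>t\<in>{t \<in> {1..k}. t * i \<le> a \<and> t * j \<le> b}. T ! (a - t * i) ! (b - t * j))"
proof (induction k arbitrary: a b)
  case (Suc k)
  show ?case
  proof (cases "i \<le> a \<and> j \<le> b")
    case True
    let ?S = "{t \<in> {1..k}. t * i \<le> a - i \<and> t * j \<le> b - j}"
    have set: "{t \<in> {1..Suc k}. t * i \<le> a \<and> t * j \<le> b} = insert 1 (Suc ` ?S)"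
    proof (intro equalityI subsetI)
      fix t assume t: "t \<in> {t \<in> {1..Suc k}. t * i \<le> a \<and> t * j \<le> b}"
      show "t \<in> insert 1 (Suc ` ?S)"
      proof (cases "t = 1")
        case False
        then obtain u where "t = Suc u" "1 \<le> u" using t by (cases t) auto
        then show ?thesis using t by auto
      qed simp
    qed (use True in auto)
    have "(\<Sum>t\<in>insert 1 (Suc ` ?S). T ! (a - t * i) ! (b - t * j))
       = T ! (a - i) ! (b - j) + (\<Sum>t\<in>?S. T ! (a - i - t * i) ! (b - j - t * j))"
      by (subst sum.insert) (auto simp: sum.reindex)
    then show ?thesis using True Suc.IH[of "a - i" "b - j"] unfolding set by simp
  next
    case False
    have e: "{t \<in> {1..Suc k}. t * i \<le> a \<and> t * j \<le> b} = {}"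
    proof (rule ccontr)
      assume "\<not> ?thesis"
      then obtain t where "1 \<le> t" "t * i \<le> a" "t * j \<le> b" by auto
      moreover have "1 * i \<le> t * i" "1 * j \<le> t * j" using \<open>1 \<le> t\<close> by (intro mult_right_mono; simp)+
      ultimately show False using False by linarith
    qed
    show ?thesis unfolding e using False by (simp only: gs.simps if_False sum.empty)
  qed
qed simp

lemma tabulates_gstep:
  assumes T: "tabulates T (gfun D z)" and p: "p \<notin> D" "p \<noteq> (0,0)" "finite D" "(0,0) \<notin> D"
  shows "tabulates (gstep z p T) (gfun (insert p D) z)"
  unfolding tabulates_def
proof (intro allI impI)
  fix a b :: nat assume a: "a < 8" and b: "b < 8"
  have "1 \<le> fst p \<or> 1 \<le> snd p" using p(2) by (cases p) auto
  then have le: "t \<le> t * fst p \<or> t \<le> t * snd p" for t by (metis mult_le_mono2 mult.right_neutral)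
  have set: "{t \<in> {1..7}. t * fst p \<le> a \<and> t * snd p \<le> b} = {t \<in> {1..a+b}. t * fst p \<le> a \<and> t * snd p \<le> b}"
  proof -
    have "t \<le> 7 \<and> t \<le> a + b" if "t * fst p \<le> a" "t * snd p \<le> b" for t
      using le[of t] that a b by linarith
    then show ?thesis by auto
  qed
  have "gstep z p T ! a ! b = T ! a ! b + z * gs T 7 (fst p) (snd p) a b"
    using a b by (simp add: gstep_def g1_def g0_def idx_nth)
  also have "\<dots> = gfun (insert p D) z (a, b)"
    unfolding gfun_insert[OF p] gs_eq set using T a b by (auto simp: tabulates_def intro!: arg_cong2[where f = "(+)"] arg_cong2[where f = "(*)"] sum.cong)
  finally show "gstep z p T ! a ! b = gfun (insert p D) z (a, b)" .
qed

lemma tabulates_fold: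
  assumes "tabulates T (gfun D z)" "finite D" "(0,0) \<notin> D" "distinct ps" "set ps \<inter> D = {}" "(0,0) \<notin> set ps"
  shows "tabulates (fold (gstep z) ps T) (gfun (D \<union> set ps) z)"
  using assms
proof (induction ps arbitrary: T D)
  case (Cons p ps)
  have "tabulates (gstep z p T) (gfun (insert p D) z)"
    using Cons.prems by (intro tabulates_gstep) auto
  then have "tabulates (fold (gstep z) ps (gstep z p T)) (gfun (insert p D \<union> set ps) z)"
    using Cons.prems by (intro Cons.IH) auto
  then show ?case by simp
qed simp

lemma tabulates_gtab: "tabulates (gtab k z) (gfun (cone (\<lambda>i j. 1 \<le> i \<and> k \<le> j)) z)"
proof -
  have "tabulates ginit (gfun {} z)" by (auto simp: tabulates_def ginit_def idx_nth gfun_empty)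
  moreover have "distinct (normals k)" unfolding normals_def by (intro distinct_filter distinct_product) auto
  moreover have s: "set (normals k) = {p. 1 \<le> fst p \<and> fst p < 8 \<and> k \<le> snd p \<and> snd p < 8 \<and> coprime (fst p) (snd p)}"
    by (auto simp: normals_def coprime_iff_gcd_eq_1)
  moreover have "(0,0) \<notin> set (normals k)" unfolding s by simp
  ultimately have "tabulates (gtab k z) (gfun ({} \<union> set (normals k)) z)"
    unfolding gtab_def by (intro tabulates_fold) auto
  moreover have "gfun (set (normals k)) z (a, b) = gfun (cone (\<lambda>i j. 1 \<le> i \<and> k \<le> j)) z (a, b)" if "a < 8" "b < 8" for a b
  proof -
    have "set (normals k) \<inter> {..a} \<times> {..b} = cone (\<lambda>i j. 1 \<le> i \<and> k \<le> j) \<inter> {..a} \<times> {..b}"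
      using that by (auto simp: s cone_def)
    then show ?thesis unfolding gfun_def
      using fns_restrict[of "set (normals k)" "(a,b)"] fns_restrict[of "cone (\<lambda>i j. 1 \<le> i \<and> k \<le> j)" "(a,b)"] by simp
  qed
  ultimately show ?thesis by (auto simp: tabulates_def)
qed

lemma tab_half: "a < 8 \<Longrightarrow> b < 8 \<Longrightarrow> gtab 0 z ! a ! b = gfun half_cone z (a, b)"
  and tab_open: "a < 8 \<Longrightarrow> b < 8 \<Longrightarrow> gtab 1 z ! a ! b = gfun open_cone z (a, b)"
  using tabulates_gtab[of 0 z] tabulates_gtab[of 1 z] by (simp_all add: tabulates_def)

definition rtab :: "'a::comm_semiring_1 \<Rightarrow> nat \<Rightarrow> 'a" where
  "rtab z i = (if i = 0 then 1 else z)"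

lemma gfun_ray: "gfun ray_cone z (i, 0) = rtab z i"
proof -
  have c: "ray_cone = insert (1,0) {}" by (auto simp: cone_def)
  have "(\<Sum>t\<in>{t \<in> {1..i}. t \<le> i}. if i - t = 0 then 1 else 0) = (if i = 0 then 0 else (1::'a))"
  proof (cases "i = 0")
    case False
    have "(\<Sum>t\<in>{t \<in> {1..i}. t \<le> i}. if i - t = 0 then 1 else 0) = (\<Sum>t\<in>{1..i}. if t = i then 1 else (0::'a))"
      by (rule sum.cong) auto
    then show ?thesis using False by simp
  qed simp
  then show ?thesis unfolding c by (subst gfun_insert) (auto simp: gfun_empty rtab_def)
qed

text \<open>The sums are organised as first-order functions applied to finished tables.\<close>

definition u0 :: "'a::comm_semiring_1 list list \<Rightarrow> nat \<Rightarrow> nat \<Rightarrow> nat \<Rightarrow> nat \<Rightarrow> 'a" where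
  "u0 G p b h a = G!a!b * G!h!(p-a)"
definition u1 where "u1 G p b h = ssum (u0 G p b h) p"
definition u2 where "u2 G p b = map (u1 G p b) idx"
definition u3 where "u3 G p = map (u2 G p) idx"
definition f0 :: "'a::comm_semiring_1 list list \<Rightarrow> nat \<Rightarrow> nat \<Rightarrow> nat \<Rightarrow> 'a" where
  "f0 U q b h = U!b!h * U!(q-h)!(q-b)"
definition f1 where "f1 U q b = ssum (f0 U q b) q"
definition f2 where "f2 U q = ssum (f1 U q) q"
definition f3 where "f3 U = map (f2 U) idx"
definition f4 where "f4 G p = f3 (u3 G p)"
definition etab where "etab G = map (f4 G) idx"
definition at2 :: "'a list list \<Rightarrow> nat \<Rightarrow> nat \<Rightarrow> 'a" where "at2 F p q = F!p!q"
definition row2 where "row2 F m p = ssum (at2 F p) m"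
definition sum2 where "sum2 F m = ssum (row2 F m) m"
definition edge_id_prog where "edge_id_prog z = map (sum2 (etab (gtab 0 z))) [1..<8]"

definition n0 :: "'a::comm_semiring_1 list list \<Rightarrow> nat \<Rightarrow> nat \<Rightarrow> nat \<Rightarrow> nat \<Rightarrow> 'a" where
  "n0 G a b c d = G!a!b * G!c!d"
definition n1 where "n1 G m a b c = ssum (n0 G a b c) (m-a)"
definition n2 where "n2 G m a b = ssum (n1 G m a b) (m-b)"
definition n3 where "n3 G m a = ssum (n2 G m a) m"
definition n4 where "n4 G m = ssum (n3 G m) m"
definition edge_neg_prog where "edge_neg_prog z = map (n4 (gtab 0 (z^2))) [1..<8]"

definition q1 :: "'a::comm_semiring_1 list list \<Rightarrow> nat \<Rightarrow> nat \<Rightarrow> 'a" where "q1 G m a = ssum (at2 G a) (m-a)"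
definition q2 where "q2 G m = ssum (q1 G m) m"
definition edge_quarter_prog where "edge_quarter_prog z = map (q2 (gtab 0 (z^4))) [1..<8]"

definition r0 :: "'a::comm_semiring_1 \<Rightarrow> 'a list list \<Rightarrow> 'a list list \<Rightarrow> nat \<Rightarrow> nat \<Rightarrow> nat \<Rightarrow> nat \<Rightarrow> nat \<Rightarrow> 'a" where
  "r0 z G I p b d a c = rtab z (p-2*b) * rtab z (p-2*d) * (G!a!b * I!c!d)"
definition r1 where "r1 z G I m p b d a = ssum (r0 z G I p b d a) (m-a)"
definition r2 where "r2 z G I m p b d = ssum (r1 z G I m p b d) m"
definition r3 where "r3 z G I m p b = ssum (r2 z G I m p b) (p div 2)"
definition r4 where "r4 z G I m p = ssum (r3 z G I m p) (p div 2)"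
definition r5 where "r5 z G I m = ssum (r4 z G I m) m"
definition edge_refl_prog where "edge_refl_prog z = map (r5 z (gtab 0 (z^2)) (gtab 1 (z^2))) [1..<8]"

definition s0 :: "'a::comm_semiring_1 \<Rightarrow> 'a list list \<Rightarrow> 'a list list \<Rightarrow> nat \<Rightarrow> nat \<Rightarrow> nat \<Rightarrow> nat \<Rightarrow> nat \<Rightarrow> 'a" where
  "s0 z G I p c b a d = rtab z (p-2*b-a-d) * G!a!b * I!c!d"
definition s1 where "s1 z G I p c b a = ssum (s0 z G I p c b a) (p-2*b-a)"
definition s2 where "s2 z G I p c b = ssum (s1 z G I p c b) (p-2*b)"
definition s3 where "s3 z G I p c = ssum (s2 z G I p c) (p div 2)"
definition s4 where "s4 z G I p = map (s3 z G I p) idx"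
definition stab where "stab z G I = map (s4 z G I) idx"
definition w0 :: "'a::comm_semiring_1 list list \<Rightarrow> 'a list list \<Rightarrow> nat \<Rightarrow> nat \<Rightarrow> nat \<Rightarrow> 'a" where
  "w0 A B p c e = A!p!c * B!p!e"
definition w1 where "w1 A B m p c = ssum (w0 A B p c) (m-p-c)"
definition w2 where "w2 A B m p = ssum (w1 A B m p) (m-p)"
definition w3 where "w3 A B m = ssum (w2 A B m) m"
definition w4 where "w4 z G I = map (w3 (stab z G G) (stab z G I)) [1..<8]"
definition edge_swap_prog where "edge_swap_prog z = w4 z (gtab 0 (z^2)) (gtab 1 (z^2))"

definition j0 :: "'a::comm_semiring_1 list list \<Rightarrow> nat \<Rightarrow> nat \<Rightarrow> nat \<Rightarrow> nat \<Rightarrow> 'a" where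
  "j0 G u v s d = G!u!d * G!(v-d)!s"
definition j1 where "j1 G u v s = ssum (j0 G u v s) v"
definition j2 where "j2 G u v = map (j1 G u v) idx"
definition j3 where "j3 G u = map (j2 G u) idx"
definition jtab where "jtab G = map (j3 G) idx"
definition h0 :: "'a::comm_semiring_1 list \<Rightarrow> 'a list list list \<Rightarrow> nat \<Rightarrow> nat \<Rightarrow> nat \<Rightarrow> nat \<Rightarrow> 'a" where
  "h0 Gp J w v s b = Gp!b * J!(w-b)!v!s"
definition h1 where "h1 Gp J w v s = ssum (h0 Gp J w v s) w"
definition h2 where "h2 Gp J w v = map (h1 Gp J w v) [0..<8-v]"
definition h3 where "h3 Gp J w = map (h2 Gp J w) idx"
definition h4 where "h4 G J p = map (h3 (G!p) J) [0..<8-p]"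
definition h5 where "h5 G J = map (h4 G J) idx"
definition htab where "htab G = h5 G (jtab G)"
definition k0 :: "'a::comm_semiring_1 list list list list \<Rightarrow> nat \<Rightarrow> nat \<Rightarrow> nat \<Rightarrow> nat \<Rightarrow> nat \<Rightarrow> nat \<Rightarrow> nat \<Rightarrow> 'a" where
  "k0 H X Y Z v w s p = H!p!w!v!s * H!(X-v-s)!(Z+v-X)!(X+w-Z)!(Z-p-w)"
definition k1 where "k1 H X Y Z v w s = slist (k0 H X Y Z v w s) [0..<Suc Z-w]"
definition k2 where "k2 H X Y Z v = slist (k1 H X Y Z v (Y-v)) [0..<Suc X-v]"
definition k3 where "k3 H X Y Z = slist (k2 H X Y Z) [X-Z..<min (Suc Y) (Suc (X+Y)-Z)]"
definition k4 where "k4 H X Y = map (k3 H X Y) idx"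
definition k5 where "k5 H X = map (k4 H X) idx"
definition ktab where "ktab H = map (k5 H) idx"
definition row3 where "row3 F m p = sum2 (F!p) m"
definition sum3 where "sum3 F m = ssum (row3 F m) m"
definition triangle_id_prog where "triangle_id_prog z = map (sum3 (ktab (htab (gtab 0 z)))) [1..<8]"

definition m0 :: "'a::comm_semiring_1 list list list list \<Rightarrow> nat \<Rightarrow> nat \<Rightarrow> nat \<Rightarrow> nat \<Rightarrow> 'a" where
  "m0 H p s v w = H!p!w!v!s"
definition m1 where "m1 H m p s v = ssum (m0 H p s v) (min (m-v) (m-p-s))"
definition m2 where "m2 H m p s = ssum (m1 H m p s) (m-p-s)"
definition m3 where "m3 H m p = ssum (m2 H m p) (m-p)"
definition m4 where "m4 H m = ssum (m3 H m) m"
definition triangle_neg_prog where "triangle_neg_prog z = map (m4 (htab (gtab 0 (z^2)))) [1..<8]"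

definition t1 where "t1 G m a b c = ssum (n0 G a b c) (m-a-b-c)"
definition t2 where "t2 G m a b = ssum (t1 G m a b) (m-a-b)"
definition t3 where "t3 G m a = ssum (t2 G m a) (m-a)"
definition t4 where "t4 G m = ssum (t3 G m) m"
definition triangle_third_prog where "triangle_third_prog z = map (t4 (gtab 0 (z^3))) [1..<8]"

definition x1 :: "'a::comm_semiring_1 list list \<Rightarrow> nat \<Rightarrow> nat \<Rightarrow> 'a" where "x1 G m a = ssum (at2 G a) ((m-2*a) div 2)"
definition x2 where "x2 G m = ssum (x1 G m) (m div 2)"
definition triangle_sixth_prog where "triangle_sixth_prog z = map (x2 (gtab 0 (z^6))) [1..<8]"

text \<open>The semiring determines the information obtained: \<open>z = 1\<close> counts the weights, while the leading term
and the terms of low degree describe extreme numbers of edges.\<close>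
definition count :: "'a::comm_semiring_1 \<Rightarrow> (vec \<Rightarrow> nat) set \<Rightarrow> 'a" where
  "count z S = (\<Sum>\<nu>\<in>S. z ^ card (supp \<nu>))"

lemma prog_nth: "1 \<le> m \<Longrightarrow> m < 8 \<Longrightarrow> map f [1..<8] ! (m - 1) = f m"
  by simp

lemma edge_id_prog:
  assumes "1 \<le> m" "m < 8" shows "count z (fixed_edge (lin 1 0 0 1) m) = edge_id_prog z ! (m - 1)"
proof -
  let ?g = "gfun half_cone z"
  have U: "u3 (gtab 0 z) p ! b ! h = (\<Sum>a\<le>p. ?g (a,b) * ?g (h,p-a))" if "p < 8" "b < 8" "h < 8" for p b h
    using that by (simp add: u3_def u2_def u1_def u0_def[abs_def] idx_nth ssum_eq tab_half cong: sum.cong_simp)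
  have F: "etab (gtab 0 z) ! p ! q = (\<Sum>b\<le>q. \<Sum>h\<le>q. (\<Sum>a\<le>p. ?g (a,b) * ?g (h,p-a)) * (\<Sum>a\<le>p. ?g (a,q-h) * ?g (q-b,p-a)))"
    if "p < 8" "q < 8" for p q
    using that by (simp add: etab_def f4_def f3_def f2_def f1_def[abs_def] f0_def[abs_def] idx_nth ssum_eq U cong: sum.cong_simp)
  have "edge_id_prog z ! (m - 1) = (\<Sum>p\<le>m. \<Sum>q\<le>m. etab (gtab 0 z) ! p ! q)"
    unfolding edge_id_prog_def prog_nth[OF assms] sum2_def row2_def[abs_def] at2_def[abs_def] ssum_eq ..
  also have "\<dots> = (\<Sum>p\<le>m. \<Sum>q\<le>m. \<Sum>b\<le>q. \<Sum>h\<le>q. (\<Sum>a\<le>p. ?g (a,b) * ?g (h,p-a)) * (\<Sum>a\<le>p. ?g (a,q-h) * ?g (q-b,p-a)))"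
    by (intro sum.cong refl F) (use assms in auto)
  also have "\<dots> = count z (fixed_edge (lin 1 0 0 1) m)"
    unfolding count_def edge_identity(2) by (intro sum.cong refl) (simp add: sum_product)
  finally show ?thesis ..
qed

lemma edge_neg_prog:
  assumes "1 \<le> m" "m < 8" shows "count z (fixed_edge (lin (-1) 0 0 (-1)) m) = edge_neg_prog z ! (m - 1)"
  unfolding edge_neg_prog_def prog_nth[OF assms] count_def edge_negation(2) n4_def n3_def[abs_def] n2_def[abs_def] n1_def[abs_def] n0_def[abs_def] ssum_eq
  using assms by (simp add: tab_half cong: sum.cong_simp)

lemma edge_quarter_prog:
  assumes "1 \<le> m" "m < 8" shows "count z (fixed_edge (lin 0 (-1) 1 0) m) = edge_quarter_prog z ! (m - 1)"
  unfolding edge_quarter_prog_def prog_nth[OF assms] count_def edge_quarter_turn(2) q2_def q1_def[abs_def] at2_def[abs_def] ssum_eq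
  using assms by (simp add: tab_half cong: sum.cong_simp)

lemma div2_less: "p < 8 \<Longrightarrow> b \<le> p div 2 \<Longrightarrow> b < (8::nat)" by linarith

lemma edge_refl_prog:
  assumes "1 \<le> m" "m < 8" shows "count z (fixed_edge (lin 1 0 0 (-1)) m) = edge_refl_prog z ! (m - 1)"
proof -
  have "r0 z (gtab 0 (z^2)) (gtab 1 (z^2)) p b d a c = gfun ray_cone z (p-2*b,0) * gfun ray_cone z (p-2*d,0) * (gfun half_cone (z^2) (a,b) * gfun open_cone (z^2) (c,d))"
    if "p \<le> m" "b \<le> p div 2" "d \<le> p div 2" "a \<le> m" "c \<le> m - a" for p b d a c
    unfolding r0_def gfun_ray using that assms div2_less[of p] by (subst tab_half tab_open; simp)+
  then show ?thesis
    unfolding edge_refl_prog_def prog_nth[OF assms] count_def edge_reflection(2) r5_def r4_def[abs_def] r3_def[abs_def] r2_def[abs_def] r1_def[abs_def] ssum_eq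
    by (intro sum.cong refl) simp
qed

lemma edge_swap_prog:
  assumes "1 \<le> m" "m < 8" shows "count z (fixed_edge (lin 0 1 1 0) m) = edge_swap_prog z ! (m - 1)"
proof -
  let ?g = "gfun half_cone (z^2)" and ?o = "gfun open_cone (z^2)" and ?r = "\<lambda>i. gfun ray_cone z (i, 0)"
  have stab: "stab z (gtab 0 (z^2)) I ! p ! c = (\<Sum>b\<le>p div 2. \<Sum>a\<le>p-2*b. \<Sum>d\<le>p-2*b-a. ?r (p-2*b-a-d) * ?g (a,b) * f (c,d))"
    if I: "\<And>a b. a < 8 \<Longrightarrow> b < 8 \<Longrightarrow> I ! a ! b = f (a,b)" and pc: "p < 8" "c < 8" for I f p c
  proof -
    have "stab z (gtab 0 (z^2)) I ! p ! c = (\<Sum>b\<le>p div 2. \<Sum>a\<le>p-2*b. \<Sum>d\<le>p-2*b-a. s0 z (gtab 0 (z^2)) I p c b a d)"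
      using pc by (simp add: stab_def s4_def s3_def s2_def[abs_def] s1_def[abs_def] ssum_eq idx_nth)
    also have "\<dots> = (\<Sum>b\<le>p div 2. \<Sum>a\<le>p-2*b. \<Sum>d\<le>p-2*b-a. ?r (p-2*b-a-d) * ?g (a,b) * f (c,d))"
    proof (intro sum.cong refl)
      fix b a d assume "b \<in> {..p div 2}" "a \<in> {..p-2*b}" "d \<in> {..p-2*b-a}"
      then have "b < 8" "a < 8" "d < 8" using pc div2_less[of p b] by auto
      then show "s0 z (gtab 0 (z^2)) I p c b a d = ?r (p-2*b-a-d) * ?g (a,b) * f (c,d)"
        unfolding s0_def gfun_ray using pc by (simp add: tab_half I)
    qed
    finally show ?thesis .
  qed
  note stab1 = stab[of "gtab 0 (z^2)" ?g, OF tab_half] and stab2 = stab[of "gtab 1 (z^2)" ?o, OF tab_open]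
  have "edge_swap_prog z ! (m - 1) = (\<Sum>p\<le>m. \<Sum>c\<le>m-p. \<Sum>e\<le>m-p-c.
      stab z (gtab 0 (z^2)) (gtab 0 (z^2)) ! p ! c * stab z (gtab 0 (z^2)) (gtab 1 (z^2)) ! p ! e)"
    unfolding edge_swap_prog_def w4_def prog_nth[OF assms] w3_def w2_def[abs_def] w1_def[abs_def] w0_def[abs_def] ssum_eq ..
  also have "\<dots> = count z (fixed_edge (lin 0 1 1 0) m)"
    unfolding count_def edge_swap(2)
  proof (intro sum.cong refl)
    fix p c e assume h: "p \<in> {..m}" "c \<in> {..m-p}" "e \<in> {..m-p-c}"
    then have "p < 8" "c < 8" "e < 8" using assms by auto
    then show "stab z (gtab 0 (z^2)) (gtab 0 (z^2)) ! p ! c * stab z (gtab 0 (z^2)) (gtab 1 (z^2)) ! p ! e =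
      (\<Sum>b\<le>p div 2. \<Sum>a\<le>p-2*b. \<Sum>d\<le>p-2*b-a. \<Sum>b'\<le>p div 2. \<Sum>a'\<le>p-2*b'. \<Sum>f\<le>p-2*b'-a'.
        ?r (p-2*b-a-d) * ?g (a,b) * ?g (c,d) * (?r (p-2*b'-a'-f) * ?g (a',b') * ?o (e,f)))"
      by (simp only: stab1 stab2 sum_distrib_right) (simp only: sum_distrib_left)
  qed
  finally show ?thesis ..
qed

lemma htab_nth:
  assumes "p + w < 8" "v + s < 8"
  shows "htab (gtab 0 z) ! p ! w ! v ! s =
    (\<Sum>b\<le>w. \<Sum>d\<le>v. gfun half_cone z (p,b) * gfun half_cone z (w-b,d) * gfun half_cone z (v-d,s))"
proof -
  have J: "jtab (gtab 0 z) ! u ! v ! s = (\<Sum>d\<le>v. gfun half_cone z (u,d) * gfun half_cone z (v-d,s))" if "u < 8" for u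
    using that assms by (simp add: jtab_def j3_def j2_def j1_def j0_def[abs_def] ssum_eq idx_nth tab_half cong: sum.cong_simp)
  have "htab (gtab 0 z) ! p ! w ! v ! s = (\<Sum>b\<le>w. gtab 0 z ! p ! b * jtab (gtab 0 z) ! (w-b) ! v ! s)"
    using assms by (simp add: htab_def h5_def h4_def h3_def h2_def h1_def h0_def[abs_def] ssum_eq idx_nth)
  also have "\<dots> = (\<Sum>b\<le>w. \<Sum>d\<le>v. gfun half_cone z (p,b) * gfun half_cone z (w-b,d) * gfun half_cone z (v-d,s))"
    using assms by (intro sum.cong refl) (simp add: J tab_half sum_distrib_left mult.assoc)
  finally show ?thesis .
qed

lemma triangle_id_prog:
  assumes "1 \<le> m" "m < 8" shows "count z (fixed_triangle (lin 1 0 0 1) m) = triangle_id_prog z ! (m - 1)"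
proof -
  let ?H = "htab (gtab 0 z)"
  have "triangle_id_prog z ! (m - 1) = (\<Sum>X\<le>m. \<Sum>Y\<le>m. \<Sum>Z\<le>m. ktab ?H ! X ! Y ! Z)"
    unfolding triangle_id_prog_def prog_nth[OF assms] sum3_def row3_def[abs_def] sum2_def row2_def[abs_def] at2_def[abs_def] ssum_eq ..
  also have "\<dots> = count z (fixed_triangle (lin 1 0 0 1) m)" unfolding count_def triangle_identity(2)
  proof (intro sum.cong refl)
    fix X Y Z assume h: "X \<in> {..m}" "Y \<in> {..m}" "Z \<in> {..m}"
    then have XYZ: "X < 8" "Y < 8" "Z < 8" using assms by auto
    let ?g = "gfun half_cone z"
    have "ktab ?H ! X ! Y ! Z = (\<Sum>v=X-Z..<min (Suc Y) (Suc (X+Y)-Z). \<Sum>s<Suc X-v. \<Sum>p<Suc Z-(Y-v). k0 ?H X Y Z v (Y-v) s p)"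
      using XYZ by (simp add: ktab_def k5_def k4_def k3_def k2_def[abs_def] k1_def[abs_def] slist_eq idx_nth atLeast0LessThan)
    also have "\<dots> = (\<Sum>v=X-Z..<min (Suc Y) (Suc (X+Y)-Z). \<Sum>s<Suc X-v. \<Sum>p<Suc Z-(Y-v). \<Sum>b\<le>Y-v. \<Sum>d\<le>v. \<Sum>b'\<le>Z+v-X. \<Sum>d'\<le>X+(Y-v)-Z.
      ?g (p,b) * ?g (Y-v-b,d) * ?g (v-d,s) * (?g (X-v-s,b') * ?g (Z+v-X-b',d') * ?g (X+(Y-v)-Z-d',Z-p-(Y-v))))"
    proof (intro sum.cong refl)
      fix v s p assume v: "v \<in> {X-Z..<min (Suc Y) (Suc (X+Y)-Z)}" and s: "s \<in> {..<Suc X-v}" and p: "p \<in> {..<Suc Z-(Y-v)}"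
      have v1: "v \<le> Y" "X \<le> Z + v" "Z + v \<le> X + Y" "v + s \<le> X" using v s by auto
      define w where "w = Y - v"
      have w: "w + v = Y" "p + w \<le> Z" "Z \<le> X + w" using v1 p unfolding w_def by auto
      have 1: "p + w < 8" "v + s < 8" using w v1 XYZ by auto
      have 2: "X - v - s + (Z + v - X) < 8" using v1 XYZ by linarith
      have 3: "X + w - Z + (Z - p - w) < 8" using w v1 XYZ by linarith
      show "k0 ?H X Y Z v (Y-v) s p = (\<Sum>b\<le>Y-v. \<Sum>d\<le>v. \<Sum>b'\<le>Z+v-X. \<Sum>d'\<le>X+(Y-v)-Z.
        ?g (p,b) * ?g (Y-v-b,d) * ?g (v-d,s) * (?g (X-v-s,b') * ?g (Z+v-X-b',d') * ?g (X+(Y-v)-Z-d',Z-p-(Y-v))))"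
        unfolding k0_def w_def[symmetric] htab_nth[OF 1] htab_nth[OF 2 3]
        by (simp only: sum_distrib_right) (simp only: sum_distrib_left)
    qed
    finally show "ktab ?H ! X ! Y ! Z = \<dots>" .
  qed
  finally show ?thesis ..
qed

lemma triangle_neg_prog:
  assumes "1 \<le> m" "m < 8" shows "count z (fixed_triangle (lin (-1) 0 0 (-1)) m) = triangle_neg_prog z ! (m - 1)"
  unfolding triangle_neg_prog_def prog_nth[OF assms] count_def triangle_negation(2) m4_def m3_def[abs_def] m2_def[abs_def] m1_def[abs_def] m0_def[abs_def] ssum_eq
proof (intro sum.cong refl)
  fix p s v w assume "p \<in> {..m}" "s \<in> {..m-p}" "v \<in> {..m-p-s}" "w \<in> {..min (m-v) (m-p-s)}"
  then have "p + w < 8" "v + s < 8" using assms by auto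
  from htab_nth[OF this] show "(\<Sum>b\<le>w. \<Sum>d\<le>v. gfun half_cone (z^2) (p,b) * gfun half_cone (z^2) (w-b,d) * gfun half_cone (z^2) (v-d,s))
    = htab (gtab 0 (z^2)) ! p ! w ! v ! s" ..
qed

lemma triangle_third_prog:
  assumes "1 \<le> m" "m < 8" shows "count z (fixed_triangle (lin (-1) (-1) 1 0) m) = triangle_third_prog z ! (m - 1)"
  unfolding triangle_third_prog_def prog_nth[OF assms] count_def triangle_third_turn(2) t4_def t3_def[abs_def] t2_def[abs_def] t1_def[abs_def] n0_def[abs_def] ssum_eq
  using assms by (simp add: tab_half cong: sum.cong_simp)

lemma triangle_sixth_prog:
  assumes "1 \<le> m" "m < 8" shows "count z (fixed_triangle (lin 0 (-1) 1 1) m) = triangle_sixth_prog z ! (m - 1)"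
  unfolding triangle_sixth_prog_def prog_nth[OF assms] count_def triangle_sixth_turn(2) x2_def x1_def[abs_def] at2_def[abs_def] ssum_eq
proof (intro sum.cong refl)
  fix a b assume "a \<in> {..m div 2}" "b \<in> {..(m-2*a) div 2}"
  then have "a < 8" "b < 8" using assms div2_less[of m a] div2_less[of "m-2*a" b] by auto
  then show "gfun half_cone (z^6) (a,b) = gtab 0 (z^6) ! a ! b" by (simp add: tab_half)
qed

section \<open>Values of the programs\<close>

text \<open>Leading terms of polynomials with their degrees. They form a semiring because the coefficients that occur
in a sum of equal degrees are simply added.\<close>
datatype lt = LZero | LT nat int
instantiation lt :: comm_semiring_1 begin
definition "0 = LZero"
definition "1 = LT 0 1"
fun plus_lt where "plus_lt LZero y = y" | "plus_lt (LT a b) LZero = LT a b"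
 | "plus_lt (LT a b) (LT c d) = (if a < c then LT c d else if c < a then LT a b else LT a (b+d))"
fun times_lt where "times_lt LZero y = LZero" | "times_lt (LT a b) LZero = LZero"
 | "times_lt (LT a b) (LT c d) = LT (a+c) (b*d)"
instance proof
  fix a b c :: lt
  show "a * b * c = a * (b * c)" by (cases a; cases b; cases c) auto
  show "a * b = b * a" by (cases a; cases b) auto
  show "a + b + c = a + (b + c)" by (cases a; cases b; cases c) auto
  show "a + b = b + a" by (cases a; cases b) auto
  show "(a + b) * c = a * c + b * c" by (cases a; cases b; cases c) (auto simp: algebra_simps)
  show "0 + a = a" by (simp add: zero_lt_def)
  show "1 * a = a" by (cases a) (auto simp: one_lt_def)
  show "0 * a = 0" by (simp add: zero_lt_def)
  show "a * 0 = 0" by (cases a) (auto simp: zero_lt_def)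
  show "(0::lt) \<noteq> 1" by (simp add: zero_lt_def one_lt_def)
qed
end
text \<open>Polynomials modulo \<open>z ^ 3\<close>: they separate the weights with at most two edges.\<close>
datatype tri = Tri int int int
instantiation tri :: comm_semiring_1 begin
definition "0 = Tri 0 0 0"
definition "1 = Tri 1 0 0"
fun plus_tri where "plus_tri (Tri a b c) (Tri d e f) = Tri (a+d) (b+e) (c+f)"
fun times_tri where "times_tri (Tri a b c) (Tri d e f) = Tri (a*d) (a*e+b*d) (a*f+b*e+c*d)"
instance proof
  fix a b c :: tri
  show "a * b * c = a * (b * c)" by (cases a; cases b; cases c) (auto simp: algebra_simps)
  show "a * b = b * a" by (cases a; cases b) auto
  show "a + b + c = a + (b + c)" by (cases a; cases b; cases c) auto
  show "a + b = b + a" by (cases a; cases b) auto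
  show "(a + b) * c = a * c + b * c" by (cases a; cases b; cases c) (auto simp: algebra_simps)
  show "0 + a = a" by (cases a) (simp add: zero_tri_def)
  show "1 * a = a" by (cases a) (auto simp: one_tri_def)
  show "0 * a = 0" by (cases a) (simp add: zero_tri_def)
  show "a * 0 = 0" by (cases a) (auto simp: zero_tri_def)
  show "(0::tri) \<noteq> 1" by (simp add: zero_tri_def one_tri_def)
qed
end


text \<open>The result \<open>None\<close> means that the leading exponent exceeds \<open>V\<close>, in which case the leading term does not
determine the coefficient.\<close>
fun top_coeff :: "nat \<Rightarrow> lt \<Rightarrow> int option" where
  "top_coeff V LZero = Some 0"
| "top_coeff V (LT d c) = (if d = V then Some c else if d < V then Some 0 else None)"

fun low :: "tri \<Rightarrow> int" where
  "low (Tri a b c) = a + b + c"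

lemma count_one: "count (1::int) S = int (card S)"
  by (simp add: count_def)

lemma low_sum: "low (\<Sum>x\<in>S. f x) = (\<Sum>x\<in>S. low (f x))"
proof (induction S rule: infinite_finite_induct)
  case (insert x F)
  have "low (a + b) = low a + low b" for a b by (cases a; cases b) simp
  with insert show ?case by simp
qed (simp_all add: zero_tri_def)

lemma low_power: "low (Tri 0 1 0 ^ n) = (if n < 3 then 1 else 0)"
proof -
  have p3: "Tri 0 1 0 ^ Suc (Suc (Suc k)) = Tri 0 0 0" for k
  proof (induction k)
    case (Suc k)
    show ?case by (subst power_Suc, subst Suc) simp
  qed (simp add: one_tri_def)
  consider "n = 0" | "n = Suc 0" | "n = Suc (Suc 0)" | k where "n = Suc (Suc (Suc k))" by (metis not0_implies_Suc)
  then show ?thesis by cases (simp_all only: p3, simp_all add: one_tri_def)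
qed

lemma count_low:
  assumes "finite S" shows "low (count (Tri 0 1 0) S) = int (card {\<nu> \<in> S. card (supp \<nu>) < 3})"
proof -
  have "low (count (Tri 0 1 0) S) = (\<Sum>\<nu>\<in>S. if card (supp \<nu>) < 3 then 1 else 0)"
    by (simp add: count_def low_sum low_power)
  also have "\<dots> = int (card {\<nu> \<in> S. card (supp \<nu>) < 3})"
    using assms by (simp add: sum.If_cases Int_def)
  finally show ?thesis .
qed

lemma count_top:
  assumes "finite S" "top_coeff V (count (LT (Suc 0) 1) S) = Some c"
  shows "(\<forall>\<nu>\<in>S. card (supp \<nu>) \<le> V) \<and> int (card {\<nu> \<in> S. card (supp \<nu>) = V}) = c"
  using assms
proof (induction S arbitrary: c rule: finite_induct)
  case empty
  then show ?case by (simp add: count_def zero_lt_def)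
next
  case (insert x F)
  have pow: "LT (Suc 0) 1 ^ n = LT n 1" for n by (induction n) (simp_all add: one_lt_def)
  have add: "\<exists>c1 c2. top_coeff V a = Some c1 \<and> top_coeff V b = Some c2 \<and> c = c1 + c2" if "top_coeff V (a + b) = Some c" for a b
    using that by (cases a; cases b) (auto split: if_splits)
  have "count (LT (Suc 0) 1) (insert x F) = LT (card (supp x)) 1 + count (LT (Suc 0) 1) F"
    using insert.hyps by (simp add: count_def pow)
  with add insert.prems obtain c1 c2 where c: "top_coeff V (LT (card (supp x)) 1) = Some c1"
    "top_coeff V (count (LT (Suc 0) 1) F) = Some c2" "c = c1 + c2" by metis
  note IH = insert.IH[OF c(2)]
  have set: "{\<nu> \<in> insert x F. card (supp \<nu>) = V} = (if card (supp x) = V then insert x {\<nu> \<in> F. card (supp \<nu>) = V} else {\<nu> \<in> F. card (supp \<nu>) = V})"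
    by auto
  show ?case unfolding set using c(1,3) IH insert.hyps by (auto split: if_splits)
qed

text \<open>Entry \<open>m - 1\<close> of each list belongs to the square of side \<open>m\<close>. The second list counts degenerate
weights, the third those with the largest number of edges.\<close>
lemma edge_id_values:
  "edge_id_prog (1::int) = [10, 132, 1658, 18019, 178028, 1589037, 13104986]"
  "map low (edge_id_prog (Tri 0 1 0)) = [5, 13, 25, 41, 61, 85, 113]"
  "map2 top_coeff [4, 6, 8, 9, 10, 12, 13] (edge_id_prog (LT (Suc 0) 1)) = map Some [1, 2, 1, 4, 88, 4, 20]"
  by code_simp+

lemma edge_neg_values:
  "edge_neg_prog (1::int) = [6, 28, 114, 415, 1404, 4461, 13478]"
  "map low (edge_neg_prog (Tri 0 1 0)) = [5, 13, 25, 41, 61, 85, 113]"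
  "map2 top_coeff [4, 6, 8, 9, 10, 12, 13] (edge_neg_prog (LT (Suc 0) 1)) = map Some [1, 2, 1, 0, 16, 4, 0]"
  by code_simp+

lemma edge_quarter_values:
  "edge_quarter_prog (1::int) = [2, 4, 8, 15, 28, 49, 86]"
  "map low (edge_quarter_prog (Tri 0 1 0)) = [1, 1, 1, 1, 1, 1, 1]"
  "map2 top_coeff [4, 6, 8, 9, 10, 12, 13] (edge_quarter_prog (LT (Suc 0) 1)) = map Some [1, 0, 1, 0, 0, 2, 0]"
  by code_simp+

lemma edge_refl_values:
  "edge_refl_prog (1::int) = [4, 16, 48, 175, 476, 1585, 4032]"
  "map low (edge_refl_prog (Tri 0 1 0)) = [3, 5, 7, 9, 11, 13, 15]"
  "map2 top_coeff [4, 6, 8, 9, 10, 12, 13] (edge_refl_prog (LT (Suc 0) 1)) = map Some [1, 0, 1, 0, 4, 0, 0]"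
  by code_simp+

lemma edge_swap_values:
  "edge_swap_prog (1::int) = [6, 24, 90, 313, 1036, 3237, 9682]"
  "map low (edge_swap_prog (Tri 0 1 0)) = [3, 5, 7, 9, 11, 13, 15]"
  "map2 top_coeff [4, 6, 8, 9, 10, 12, 13] (edge_swap_prog (LT (Suc 0) 1)) = map Some [1, 2, 1, 2, 8, 2, 2]"
  by code_simp+

lemma triangle_id_values:
  "triangle_id_prog (1::int) = [6, 59, 599, 5299, 44202, 333574, 2358471]"
  "map low (triangle_id_prog (Tri 0 1 0)) = [4, 10, 19, 31, 46, 64, 85]"
  "map2 top_coeff [4, 6, 8, 9, 10, 12, 13] (triangle_id_prog (LT (Suc 0) 1)) = map Some [0, 1, 0, 2, 3, 1, 0]"
  by code_simp+

lemma triangle_neg_values: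
  "triangle_neg_prog (1::int) = [4, 17, 59, 199, 598, 1772, 4841]"
  "map low (triangle_neg_prog (Tri 0 1 0)) = [4, 10, 19, 31, 46, 64, 85]"
  "map2 top_coeff [4, 6, 8, 9, 10, 12, 13] (triangle_neg_prog (LT (Suc 0) 1)) = map Some [0, 1, 0, 0, 3, 1, 0]"
  by code_simp+

lemma triangle_sixth_values:
  "triangle_sixth_prog (1::int) = [1, 2, 2, 4, 4, 8, 8]"
  "map low (triangle_sixth_prog (Tri 0 1 0)) = [1, 1, 1, 1, 1, 1, 1]"
  "map2 top_coeff [4, 6, 8, 9, 10, 12, 13] (triangle_sixth_prog (LT (Suc 0) 1)) = map Some [0, 1, 0, 0, 0, 1, 0]"
  by code_simp+

lemma triangle_third_values:
  "triangle_third_prog (1::int) = [3, 8, 20, 46, 102, 214, 438]"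
  "map low (triangle_third_prog (Tri 0 1 0)) = [1, 1, 1, 1, 1, 1, 1]"
  "map2 top_coeff [4, 6, 8, 9, 10, 12, 13] (triangle_third_prog (LT (Suc 0) 1)) = map Some [0, 1, 0, 2, 0, 1, 0]"
  by code_simp+

section \<open>Classes of polygons and orbits of weights\<close>

text \<open>A closed weight whose edges are all parallel has at most two of them, and conversely two edges can
close up only if they are opposite.\<close>
lemma nondeg_iff:
  assumes \<nu>: "\<nu> \<in> weights" shows "nondeg \<nu> \<longleftrightarrow> 3 \<le> card (supp \<nu>)"
proof
  have fin: "finite (supp \<nu>)" and z: "msum \<nu> fst = 0" "msum \<nu> snd = 0" using \<nu> by (auto simp: weights_def)
  assume "nondeg \<nu>"
  then obtain n k where nk: "n \<in> supp \<nu>" "k \<in> supp \<nu>" "cross n k \<noteq> 0" unfolding nondeg_def by blast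
  show "3 \<le> card (supp \<nu>)"
  proof (rule ccontr)
    assume "\<not> ?thesis"
    moreover have ne: "n \<noteq> k" using nk(3) by (auto simp: cross_def)
    then have "card {n, k} = 2" by simp
    ultimately have lt: "card (supp \<nu>) \<le> card {n, k}" by simp
    have sub: "{n, k} \<subseteq> supp \<nu>" using nk by simp
    have "{n, k} = supp \<nu>" by (rule card_subset_eq[OF fin sub le_antisym[OF card_mono[OF fin sub] lt]])
    then have s: "supp \<nu> = {n, k}" by (rule sym)
    have "msum \<nu> (\<lambda>x. snd n * fst x + (- fst n) * snd x) = 0" unfolding msum_linear z by simp
    then have "int (\<nu> n) * (snd n * fst n - fst n * snd n) + int (\<nu> k) * (snd n * fst k - fst n * snd k) = 0"
      unfolding msum_def s using ne by simp
    moreover have "snd n * fst n - fst n * snd n = 0" "snd n * fst k - fst n * snd k = - cross n k" by (simp_all add: cross_def)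
    ultimately have "int (\<nu> k) * cross n k = 0" by simp
    then show False using nk by (simp add: supp_def)
  qed
next
  assume c: "3 \<le> card (supp \<nu>)"
  show "nondeg \<nu>"
  proof (rule ccontr)
    assume d: "\<not> nondeg \<nu>"
    have "supp \<nu> \<noteq> {}" using c by (intro notI) simp
    then obtain n where n: "n \<in> supp \<nu>" by blast
    have pr: "prim k" if "k \<in> supp \<nu>" for k using that \<nu> by (auto simp: weights_def)
    have "supp \<nu> \<subseteq> {n, - n}"
    proof
      fix k assume k: "k \<in> supp \<nu>"
      have "cross n k = 0" using d n k by (auto simp: nondeg_def)
      then show "k \<in> {n, - n}" using prim_parallel[OF pr[OF n] pr[OF k]] by blast
    qed
    then have "card (supp \<nu>) \<le> card {n, - n}" by (intro card_mono) simp_all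
    also have "\<dots> \<le> 2" by (simp add: card_insert_if)
    finally show False using c by simp
  qed
qed

definition family :: "(nat \<Rightarrow> bool) \<Rightarrow> (vec \<Rightarrow> nat) set" where
  "family R = {\<nu> \<in> weights. 3 \<le> card (supp \<nu>) \<and> R (card (supp \<nu>))}"

definition fitting :: "(nat \<Rightarrow> bool) \<Rightarrow> nat \<Rightarrow> (vec \<Rightarrow> nat) set" where
  "fitting R m = {\<nu> \<in> family R. \<exists>A\<in>GL. \<nu> \<circ> A \<in> edge_set (family R) m}"

text \<open>The weights counted by \<open>fixed_edge\<close> and \<open>fixed_triangle\<close> include the degenerate ones, which are points
and segments and have at most two edges.\<close>
definition select :: "(nat \<Rightarrow> bool) \<Rightarrow> (vec \<Rightarrow> nat) set \<Rightarrow> int" where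
  "select R S = int (card {\<nu> \<in> S. 3 \<le> card (supp \<nu>) \<and> R (card (supp \<nu>))})"

lemma family_weight_family: "weight_family (family R) m"
proof
  show "family R \<subseteq> weights" by (auto simp: family_def)
  show "nondeg \<nu>" if "\<nu> \<in> family R" for \<nu> using that nondeg_iff by (auto simp: family_def)
  show "stable GL (family R)" unfolding stable_def
    by (auto simp: family_def weights_GL card_supp_comp GL_bij)
  have "edge_set (family R) m \<subseteq> fixed_edge (lin 1 0 0 1) m"
    by (auto simp: edge_set_def family_def fixed_edge_def lin_id)
  then show "finite (edge_set (family R) m)" using edge_identity(1) finite_subset by blast
qed

text \<open>Burnside's lemma is applied to bases, triangles and incidences. Conjugate symmetries fix equally many
weights, and the terms of the reflections of a triangle cancel against those of the incidences.\<close>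
theorem orbit_count:
  "24 * int (card (orbit GL ` fitting R m)) =
    3 * (select R (fixed_edge (lin 1 0 0 1) m) + select R (fixed_edge (lin (-1) 0 0 (-1)) m)
      + 2 * select R (fixed_edge (lin 0 (-1) 1 0) m) + 2 * select R (fixed_edge (lin 1 0 0 (-1)) m)
      + 2 * select R (fixed_edge (lin 0 1 1 0) m))
    + 4 * (select R (fixed_triangle (lin (-1) (-1) 1 0) m) + select R (fixed_triangle (lin 0 (-1) 1 1) m)
      - select R (fixed_triangle (lin 1 0 0 1) m) - select R (fixed_triangle (lin (-1) 0 0 (-1)) m))"
proof -
  interpret weight_family "family R" m by (rule family_weight_family)
  define e where "e A = int (card {\<nu> \<in> E. \<nu> \<circ> A = \<nu>})" for A
  define t where "t A = int (card {\<nu> \<in> T. \<nu> \<circ> A = \<nu>})" for A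
  have es: "select R (fixed_edge A m) = e A" for A
    unfolding select_def e_def by (rule arg_cong[where f = "\<lambda>X. int (card X)"]) (auto simp: family_def edge_set_def fixed_edge_def)
  have ts: "select R (fixed_triangle A m) = t A" for A
    unfolding select_def t_def by (rule arg_cong[where f = "\<lambda>X. int (card X)"])
      (auto simp: family_def edge_set_def triangle_set_def fixed_triangle_def)
  have finT: "finite T" using finite_edge T_E finite_subset by blast
  have V4T: "stable V4 T" by (rule stable_mono[OF stable_T V4_D6])
  have fin: "finite D4" "finite D6" "finite V4" by (simp_all add: D4_def D6_def V4_def)
  have cards: "card D4 = 8" "card D6 = 12" "card V4 = 4" by (simp_all add: D4_def D6_def V4_def lin_inject)
  have b1: "8 * int (card (orbit D4 ` E)) = (\<Sum>A\<in>D4. e A)"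
    using burnside[OF group_D4 fin(1) stable_E finite_edge, THEN arg_cong[of _ _ int]] by (simp add: e_def cards)
  have b2: "12 * int (card (orbit D6 ` T)) = (\<Sum>A\<in>D6. t A)"
    using burnside[OF group_D6 fin(2) stable_T finT, THEN arg_cong[of _ _ int]] by (simp add: t_def cards)
  have b3: "4 * int (card (orbit V4 ` T)) = (\<Sum>A\<in>V4. t A)"
    using burnside[OF group_V4 fin(3) V4T finT, THEN arg_cong[of _ _ int]] by (simp add: t_def cards)
  have s1: "(\<Sum>A\<in>D4. e A) = e (lin 1 0 0 1) + e (lin (-1) 0 0 (-1)) + e (lin 0 1 1 0) + e (lin 0 (-1) (-1) 0)
      + e (lin 1 0 0 (-1)) + e (lin (-1) 0 0 1) + e (lin 0 1 (-1) 0) + e (lin 0 (-1) 1 0)"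
    by (simp add: D4_def lin_inject)
  have s2: "(\<Sum>A\<in>D6. t A) = t (lin 1 0 0 1) + t (lin (-1) 0 0 (-1)) + t (lin 0 1 1 0) + t (lin 0 (-1) (-1) 0)
      + t (lin (-1) (-1) 1 0) + t (lin 1 1 (-1) 0) + t (lin 0 1 (-1) (-1)) + t (lin 0 (-1) 1 1)
      + t (lin (-1) 0 1 1) + t (lin 1 0 (-1) (-1)) + t (lin 1 1 0 (-1)) + t (lin (-1) (-1) 0 1)"
    by (simp add: D6_def lin_inject)
  have s3: "(\<Sum>A\<in>V4. t A) = t (lin 1 0 0 1) + t (lin (-1) 0 0 (-1)) + t (lin 0 1 1 0) + t (lin 0 (-1) (-1) 0)"
    by (simp add: V4_def lin_inject)
  have ce: "e (B \<circ> A \<circ> C) = e A" if "B \<in> D4" "C \<in> D4" "B \<circ> C = id" "C \<circ> B = id" for A B C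
    unfolding e_def card_fixed_conj[OF that stable_E] ..
  have ct: "t (B \<circ> A \<circ> C) = t A" if "B \<in> D6" "C \<in> D6" "B \<circ> C = id" "C \<circ> B = id" for A B C
    unfolding t_def card_fixed_conj[OF that stable_T] ..
  have r: "lin 1 0 0 (-1) \<in> D4" "lin 1 0 0 (-1) \<circ> lin 1 0 0 (-1) = id" by (simp_all add: D4_def lin_comp lin_id)
  have sw: "lin 0 1 1 0 \<in> D4" "lin 0 1 1 0 \<in> D6" "lin 0 1 1 0 \<circ> lin 0 1 1 0 = id" by (simp_all add: D4_def D6_def lin_comp lin_id)
  have \<rho>: "lin (-1) (-1) 1 0 \<in> D6" "lin 0 1 (-1) (-1) \<in> D6" "lin (-1) (-1) 1 0 \<circ> lin 0 1 (-1) (-1) = id"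
    "lin 0 1 (-1) (-1) \<circ> lin (-1) (-1) 1 0 = id" by (simp_all add: D6_def lin_comp lin_id)
  have ee: "e (lin 0 (-1) (-1) 0) = e (lin 0 1 1 0)" "e (lin 0 1 (-1) 0) = e (lin 0 (-1) 1 0)" "e (lin (-1) 0 0 1) = e (lin 1 0 0 (-1))"
    using ce[OF r(1,1,2,2), of "lin 0 1 1 0"] ce[OF r(1,1,2,2), of "lin 0 (-1) 1 0"] ce[OF sw(1,1,3,3), of "lin 1 0 0 (-1)"]
    by (simp_all add: lin_comp)
  have tt: "t (lin 0 1 (-1) (-1)) = t (lin (-1) (-1) 1 0)" "t (lin 1 1 (-1) 0) = t (lin 0 (-1) 1 1)"
    using ct[OF sw(2,2,3,3), of "lin (-1) (-1) 1 0"] ct[OF sw(2,2,3,3), of "lin 0 (-1) 1 1"] by (simp_all add: lin_comp)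
  have tr: "t (lin 1 0 (-1) (-1)) = t (lin 0 1 1 0)" "t (lin (-1) (-1) 0 1) = t (lin 0 1 1 0)"
    "t (lin (-1) 0 1 1) = t (lin 0 (-1) (-1) 0)" "t (lin 1 1 0 (-1)) = t (lin 0 (-1) (-1) 0)"
    using ct[OF \<rho>(1,2,3,4), of "lin 0 1 1 0"] ct[OF \<rho>(2,1,4,3), of "lin 0 1 1 0"]
      ct[OF \<rho>(1,2,3,4), of "lin 0 (-1) (-1) 0"] ct[OF \<rho>(2,1,4,3), of "lin 0 (-1) (-1) 0"] by (simp_all add: lin_comp)
  have cl: "int (card (orbit GL ` fitting R m)) + int (card (orbit V4 ` T)) = int (card (orbit D4 ` E)) + int (card (orbit D6 ` T))"
    using card_classes unfolding fitting_def by linarith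
  have solve: "24 * q = 3 * (e1 + e2 + 2 * eq + 2 * er + 2 * es) + 4 * (t3 + t6 - t1 - t2)"
    if "q + v = d + s" "8 * d = e1 + e2 + es + es + er + er + eq + eq" "4 * v = t1 + t2 + r + r'"
      "12 * s = t1 + t2 + r + r' + t3 + t6 + t3 + t6 + r' + r + r' + r" for q v d s e1 e2 eq er es t1 t2 t3 t6 r r' :: int
  proof -
    have q: "q = d + s - v" using that(1)[symmetric] by simp
    have "24 * q = 3 * (8 * d) + 2 * (12 * s) - 6 * (4 * v)" unfolding q by (simp add: algebra_simps)
    then show ?thesis unfolding that(2-4) by (simp add: algebra_simps)
  qed
  show ?thesis unfolding es ts
    by (rule solve[OF cl b1[unfolded s1 ee] b3[unfolded s3] b2[unfolded s2 tt tr]])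
qed

lemma polygon_class:
  assumes "lattice_polygon P"
  shows "polygon_equiv `` {P} = {P'. lattice_polygon P' \<and> weight P' \<in> orbit GL (weight P)}"
proof -
  have "(P, P') \<in> polygon_equiv \<Longrightarrow> lattice_polygon P'" for P' by (simp add: polygon_equiv_iff_act)
  then show ?thesis using polygon_equiv_iff[OF assms] unfolding orbit_def by blast
qed

text \<open>Since every nondegenerate weight belongs to a polygon, a class of polygons maps onto a full
orbit.\<close>
lemma weight_polygon_class:
  assumes "lattice_polygon P" shows "weight ` (polygon_equiv `` {P}) = orbit GL (weight P)"
proof
  show "weight ` (polygon_equiv `` {P}) \<subseteq> orbit GL (weight P)" unfolding polygon_class[OF assms] by blast
  show "orbit GL (weight P) \<subseteq> weight ` (polygon_equiv `` {P})"
  proof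
    fix \<nu> assume \<nu>: "\<nu> \<in> orbit GL (weight P)"
    then obtain A where A: "A \<in> GL" "\<nu> = weight P \<circ> A" unfolding orbit_def by blast
    have "\<nu> \<in> weights" "nondeg \<nu>" unfolding A(2) using weights_GL[OF A(1)] nondeg_comp[OF A(1)] weight_weights[OF assms] by blast+
    then obtain P' where P': "lattice_polygon P'" "weight P' = \<nu>" using weight_surj by blast
    have "P' \<in> polygon_equiv `` {P}" unfolding polygon_class[OF assms] using P' \<nu> by simp
    then show "\<nu> \<in> weight ` (polygon_equiv `` {P})" using P'(2) by blast
  qed
qed

lemma class_representative:
  assumes "X \<in> {P. lattice_polygon P} // polygon_equiv" "P \<in> X"
  shows "lattice_polygon P" "X = polygon_equiv `` {P}"
proof -
  obtain Q where Q: "lattice_polygon Q" "X = polygon_equiv `` {Q}" using assms(1) by (auto elim: quotientE)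
  have P: "lattice_polygon P" "weight P \<in> orbit GL (weight Q)" using assms(2) unfolding Q(2) polygon_class[OF Q(1)] by blast+
  show "lattice_polygon P" by (rule P(1))
  show "X = polygon_equiv `` {P}" unfolding Q(2) polygon_class[OF Q(1)] polygon_class[OF P(1)] orbit_eqI[OF group_GL P(2)] ..
qed

lemma class_vertices:
  assumes "X \<in> {P. lattice_polygon P} // polygon_equiv" "P \<in> X" "Q \<in> X"
  shows "card (vertices P) = card (vertices Q)"
proof -
  note P = class_representative[OF assms(1,2)]
  have Q: "lattice_polygon Q" "weight Q \<in> orbit GL (weight P)" using assms(3) unfolding P(2) polygon_class[OF P(1)] by blast+
  then obtain A where "A \<in> GL" "weight Q = weight P \<circ> A" unfolding orbit_def by blast
  then show ?thesis using weight_weights(3)[OF P(1)] weight_weights(3)[OF Q(1)] card_supp_comp[OF GL_bij] by simp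
qed

definition fits :: "(nat \<Rightarrow> bool) \<Rightarrow> nat \<Rightarrow> (rat ^ 2) set set set" where
  "fits R m = {X \<in> {P. lattice_polygon P} // polygon_equiv. (\<exists>P\<in>X. P \<subseteq> square m) \<and> (\<forall>P\<in>X. R (card (vertices P)))}"

lemma weight_family_mem:
  assumes "lattice_polygon P" shows "weight P \<in> family R \<longleftrightarrow> R (card (vertices P))"
  using weight_weights[OF assms] nondeg_iff by (auto simp: family_def)

text \<open>A class fits into the square if and only if some basis has both widths at most \<open>m\<close>: a polygon with small
coordinate widths can be translated into the square.\<close>
theorem card_fits: "card (fits R m) = card (orbit GL ` fitting R m)"
proof (rule bij_betw_same_card[of "image weight"], unfold bij_betw_def, intro conjI equalityI subsetI)
  show "inj_on (image weight) (fits R m)"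
  proof (rule inj_onI)
    fix X Y assume X: "X \<in> fits R m" and Y: "Y \<in> fits R m" and e: "weight ` X = weight ` Y"
    obtain P Q where PQ: "P \<in> X" "Q \<in> Y" using X Y unfolding fits_def by blast
    have "X \<in> {P. lattice_polygon P} // polygon_equiv" "Y \<in> {P. lattice_polygon P} // polygon_equiv" using X Y unfolding fits_def by blast+
    note P = class_representative[OF this(1) PQ(1)] and Q = class_representative[OF this(2) PQ(2)]
    have "orbit GL (weight P) = orbit GL (weight Q)"
      unfolding weight_polygon_class[OF P(1), symmetric] weight_polygon_class[OF Q(1), symmetric] P(2)[symmetric] Q(2)[symmetric] by (rule e)
    then show "X = Y" unfolding P(2) Q(2) polygon_class[OF P(1)] polygon_class[OF Q(1)] by simp
  qed
next
  fix Z assume "Z \<in> image weight ` fits R m"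
  then obtain X where X: "X \<in> fits R m" "Z = weight ` X" by blast
  then obtain P where P: "P \<in> X" "P \<subseteq> square m" and R: "R (card (vertices P))" and q: "X \<in> {P. lattice_polygon P} // polygon_equiv"
    unfolding fits_def by blast
  note c = class_representative[OF q P(1)]
  have "weight P \<in> family R" using R weight_family_mem[OF c(1)] by simp
  moreover have "weight P \<circ> id \<in> edge_set (family R) m" using calculation square_width[OF c(1) P(2)] by (simp add: edge_set_def)
  ultimately have "weight P \<in> fitting R m" unfolding fitting_def using GL_id by blast
  moreover have "Z = orbit GL (weight P)" unfolding X(2) weight_polygon_class[OF c(1), symmetric] c(2)[symmetric] ..
  ultimately show "Z \<in> orbit GL ` fitting R m" by blast
next
  fix Z assume "Z \<in> orbit GL ` fitting R m"
  then obtain \<nu> A where \<nu>: "Z = orbit GL \<nu>" "\<nu> \<in> family R" "A \<in> GL" "\<nu> \<circ> A \<in> edge_set (family R) m"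
    unfolding fitting_def by blast
  interpret weight_family "family R" m by (rule family_weight_family)
  have \<nu>A: "\<nu> \<circ> A \<in> family R" using \<nu>(4) unfolding edge_set_def by blast
  obtain P where P: "lattice_polygon P" "weight P = \<nu> \<circ> A" using weight_surj \<nu>A N by blast
  have "width2 (weight P) (1,0) \<le> 2 * int m" "width2 (weight P) (0,1) \<le> 2 * int m" using \<nu>(4) unfolding P(2) edge_set_def by blast+
  from width_square[OF P(1) this] obtain Q where Q: "lattice_polygon Q" "weight Q = \<nu> \<circ> A" "Q \<subseteq> square m" using P(2) by metis
  let ?X = "polygon_equiv `` {Q}"
  have q: "?X \<in> {P. lattice_polygon P} // polygon_equiv" using Q(1) by (intro quotientI) simp
  have QX: "Q \<in> ?X" unfolding polygon_class[OF Q(1)] using Q(1) orbit_self[OF group_GL] by simp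
  have "R (card (vertices Q))" using \<nu>A weight_family_mem[OF Q(1)] Q(2) by simp
  then have "R (card (vertices P'))" if "P' \<in> ?X" for P' using class_vertices[OF q that QX] by simp
  then have "?X \<in> fits R m" unfolding fits_def using q QX Q(3) by blast
  moreover have "Z = weight ` ?X" unfolding weight_polygon_class[OF Q(1)] Q(2) \<nu>(1) orbit_eq[OF group_GL \<nu>(3)] ..
  ultimately show "Z \<in> image weight ` fits R m" by blast
qed

lemma square_mono: assumes "m \<le> m'" shows "square m \<subseteq> square m'"
proof
  fix x assume x: "x \<in> square m"
  have le: "(of_nat m :: rat) \<le> of_nat m'" using assms by simp
  have "0 \<le> x $ i \<and> x $ i \<le> of_nat m'" for i
    using x order_trans[OF _ le, of "x $ i"] by (simp add: square_def)
  then show "x \<in> square m'" by (simp add: square_def)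
qed

lemma fits_mono: "m \<le> m' \<Longrightarrow> fits R m \<subseteq> fits R m'"
  unfolding fits_def using square_mono[of m m'] by blast

lemma polygon_classes_fits:
  "polygon_classes 1 = fits (\<lambda>_. True) 1"
  "1 < m \<Longrightarrow> polygon_classes m = fits (\<lambda>_. True) m - fits (\<lambda>_. True) (m - 1)"
proof -
  show "polygon_classes 1 = fits (\<lambda>_. True) 1" unfolding polygon_classes_def fits_def by auto
  assume m: "1 < m"
  have sq: "square m' \<subseteq> square (m - 1)" if "m' < m" for m' using that by (intro square_mono) simp
  have iff: "(\<exists>m'. 0 < m' \<and> m' < m \<and> (\<exists>P\<in>X. P \<subseteq> square m')) \<longleftrightarrow> (\<exists>P\<in>X. P \<subseteq> square (m - 1))" for X
  proof
    assume "\<exists>m'. 0 < m' \<and> m' < m \<and> (\<exists>P\<in>X. P \<subseteq> square m')"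
    then show "\<exists>P\<in>X. P \<subseteq> square (m - 1)" using sq by (meson subset_trans)
  next
    assume "\<exists>P\<in>X. P \<subseteq> square (m - 1)"
    then show "\<exists>m'. 0 < m' \<and> m' < m \<and> (\<exists>P\<in>X. P \<subseteq> square m')" using m by (intro exI[of _ "m - 1"]) simp
  qed
  show "polygon_classes m = fits (\<lambda>_. True) m - fits (\<lambda>_. True) (m - 1)" unfolding polygon_classes_def fits_def iff by blast
qed

lemma fits_vertices:
  assumes bound: "\<And>\<nu>. \<nu> \<in> fixed_edge (lin 1 0 0 1) m \<Longrightarrow> card (supp \<nu>) \<le> V"
    and X: "X \<in> fits R m" "P \<in> X"
  shows "card (vertices P) \<le> V"
proof -
  have q: "X \<in> {P. lattice_polygon P} // polygon_equiv" using X(1) unfolding fits_def by blast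
  obtain Q where Q: "Q \<in> X" "Q \<subseteq> square m" using X(1) unfolding fits_def by blast
  note c = class_representative[OF q Q(1)]
  have "weight Q \<in> fixed_edge (lin 1 0 0 1) m"
    using square_width[OF c(1) Q(2)] weight_weights(1)[OF c(1)] by (simp add: fixed_edge_def edge_set_def lin_id)
  then show ?thesis using bound weight_weights(3)[OF c(1)] class_vertices[OF q X(2) Q(1)] by simp
qed

lemma max_vertices_eq:
  assumes all: "\<And>X P. X \<in> polygon_classes m \<Longrightarrow> P \<in> X \<Longrightarrow> card (vertices P) \<le> V"
    and sub: "fits (\<lambda>k. k = V) m \<subseteq> polygon_classes m" and pos: "0 < card (fits (\<lambda>k. k = V) m)"
  shows "max_vertices m = V" "num_max_classes m = card (fits (\<lambda>k. k = V) m)"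
proof -
  let ?S = "{card (vertices P) | P. \<exists>X\<in>polygon_classes m. P \<in> X}"
  have "fits (\<lambda>k. k = V) m \<noteq> {}" using pos by (intro notI) simp
  then obtain X where X: "X \<in> fits (\<lambda>k. k = V) m" by blast
  then obtain P where P: "P \<in> X" "card (vertices P) = V" unfolding fits_def by blast
  show max: "max_vertices m = V" unfolding max_vertices_def
  proof (rule Max_eqI)
    show "finite ?S" by (rule finite_subset[of _ "{..V}"]) (use all in auto)
    show "y \<le> V" if "y \<in> ?S" for y using that all by blast
    show "V \<in> ?S" using P X sub by blast
  qed
  have "polygon_classes m \<subseteq> fits (\<lambda>_. True) m" unfolding polygon_classes_def fits_def by blast
  then have "{X \<in> polygon_classes m. \<forall>P\<in>X. card (vertices P) = V} = fits (\<lambda>k. k = V) m"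
    using sub unfolding fits_def by blast
  then show "num_max_classes m = card (fits (\<lambda>k. k = V) m)" unfolding num_max_classes_def max by simp
qed

section \<open>The table\<close>

abbreviation (input) most :: "nat \<Rightarrow> nat" where
  "most m \<equiv> [4, 6, 8, 9, 10, 12, 13] ! (m - 1)"

lemma counts_from_values:
  assumes m: "1 \<le> m" "m < 8" and S: "finite S"
    and c: "count (1::int) S = p1 ! (m - 1)" "count (Tri 0 1 0) S = p2 ! (m - 1)" "count (LT (Suc 0) 1) S = p3 ! (m - 1)"
    and v: "p1 = a" "map low p2 = b" "map2 top_coeff [4, 6, 8, 9, 10, 12, 13] p3 = map Some c"
    and l: "length b = 7" "length c = 7"
  shows "select (\<lambda>_. True) S = a ! (m - 1) - b ! (m - 1)" "select (\<lambda>k. k = most m) S = c ! (m - 1)"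
    "\<forall>\<nu>\<in>S. card (supp \<nu>) \<le> most m"
proof -
  have i: "m - 1 < 7" using m by linarith
  have "length p2 = 7" using arg_cong[OF v(2), of length] l(1) by simp
  then have low: "low (p2 ! (m - 1)) = b ! (m - 1)" using i v(2) nth_map[of "m - 1" p2 low] by simp
  let ?A = "{\<nu> \<in> S. card (supp \<nu>) < 3}" and ?B = "{\<nu> \<in> S. 3 \<le> card (supp \<nu>) \<and> True}"
  have "card (?A \<union> ?B) = card ?A + card ?B" by (rule card_Un_disjoint) (use S in auto)
  moreover have "?A \<union> ?B = S" by auto
  ultimately have "int (card S) = int (card ?A) + int (card ?B)" by simp
  moreover have "int (card S) = a ! (m - 1)" using c(1) v(1) unfolding count_one by simp
  moreover have "int (card ?A) = b ! (m - 1)" using count_low[OF S] unfolding c(2) low by simp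
  ultimately show "select (\<lambda>_. True) S = a ! (m - 1) - b ! (m - 1)" unfolding select_def by linarith
  have "min 7 (length p3) = 7" using arg_cong[OF v(3), of length] l(2) by simp
  then have l3: "m - 1 < length p3" using i by linarith
  have "map2 top_coeff [4, 6, 8, 9, 10, 12, 13] p3 ! (m - 1) = top_coeff (most m) (p3 ! (m - 1))"
    using i l3 by (subst nth_map) (simp_all add: nth_zip)
  then have "top_coeff (most m) (count (LT (Suc 0) 1) S) = Some (c ! (m - 1))" unfolding c(3) v(3) using i l(2) by simp
  note top = count_top[OF S this]
  then show "\<forall>\<nu>\<in>S. card (supp \<nu>) \<le> most m" by (rule conjunct1)
  have "m - 1 = 0 \<or> m - 1 = 1 \<or> m - 1 = 2 \<or> m - 1 = 3 \<or> m - 1 = 4 \<or> m - 1 = 5 \<or> m - 1 = 6" using i by linarith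
  then have "3 \<le> most m" by (elim disjE) (simp_all only:, simp_all)
  then have "{\<nu> \<in> S. 3 \<le> card (supp \<nu>) \<and> card (supp \<nu>) = most m} = {\<nu> \<in> S. card (supp \<nu>) = most m}" by auto
  then show "select (\<lambda>k. k = most m) S = c ! (m - 1)" unfolding select_def using top by simp
qed

lemma seven:
  fixes a b c d e f g :: 'a shows "length [a, b, c, d, e, f, g] = 7"
  by simp

lemma cases_upto_seven: "1 \<le> m \<Longrightarrow> m < 8 \<Longrightarrow> m = 1 \<or> m = 2 \<or> m = 3 \<or> m = 4 \<or> m = 5 \<or> m = 6 \<or> m = (7::nat)"
  by linarith

lemma fits_values:
  assumes m: "1 \<le> m" "m < 8"
  shows "int (card (fits (\<lambda>_. True) m)) = [2, 17, 148, 1517, 15359, 144544, 1249439] ! (m - 1)"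
    "int (card (fits (\<lambda>k. k = most m) m)) = [1, 1, 1, 1, 15, 2, 3] ! (m - 1)"
    "\<forall>\<nu>\<in>fixed_edge (lin 1 0 0 1) m. card (supp \<nu>) \<le> most m"
proof -
  note c0 = counts_from_values[OF m edge_identity(1) edge_id_prog[OF m] edge_id_prog[OF m] edge_id_prog[OF m] edge_id_values seven seven]
  note c1 = counts_from_values[OF m edge_negation(1) edge_neg_prog[OF m] edge_neg_prog[OF m] edge_neg_prog[OF m] edge_neg_values seven seven]
  note c2 = counts_from_values[OF m edge_quarter_turn(1) edge_quarter_prog[OF m] edge_quarter_prog[OF m] edge_quarter_prog[OF m] edge_quarter_values seven seven]
  note c3 = counts_from_values[OF m edge_reflection(1) edge_refl_prog[OF m] edge_refl_prog[OF m] edge_refl_prog[OF m] edge_refl_values seven seven]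
  note c4 = counts_from_values[OF m edge_swap(1) edge_swap_prog[OF m] edge_swap_prog[OF m] edge_swap_prog[OF m] edge_swap_values seven seven]
  note c5 = counts_from_values[OF m triangle_identity(1) triangle_id_prog[OF m] triangle_id_prog[OF m] triangle_id_prog[OF m] triangle_id_values seven seven]
  note c6 = counts_from_values[OF m triangle_negation(1) triangle_neg_prog[OF m] triangle_neg_prog[OF m] triangle_neg_prog[OF m] triangle_neg_values seven seven]
  note c7 = counts_from_values[OF m triangle_sixth_turn(1) triangle_sixth_prog[OF m] triangle_sixth_prog[OF m] triangle_sixth_prog[OF m] triangle_sixth_values seven seven]
  note c8 = counts_from_values[OF m triangle_third_turn(1) triangle_third_prog[OF m] triangle_third_prog[OF m] triangle_third_prog[OF m] triangle_third_values seven seven]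
  show "\<forall>\<nu>\<in>fixed_edge (lin 1 0 0 1) m. card (supp \<nu>) \<le> most m" by (rule c0(3))
  note all = orbit_count[of "\<lambda>_. True" m, folded card_fits, unfolded c0(1) c1(1) c2(1) c3(1) c4(1) c5(1) c6(1) c7(1) c8(1)]
  note top = orbit_count[of "\<lambda>k. k = most m" m, folded card_fits, unfolded c0(2) c1(2) c2(2) c3(2) c4(2) c5(2) c6(2) c7(2) c8(2)]
  show "int (card (fits (\<lambda>_. True) m)) = [2, 17, 148, 1517, 15359, 144544, 1249439] ! (m - 1)"
    using cases_upto_seven[OF m] all by (elim disjE; (simp; fail | simp, linarith))
  show "int (card (fits (\<lambda>k. k = most m) m)) = [1, 1, 1, 1, 15, 2, 3] ! (m - 1)"
    using cases_upto_seven[OF m] top by (elim disjE; (simp; fail | simp, linarith))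
qed

lemma most_less: assumes "1 < m" "m < 8" shows "most (m - 1) < most m"
proof -
  have "1 \<le> m" using assms(1) by simp
  from cases_upto_seven[OF this assms(2)] show ?thesis using assms(1) by (elim disjE; simp)
qed

lemma table:
  assumes m: "1 \<le> m" "m < 8"
  shows "num_classes m = [2, 15, 131, 1369, 13842, 129185, 1104895] ! (m - 1)"
    "max_vertices m = most m" "num_max_classes m = [1, 1, 1, 1, 15, 2, 3] ! (m - 1)"
proof -
  note v = fits_values[OF m]
  have bound: "card (vertices P) \<le> most m" if "X \<in> polygon_classes m" "P \<in> X" for X P
  proof (rule fits_vertices[OF _ _ that(2)])
    show "X \<in> fits (\<lambda>_. True) m" using that(1) unfolding polygon_classes_def fits_def by blast
    show "card (supp \<nu>) \<le> most m" if "\<nu> \<in> fixed_edge (lin 1 0 0 1) m" for \<nu> using v(3) that by blast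
  qed
  have sub_all: "fits (\<lambda>k. k = most m) m \<subseteq> fits (\<lambda>_. True) m" unfolding fits_def by blast
  \<comment> \<open>A polygon with this many vertices cannot fit into the smaller square, where the maximum is smaller.\<close>
  have sub: "fits (\<lambda>k. k = most m) m \<subseteq> polygon_classes m"
  proof (cases "m = 1")
    case True
    show ?thesis using sub_all unfolding True polygon_classes_fits(1) .
  next
    case False
    then have m1: "1 < m" "1 \<le> m - 1" "m - 1 < 8" using m by linarith+
    have "X \<notin> fits (\<lambda>_. True) (m - 1)" if X: "X \<in> fits (\<lambda>k. k = most m) m" for X
    proof
      assume X': "X \<in> fits (\<lambda>_. True) (m - 1)"
      obtain P where P: "P \<in> X" "card (vertices P) = most m" using X unfolding fits_def by blast
      have "card (vertices P) \<le> most (m - 1)"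
        by (rule fits_vertices[OF _ X' P(1)]) (use fits_values(3)[OF m1(2,3)] in blast)
      then show False using most_less[OF m1(1) m(2)] P(2) by linarith
    qed
    then show ?thesis using sub_all unfolding polygon_classes_fits(2)[OF m1(1)] by blast
  qed
  have "0 < card (fits (\<lambda>k. k = most m) m)"
    using cases_upto_seven[OF m] v(2) by (elim disjE; (simp; fail | simp, linarith))
  note max = max_vertices_eq[OF bound sub this]
  show "max_vertices m = most m" by (rule max(1))
  show "num_max_classes m = [1, 1, 1, 1, 15, 2, 3] ! (m - 1)"
  proof -
    have "num_max_classes m = card (fits (\<lambda>k. k = most m) m)" by (rule max(2))
    then have "int (num_max_classes m) = [1, 1, 1, 1, 15, 2, 3] ! (m - 1)" using v(2) by simp
    then show ?thesis using cases_upto_seven[OF m] by (elim disjE; simp)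
  qed
  show "num_classes m = [2, 15, 131, 1369, 13842, 129185, 1104895] ! (m - 1)"
  proof (cases "m = 1")
    case True
    then show ?thesis using v(1) unfolding num_classes_def True polygon_classes_fits(1) by simp
  next
    case False
    then have m1: "1 < m" "1 \<le> m - 1" "m - 1 < 8" using m by linarith+
    note w = fits_values(1)[OF m1(2,3)]
    have "0 < card (fits (\<lambda>_. True) (m - 1))"
      using cases_upto_seven[OF m1(2,3)] w by (elim disjE; (simp; fail | simp, linarith))
    then have "finite (fits (\<lambda>_. True) (m - 1))" by (rule card_ge_0_finite)
    then have "num_classes m = card (fits (\<lambda>_. True) m) - card (fits (\<lambda>_. True) (m - 1))"
      unfolding num_classes_def polygon_classes_fits(2)[OF m1(1)] by (rule card_Diff_subset) (rule fits_mono, simp)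
    moreover have "card (fits (\<lambda>_. True) m) = nat ([2, 17, 148, 1517, 15359, 144544, 1249439] ! (m - 1))"
      "card (fits (\<lambda>_. True) (m - 1)) = nat ([2, 17, 148, 1517, 15359, 144544, 1249439] ! (m - 1 - 1))"
      unfolding v(1)[symmetric] w[symmetric] by simp_all
    ultimately have "num_classes m = nat ([2, 17, 148, 1517, 15359, 144544, 1249439] ! (m - 1))
        - nat ([2, 17, 148, 1517, 15359, 144544, 1249439] ! (m - 1 - 1))" by simp
    then show ?thesis using cases_upto_seven[OF m] m1(1) by (elim disjE; simp)
  qed
qed

theorem mainTheorem2:
  "map num_classes [1, 2, 3, 4, 5, 6, 7] = [2, 15, 131, 1369, 13842, 129185, 1104895] \<and>
   map max_vertices [1, 2, 3, 4, 5, 6, 7] = [4, 6, 8, 9, 10, 12, 13] \<and>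
   map num_max_classes [1, 2, 3, 4, 5, 6, 7] = [1, 1, 1, 1, 15, 2, 3]"
  by (simp add: table)

end
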